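(* Let $\mathbb{F}$ be $\mathbb{R}$ or $\mathbb{C}$ and suppose that $E=(\mathbb{F}^\infty,\|\cdot\|_E)$ is a normed space such that $\mathrm{Age}(E)$ is an amalgamation class. Let $\widehat E$ be the Fraïssé limit of $\mathrm{Age}(E)$. Then: (a) for every finite-dimensional normed space $X$ over $\mathbb{F}$, $\partial_{X,\widehat E}$ is a compatible metric on $\mathcal{N}_X(\widehat E)$ that is uniformly equivalent to $\omega$ on $\omega$-bounded sets, $\partial_{X,E}=\partial_{X,\widehat E}$ on $\mathcal{N}_X(E)$, and $\mathcal{N}_X(E)$ is dense in $\mathcal{N}_X(\widehat E)$; (b) for every $k\in\mathbb N$, $\gamma_{k,\widehat E}$ is a compatible metric on $\mathcal{B}_k(\widehat E)$, $\gamma_{k,\widehat E}=\gamma_{k,E}$ on $\mathcal{B}_k(E)$, and $\mathcal{B}_k(E)$ is dense in $\mathcal{B}_k(\widehat E)$; (c) for every $k\in\mathbb N$, $\mathfrak{d}_{k,\widehat E}$ is a compatible metric on $\mathcal{D}_k(\widehat E)$ that is uniformly equivalent to $\widetilde\omega_2$ on $\widetilde\omega_2$-bounded sets, $\mathfrak{d}_{k,E}=\mathfrak{d}_{k,\widehat E}$ on $\mathcal{D}_k(E)$, and $\mathcal{D}_k(E)$ is dense in $\mathcal{D}_k(\widehat E)$.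
   Context: $\mathbb{F}^\infty$ is the space of eventually zero sequences in $\mathbb{F}$. $\mathrm{Age}(F)$ is the family of finite-dimensional subspaces of a normed space $F$. $\mathrm{Emb}(X,Y)$ is the set of linear isometric embeddings; for $\delta\ge0$, $\mathrm{Emb}_\delta(X,Y)$ is the set of linear $T:X\to Y$ with $(1+\delta)^{-1}\|x\|\le\|Tx\|\le(1+\delta)\|x\|$ for all $x$. A class $\mathcal G$ of finite-dimensional normed spaces is an amalgamation class if $\{0\}\in\mathcal G$ and for every $\varepsilon>0$, $k\in\mathbb{N}$ there is $\delta>0$ such that if $X\in\mathcal G$ has dimension $k$, $Y,Z\in\mathcal G$, $\gamma\in\mathrm{Emb}_\delta(X,Y)$, $\eta\in\mathrm{Emb}_\delta(X,Z)$, then there are $V\in\mathcal G$, $i\in\mathrm{Emb}(Y,V)$, $j\in\mathrm{Emb}(Z,V)$ with $\|i\circ\gamma-j\circ\eta\|\le\varepsilon$. A Banach space $F$ is Fraïssé if for every $\varepsilon>0$ and $k$ there is $\delta>0$ such that for every $k$-dimensional $X\in\mathrm{Age}(F)$ and all $\gamma,\eta\in\mathrm{Emb}_\delta(X,F)$ there is a linear (surjective) isometry $g$ of $F$ with $\|g\circ\eta-\gamma\|\le\varepsilon$. $\widehat E$ denotes the Fraïssé limit of $\mathrm{Age}(E)$: the unique (existing by the known Fraïssé correspondence) separable Fraïssé Banach space such that the family of subspaces of $\widehat E$ isometric to some element of $\mathrm{Age}(E)$ is dense in $\mathrm{Age}(\widehat E)$ for the Hausdorff distance between unit balls. Let $F$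 be a normed space ($F=E$ or $F=\widehat E$). For a finite-dimensional vector space $V$, $\mathcal{N}_V$ is the set of norms on $V$ with the topology of pointwise convergence; a compatible metric is $\omega(\mathsf m,\mathsf n)=\log\max\{\|\mathrm{Id}\|_{(V,\mathsf m),(V,\mathsf n)},\|\mathrm{Id}\|_{(V,\mathsf n),(V,\mathsf m)}\}$; $\mathcal{N}_V(F)$ is the set of $\mathsf m\in\mathcal N_V$ such that $(V,\mathsf m)$ embeds linearly isometrically in $F$. For a finite-dimensional normed space $X$ and $\mathsf m,\mathsf n\in\mathcal{N}_X(F)$, $\partial_{X,F}(\mathsf m,\mathsf n)=\inf\{\|T-U\|_{X,F}:T\in\mathrm{Emb}((X,\mathsf m),F),U\in\mathrm{Emb}((X,\mathsf n),F)\}$, where $\|\cdot\|_{X,F}$ is the operator norm for the given norm of $X$. $\mathrm{GL}(V)$ acts on $\mathcal N_V$ by $(\Delta\cdot\mathsf m)(x)=\mathsf m(\Delta^{-1}x)$. $\mathcal{B}_k$ is the quotient of $\mathcal{N}_{\mathbb{F}^k}$ by $\mathrm{GL}(\mathbb{F}^k)$ (the Banach–Mazur compactum) and $\mathcal{B}_k(F)$ the subset of classes $[\mathsf m]$ with $\mathsf m\in\mathcal{N}_{\mathbb{F}^k}(F)$. $\gamma_{k,F}([\mathsf m],[\mathsf n])$ is the infimum of $\Lambda_F(U,W)$ over $k$-dimensional subspaces $U,W$ of $F$ with $(U,\|\cdot\|_F)$ isometric to $(\mathbb{F}^k,\mathsf m)$ and $(W,\|\cdot\|_F)$ isometric to $(\mathbb{F}^k,\mathsf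 n)$, where $\Lambda_F(U,W)$ is the Hausdorff distance in $F$ between the unit balls of $U$ and $W$. $\mathrm{GL}(V)$ acts on $\mathcal{N}_V\times\mathcal{N}_{V^*}$ by $\Delta\cdot(\mathsf m,\mathsf n)=(\Delta\cdot\mathsf m,\Delta\cdot\mathsf n)$ with $(\Delta\cdot\mathsf n)(f)=\mathsf n(\Delta^*f)$. Let $\omega_2((\mathsf m,\mathsf n),(\mathsf p,\mathsf q))=\omega(\mathsf m,\mathsf p)+\omega(\mathsf n,\mathsf q)$. For $V=\mathbb{F}^k$, $\mathcal{D}_k$ is the quotient of $\mathcal{N}_V\times\mathcal{N}_{V^*}$ by $\mathrm{GL}(V)$, with quotient metric $\widetilde\omega_2$; $\mathcal{D}_k(F)$ is the set of classes of pairs in $\mathcal{N}_V(F)\times\mathcal{N}_{V^*}(F)$. For an injective linear $T:V\to F$, $\nu_{V,F}(T)$ is the norm $x\mapsto\|Tx\|_F$. $\mathfrak{d}_{k,F}([\mathbf m],[\mathbf n])=\inf\|T-U\|_{F^*,F}$ over rank-$k$ bounded linear $T,U:F^*\to F$ with decompositions $T=T_0\circ T_1^*$, $U=U_0\circ U_1^*$, where $T_0,U_0:\mathbb{F}^k\to F$, $T_1,U_1:(\mathbb{F}^k)^*\to F$ are linear of rank $k$, $(\nu_{\mathbb{F}^k,F}(T_0),\nu_{(\mathbb{F}^k)^*,F}(T_1))\in[\mathbf m]$ and $(\nu_{\mathbb{F}^k,F}(U_0),\nu_{(\mathbb{F}^k)^*,F}(U_1))\in[\mathbf n]$.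
   Formalization: The Fraïssé limit is additionally required to contain an isometric copy of every member of Age(E); density of copies in Age(Ê) alone is also satisfied by the zero space, for which the inclusion of N_X(E) in N_X(Ê) fails. *)

theory Defs
  imports "HOL-Analysis.Analysis" "HOL-Library.Function_Algebras"
begin

section \<open>Scalars\<close>

text \<open>
  The scalar field is R or C: the models of the following class are exactly the fields admitting
  an isometric field isomorphism onto R or onto C.
\<close>

class rc_scalar = real_normed_field +
  assumes rc_scalar_embeds:
    "\<exists>\<phi> :: 'a \<Rightarrow> complex.
       (\<forall>x y. \<phi> (x + y) = \<phi> x + \<phi> y) \<and> (\<forall>x y. \<phi> (x * y) = \<phi> x * \<phi> y) \<and>
       \<phi> 1 = 1 \<and> (\<forall>x. norm (\<phi> x) = norm x) \<and> (range \<phi> = \<real> \<or> range \<phi> = UNIV)"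

instance real :: rc_scalar
proof
  show "\<exists>\<phi> :: real \<Rightarrow> complex.
       (\<forall>x y. \<phi> (x + y) = \<phi> x + \<phi> y) \<and> (\<forall>x y. \<phi> (x * y) = \<phi> x * \<phi> y) \<and>
       \<phi> 1 = 1 \<and> (\<forall>x. norm (\<phi> x) = norm x) \<and> (range \<phi> = \<real> \<or> range \<phi> = UNIV)"
    by (rule exI[of _ complex_of_real]) (simp add: Reals_def)
qed

instance complex :: rc_scalar
proof
  show "\<exists>\<phi> :: complex \<Rightarrow> complex.
       (\<forall>x y. \<phi> (x + y) = \<phi> x + \<phi> y) \<and> (\<forall>x y. \<phi> (x * y) = \<phi> x * \<phi> y) \<and>
       \<phi> 1 = 1 \<and> (\<forall>x. norm (\<phi> x) = norm x) \<and> (range \<phi> = \<real> \<or> range \<phi> = UNIV)"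
    by (rule exI[of _ "\<lambda>x. x"]) simp
qed


section \<open>Vector spaces and normed spaces with explicit carriers\<close>

text \<open>
  A vector space is a linear subspace of an ambient type, with an explicit scalar multiplication.
  Spaces carry explicit carriers, scalars and norms because one and the same vector space is
  equipped with many norms, and because the dimension of scalar k-space is quantified over.
  The values of a norm, or of a linear map, outside of the carrier are irrelevant.
\<close>

record ('k, 'v) vspace =
  vcarrier :: "'v set"
  vscale :: "'k \<Rightarrow> 'v \<Rightarrow> 'v"

record ('k, 'v) nspace = "('k, 'v) vspace" +
  vnorm :: "'v \<Rightarrow> real"

definition vec_space :: "('k::field, 'v::ab_group_add, 'z) vspace_scheme \<Rightarrow> bool" where
  "vec_space V \<longleftrightarrow> vector_space (vscale V) \<and> module.subspace (vscale V) (vcarrier V)"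

definition has_dim :: "('k::field, 'v::ab_group_add, 'z) vspace_scheme \<Rightarrow> nat \<Rightarrow> bool" where
  "has_dim V k \<longleftrightarrow>
     (\<exists>B. finite B \<and> card B = k \<and> \<not> module.dependent (vscale V) B \<and>
          module.span (vscale V) B = vcarrier V)"

definition fin_dim :: "('k::field, 'v::ab_group_add, 'z) vspace_scheme \<Rightarrow> bool" where
  "fin_dim V \<longleftrightarrow> (\<exists>k. has_dim V k)"

definition is_norm ::
    "('k::real_normed_field, 'v::ab_group_add, 'z) vspace_scheme \<Rightarrow> ('v \<Rightarrow> real) \<Rightarrow> bool" where
  "is_norm V m \<longleftrightarrow>
     (\<forall>x\<in>vcarrier V. 0 \<le> m x) \<and>
     (\<forall>x\<in>vcarrier V. m x = 0 \<longleftrightarrow> x = 0) \<and>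
     (\<forall>c. \<forall>x\<in>vcarrier V. m (vscale V c x) = norm c * m x) \<and>
     (\<forall>x\<in>vcarrier V. \<forall>y\<in>vcarrier V. m (x + y) \<le> m x + m y)"

definition normed_space :: "('k::real_normed_field, 'v::ab_group_add) nspace \<Rightarrow> bool" where
  "normed_space X \<longleftrightarrow> vec_space X \<and> is_norm X (vnorm X)"

definition with_norm :: "('k, 'v, 'z) vspace_scheme \<Rightarrow> ('v \<Rightarrow> real) \<Rightarrow> ('k, 'v) nspace" where
  "with_norm V m = \<lparr>vcarrier = vcarrier V, vscale = vscale V, vnorm = m\<rparr>"

definition lin_map ::
    "('k::field, 'v::ab_group_add, 'y) vspace_scheme \<Rightarrow> ('k, 'w::ab_group_add, 'z) vspace_scheme \<Rightarrow>
     ('v \<Rightarrow> 'w) \<Rightarrow> bool" where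
  "lin_map V W T \<longleftrightarrow>
     (\<forall>x\<in>vcarrier V. T x \<in> vcarrier W) \<and>
     (\<forall>x\<in>vcarrier V. \<forall>y\<in>vcarrier V. T (x + y) = T x + T y) \<and>
     (\<forall>c. \<forall>x\<in>vcarrier V. T (vscale V c x) = vscale W c (T x))"

definition has_rank ::
    "('k::field, 'v::ab_group_add, 'y) vspace_scheme \<Rightarrow> ('k, 'w::ab_group_add, 'z) vspace_scheme \<Rightarrow>
     ('v \<Rightarrow> 'w) \<Rightarrow> nat \<Rightarrow> bool" where
  "has_rank V W T k \<longleftrightarrow> has_dim (W\<lparr>vcarrier := T ` vcarrier V\<rparr>) k"

definition bounded_map ::
    "('k, 'v) nspace \<Rightarrow> ('k, 'w) nspace \<Rightarrow> ('v \<Rightarrow> 'w) \<Rightarrow> bool" where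
  "bounded_map X Y T \<longleftrightarrow> (\<exists>C. \<forall>x\<in>vcarrier X. vnorm Y (T x) \<le> C * vnorm X x)"

definition unit_ball :: "('k, 'v) nspace \<Rightarrow> 'v set" where
  "unit_ball X = {x \<in> vcarrier X. vnorm X x \<le> 1}"

definition op_norm :: "('k, 'v) nspace \<Rightarrow> ('k, 'w) nspace \<Rightarrow> ('v \<Rightarrow> 'w) \<Rightarrow> real" where
  "op_norm X Y T = (SUP x\<in>unit_ball X. vnorm Y (T x))"

text \<open>Functions into the scalars are scaled pointwise; their sum is that of
  \<^theory>\<open>HOL-Library.Function_Algebras\<close>.\<close>

definition fun_scale :: "'k::times \<Rightarrow> ('i \<Rightarrow> 'k) \<Rightarrow> 'i \<Rightarrow> 'k" where
  "fun_scale c f = (\<lambda>i. c * f i)"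

lemma vector_space_fun_scale: "vector_space (fun_scale :: 'k::field \<Rightarrow> ('i \<Rightarrow> 'k) \<Rightarrow> 'i \<Rightarrow> 'k)"
  by unfold_locales (auto simp: fun_scale_def fun_eq_iff algebra_simps)

definition fin_seqs :: "('k::field, nat \<Rightarrow> 'k) vspace" where
  "fin_seqs = \<lparr>vcarrier = {x. finite {i. x i \<noteq> 0}}, vscale = fun_scale\<rparr>"

definition coord_space :: "nat \<Rightarrow> ('k::field, nat \<Rightarrow> 'k) vspace" where
  "coord_space k = \<lparr>vcarrier = {x. \<forall>i\<ge>k. x i = 0}, vscale = fun_scale\<rparr>"

text \<open>A functional is represented by the function that vanishes outside of the carrier.\<close>

definition lin_functional ::
    "('k::field, 'v::ab_group_add, 'z) vspace_scheme \<Rightarrow> ('v \<Rightarrow> 'k) \<Rightarrow> bool" where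
  "lin_functional V f \<longleftrightarrow>
     (\<forall>x\<in>vcarrier V. \<forall>y\<in>vcarrier V. f (x + y) = f x + f y) \<and>
     (\<forall>c. \<forall>x\<in>vcarrier V. f (vscale V c x) = c * f x) \<and>
     (\<forall>x. x \<notin> vcarrier V \<longrightarrow> f x = 0)"

definition alg_dual :: "('k::field, 'v::ab_group_add, 'z) vspace_scheme \<Rightarrow> ('k, 'v \<Rightarrow> 'k) vspace" where
  "alg_dual V = \<lparr>vcarrier = {f. lin_functional V f}, vscale = fun_scale\<rparr>"

definition norm_dual ::
    "('k::real_normed_field, 'v::ab_group_add) nspace \<Rightarrow> ('k, 'v \<Rightarrow> 'k) nspace" where
  "norm_dual F =
     \<lparr>vcarrier = {f. lin_functional F f \<and> (\<exists>C. \<forall>x\<in>vcarrier F. norm (f x) \<le> C * vnorm F x)},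
      vscale = fun_scale,
      vnorm = (\<lambda>f. SUP x\<in>unit_ball F. norm (f x))\<rparr>"

definition adjoint ::
    "('k::field, 'v::ab_group_add, 'z) vspace_scheme \<Rightarrow> ('v \<Rightarrow> 'w) \<Rightarrow> ('w \<Rightarrow> 'k) \<Rightarrow> 'v \<Rightarrow> 'k" where
  "adjoint V T f = (\<lambda>x. if x \<in> vcarrier V then f (T x) else 0)"

definition bidual_eval ::
    "('k::field, 'v::ab_group_add, 'z) vspace_scheme \<Rightarrow> 'v \<Rightarrow> ('v \<Rightarrow> 'k) \<Rightarrow> 'k" where
  "bidual_eval V x = (\<lambda>f. if f \<in> vcarrier (alg_dual V) then f x else 0)"


section \<open>Metrics and topologies\<close>

text \<open>Our distances are infima and suprema that are meaningful on a set only, whereas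
  \<^locale>\<open>Metric_space\<close> demands nonnegativity and symmetry everywhere.\<close>

definition dist_on :: "'a set \<Rightarrow> ('a \<Rightarrow> 'a \<Rightarrow> real) \<Rightarrow> 'a \<Rightarrow> 'a \<Rightarrow> real" where
  "dist_on A d x y = (if x \<in> A \<and> y \<in> A then d x y else 0)"

definition metric_topology :: "'a set \<Rightarrow> ('a \<Rightarrow> 'a \<Rightarrow> real) \<Rightarrow> 'a topology" where
  "metric_topology A d = Metric_space.mtopology A (dist_on A d)"

definition compatible_metric :: "'a topology \<Rightarrow> 'a set \<Rightarrow> ('a \<Rightarrow> 'a \<Rightarrow> real) \<Rightarrow> bool" where
  "compatible_metric T A d \<longleftrightarrow>
     Metric_space A (dist_on A d) \<and> metric_topology A d = subtopology T A"

definition dense_subset :: "'a topology \<Rightarrow> 'a set \<Rightarrow> 'a set \<Rightarrow> bool" where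
  "dense_subset T A B \<longleftrightarrow> A \<subseteq> B \<and> B \<subseteq> T closure_of A"

definition unif_finer_on :: "'a set \<Rightarrow> ('a \<Rightarrow> 'a \<Rightarrow> real) \<Rightarrow> ('a \<Rightarrow> 'a \<Rightarrow> real) \<Rightarrow> bool" where
  "unif_finer_on S d d' \<longleftrightarrow>
     (\<forall>\<epsilon>>0. \<exists>\<delta>>0. \<forall>x\<in>S. \<forall>y\<in>S. d x y < \<delta> \<longrightarrow> d' x y < \<epsilon>)"

definition unif_equiv_on_bounded ::
    "'a set \<Rightarrow> ('a \<Rightarrow> 'a \<Rightarrow> real) \<Rightarrow> ('a \<Rightarrow> 'a \<Rightarrow> real) \<Rightarrow> bool" where
  "unif_equiv_on_bounded A d w \<longleftrightarrow>
     (\<forall>S\<subseteq>A. (\<exists>C. \<forall>x\<in>S. \<forall>y\<in>S. w x y \<le> C) \<longrightarrow> unif_finer_on S d w \<and> unif_finer_on S w d)"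

definition quotient_topology :: "'a topology \<Rightarrow> ('a \<Rightarrow> 'b) \<Rightarrow> 'b topology" where
  "quotient_topology T q =
     topology (\<lambda>U. U \<subseteq> q ` topspace T \<and> openin T {x \<in> topspace T. q x \<in> U})"

lemma openin_quotient_topology:
  "openin (quotient_topology T q) U \<longleftrightarrow>
     U \<subseteq> q ` topspace T \<and> openin T {x \<in> topspace T. q x \<in> U}"
proof -
  have "istopology (\<lambda>U. U \<subseteq> q ` topspace T \<and> openin T {x \<in> topspace T. q x \<in> U})"
    unfolding istopology_def
  proof (intro conjI allI impI)
    fix S R
    assume S: "S \<subseteq> q ` topspace T \<and> openin T {x \<in> topspace T. q x \<in> S}"
      and R: "R \<subseteq> q ` topspace T \<and> openin T {x \<in> topspace T. q x \<in> R}"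
    show "S \<inter> R \<subseteq> q ` topspace T" using S by blast
    have eq: "{x \<in> topspace T. q x \<in> S \<inter> R} =
        {x \<in> topspace T. q x \<in> S} \<inter> {x \<in> topspace T. q x \<in> R}" by auto
    show "openin T {x \<in> topspace T. q x \<in> S \<inter> R}"
      unfolding eq by (rule openin_Int[OF conjunct2[OF S] conjunct2[OF R]])
  next
    fix K
    assume K: "\<forall>S\<in>K. S \<subseteq> q ` topspace T \<and> openin T {x \<in> topspace T. q x \<in> S}"
    show "\<Union>K \<subseteq> q ` topspace T" using K by blast
    have eq: "{x \<in> topspace T. q x \<in> \<Union>K} = (\<Union>S\<in>K. {x \<in> topspace T. q x \<in> S})" by blast
    show "openin T {x \<in> topspace T. q x \<in> \<Union>K}"
      unfolding eq by (rule openin_Union) (use K in blast)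
  qed
  then show ?thesis unfolding quotient_topology_def by (subst topology_inverse') auto
qed

lemma quotient_map_quotient_topology:
  "quotient_map T (quotient_topology T q) q"
proof -
  have "topspace (quotient_topology T q) = q ` topspace T"
  proof
    show "topspace (quotient_topology T q) \<subseteq> q ` topspace T"
      using openin_topspace[of "quotient_topology T q"] unfolding openin_quotient_topology by blast
    have "{x \<in> topspace T. q x \<in> q ` topspace T} = topspace T" by auto
    then have "openin (quotient_topology T q) (q ` topspace T)"
      unfolding openin_quotient_topology by simp
    then show "q ` topspace T \<subseteq> topspace (quotient_topology T q)"
      by (rule openin_subset)
  qed
  then show ?thesis unfolding quotient_map_def openin_quotient_topology by auto
qed

definition norm_dist :: "('k, 'v::ab_group_add) nspace \<Rightarrow> 'v \<Rightarrow> 'v \<Rightarrow> real" where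
  "norm_dist X = dist_on (vcarrier X) (\<lambda>x y. vnorm X (x - y))"

definition hausdorff_dist :: "('a \<Rightarrow> 'a \<Rightarrow> real) \<Rightarrow> 'a set \<Rightarrow> 'a set \<Rightarrow> real" where
  "hausdorff_dist d A B =
     max (SUP a\<in>A. INF b\<in>B. d a b) (SUP b\<in>B. INF a\<in>A. d a b)"


section \<open>Ages, amalgamation classes and Fraisse spaces\<close>

definition Age :: "('k::field, 'v::ab_group_add) nspace \<Rightarrow> ('k, 'v) nspace set" where
  "Age F = {F\<lparr>vcarrier := U\<rparr> | U.
      U \<subseteq> vcarrier F \<and> module.subspace (vscale F) U \<and> fin_dim (F\<lparr>vcarrier := U\<rparr>)}"

definition Emb ::
    "('k::field, 'v::ab_group_add) nspace \<Rightarrow> ('k, 'w::ab_group_add) nspace \<Rightarrow> ('v \<Rightarrow> 'w) set" where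
  "Emb X Y = {T. lin_map X Y T \<and> (\<forall>x\<in>vcarrier X. vnorm Y (T x) = vnorm X x)}"

definition Emb_approx ::
    "real \<Rightarrow> ('k::field, 'v::ab_group_add) nspace \<Rightarrow> ('k, 'w::ab_group_add) nspace \<Rightarrow>
     ('v \<Rightarrow> 'w) set" where
  "Emb_approx \<delta> X Y = {T. lin_map X Y T \<and>
     (\<forall>x\<in>vcarrier X. inverse (1 + \<delta>) * vnorm X x \<le> vnorm Y (T x) \<and>
                      vnorm Y (T x) \<le> (1 + \<delta>) * vnorm X x)}"

definition isometric ::
    "('k::field, 'v::ab_group_add) nspace \<Rightarrow> ('k, 'w::ab_group_add) nspace \<Rightarrow> bool" where
  "isometric X Y \<longleftrightarrow> (\<exists>T\<in>Emb X Y. T ` vcarrier X = vcarrier Y)"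

definition amalgamation_class :: "('k::real_normed_field, 'v::ab_group_add) nspace set \<Rightarrow> bool" where
  "amalgamation_class G \<longleftrightarrow>
     (\<forall>X\<in>G. normed_space X \<and> fin_dim X) \<and>
     (\<exists>X\<in>G. vcarrier X = {0}) \<and>
     (\<forall>\<epsilon>>0. \<forall>k. \<exists>\<delta>>0. \<forall>X\<in>G. \<forall>Y\<in>G. \<forall>Z\<in>G. has_dim X k \<longrightarrow>
        (\<forall>\<gamma>\<in>Emb_approx \<delta> X Y. \<forall>\<eta>\<in>Emb_approx \<delta> X Z.
           \<exists>V\<in>G. \<exists>i\<in>Emb Y V. \<exists>j\<in>Emb Z V.
             op_norm X V (\<lambda>x. i (\<gamma> x) - j (\<eta> x)) \<le> \<epsilon>))"

definition banach_space :: "('k::real_normed_field, 'v::ab_group_add) nspace \<Rightarrow> bool" where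
  "banach_space F \<longleftrightarrow>
     normed_space F \<and> Metric_space.mcomplete (vcarrier F) (norm_dist F)"

definition separable :: "('k::real_normed_field, 'v::ab_group_add) nspace \<Rightarrow> bool" where
  "separable F \<longleftrightarrow> separable_space (Metric_space.mtopology (vcarrier F) (norm_dist F))"

definition fraisse :: "('k::real_normed_field, 'v::ab_group_add) nspace \<Rightarrow> bool" where
  "fraisse F \<longleftrightarrow> banach_space F \<and>
     (\<forall>\<epsilon>>0. \<forall>k. \<exists>\<delta>>0. \<forall>X\<in>Age F. has_dim X k \<longrightarrow>
        (\<forall>\<gamma>\<in>Emb_approx \<delta> X F. \<forall>\<eta>\<in>Emb_approx \<delta> X F.
           \<exists>g\<in>Emb F F. g ` vcarrier F = vcarrier F \<and>
             op_norm X F (\<lambda>x. g (\<eta> x) - \<gamma> x) \<le> \<epsilon>))"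

definition ball_dist ::
    "('k, 'v::ab_group_add) nspace \<Rightarrow> ('k, 'v) nspace \<Rightarrow> ('k, 'v) nspace \<Rightarrow> real" where
  "ball_dist F U W = hausdorff_dist (norm_dist F) (unit_ball U) (unit_ball W)"

text \<open>
  The defining property of the Fraisse limit of a class \<open>G\<close>, which determines it up to isometry.
  Besides the density of the copies of members of \<open>G\<close> it comprises that every member of \<open>G\<close> has a
  copy: otherwise the zero space would be a limit of every amalgamation class.
\<close>

definition fraisse_limit ::
    "('k::real_normed_field, 'v::ab_group_add) nspace set \<Rightarrow> ('k, 'w::ab_group_add) nspace \<Rightarrow> bool" where
  "fraisse_limit G F \<longleftrightarrow> fraisse F \<and> separable F \<and>
     (\<forall>X\<in>G. \<exists>U\<in>Age F. isometric U X) \<and>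
     (\<forall>U\<in>Age F. \<forall>\<epsilon>>0. \<exists>W\<in>Age F. (\<exists>X\<in>G. isometric W X) \<and> ball_dist F U W < \<epsilon>)"


section \<open>Spaces of norms\<close>

text \<open>A norm on \<open>V\<close> is an extensional function on the carrier, so that norms are equal as soon as
  they agree on \<open>V\<close>.\<close>

definition Norms ::
    "('k::real_normed_field, 'v::ab_group_add, 'z) vspace_scheme \<Rightarrow> ('v \<Rightarrow> real) set" where
  "Norms V = {m \<in> extensional (vcarrier V). is_norm V m}"

definition norm_topology ::
    "('k::real_normed_field, 'v::ab_group_add, 'z) vspace_scheme \<Rightarrow> ('v \<Rightarrow> real) topology" where
  "norm_topology V = subtopology (powertop_real (vcarrier V)) (Norms V)"

definition Norms_in ::
    "('k::real_normed_field, 'v::ab_group_add, 'z) vspace_scheme \<Rightarrow> ('k, 'w::ab_group_add) nspace \<Rightarrow>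
     ('v \<Rightarrow> real) set" where
  "Norms_in V F = {m \<in> Norms V. Emb (with_norm V m) F \<noteq> {}}"

text \<open>For \<open>V = {0}\<close> both operator norms are 0, and \<open>ln 0 = 0\<close> gives the correct value.\<close>

definition omega ::
    "('k::real_normed_field, 'v::ab_group_add, 'z) vspace_scheme \<Rightarrow>
     ('v \<Rightarrow> real) \<Rightarrow> ('v \<Rightarrow> real) \<Rightarrow> real" where
  "omega V m n = ln (max (op_norm (with_norm V m) (with_norm V n) id)
                         (op_norm (with_norm V n) (with_norm V m) id))"

definition partial_dist ::
    "('k::real_normed_field, 'v::ab_group_add) nspace \<Rightarrow> ('k, 'w::ab_group_add) nspace \<Rightarrow>
     ('v \<Rightarrow> real) \<Rightarrow> ('v \<Rightarrow> real) \<Rightarrow> real" where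
  "partial_dist X F m n =
     Inf {op_norm X F (\<lambda>x. T x - U x) | T U. T \<in> Emb (with_norm X m) F \<and> U \<in> Emb (with_norm X n) F}"


section \<open>Banach--Mazur compacta\<close>

definition GL :: "('k::field, 'v::ab_group_add, 'z) vspace_scheme \<Rightarrow> ('v \<Rightarrow> 'v) set" where
  "GL V = {\<Delta>. lin_map V V \<Delta> \<and> bij_betw \<Delta> (vcarrier V) (vcarrier V)}"

definition act ::
    "('k::field, 'v::ab_group_add, 'z) vspace_scheme \<Rightarrow> ('v \<Rightarrow> 'v) \<Rightarrow> ('v \<Rightarrow> real) \<Rightarrow> 'v \<Rightarrow> real" where
  "act V \<Delta> m = restrict (\<lambda>x. m (inv_into (vcarrier V) \<Delta> x)) (vcarrier V)"

definition orbit ::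
    "('k::field, 'v::ab_group_add, 'z) vspace_scheme \<Rightarrow> ('v \<Rightarrow> real) \<Rightarrow> ('v \<Rightarrow> real) set" where
  "orbit V m = (\<lambda>\<Delta>. act V \<Delta> m) ` GL V"

definition BM_topology :: "'k itself \<Rightarrow> nat \<Rightarrow> ((nat \<Rightarrow> 'k::real_normed_field) \<Rightarrow> real) set topology" where
  "BM_topology _ k =
     quotient_topology (norm_topology (coord_space k :: ('k, nat \<Rightarrow> 'k) vspace))
       (orbit (coord_space k :: ('k, nat \<Rightarrow> 'k) vspace))"

definition BM_in ::
    "nat \<Rightarrow> ('k::real_normed_field, 'w::ab_group_add) nspace \<Rightarrow> ((nat \<Rightarrow> 'k) \<Rightarrow> real) set set" where
  "BM_in k F =
     orbit (coord_space k :: ('k, nat \<Rightarrow> 'k) vspace) `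
       Norms_in (coord_space k :: ('k, nat \<Rightarrow> 'k) vspace) F"

definition gamma_dist ::
    "nat \<Rightarrow> ('k::real_normed_field, 'w::ab_group_add) nspace \<Rightarrow>
     ((nat \<Rightarrow> 'k) \<Rightarrow> real) set \<Rightarrow> ((nat \<Rightarrow> 'k) \<Rightarrow> real) set \<Rightarrow> real" where
  "gamma_dist k F P Q =
     Inf {ball_dist F U W | U W. U \<in> Age F \<and> W \<in> Age F \<and> has_dim U k \<and> has_dim W k \<and>
       (\<exists>m\<in>P. isometric U (with_norm (coord_space k :: ('k, nat \<Rightarrow> 'k) vspace) m)) \<and>
       (\<exists>n\<in>Q. isometric W (with_norm (coord_space k :: ('k, nat \<Rightarrow> 'k) vspace) n))}"


section \<open>Pairs of norms on a space and on its dual\<close>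

type_synonym ('k, 'v) norm_pair = "('v \<Rightarrow> real) \<times> (('v \<Rightarrow> 'k) \<Rightarrow> real)"

definition act_dual ::
    "('k::field, 'v::ab_group_add, 'z) vspace_scheme \<Rightarrow> ('v \<Rightarrow> 'v) \<Rightarrow>
     (('v \<Rightarrow> 'k) \<Rightarrow> real) \<Rightarrow> ('v \<Rightarrow> 'k) \<Rightarrow> real" where
  "act_dual V \<Delta> n = restrict (\<lambda>f. n (adjoint V \<Delta> f)) (vcarrier (alg_dual V))"

definition orbit2 ::
    "('k::field, 'v::ab_group_add, 'z) vspace_scheme \<Rightarrow> ('k, 'v) norm_pair \<Rightarrow>
     ('k, 'v) norm_pair set" where
  "orbit2 V p = (\<lambda>\<Delta>. (act V \<Delta> (fst p), act_dual V \<Delta> (snd p))) ` GL V"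

definition omega2 ::
    "('k::real_normed_field, 'v::ab_group_add, 'z) vspace_scheme \<Rightarrow>
     ('k, 'v) norm_pair \<Rightarrow> ('k, 'v) norm_pair \<Rightarrow> real" where
  "omega2 V p q = omega V (fst p) (fst q) + omega (alg_dual V) (snd p) (snd q)"

definition D_space :: "nat \<Rightarrow> ('k::real_normed_field, nat \<Rightarrow> 'k) norm_pair set set" where
  "D_space k =
     orbit2 (coord_space k :: ('k, nat \<Rightarrow> 'k) vspace) `
       (Norms (coord_space k :: ('k, nat \<Rightarrow> 'k) vspace) \<times>
        Norms (alg_dual (coord_space k :: ('k, nat \<Rightarrow> 'k) vspace)))"

definition omega2_quot ::
    "nat \<Rightarrow> ('k::real_normed_field, nat \<Rightarrow> 'k) norm_pair set \<Rightarrow>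
     ('k, nat \<Rightarrow> 'k) norm_pair set \<Rightarrow> real" where
  "omega2_quot k P Q =
     Inf {omega2 (coord_space k :: ('k, nat \<Rightarrow> 'k) vspace) p q | p q. p \<in> P \<and> q \<in> Q}"

definition D_in ::
    "nat \<Rightarrow> ('k::real_normed_field, 'w::ab_group_add) nspace \<Rightarrow>
     ('k, nat \<Rightarrow> 'k) norm_pair set set" where
  "D_in k F =
     orbit2 (coord_space k :: ('k, nat \<Rightarrow> 'k) vspace) `
       (Norms_in (coord_space k :: ('k, nat \<Rightarrow> 'k) vspace) F \<times>
        Norms_in (alg_dual (coord_space k :: ('k, nat \<Rightarrow> 'k) vspace)) F)"

definition pullback_norm ::
    "('k, 'v, 'z) vspace_scheme \<Rightarrow> ('k, 'w) nspace \<Rightarrow> ('v \<Rightarrow> 'w) \<Rightarrow> 'v \<Rightarrow> real" where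
  "pullback_norm V F T = restrict (\<lambda>x. vnorm F (T x)) (vcarrier V)"

text \<open>The bounded rank \<open>k\<close> operators \<open>T = T\<^sub>0 \<circ> T\<^sub>1\<^sup>*\<close> from the dual of \<open>F\<close> to \<open>F\<close>
  whose factors induce a pair of norms in \<open>P\<close>. The adjoint of \<open>T\<^sub>1\<close> takes values in the bidual of
  scalar \<open>k\<close>-space, which is identified with scalar \<open>k\<close>-space by inverting the evaluation map.\<close>

definition factored_ops ::
    "nat \<Rightarrow> ('k::real_normed_field, 'w::ab_group_add) nspace \<Rightarrow>
     ('k, nat \<Rightarrow> 'k) norm_pair set \<Rightarrow> (('w \<Rightarrow> 'k) \<Rightarrow> 'w) set" where
  "factored_ops k F P =
     (let V = (coord_space k :: ('k, nat \<Rightarrow> 'k) vspace) in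
      {T. lin_map (norm_dual F) F T \<and> bounded_map (norm_dual F) F T \<and> has_rank (norm_dual F) F T k \<and>
          (\<exists>T\<^sub>0 T\<^sub>1. lin_map V F T\<^sub>0 \<and> has_rank V F T\<^sub>0 k \<and>
             lin_map (alg_dual V) F T\<^sub>1 \<and> has_rank (alg_dual V) F T\<^sub>1 k \<and>
             (pullback_norm V F T\<^sub>0, pullback_norm (alg_dual V) F T\<^sub>1) \<in> P \<and>
             (\<forall>f\<in>vcarrier (norm_dual F).
                T f = T\<^sub>0 (inv_into (vcarrier V) (bidual_eval V) (adjoint (alg_dual V) T\<^sub>1 f))))})"

definition d_dist ::
    "nat \<Rightarrow> ('k::real_normed_field, 'w::ab_group_add) nspace \<Rightarrow>
     ('k, nat \<Rightarrow> 'k) norm_pair set \<Rightarrow> ('k, nat \<Rightarrow> 'k) norm_pair set \<Rightarrow> real" where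
  "d_dist k F P Q =
     Inf {op_norm (norm_dual F) F (\<lambda>f. T f - U f) | T U.
            T \<in> factored_ops k F P \<and> U \<in> factored_ops k F Q}"

end

theory Submission
  imports Defs
begin

text \<open>
  Each of the three distances is the infimum of the numbers \<open>C\<close> for which two objects are in a
  relation \<open>R C\<close>: they are realised in the space \<open>F\<close> by embeddings that are \<open>C\<close>-close, as operators
  (\<open>partial_rel\<close>), in the Hausdorff distance of the images of the unit balls (\<open>gamma_rel\<close>), or for the
  operators \<open>T\<^sub>0 \<circ> T\<^sub>1\<^sup>*\<close> that they define (\<open>d_rel\<close>). For classes of norms it suffices to realise fixed
  representatives. The three parts follow the same pattern.

  Homogeneity. If the norms \<open>m\<close> and \<open>n\<close> are close, then for all embeddings \<open>T\<close> of \<open>m\<close> and \<open>U\<close> of \<open>n\<close>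
  in the Fraisse space there is a surjective isometry \<open>g\<close> for which \<open>g \<circ> U\<close> is close to \<open>T\<close>
  (\<open>fraisse_align\<close>). With \<open>m = n\<close> this gives the triangle inequality: two realisations of the middle
  object are aligned by \<open>g\<close>, and moving a pair of embeddings by \<open>g\<close> does not change their distance.
  For \<open>m\<close> and \<open>n\<close> close it bounds the distance in terms of \<open>\<omega>\<close>. The operators \<open>T\<^sub>0 \<circ> T\<^sub>1\<^sup>*\<close> are
  moved to \<open>g \<circ> T\<^sub>0 \<circ> T\<^sub>1\<^sup>* \<circ> h\<^sup>*\<close> with independent isometries \<open>g\<close> and \<open>h\<close>.

  Rigidity. Conversely, realisations at a small distance come from norms that are close for \<open>\<omega>\<close>, up
  to a change of coordinates: this is immediate for \<open>\<partial>\<close>; if two unit balls are close, moving a basis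
  into the other subspace gives an almost isometric isomorphism (\<open>omega_of_gamma_rel\<close>); and if two
  operators of rank \<open>k\<close> are close, evaluating both on functionals that the first one maps to the
  images of a basis yields the change of coordinates (\<open>omega_of_d_rel\<close>). Homogeneity and rigidity
  make the distances metrics with the right topology (\<open>compatible_metric_from_relation\<close>), and since
  the estimates depend only on a bound for the \<open>\<omega>\<close>-distance to a base point, they are uniform on
  bounded sets (\<open>unif_equiv_from_based\<close>).

  The comparison spaces themselves need two facts on finite dimension: \<open>\<omega>\<close> induces pointwise
  convergence, because a norm is determined up to a small factor by its values on a finite set
  (\<open>norm_topology_eq_omega\<close>), and orbits of \<open>GL(V)\<close> at distance 0 coincide, because bounded sequences
  of matrices have convergent subsequences. Therefore the quotients carry quotient metrics
  (\<open>orbit_metric\<close>).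

  Comparison of \<open>E\<close> with its limit. Finitely many finite-dimensional subspaces of one of the two spaces
  that have isometric copies in the other one can be moved there by one almost isometry, which is
  moreover close to an isometry on each of them. From \<open>E\<close> to the limit this holds because the limit
  contains copies of the members of the age. From the limit to \<open>E\<close>, density gives an almost isometry
  into a member of the age, and amalgamation, applied once per subspace, makes it close to isometries
  (\<open>transfers_from_limit\<close>). Moving realisations in this way increases \<open>C\<close> by an arbitrarily
  small amount, so the distances agree (\<open>dist_le_of_rel\<close>). For the operators one needs in addition that
  a functional on the target, pulled back to a finite-dimensional subspace, extends with almost the
  same norm, which is the Hahn--Banach theorem. The density of the norms that are realised in \<open>E\<close> is
  the density of copies of members of the age (\<open>Norms_in_dense\<close>).
\<close>

section \<open>Scalars\<close>

text \<open>Real and imaginary parts, uniformly for both fields of scalars: \<open>I\<close> is an imaginary unit, or 0 in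
  the real case, where the imaginary parts vanish.\<close>

lemma rc_scalar_real_imag:
  obtains \<phi> :: "'k::rc_scalar \<Rightarrow> complex" and I :: 'k where
    "\<And>x y. \<phi> (x + y) = \<phi> x + \<phi> y" "\<And>x y. \<phi> (x * y) = \<phi> x * \<phi> y"
    "\<And>x. norm (\<phi> x) = norm x" "\<And>r. \<phi> (of_real r) = of_real r"
    "range \<phi> = \<real> \<or> range \<phi> = UNIV"
    "\<And>c. c = of_real (Re (\<phi> c)) + I * of_real (Im (\<phi> c))"
    "\<And>c. I * of_real (Re (\<phi> (I * c))) = - (I * of_real (Im (\<phi> c)))"
    "\<And>r. Re (\<phi> (I * of_real r)) = 0"
    "I = 0 \<or> I * I = - 1"
proof -
  obtain \<phi> :: "'k \<Rightarrow> complex" where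
    add: "\<And>x y. \<phi> (x + y) = \<phi> x + \<phi> y" and mult: "\<And>x y. \<phi> (x * y) = \<phi> x * \<phi> y"
    and one: "\<phi> 1 = 1" and nrm: "\<And>x. norm (\<phi> x) = norm x"
    and rng: "range \<phi> = \<real> \<or> range \<phi> = UNIV"
    using rc_scalar_embeds by blast
  have zero: "\<phi> 0 = 0" using nrm[of 0] by simp
  have minus: "\<phi> (- x) = - \<phi> x" for x
    using add[of x "- x"] zero by (simp add: eq_neg_iff_add_eq_0 add.commute)
  have diff: "\<phi> (x - y) = \<phi> x - \<phi> y" for x y
    using add[of x "- y"] minus by simp
  have inj: "x = y" if "\<phi> x = \<phi> y" for x y
    using nrm[of "x - y"] diff[of x y] that by simp
  have re: "\<phi> (of_real r) = of_real r" for r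
  proof -
    let ?z = "\<phi> (of_real r)"
    \<comment> \<open>The point \<open>?z\<close> has distance \<open>\<bar>r\<bar>\<close> to 0 and distance \<open>\<bar>r - 1\<bar>\<close> to 1, which pins it down.\<close>
    have 1: "norm ?z = \<bar>r\<bar>" using nrm[of "of_real r"] by simp
    have "norm (?z - 1) = norm ((of_real r :: 'k) - 1)"
      using nrm[of "of_real r - 1"] diff one by simp
    also have "\<dots> = \<bar>r - 1\<bar>" by (metis norm_of_real of_real_1 of_real_diff)
    finally have 2: "norm (?z - 1) = \<bar>r - 1\<bar>" .
    have a: "(Re ?z)\<^sup>2 + (Im ?z)\<^sup>2 = r\<^sup>2" using 1 by (metis cmod_power2 power2_abs)
    have b: "(Re ?z - 1)\<^sup>2 + (Im ?z)\<^sup>2 = (r - 1)\<^sup>2" using 2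
      by (metis cmod_power2 minus_complex.simps one_complex.simps diff_zero power2_abs)
    have "Re ?z = r" using a b by (simp add: power2_eq_square algebra_simps)
    moreover from this have "Im ?z = 0" using a by simp
    ultimately show ?thesis by (simp add: complex_eq_iff)
  qed
  show thesis
  proof (cases "range \<phi> = UNIV")
    case True
    then obtain I where I: "\<phi> I = \<i>" by (metis rangeE UNIV_I)
    have II: "I * I = - 1" by (rule inj) (simp add: mult I minus one)
    show thesis
    proof (rule that[of \<phi> I])
      show "c = of_real (Re (\<phi> c)) + I * of_real (Im (\<phi> c))" for c
        by (rule inj) (simp add: add mult re I complex_eq_iff)
      show "I * of_real (Re (\<phi> (I * c))) = - (I * of_real (Im (\<phi> c)))" for c
        by (rule inj) (simp add: mult re I minus)
      show "Re (\<phi> (I * of_real r)) = 0" for r by (simp add: mult re I)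
    qed (use add mult nrm re rng II in auto)
  next
    case False
    then have real: "range \<phi> = \<real>" using rng by blast
    have im: "Im (\<phi> c) = 0" for c using real complex_is_Real_iff by blast
    show thesis
    proof (rule that[of \<phi> 0])
      show "c = of_real (Re (\<phi> c)) + 0 * of_real (Im (\<phi> c))" for c
        by (rule inj) (simp add: add mult re zero im complex_eq_iff)
    qed (use add mult nrm re rng zero im in auto)
  qed
qed

text \<open>The field is isometric to a closed subset of \<open>\<complex>\<close>.\<close>

lemma compact_cball_scalar: "compact (cball (0::'k::rc_scalar) K)"
proof -
  obtain \<phi> :: "'k \<Rightarrow> complex" and I where add: "\<And>x y. \<phi> (x + y) = \<phi> x + \<phi> y"
    and nrm: "\<And>x. norm (\<phi> x) = norm x" and rng: "range \<phi> = \<real> \<or> range \<phi> = UNIV"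
    using rc_scalar_real_imag by metis
  have diff: "norm (\<phi> x - \<phi> y) = norm (x - y)" for x y
  proof -
    have "\<phi> x = \<phi> (x - y) + \<phi> y" using add[of "x - y" y] by simp
    then show ?thesis using nrm[of "x - y"] by simp
  qed
  define \<psi> where "\<psi> = inv_into UNIV \<phi>"
  have inj: "inj \<phi>" by (rule injI) (use diff in \<open>metis eq_iff_diff_eq_0 norm_eq_zero\<close>)
  have \<psi>: "\<psi> (\<phi> x) = x" for x unfolding \<psi>_def by (simp add: inj)
  have "closed (range \<phi>)" using rng closed_complex_Reals by auto
  then have "compact (range \<phi> \<inter> cball 0 K)" by (simp add: closed_Int_compact)
  moreover have "continuous_on (range \<phi> \<inter> cball 0 K) \<psi>"
    unfolding continuous_on_iff by (auto simp: \<psi> dist_norm diff)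
  moreover have "\<psi> ` (range \<phi> \<inter> cball 0 K) = cball 0 K"
  proof -
    have "x \<in> \<psi> ` (range \<phi> \<inter> cball 0 K)" if "norm x \<le> K" for x
      by (rule image_eqI[of _ _ "\<phi> x"]) (use that in \<open>auto simp: \<psi> nrm\<close>)
    then show ?thesis by (auto simp: \<psi> nrm)
  qed
  ultimately show ?thesis using compact_continuous_image by metis
qed

lemma finite_net_scalars:
  assumes "\<tau> > 0"
  obtains N :: "'k::rc_scalar set" where "finite N" "\<And>c. norm c \<le> K \<Longrightarrow> \<exists>d\<in>N. norm (c - d) < \<tau>"
proof -
  have "seq_compact (cball (0::'k) K)"
    using compact_cball_scalar compact_imp_seq_compact by blast
  then obtain N where "finite N" "cball (0::'k) K \<subseteq> (\<Union>x\<in>N. ball x \<tau>)"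
    using seq_compact_imp_totally_bounded[rule_format, OF _ assms] by metis
  then show thesis
    by (intro that[of N]) (auto simp: dist_norm subset_iff norm_minus_commute)
qed

lemma bounded_family_convergent_subseq:
  fixes x :: "nat \<Rightarrow> 'i \<Rightarrow> 'k::rc_scalar"
  assumes "finite I" "\<And>n i. i \<in> I \<Longrightarrow> norm (x n i) \<le> K"
  obtains r l where "strict_mono (r :: nat \<Rightarrow> nat)" "\<And>i. i \<in> I \<Longrightarrow> (\<lambda>n. x (r n) i) \<longlonglongrightarrow> l i"
proof -
  from assms have "\<exists>r l. strict_mono (r :: nat \<Rightarrow> nat) \<and> (\<forall>i\<in>I. (\<lambda>n. x (r n) i) \<longlonglongrightarrow> l i)"
  proof (induction I rule: finite_induct)
    case empty
    have "strict_mono (\<lambda>n::nat. n)" by (simp add: strict_mono_def)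
    then show ?case by blast
  next
    case (insert j J)
    then obtain r l where r: "strict_mono (r :: nat \<Rightarrow> nat)"
      and l: "\<forall>i\<in>J. (\<lambda>n. x (r n) i) \<longlonglongrightarrow> l i" by blast
    have "seq_compact (cball (0::'k) K)"
      using compact_cball_scalar compact_imp_seq_compact by blast
    moreover have "\<forall>n. x (r n) j \<in> cball 0 K" using insert.prems by simp
    ultimately obtain a s where s: "strict_mono (s :: nat \<Rightarrow> nat)"
      and a: "((\<lambda>n. x (r n) j) \<circ> s) \<longlonglongrightarrow> a" unfolding seq_compact_def by metis
    have "(\<lambda>n. x ((r \<circ> s) n) i) \<longlonglongrightarrow> (l(j := a)) i" if "i \<in> insert j J" for i
    proof (cases "i = j")
      case True
      then show ?thesis using a by (simp add: comp_def)
    next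
      case False
      then have "(\<lambda>n. x (r n) i) \<longlonglongrightarrow> l i" using l that by blast
      then show ?thesis using LIMSEQ_subseq_LIMSEQ[OF _ s] False by (fastforce simp: comp_def)
    qed
    then show ?case using strict_mono_o[OF r s] by blast
  qed
  then show thesis using that by blast
qed

section \<open>Linear algebra in explicit carriers\<close>

lemma vec_space_vector_space: "vec_space V \<Longrightarrow> vector_space (vscale V)"
  by (simp add: vec_space_def)

lemma vec_space_module: "vec_space V \<Longrightarrow> module (vscale V)"
  by (simp add: vec_space_def module_iff_vector_space)

lemma vec_space_subspace: "vec_space V \<Longrightarrow> module.subspace (vscale V) (vcarrier V)"
  by (simp add: vec_space_def)

lemma vs_closed:
  assumes "vec_space V"
  shows "0 \<in> vcarrier V" "x \<in> vcarrier V \<Longrightarrow> y \<in> vcarrier V \<Longrightarrow> x + y \<in> vcarrier V"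
    "x \<in> vcarrier V \<Longrightarrow> y \<in> vcarrier V \<Longrightarrow> x - y \<in> vcarrier V"
    "x \<in> vcarrier V \<Longrightarrow> - x \<in> vcarrier V"
    "x \<in> vcarrier V \<Longrightarrow> vscale V c x \<in> vcarrier V"
    "(\<And>i. i \<in> A \<Longrightarrow> f i \<in> vcarrier V) \<Longrightarrow> sum f A \<in> vcarrier V"
proof -
  note sp = vec_space_subspace[OF assms]
  interpret module "vscale V" using vec_space_module[OF assms] .
  show "0 \<in> vcarrier V" "x \<in> vcarrier V \<Longrightarrow> y \<in> vcarrier V \<Longrightarrow> x + y \<in> vcarrier V"
    "x \<in> vcarrier V \<Longrightarrow> y \<in> vcarrier V \<Longrightarrow> x - y \<in> vcarrier V"
    "x \<in> vcarrier V \<Longrightarrow> - x \<in> vcarrier V"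
    "x \<in> vcarrier V \<Longrightarrow> vscale V c x \<in> vcarrier V"
    "(\<And>i. i \<in> A \<Longrightarrow> f i \<in> vcarrier V) \<Longrightarrow> sum f A \<in> vcarrier V"
    by (simp_all add: subspace_0[OF sp] subspace_add[OF sp] subspace_diff[OF sp] subspace_neg[OF sp]
        subspace_scale[OF sp] subspace_sum[OF sp])
qed

lemma vs_algebra:
  assumes "vec_space V"
  shows "vscale V c (x + y) = vscale V c x + vscale V c y"
    "vscale V c (x - y) = vscale V c x - vscale V c y"
    "vscale V c (- x) = - vscale V c x"
    "vscale V (c + d) x = vscale V c x + vscale V d x"
    "vscale V (c - d) x = vscale V c x - vscale V d x"
    "vscale V (- c) x = - vscale V c x"
    "vscale V c (vscale V d x) = vscale V (c * d) x"
    "vscale V 1 x = x" "vscale V 0 x = 0" "vscale V c 0 = 0"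
    "vscale V c (sum f A) = (\<Sum>i\<in>A. vscale V c (f i))"
    "vscale V (sum g A) x = (\<Sum>i\<in>A. vscale V (g i) x)"
proof -
  interpret module "vscale V" using vec_space_module[OF assms] .
  show "vscale V c (x + y) = vscale V c x + vscale V c y"
    "vscale V c (x - y) = vscale V c x - vscale V c y"
    "vscale V c (- x) = - vscale V c x"
    "vscale V (c + d) x = vscale V c x + vscale V d x"
    "vscale V (c - d) x = vscale V c x - vscale V d x"
    "vscale V (- c) x = - vscale V c x"
    "vscale V c (vscale V d x) = vscale V (c * d) x"
    "vscale V 1 x = x" "vscale V 0 x = 0" "vscale V c 0 = 0"
    "vscale V c (sum f A) = (\<Sum>i\<in>A. vscale V c (f i))"
    "vscale V (sum g A) x = (\<Sum>i\<in>A. vscale V (g i) x)"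
    by (simp_all add: scale_right_distrib scale_right_diff_distrib scale_left_distrib
        scale_left_diff_distrib scale_sum_left scale_sum_right)
qed

lemma lin_mapD:
  assumes "lin_map V W T"
  shows "x \<in> vcarrier V \<Longrightarrow> T x \<in> vcarrier W"
    "x \<in> vcarrier V \<Longrightarrow> y \<in> vcarrier V \<Longrightarrow> T (x + y) = T x + T y"
    "x \<in> vcarrier V \<Longrightarrow> T (vscale V c x) = vscale W c (T x)"
  using assms by (auto simp: lin_map_def)

lemma lin_map_algebra:
  assumes V: "vec_space V" and T: "lin_map V W T"
  shows "T 0 = 0" "x \<in> vcarrier V \<Longrightarrow> T (- x) = - T x"
    "x \<in> vcarrier V \<Longrightarrow> y \<in> vcarrier V \<Longrightarrow> T (x - y) = T x - T y"
    "(\<And>i. i \<in> A \<Longrightarrow> f i \<in> vcarrier V) \<Longrightarrow> T (sum f A) = (\<Sum>i\<in>A. T (f i))"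
proof -
  show 0: "T 0 = 0" using lin_mapD(2)[OF T, of 0 0] vs_closed(1)[OF V] by simp
  have neg: "T (- x) = - T x" if "x \<in> vcarrier V" for x
    using lin_mapD(2)[OF T that vs_closed(4)[OF V that]] 0 by (simp add: eq_neg_iff_add_eq_0 add.commute)
  show "x \<in> vcarrier V \<Longrightarrow> T (- x) = - T x" by (rule neg)
  show "T (x - y) = T x - T y" if "x \<in> vcarrier V" "y \<in> vcarrier V"
    using lin_mapD(2)[OF T that(1) vs_closed(4)[OF V that(2)]] neg[OF that(2)] by simp
  show "T (sum f A) = (\<Sum>i\<in>A. T (f i))" if "\<And>i. i \<in> A \<Longrightarrow> f i \<in> vcarrier V"
  proof (cases "finite A")
    case True
    then show ?thesis using that
    proof (induction A rule: finite_induct)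
      case (insert a A)
      then have "T (f a + sum f A) = T (f a) + T (sum f A)"
        by (intro lin_mapD(2)[OF T] vs_closed(6)[OF V]) auto
      then show ?case using insert by simp
    qed (simp add: 0)
  qed (simp add: 0)
qed

lemma lin_map_comp:
  "lin_map U V S \<Longrightarrow> lin_map V W T \<Longrightarrow> lin_map U W (\<lambda>x. T (S x))"
  by (simp add: lin_map_def)

lemma lin_map_inj_on_iff:
  assumes "vec_space V" "lin_map V W T"
  shows "inj_on T (vcarrier V) \<longleftrightarrow> (\<forall>x\<in>vcarrier V. T x = 0 \<longrightarrow> x = 0)"
proof
  assume "inj_on T (vcarrier V)"
  then show "\<forall>x\<in>vcarrier V. T x = 0 \<longrightarrow> x = 0"
    using lin_map_algebra(1)[OF assms] vs_closed(1)[OF assms(1)] by (metis inj_onD)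
next
  assume *: "\<forall>x\<in>vcarrier V. T x = 0 \<longrightarrow> x = 0"
  show "inj_on T (vcarrier V)"
  proof (rule inj_onI)
    fix x y assume "x \<in> vcarrier V" "y \<in> vcarrier V" "T x = T y"
    then show "x = y"
      using * lin_map_algebra(3)[OF assms] vs_closed(3)[OF assms(1)] by (metis eq_iff_diff_eq_0)
  qed
qed

lemma lin_map_inv_into:
  assumes V: "vec_space V" and T: "lin_map V W T" and inj: "inj_on T (vcarrier V)"
  shows "lin_map (W\<lparr>vcarrier := T ` vcarrier V\<rparr>) V (inv_into (vcarrier V) T)"
proof -
  have [simp]: "inv_into (vcarrier V) T (T x) = x" if "x \<in> vcarrier V" for x
    using that inj by simp
  have "inv_into (vcarrier V) T (T x + T y) = x + y" if "x \<in> vcarrier V" "y \<in> vcarrier V" for x y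
    using that lin_mapD(2)[OF T that, symmetric] vs_closed[OF V] by simp
  moreover have "inv_into (vcarrier V) T (vscale W c (T x)) = vscale V c x" if "x \<in> vcarrier V" for x c
    using that lin_mapD(3)[OF T that, symmetric] vs_closed[OF V] by simp
  ultimately show ?thesis unfolding lin_map_def by auto
qed

lemma subspace_image_lin_map:
  assumes "vec_space V" "vec_space W" "lin_map V W T"
  shows "module.subspace (vscale W) (T ` vcarrier V)"
proof (rule module.subspaceI[OF vec_space_module[OF assms(2)]])
  show "0 \<in> T ` vcarrier V"
    using lin_map_algebra(1)[OF assms(1,3)] vs_closed(1)[OF assms(1)] by (metis image_eqI)
  show "x + y \<in> T ` vcarrier V" if "x \<in> T ` vcarrier V" "y \<in> T ` vcarrier V" for x y
    using that lin_mapD(2)[OF assms(3)] vs_closed(2)[OF assms(1)] by (smt (verit) image_iff)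
  show "vscale W c x \<in> T ` vcarrier V" if "x \<in> T ` vcarrier V" for x c
    using that lin_mapD(3)[OF assms(3)] vs_closed(5)[OF assms(1)] by (smt (verit) image_iff)
qed

lemma vec_space_subcarrier:
  "vec_space F \<Longrightarrow> module.subspace (vscale F) U \<Longrightarrow> vec_space (F\<lparr>vcarrier := U\<rparr>)"
  by (simp add: vec_space_def)

text \<open>A basis together with its coordinate functionals. The latter are elements of the dual, so
  they form the dual basis.\<close>

definition coord_basis ::
    "('k::field, 'v::ab_group_add, 'z) vspace_scheme \<Rightarrow> nat \<Rightarrow> (nat \<Rightarrow> 'v) \<Rightarrow> (nat \<Rightarrow> 'v \<Rightarrow> 'k) \<Rightarrow> bool"
  where
  "coord_basis V k b c \<longleftrightarrow>
     (\<forall>i<k. b i \<in> vcarrier V \<and> lin_functional V (c i)) \<and>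
     (\<forall>i<k. \<forall>j<k. c i (b j) = (if i = j then 1 else 0)) \<and>
     (\<forall>x\<in>vcarrier V. x = (\<Sum>i<k. vscale V (c i x) (b i)))"

lemma coord_basisD:
  assumes "coord_basis V k b c"
  shows "i < k \<Longrightarrow> b i \<in> vcarrier V" "i < k \<Longrightarrow> lin_functional V (c i)"
    "i < k \<Longrightarrow> j < k \<Longrightarrow> c i (b j) = (if i = j then 1 else 0)"
    "x \<in> vcarrier V \<Longrightarrow> (\<Sum>i<k. vscale V (c i x) (b i)) = x"
  using assms unfolding coord_basis_def by auto

lemma lin_functional_algebra:
  fixes V :: "('k::field, 'v::ab_group_add, 'z) vspace_scheme"
  assumes V: "vec_space V" and f: "lin_functional V f"
  shows "f 0 = 0" "x \<in> vcarrier V \<Longrightarrow> y \<in> vcarrier V \<Longrightarrow> f (x + y) = f x + f y"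
    "x \<in> vcarrier V \<Longrightarrow> y \<in> vcarrier V \<Longrightarrow> f (x - y) = f x - f y"
    "x \<in> vcarrier V \<Longrightarrow> f (- x) = - f x"
    "x \<in> vcarrier V \<Longrightarrow> f (vscale V a x) = a * f x"
    "(\<And>i. i \<in> A \<Longrightarrow> g i \<in> vcarrier V) \<Longrightarrow> f (sum g A) = (\<Sum>i\<in>A. f (g i))"
proof -
  define K :: "('k, 'k) vspace" where "K = \<lparr>vcarrier = UNIV, vscale = (*)\<rparr>"
  have T: "lin_map V K f" using f by (simp add: lin_map_def K_def lin_functional_def)
  show "f 0 = 0" "x \<in> vcarrier V \<Longrightarrow> y \<in> vcarrier V \<Longrightarrow> f (x + y) = f x + f y"
    "x \<in> vcarrier V \<Longrightarrow> y \<in> vcarrier V \<Longrightarrow> f (x - y) = f x - f y"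
    "x \<in> vcarrier V \<Longrightarrow> f (- x) = - f x"
    "x \<in> vcarrier V \<Longrightarrow> f (vscale V a x) = a * f x"
    using lin_map_algebra(1-3)[OF V T] lin_mapD[OF T] by (simp_all add: K_def)
  show "(\<And>i. i \<in> A \<Longrightarrow> g i \<in> vcarrier V) \<Longrightarrow> f (sum g A) = (\<Sum>i\<in>A. f (g i))"
    by (rule lin_map_algebra(4)[OF V T])
qed

lemma lin_comb_lin_map:
  assumes W: "vec_space W" and c: "\<And>i. i < k \<Longrightarrow> lin_functional V (c i)"
    and w: "\<And>i. i < (k::nat) \<Longrightarrow> w i \<in> vcarrier W"
  shows "lin_map V W (\<lambda>x. \<Sum>i<k. vscale W (c i x) (w i))"
  unfolding lin_map_def
proof (intro conjI ballI allI)
  fix x assume "x \<in> vcarrier V"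
  then show "(\<Sum>i<k. vscale W (c i x) (w i)) \<in> vcarrier W"
    using w by (intro vs_closed[OF W]) auto
next
  fix x y assume "x \<in> vcarrier V" "y \<in> vcarrier V"
  then show "(\<Sum>i<k. vscale W (c i (x + y)) (w i))
      = (\<Sum>i<k. vscale W (c i x) (w i)) + (\<Sum>i<k. vscale W (c i y) (w i))"
    using c by (simp add: lin_functional_def vs_algebra[OF W] sum.distrib)
next
  fix a x assume "x \<in> vcarrier V"
  then show "(\<Sum>i<k. vscale W (c i (vscale V a x)) (w i)) = vscale W a (\<Sum>i<k. vscale W (c i x) (w i))"
    using c by (simp add: lin_functional_def vs_algebra[OF W])
qed

lemma coord_basis_sum_coord:
  assumes V: "vec_space V" and b: "coord_basis V k b c" and i: "i < k"
  shows "c i (\<Sum>j<k. vscale V (a j) (b j)) = a i"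
proof -
  have "c i (\<Sum>j<k. vscale V (a j) (b j)) = (\<Sum>j<k. c i (vscale V (a j) (b j)))"
    by (rule lin_functional_algebra(6)[OF V coord_basisD(2)[OF b i]])
      (simp add: coord_basisD(1)[OF b] vs_closed[OF V])
  also have "\<dots> = (\<Sum>j<k. if j = i then a j else 0)"
    by (rule sum.cong) (auto simp: lin_functional_algebra(5)[OF V coord_basisD(2)[OF b i]]
      coord_basisD(1)[OF b] coord_basisD(3)[OF b i])
  also have "\<dots> = a i" using i by simp
  finally show ?thesis .
qed

lemma coord_basis_lin_map_expand:
  assumes V: "vec_space V" and b: "coord_basis V k b c" and T: "lin_map V W T" and x: "x \<in> vcarrier V"
  shows "T x = (\<Sum>i<k. vscale W (c i x) (T (b i)))"
proof -
  have "T x = T (\<Sum>i<k. vscale V (c i x) (b i))" using coord_basisD(4)[OF b x] by simp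
  also have "\<dots> = (\<Sum>i<k. T (vscale V (c i x) (b i)))"
    by (rule lin_map_algebra(4)[OF V T]) (simp add: coord_basisD(1)[OF b] vs_closed[OF V])
  also have "\<dots> = (\<Sum>i<k. vscale W (c i x) (T (b i)))"
    by (rule sum.cong) (auto simp: lin_mapD(3)[OF T] coord_basisD(1)[OF b])
  finally show ?thesis .
qed

lemma coord_basis_functional_expand:
  assumes V: "vec_space V" and b: "coord_basis V k b c" and f: "lin_functional V f"
    and x: "x \<in> vcarrier V"
  shows "f x = (\<Sum>i<k. c i x * f (b i))"
proof -
  have "f x = f (\<Sum>i<k. vscale V (c i x) (b i))" using coord_basisD(4)[OF b x] by simp
  also have "\<dots> = (\<Sum>i<k. f (vscale V (c i x) (b i)))"
    by (rule lin_functional_algebra(6)[OF V f]) (simp add: coord_basisD(1)[OF b] vs_closed[OF V])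
  also have "\<dots> = (\<Sum>i<k. c i x * f (b i))"
    by (rule sum.cong) (auto simp: lin_functional_algebra(5)[OF V f] coord_basisD(1)[OF b])
  finally show ?thesis .
qed

lemma coord_basis_independent:
  assumes V: "vec_space V" and b: "coord_basis V k b c"
  shows "inj_on b {..<k}" "\<not> module.dependent (vscale V) (b ` {..<k})"
    "module.span (vscale V) (b ` {..<k}) = vcarrier V"
proof -
  interpret vector_space "vscale V" using vec_space_vector_space[OF V] .
  show inj: "inj_on b {..<k}"
  proof (rule inj_onI)
    fix i j assume "i \<in> {..<k}" "j \<in> {..<k}" "b i = b j"
    then show "i = j" using coord_basisD(3)[OF b, of i i] coord_basisD(3)[OF b, of i j]
      by (auto split: if_splits)
  qed
  show "\<not> dependent (b ` {..<k})"
  proof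
    assume "dependent (b ` {..<k})"
    then obtain u where u: "(\<Sum>v\<in>b ` {..<k}. vscale V (u v) v) = 0" "\<exists>v\<in>b ` {..<k}. u v \<noteq> 0"
      by (auto simp: dependent_finite)
    then obtain i where i: "i < k" "u (b i) \<noteq> 0" by auto
    have "(\<Sum>v\<in>b ` {..<k}. vscale V (u v) v) = (\<Sum>j<k. vscale V (u (b j)) (b j))"
      by (simp add: sum.reindex[OF inj])
    then have "c i 0 = u (b i)" using coord_basis_sum_coord[OF V b i(1), of "\<lambda>j. u (b j)"] u(1) by simp
    then show False using i lin_functional_algebra(1)[OF V coord_basisD(2)[OF b i(1)]] by simp
  qed
  show "span (b ` {..<k}) = vcarrier V"
  proof (rule span_subspace)
    show "b ` {..<k} \<subseteq> vcarrier V" using coord_basisD(1)[OF b] by auto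
    show "vcarrier V \<subseteq> span (b ` {..<k})"
    proof
      fix x assume "x \<in> vcarrier V"
      then have "x = (\<Sum>i<k. vscale V (c i x) (b i))" using coord_basisD(4)[OF b] by simp
      also have "\<dots> \<in> span (b ` {..<k})" by (intro span_sum span_scale span_base) auto
      finally show "x \<in> span (b ` {..<k})" .
    qed
    show "subspace (vcarrier V)" using vec_space_subspace[OF V] .
  qed
qed

lemma coord_basis_imp_has_dim:
  assumes V: "vec_space V" and b: "coord_basis V k b c"
  shows "has_dim V k"
  unfolding has_dim_def
  using coord_basis_independent[OF V b] by (intro exI[of _ "b ` {..<k}"]) (simp add: card_image)

lemma has_dim_coord_basis:
  assumes V: "vec_space V" and k: "has_dim V k"
  obtains b c where "coord_basis V k b c"
proof -
  interpret vector_space "vscale V" using vec_space_vector_space[OF V] .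
  obtain B where B: "finite B" "card B = k" "independent B" "span B = vcarrier V"
    using k unfolding has_dim_def by blast
  obtain b where bij: "bij_betw b {..<k} B"
    using ex_bij_betw_nat_finite[OF B(1)] B(2) by (auto simp: atLeast0LessThan)
  then have im: "b ` {..<k} = B" and inj: "inj_on b {..<k}" by (auto simp: bij_betw_def)
  define c where "c i x = (if x \<in> vcarrier V then representation B x (b i) else 0)" for i x
  have mem: "b i \<in> B" if "i < k" for i using that im by blast
  have "coord_basis V k b c"
    unfolding coord_basis_def
  proof (intro conjI allI ballI impI)
    fix i assume i: "i < k"
    show "b i \<in> vcarrier V" using mem[OF i] B(4) span_base by auto
    show "lin_functional V (c i)"
      unfolding lin_functional_def
      using representation_add[OF B(3)] representation_scale[OF B(3)] B(4)
      by (auto simp: c_def vs_closed[OF V])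
    fix j assume j: "j < k"
    show "c i (b j) = (if i = j then 1 else 0)"
      using representation_basis[OF B(3) mem[OF j]] inj i j mem[OF j] span_base[OF mem[OF j]] B(4)
      by (auto simp: c_def inj_on_def)
  next
    fix x assume x: "x \<in> vcarrier V"
    have "(\<Sum>v\<in>B. vscale V (representation B x v) v) = x"
      using sum_representation_eq[OF B(3) _ B(1) subset_refl, of x] x B(4) by simp
    then have "(\<Sum>i<k. vscale V (representation B x (b i)) (b i)) = x"
      unfolding im[symmetric] by (simp add: sum.reindex[OF inj])
    then show "x = (\<Sum>i<k. vscale V (c i x) (b i))" using x by (simp add: c_def)
  qed
  then show thesis by (rule that)
qed

lemma has_dim_image:
  assumes V: "vec_space V" and W: "vec_space W" and k: "has_dim V k"
    and T: "lin_map V W T" and inj: "inj_on T (vcarrier V)"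
  shows "has_dim (W\<lparr>vcarrier := T ` vcarrier V\<rparr>) k"
proof -
  obtain b c where b: "coord_basis V k b c" using has_dim_coord_basis[OF V k] .
  let ?W = "W\<lparr>vcarrier := T ` vcarrier V\<rparr>"
  have W': "vec_space ?W" using vec_space_subcarrier[OF W subspace_image_lin_map[OF V W T]] .
  define d where "d i y = (if y \<in> T ` vcarrier V then c i (inv_into (vcarrier V) T y) else 0)" for i y
  have inv: "inv_into (vcarrier V) T (T x) = x" if "x \<in> vcarrier V" for x using that inj by simp
  have d: "d i (T x) = c i x" if "x \<in> vcarrier V" for i x using that inv by (simp add: d_def)
  have "coord_basis ?W k (\<lambda>i. T (b i)) d"
    unfolding coord_basis_def
  proof (intro conjI allI ballI impI)
    fix i assume i: "i < k"
    show "T (b i) \<in> vcarrier ?W" using coord_basisD(1)[OF b i] by simp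
    show "lin_functional ?W (d i)"
      unfolding lin_functional_def
    proof (intro conjI ballI allI impI)
      fix x y assume "x \<in> vcarrier ?W" "y \<in> vcarrier ?W"
      then obtain x' y' where "x' \<in> vcarrier V" "x = T x'" "y' \<in> vcarrier V" "y = T y'" by auto
      then show "d i (x + y) = d i x + d i y"
        using lin_mapD(2)[OF T, symmetric] d vs_closed[OF V]
          lin_functional_algebra(2)[OF V coord_basisD(2)[OF b i]] by simp
    next
      fix a x assume "x \<in> vcarrier ?W"
      then obtain x' where "x' \<in> vcarrier V" "x = T x'" by auto
      then show "d i (vscale ?W a x) = a * d i x"
        using lin_mapD(3)[OF T, symmetric] d vs_closed[OF V]
          lin_functional_algebra(5)[OF V coord_basisD(2)[OF b i]] by simp
    qed (simp add: d_def)
    show "d i (T (b j)) = (if i = j then 1 else 0)" if "j < k" for j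
      using d coord_basisD(1)[OF b that] coord_basisD(3)[OF b i that] by simp
  next
    fix x assume "x \<in> vcarrier ?W"
    then obtain x' where x': "x' \<in> vcarrier V" "x = T x'" by auto
    have "(\<Sum>i<k. vscale ?W (d i x) (T (b i))) = (\<Sum>i<k. vscale W (c i x') (T (b i)))"
      using x' d by simp
    then show "x = (\<Sum>i<k. vscale ?W (d i x) (T (b i)))"
      using coord_basis_lin_map_expand[OF V b T x'(1)] x'(2) by simp
  qed
  then show ?thesis using coord_basis_imp_has_dim[OF W'] by blast
qed

lemma has_dim_subspace_eq:
  assumes W: "vec_space W" and k: "has_dim W k"
    and U: "U \<subseteq> vcarrier W" and kU: "has_dim (W\<lparr>vcarrier := U\<rparr>) k"
  shows "U = vcarrier W"
proof -
  interpret vector_space "vscale W" using vec_space_vector_space[OF W] .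
  obtain B where B: "finite B" "card B = k" "independent B" "span B = vcarrier W"
    using k unfolding has_dim_def by blast
  obtain C where C: "finite C" "card C = k" "independent C" "span C = U"
    using kU unfolding has_dim_def by auto
  have "w \<in> span C" if w: "w \<in> vcarrier W" for w
  proof (rule ccontr)
    assume n: "w \<notin> span C"
    then have "independent (insert w C)" using independent_insertI C(3) by blast
    moreover have "insert w C \<subseteq> span B" using w U C(4) B(4) span_superset[of C] by blast
    ultimately have "card (insert w C) \<le> card B" using independent_span_bound[OF B(1)] by blast
    moreover have "w \<notin> C" using n span_base by blast
    ultimately show False using C B by simp
  qed
  then show ?thesis using U C(4) by blast
qed

lemma lin_map_inj_imp_surj:
  assumes V: "vec_space V" and W: "vec_space W" and k: "has_dim V k" "has_dim W k"
    and T: "lin_map V W T" and inj: "inj_on T (vcarrier V)"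
  shows "T ` vcarrier V = vcarrier W"
  using has_dim_subspace_eq[OF W k(2) _ has_dim_image[OF V W k(1) T inj]] lin_mapD(1)[OF T] by blast

lemma has_dim_with_norm [simp]: "has_dim (with_norm V m) k = has_dim V k"
  by (simp add: has_dim_def with_norm_def)

lemma vec_space_with_norm [simp]: "vec_space (with_norm V m) = vec_space V"
  by (simp add: vec_space_def with_norm_def)

lemma with_norm_sel [simp]:
  "vcarrier (with_norm V m) = vcarrier V" "vscale (with_norm V m) = vscale V"
  "vnorm (with_norm V m) = m"
  by (simp_all add: with_norm_def)

lemma lin_map_with_norm [simp]:
  "lin_map (with_norm V m) W T = lin_map V W T" "lin_map V (with_norm W n) T = lin_map V W T"
  by (simp_all add: lin_map_def)

lemma vec_space_alg_dual: "vec_space V \<Longrightarrow> vec_space (alg_dual V)"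
  unfolding vec_space_def[of "alg_dual V"]
proof
  assume V: "vec_space V"
  show "vector_space (vscale (alg_dual V))" by (simp add: alg_dual_def vector_space_fun_scale)
  then have m: "module (vscale (alg_dual V))" by (simp add: module_iff_vector_space)
  show "module.subspace (vscale (alg_dual V)) (vcarrier (alg_dual V))"
    by (rule module.subspaceI[OF m])
      (simp_all add: alg_dual_def lin_functional_def fun_scale_def algebra_simps)
qed

lemma alg_dual_carrier: "f \<in> vcarrier (alg_dual V) \<longleftrightarrow> lin_functional V f"
  by (simp add: alg_dual_def)

lemma alg_dual_scale: "vscale (alg_dual V) a f x = a * f x"
  by (simp add: alg_dual_def fun_scale_def)

lemma sum_fun_apply: "(\<Sum>i\<in>A. g i) x = (\<Sum>i\<in>A. g i x)" for g :: "'i \<Rightarrow> 'a \<Rightarrow> 'b::comm_monoid_add"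
  by (induction A rule: infinite_finite_induct) auto

lemma unit_vectors_expand:
  fixes x :: "nat \<Rightarrow> 'k::field" assumes "\<forall>i\<ge>k. x i = 0"
  shows "(\<Sum>i<k. fun_scale (x i) (\<lambda>j. if j = i then 1 else 0)) = x"
proof
  fix j
  have "(\<Sum>i<k. fun_scale (x i) (\<lambda>j. if j = i then 1 else 0)) j = (\<Sum>i<k. if i = j then x i else 0)"
    unfolding sum_fun_apply by (rule sum.cong) (auto simp: fun_scale_def)
  also have "\<dots> = x j" using assms by (simp add: not_less)
  finally show "(\<Sum>i<k. fun_scale (x i) (\<lambda>j. if j = i then 1 else 0)) j = x j" .
qed

lemma coord_basis_alg_dual:
  assumes V: "vec_space V" and b: "coord_basis V k b c"
  shows "coord_basis (alg_dual V) k c (\<lambda>i. bidual_eval V (b i))"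
  unfolding coord_basis_def
proof (intro conjI allI ballI impI)
  fix i assume i: "i < k"
  show "c i \<in> vcarrier (alg_dual V)" using coord_basisD(2)[OF b i] by (simp add: alg_dual_carrier)
  show "lin_functional (alg_dual V) (bidual_eval V (b i))"
    using vs_closed[OF vec_space_alg_dual[OF V]]
    by (auto simp: lin_functional_def bidual_eval_def alg_dual_scale)
  show "bidual_eval V (b i) (c j) = (if i = j then 1 else 0)" if "j < k" for j
    using coord_basisD(3)[OF b that i] coord_basisD(2)[OF b that]
    by (simp add: bidual_eval_def alg_dual_carrier)
next
  fix f assume f: "f \<in> vcarrier (alg_dual V)"
  show "f = (\<Sum>i<k. vscale (alg_dual V) (bidual_eval V (b i) f) (c i))"
  proof
    fix x show "f x = (\<Sum>i<k. vscale (alg_dual V) (bidual_eval V (b i) f) (c i)) x"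
    proof (cases "x \<in> vcarrier V")
      case True
      then show ?thesis
        using coord_basis_functional_expand[OF V b _ True, of f] f
        by (simp add: sum_fun_apply alg_dual_scale alg_dual_carrier bidual_eval_def mult.commute)
    next
      case False
      then show ?thesis using f coord_basisD(2)[OF b]
        by (simp add: sum_fun_apply alg_dual_scale alg_dual_carrier lin_functional_def)
    qed
  qed
qed

lemma has_dim_alg_dual: "vec_space V \<Longrightarrow> has_dim V k \<Longrightarrow> has_dim (alg_dual V) k"
  by (rule has_dim_coord_basis[of V k])
    (auto intro: coord_basis_imp_has_dim[OF vec_space_alg_dual coord_basis_alg_dual])

lemma vec_space_coord_space: "vec_space (coord_space k :: ('k::field, nat \<Rightarrow> 'k) vspace)"
  unfolding vec_space_def
proof
  show "vector_space (vscale (coord_space k :: ('k, nat \<Rightarrow> 'k) vspace))"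
    by (simp add: coord_space_def vector_space_fun_scale)
  then have m: "module (vscale (coord_space k :: ('k, nat \<Rightarrow> 'k) vspace))"
    by (simp add: module_iff_vector_space)
  show "module.subspace (vscale (coord_space k)) (vcarrier (coord_space k :: ('k, nat \<Rightarrow> 'k) vspace))"
    by (rule module.subspaceI[OF m]) (simp_all add: coord_space_def fun_scale_def)
qed

lemma has_dim_coord_space: "has_dim (coord_space k :: ('k::field, nat \<Rightarrow> 'k) vspace) k"
proof -
  let ?V = "coord_space k :: ('k, nat \<Rightarrow> 'k) vspace"
  let ?b = "\<lambda>i j. if j = i then 1 else (0::'k)" and ?c = "\<lambda>i x. if x \<in> vcarrier ?V then x i else 0"
  have "coord_basis ?V k ?b ?c"
    unfolding coord_basis_def
  proof (intro conjI)
    have "lin_functional ?V (?c i)" for i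
      unfolding lin_functional_def using vs_closed[OF vec_space_coord_space]
      by (auto simp: coord_space_def fun_scale_def)
    then show "\<forall>i<k. ?b i \<in> vcarrier ?V \<and> lin_functional ?V (?c i)"
      by (simp add: coord_space_def)
    show "\<forall>i<k. \<forall>j<k. ?c i (?b j) = (if i = j then 1 else 0)"
      by (simp add: coord_space_def)
    show "\<forall>x\<in>vcarrier ?V. x = (\<Sum>i<k. vscale ?V (?c i x) (?b i))"
    proof
      fix x assume x: "x \<in> vcarrier ?V"
      then have "(\<Sum>i<k. vscale ?V (?c i x) (?b i)) = (\<Sum>i<k. fun_scale (x i) (?b i))"
        by (simp add: coord_space_def)
      also have "\<dots> = x" by (rule unit_vectors_expand) (use x in \<open>simp add: coord_space_def\<close>)
      finally show "x = (\<Sum>i<k. vscale ?V (?c i x) (?b i))" by simp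
    qed
  qed
  then show ?thesis using coord_basis_imp_has_dim[OF vec_space_coord_space] by blast
qed

text \<open>The union of finite spanning sets of the given subspaces spans a space that contains them all.\<close>

lemma finite_dim_subspaces_common:
  fixes F :: "('k::field, 'v::ab_group_add, 'z) vspace_scheme"
  assumes F: "vec_space F" and "finite \<U>"
    and U: "\<And>U. U \<in> \<U> \<Longrightarrow> U \<subseteq> vcarrier F \<and> fin_dim (F\<lparr>vcarrier := U\<rparr>)"
  obtains Y where "Y \<subseteq> vcarrier F" "module.subspace (vscale F) Y" "fin_dim (F\<lparr>vcarrier := Y\<rparr>)"
    "\<And>U. U \<in> \<U> \<Longrightarrow> U \<subseteq> Y"
proof -
  interpret vector_space "vscale F" using vec_space_vector_space[OF F] .
  have "\<forall>U\<in>\<U>. \<exists>B. finite B \<and> span B = U"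
  proof
    fix U assume "U \<in> \<U>"
    then have "fin_dim (F\<lparr>vcarrier := U\<rparr>)" using U by blast
    then show "\<exists>B. finite B \<and> span B = U" unfolding fin_dim_def has_dim_def by auto
  qed
  then obtain B where B: "\<And>U. U \<in> \<U> \<Longrightarrow> finite (B U)" "\<And>U. U \<in> \<U> \<Longrightarrow> span (B U) = U" by metis
  define C where "C = (\<Union>U\<in>\<U>. B U)"
  have C: "finite C" using assms(2) B by (simp add: C_def)
  obtain D where D: "D \<subseteq> C" "independent D" "C \<subseteq> span D"
    by (rule maximal_independent_subset)
  have sp: "span C = span D"
    using span_mono[OF D(1)] span_minimal[OF D(3) subspace_span] by blast
  show thesis
  proof (rule that[of "span C"])
    have "C \<subseteq> vcarrier F" using U B(2) span_superset unfolding C_def by blast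
    then show "span C \<subseteq> vcarrier F" using span_minimal vec_space_subspace[OF F] by blast
    show "fin_dim (F\<lparr>vcarrier := span C\<rparr>)"
      unfolding fin_dim_def has_dim_def
      using D(2) sp finite_subset[OF D(1) C] by (intro exI[of _ "card D"] exI[of _ D]) simp
    show "U \<subseteq> span C" if "U \<in> \<U>" for U using B(2)[OF that] span_mono[of "B U" C] that
      by (auto simp: C_def)
  qed simp
qed

section \<open>Norms and operator norms\<close>

lemma is_normD:
  assumes "is_norm V m"
  shows "x \<in> vcarrier V \<Longrightarrow> 0 \<le> m x" "x \<in> vcarrier V \<Longrightarrow> m x = 0 \<longleftrightarrow> x = 0"
    "x \<in> vcarrier V \<Longrightarrow> m (vscale V c x) = norm c * m x"
    "x \<in> vcarrier V \<Longrightarrow> y \<in> vcarrier V \<Longrightarrow> m (x + y) \<le> m x + m y"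
  using assms unfolding is_norm_def by simp_all

lemma norm_algebra:
  fixes V :: "('k::real_normed_field, 'v::ab_group_add, 'z) vspace_scheme"
  assumes V: "vec_space V" and m: "is_norm V m"
  shows "m 0 = 0" "x \<in> vcarrier V \<Longrightarrow> m (- x) = m x"
    "x \<in> vcarrier V \<Longrightarrow> y \<in> vcarrier V \<Longrightarrow> m (x - y) = m (y - x)"
    "x \<in> vcarrier V \<Longrightarrow> y \<in> vcarrier V \<Longrightarrow> m (x - y) \<le> m x + m y"
    "x \<in> vcarrier V \<Longrightarrow> y \<in> vcarrier V \<Longrightarrow> m x \<le> m (x - y) + m y"
    "x \<in> vcarrier V \<Longrightarrow> y \<in> vcarrier V \<Longrightarrow> \<bar>m x - m y\<bar> \<le> m (x - y)"
    "(\<And>i. i \<in> A \<Longrightarrow> f i \<in> vcarrier V) \<Longrightarrow> m (sum f A) \<le> (\<Sum>i\<in>A. m (f i))"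
proof -
  show 0: "m 0 = 0" using is_normD(2)[OF m] vs_closed(1)[OF V] by blast
  have neg: "m (- x) = m x" if "x \<in> vcarrier V" for x
    using is_normD(3)[OF m that, of "-1"] by (simp add: vs_algebra[OF V])
  then show "x \<in> vcarrier V \<Longrightarrow> m (- x) = m x" .
  have comm: "m (x - y) = m (y - x)" if "x \<in> vcarrier V" "y \<in> vcarrier V" for x y
    using neg[OF vs_closed(3)[OF V that]] by simp
  then show "x \<in> vcarrier V \<Longrightarrow> y \<in> vcarrier V \<Longrightarrow> m (x - y) = m (y - x)" .
  show "m (x - y) \<le> m x + m y" if "x \<in> vcarrier V" "y \<in> vcarrier V"
    using is_normD(4)[OF m that(1) vs_closed(4)[OF V that(2)]] neg[OF that(2)] by simp
  have tri: "m x \<le> m (x - y) + m y" if "x \<in> vcarrier V" "y \<in> vcarrier V" for x y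
    using is_normD(4)[OF m vs_closed(3)[OF V that] that(2)] by simp
  then show "x \<in> vcarrier V \<Longrightarrow> y \<in> vcarrier V \<Longrightarrow> m x \<le> m (x - y) + m y" .
  show "\<bar>m x - m y\<bar> \<le> m (x - y)" if "x \<in> vcarrier V" "y \<in> vcarrier V"
    using tri[OF that] tri[OF that(2,1)] comm[OF that] by linarith
  show "m (sum f A) \<le> (\<Sum>i\<in>A. m (f i))" if "\<And>i. i \<in> A \<Longrightarrow> f i \<in> vcarrier V"
  proof (cases "finite A")
    case True
    then show ?thesis using that
    proof (induction A rule: finite_induct)
      case (insert a A)
      then have "m (f a + sum f A) \<le> m (f a) + m (sum f A)"
        by (intro is_normD(4)[OF m] vs_closed(6)[OF V]) auto
      then show ?case using insert by fastforce
    qed (simp add: 0)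
  qed (simp add: 0)
qed

lemma norm_lin_comb_le:
  assumes V: "vec_space V" and m: "is_norm V m" and w: "\<And>i. i \<in> A \<Longrightarrow> w i \<in> vcarrier V"
  shows "m (\<Sum>i\<in>A. vscale V (a i) (w i)) \<le> (\<Sum>i\<in>A. norm (a i) * m (w i))"
proof -
  have "m (\<Sum>i\<in>A. vscale V (a i) (w i)) \<le> (\<Sum>i\<in>A. m (vscale V (a i) (w i)))"
    by (rule norm_algebra(7)[OF V m]) (simp add: vs_closed(5)[OF V] w)
  also have "\<dots> = (\<Sum>i\<in>A. norm (a i) * m (w i))"
    using w by (intro sum.cong) (auto simp: is_normD(3)[OF m])
  finally show ?thesis .
qed

lemma norm_le_coords:
  assumes V: "vec_space V" and m: "is_norm V m" and b: "coord_basis V k b c" and x: "x \<in> vcarrier V"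
  shows "m x \<le> (\<Sum>i<k. norm (c i x) * m (b i))"
  using norm_lin_comb_le[OF V m, of "{..<k}" b "\<lambda>i. c i x"] coord_basisD(1)[OF b] coord_basisD(4)[OF b x]
  by simp

lemma normed_spaceD: "normed_space X \<Longrightarrow> vec_space X" "normed_space X \<Longrightarrow> is_norm X (vnorm X)"
  by (auto simp: normed_space_def)

lemma normed_space_with_norm: "vec_space V \<Longrightarrow> is_norm V m \<Longrightarrow> normed_space (with_norm V m)"
  by (simp add: normed_space_def is_norm_def)

lemma normed_space_subcarrier:
  assumes "normed_space F" "module.subspace (vscale F) U" "U \<subseteq> vcarrier F"
  shows "normed_space (F\<lparr>vcarrier := U\<rparr>)"
  using assms vec_space_subcarrier[of F U] unfolding normed_space_def is_norm_def by (auto simp: subset_iff)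

text \<open>All norms on a finite-dimensional space are equivalent: on the compact unit sphere of the
  \<open>\<ell>\<^sub>1\<close>-norm of the coordinates, a norm cannot come arbitrarily close to 0.\<close>

lemma coords_le_norm:
  fixes V :: "('k::rc_scalar, 'v::ab_group_add, 'z) vspace_scheme"
  assumes V: "vec_space V" and m: "is_norm V m" and b: "coord_basis V k b c"
  obtains K where "K > 0" "\<And>x. x \<in> vcarrier V \<Longrightarrow> (\<Sum>i<k. norm (c i x)) \<le> K * m x"
proof -
  have "\<exists>K>0. \<forall>x\<in>vcarrier V. (\<Sum>i<k. norm (c i x)) \<le> K * m x"
  proof (rule ccontr)
    assume "\<not> ?thesis"
    then have "\<forall>n::nat. \<exists>x\<in>vcarrier V. (\<Sum>i<k. norm (c i x)) > real (Suc n) * m x"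
      by (meson not_le of_nat_0_less_iff zero_less_Suc)
    then obtain x where x: "\<And>n. x n \<in> vcarrier V" "\<And>n. (\<Sum>i<k. norm (c i (x n))) > real (Suc n) * m (x n)"
      by metis
    define s where "s n = (\<Sum>i<k. norm (c i (x n)))" for n
    have s: "s n > 0" for n
      using x(2)[of n] is_normD(1)[OF m x(1)[of n]] unfolding s_def
      by (smt (verit) mult_nonneg_nonneg of_nat_0_le_iff)
    define y where "y n = vscale V (of_real (1 / s n)) (x n)" for n
    have y: "y n \<in> vcarrier V" for n unfolding y_def using x(1) vs_closed[OF V] by blast
    have cy: "norm (c i (y n)) = norm (c i (x n)) / s n" if "i < k" for i n
      using lin_functional_algebra(5)[OF V coord_basisD(2)[OF b that] x(1)] s[of n]
      by (simp add: y_def norm_mult norm_divide)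
    have sy: "(\<Sum>i<k. norm (c i (y n))) = 1" for n
      using s[of n] by (simp add: cy sum_divide_distrib[symmetric] s_def)
    have my: "m (y n) \<le> inverse (real (Suc n))" for n
    proof -
      have "m (y n) = m (x n) / s n" using s[of n] by (simp add: y_def is_normD(3)[OF m x(1)] norm_divide)
      also have "\<dots> \<le> inverse (real (Suc n))"
        using x(2)[of n] s[of n] by (simp add: s_def[symmetric] field_simps)
      finally show ?thesis .
    qed
    have "norm (c i (y n)) \<le> 1" if "i \<in> {..<k}" for n i
      using member_le_sum[of i "{..<k}" "\<lambda>i. norm (c i (y n))"] sy[of n] that by simp
    then obtain r l where r: "strict_mono (r :: nat \<Rightarrow> nat)"
      and l: "\<And>i. i \<in> {..<k} \<Longrightarrow> (\<lambda>n. c i (y (r n))) \<longlonglongrightarrow> l i"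
      using bounded_family_convergent_subseq[of "{..<k}" "\<lambda>n i. c i (y n)" 1] by (metis finite_lessThan)
    define z where "z = (\<Sum>i<k. vscale V (l i) (b i))"
    have z: "z \<in> vcarrier V"
      unfolding z_def by (rule vs_closed(6)[OF V]) (simp add: vs_closed[OF V] coord_basisD(1)[OF b])
    have cz: "c i z = l i" if "i < k" for i unfolding z_def by (rule coord_basis_sum_coord[OF V b that])
    have "m z \<le> inverse (real (Suc (r n))) + (\<Sum>i<k. norm (c i (y (r n)) - l i) * m (b i))" for n
    proof -
      have "m z \<le> m (z - y (r n)) + m (y (r n))" by (rule norm_algebra(5)[OF V m z y])
      also have "m (z - y (r n)) = m (y (r n) - z)" by (rule norm_algebra(3)[OF V m z y])
      also have "\<dots> \<le> (\<Sum>i<k. norm (c i (y (r n) - z)) * m (b i))"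
        by (rule norm_le_coords[OF V m b vs_closed(3)[OF V y z]])
      also have "\<dots> = (\<Sum>i<k. norm (c i (y (r n)) - l i) * m (b i))"
        by (rule sum.cong) (auto simp: lin_functional_algebra(3)[OF V coord_basisD(2)[OF b] y z] cz)
      finally show ?thesis using my[of "r n"] by linarith
    qed
    moreover have "(\<lambda>n. inverse (real (Suc (r n))) + (\<Sum>i<k. norm (c i (y (r n)) - l i) * m (b i)))
        \<longlonglongrightarrow> 0 + (\<Sum>i<k. norm (l i - l i) * m (b i))"
      using LIMSEQ_subseq_LIMSEQ[OF LIMSEQ_inverse_real_of_nat r] l
      by (intro tendsto_intros) (auto simp: comp_def)
    ultimately have "m z \<le> 0" by (intro LIMSEQ_le_const) auto
    then have "z = 0" using is_normD(1,2)[OF m z] by simp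
    then have "l i = 0" if "i < k" for i
      using cz[OF that] lin_functional_algebra(1)[OF V coord_basisD(2)[OF b that]] by simp
    moreover have "(\<lambda>n. \<Sum>i<k. norm (c i (y (r n)))) \<longlonglongrightarrow> (\<Sum>i<k. norm (l i))"
      using l by (intro tendsto_intros) auto
    then have "(\<Sum>i<k. norm (l i)) = 1" using LIMSEQ_unique[OF _ tendsto_const] sy by simp
    ultimately show False by simp
  qed
  then show thesis using that by blast
qed

lemma lin_map_diff:
  assumes W: "vec_space W" and "lin_map V W T" "lin_map V W U"
  shows "lin_map V W (\<lambda>x. T x - U x)"
  using assms vs_closed[OF W] unfolding lin_map_def by (auto simp: vs_algebra[OF W])

lemma lin_map_bounded:
  fixes V :: "('k::rc_scalar, 'v::ab_group_add, 'z) vspace_scheme"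
  assumes V: "vec_space V" and fd: "fin_dim V" and m: "is_norm V m"
    and W: "vec_space W" and n: "is_norm W n" and T: "lin_map V W T"
  obtains B where "B \<ge> 0" "\<And>x. x \<in> vcarrier V \<Longrightarrow> n (T x) \<le> B * m x"
proof -
  obtain k b c where b: "coord_basis V k b c" using fd has_dim_coord_basis[OF V] unfolding fin_dim_def by metis
  obtain K where K: "K > 0" "\<And>x. x \<in> vcarrier V \<Longrightarrow> (\<Sum>i<k. norm (c i x)) \<le> K * m x"
    using coords_le_norm[OF V m b] by blast
  define M where "M = (\<Sum>i<k. n (T (b i)))"
  have Tb: "T (b i) \<in> vcarrier W" if "i < k" for i using lin_mapD(1)[OF T coord_basisD(1)[OF b that]] .
  have M0: "M \<ge> 0" unfolding M_def using is_normD(1)[OF n] Tb by (intro sum_nonneg) auto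
  show thesis
  proof (rule that[of "K * M"])
    show "K * M \<ge> 0" using K M0 by simp
    fix x assume x: "x \<in> vcarrier V"
    have "n (T x) = n (\<Sum>i<k. vscale W (c i x) (T (b i)))"
      using coord_basis_lin_map_expand[OF V b T x] by simp
    also have "\<dots> \<le> (\<Sum>i<k. norm (c i x) * n (T (b i)))"
      by (rule norm_lin_comb_le[OF W n]) (use Tb in auto)
    also have "\<dots> \<le> (\<Sum>i<k. norm (c i x) * M)"
      unfolding M_def using is_normD(1)[OF n] Tb by (intro sum_mono mult_left_mono member_le_sum) auto
    also have "\<dots> = (\<Sum>i<k. norm (c i x)) * M" by (simp add: sum_distrib_right)
    also have "\<dots> \<le> K * M * m x" using mult_right_mono[OF K(2)[OF x] M0] by (simp add: algebra_simps)
    finally show "n (T x) \<le> K * M * m x" .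
  qed
qed

lemma norms_equivalent:
  fixes V :: "('k::rc_scalar, 'v::ab_group_add, 'z) vspace_scheme"
  assumes V: "vec_space V" and fd: "fin_dim V" and m: "is_norm V m" and n: "is_norm V n"
  obtains B where "B \<ge> 0" "\<And>x. x \<in> vcarrier V \<Longrightarrow> n x \<le> B * m x"
  using lin_map_bounded[OF V fd m V n, of "\<lambda>x. x"] by (auto simp: lin_map_def)

lemma zero_in_unit_ball: "normed_space X \<Longrightarrow> 0 \<in> unit_ball X"
  using vs_closed(1)[of X] norm_algebra(1)[of X "vnorm X"] by (simp add: unit_ball_def normed_space_def)

lemma op_norm_le:
  assumes X: "normed_space X" and C: "0 \<le> C"
    and T: "\<And>x. x \<in> vcarrier X \<Longrightarrow> vnorm Y (T x) \<le> C * vnorm X x"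
  shows "op_norm X Y T \<le> C"
  unfolding op_norm_def
proof (rule cSUP_least)
  show "unit_ball X \<noteq> {}" using zero_in_unit_ball[OF X] by blast
  fix x assume x: "x \<in> unit_ball X"
  then have "vnorm Y (T x) \<le> C * vnorm X x" using T by (simp add: unit_ball_def)
  also have "\<dots> \<le> C" using x C by (simp add: unit_ball_def mult_left_le)
  finally show "vnorm Y (T x) \<le> C" .
qed

lemma op_norm_bound:
  fixes X :: "('k::real_normed_field, 'v::ab_group_add) nspace"
  assumes X: "normed_space X" and Y: "normed_space Y" and T: "lin_map X Y T"
    and B: "\<And>x. x \<in> vcarrier X \<Longrightarrow> vnorm Y (T x) \<le> B * vnorm X x"
  shows "0 \<le> op_norm X Y T" "x \<in> vcarrier X \<Longrightarrow> vnorm Y (T x) \<le> op_norm X Y T * vnorm X x"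
proof -
  have bdd: "bdd_above ((\<lambda>x. vnorm Y (T x)) ` unit_ball X)"
  proof (rule bdd_aboveI2)
    fix x assume "x \<in> unit_ball X"
    then have "vnorm Y (T x) \<le> B * vnorm X x" "0 \<le> vnorm X x" "vnorm X x \<le> 1"
      using B is_normD(1)[OF normed_spaceD(2)[OF X]] by (auto simp: unit_ball_def)
    then show "vnorm Y (T x) \<le> \<bar>B\<bar>"
      by (smt (verit, best) mult_left_le mult_nonneg_nonneg mult_right_mono)
  qed
  have up: "vnorm Y (T x) \<le> op_norm X Y T" if "x \<in> unit_ball X" for x
    unfolding op_norm_def using cSUP_upper[OF that bdd] .
  have T0: "T 0 = 0" by (rule lin_map_algebra(1)[OF normed_spaceD(1)[OF X] T])
  show "0 \<le> op_norm X Y T"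
    using up[OF zero_in_unit_ball[OF X]] T0
      norm_algebra(1)[OF normed_spaceD(1)[OF Y] normed_spaceD(2)[OF Y]] by simp
  assume x: "x \<in> vcarrier X"
  show "vnorm Y (T x) \<le> op_norm X Y T * vnorm X x"
  proof (cases "vnorm X x = 0")
    case True
    then have "x = 0" using is_normD(2)[OF normed_spaceD(2)[OF X] x] by simp
    then show ?thesis
      using T0 norm_algebra(1)[OF normed_spaceD(1)[OF Y] normed_spaceD(2)[OF Y]] True by simp
  next
    case False
    then have pos: "vnorm X x > 0" using is_normD(1)[OF normed_spaceD(2)[OF X] x] by simp
    let ?c = "of_real (inverse (vnorm X x)) :: 'k"
    have "vscale X ?c x \<in> unit_ball X"
      using is_normD(3)[OF normed_spaceD(2)[OF X] x, of ?c] pos vs_closed(5)[OF normed_spaceD(1)[OF X] x]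
      by (simp add: unit_ball_def norm_inverse)
    from up[OF this] have "vnorm Y (vscale Y ?c (T x)) \<le> op_norm X Y T"
      using lin_mapD(3)[OF T x] by simp
    then have "inverse (vnorm X x) * vnorm Y (T x) \<le> op_norm X Y T"
      using is_normD(3)[OF normed_spaceD(2)[OF Y] lin_mapD(1)[OF T x], of ?c] pos
      by (simp add: norm_inverse)
    then show ?thesis using pos by (simp add: field_simps)
  qed
qed

section \<open>The metric \<open>\<omega>\<close> on norms\<close>

text \<open>The condition \<open>\<omega>(m, n) \<le> r\<close> in terms of the values of the norms.\<close>

definition norm_near ::
    "('k, 'v, 'z) vspace_scheme \<Rightarrow> real \<Rightarrow> ('v \<Rightarrow> real) \<Rightarrow> ('v \<Rightarrow> real) \<Rightarrow> bool" where
  "norm_near V r m n \<longleftrightarrow> (\<forall>x\<in>vcarrier V. m x \<le> exp r * n x \<and> n x \<le> exp r * m x)"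

lemma norm_near_refl: "norm_near V 0 m m"
  by (simp add: norm_near_def)

lemma norm_near_trans:
  assumes "norm_near V r m n" "norm_near V s n p"
  shows "norm_near V (r + s) m p"
  unfolding norm_near_def
proof
  fix x assume x: "x \<in> vcarrier V"
  have 1: "m x \<le> exp r * n x" "n x \<le> exp r * m x" "n x \<le> exp s * p x" "p x \<le> exp s * n x"
    using assms x by (simp_all add: norm_near_def)
  have "exp r * n x \<le> exp r * (exp s * p x)" "exp s * n x \<le> exp s * (exp r * m x)"
    using 1 by simp_all
  then have "m x \<le> exp r * (exp s * p x)" "p x \<le> exp s * (exp r * m x)" using 1 by linarith+
  then show "m x \<le> exp (r + s) * p x \<and> p x \<le> exp (r + s) * m x"
    by (simp add: exp_add mult.assoc mult.left_commute)
qed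

lemma norm_near_mono:
  assumes "norm_near V r m n" "r \<le> s" "is_norm V m" "is_norm V n"
  shows "norm_near V s m n"
  using assms unfolding norm_near_def is_norm_def
  by (meson exp_le_cancel_iff mult_right_mono order_trans)

lemma norm_near_diffI:
  assumes "r \<ge> 0" and m: "is_norm V m"
    and d: "\<And>x. x \<in> vcarrier V \<Longrightarrow> \<bar>n x - m x\<bar> \<le> (1 - exp (- r)) * m x"
  shows "norm_near V r m n"
  unfolding norm_near_def
proof
  fix x assume x: "x \<in> vcarrier V"
  have m0: "0 \<le> m x" by (rule is_normD(1)[OF m x])
  have "exp (- r) * m x \<le> n x" "n x \<le> (2 - exp (- r)) * m x"
    using d[OF x] by (auto simp: algebra_simps abs_le_iff)
  moreover have "2 - exp (- r) \<le> exp r"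
  proof -
    \<comment> \<open>That is, \<open>2 \<le> exp r + exp (- r)\<close>.\<close>
    have "0 \<le> (exp (r / 2) - exp (- r / 2))\<^sup>2" by simp
    also have "\<dots> = exp r + exp (- r) - 2"
      by (simp add: power2_eq_square algebra_simps flip: exp_add)
    finally show ?thesis by simp
  qed
  ultimately have "n x \<le> exp r * m x" using mult_right_mono[OF _ m0] order_trans by blast
  moreover have "m x \<le> exp r * n x"
    using mult_left_mono[OF \<open>exp (- r) * m x \<le> n x\<close>, of "exp r"]
    by (simp add: mult.assoc[symmetric] flip: exp_add)
  ultimately show "m x \<le> exp r * n x \<and> n x \<le> exp r * m x" by blast
qed

lemma norm_near_diffD:
  assumes "norm_near V r m n" "is_norm V m" "r \<ge> 0" "x \<in> vcarrier V"
  shows "\<bar>n x - m x\<bar> \<le> (exp r - 1) * m x"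
proof -
  have 1: "m x \<le> exp r * n x" "n x \<le> exp r * m x" using assms by (auto simp: norm_near_def)
  have 2: "exp r \<ge> 1" "m x \<ge> 0" using assms is_normD(1)[OF assms(2,4)] by auto
  have n: "n x \<ge> 0" using 1(1) 2 by (smt (verit) mult_less_0_iff)
  show ?thesis
  proof (cases "n x \<ge> m x")
    case True then show ?thesis using 1 by (simp add: algebra_simps)
  next
    case False
    then have "m x - n x \<le> (exp r - 1) * n x" using 1 by (simp add: algebra_simps)
    also have "\<dots> \<le> (exp r - 1) * m x" using False 2 by (intro mult_left_mono) auto
    finally show ?thesis using False by simp
  qed
qed

text \<open>Both conditions say that the identity maps have norm at most \<open>exp r\<close>. On a nonzero space the
  product of their norms is at least 1, so \<open>\<omega>\<close> is the logarithm of a number that is at least 1.\<close>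

lemma omega_le_iff:
  fixes V :: "('k::rc_scalar, 'v::ab_group_add, 'z) vspace_scheme"
  assumes V: "vec_space V" and fd: "fin_dim V" and m: "is_norm V m" and n: "is_norm V n"
  shows "0 \<le> omega V m n" "0 \<le> r \<Longrightarrow> omega V m n \<le> r \<longleftrightarrow> norm_near V r m n"
proof -
  let ?M = "with_norm V m" and ?N = "with_norm V n"
  have MN: "normed_space ?M" "normed_space ?N" using normed_space_with_norm V m n by auto
  define A where "A = op_norm ?M ?N id"
  define B where "B = op_norm ?N ?M id"
  have om: "omega V m n = ln (max A B)" by (simp add: omega_def A_def B_def)
  have id: "lin_map ?M ?N id" "lin_map ?N ?M id" by (auto simp: lin_map_def)
  obtain K L where "\<And>x. x \<in> vcarrier V \<Longrightarrow> n x \<le> K * m x" "\<And>x. x \<in> vcarrier V \<Longrightarrow> m x \<le> L * n x"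
    using norms_equivalent[OF V fd m n] norms_equivalent[OF V fd n m] by metis
  then have A: "A \<ge> 0" "\<And>x. x \<in> vcarrier V \<Longrightarrow> n x \<le> A * m x"
    and B: "B \<ge> 0" "\<And>x. x \<in> vcarrier V \<Longrightarrow> m x \<le> B * n x"
    unfolding A_def B_def
    using op_norm_bound[OF MN(1,2) id(1), of K] op_norm_bound[OF MN(2,1) id(2), of L] by auto
  have "0 \<le> omega V m n \<and> (0 \<le> r \<longrightarrow> omega V m n \<le> r \<longleftrightarrow> norm_near V r m n)"
  proof (cases "vcarrier V = {0}")
    case True
    then have "A \<le> 0" "B \<le> 0" unfolding A_def B_def
      by (intro op_norm_le MN; use norm_algebra(1)[OF V m] norm_algebra(1)[OF V n] in simp)+
    then have "omega V m n = 0" using A B om by simp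
    then show ?thesis using True norm_algebra(1)[OF V m] norm_algebra(1)[OF V n]
      by (simp add: norm_near_def)
  next
    case False
    then obtain x where x: "x \<in> vcarrier V" "x \<noteq> 0" using vs_closed(1)[OF V] by blast
    have mx: "m x > 0" using is_normD(1,2)[OF m x(1)] x(2) by (simp add: less_le)
    have "m x \<le> B * n x" using B(2)[OF x(1)] .
    also have "\<dots> \<le> B * (A * m x)" by (intro mult_left_mono A(2) B x)
    finally have "1 \<le> B * A" using mx by (simp add: mult.assoc[symmetric])
    have 1: "1 \<le> max A B"
    proof (rule ccontr)
      assume "\<not> 1 \<le> max A B"
      then have "A < 1" "B < 1" by auto
      then have "B * A < 1" using A(1) B(1) by (meson le_less_trans less_imp_le mult_left_le)
      then show False using \<open>1 \<le> B * A\<close> by simp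
    qed
    have "omega V m n \<le> r \<longleftrightarrow> norm_near V r m n" if "0 \<le> r"
    proof -
      have "omega V m n \<le> r \<longleftrightarrow> max A B \<le> exp r" unfolding om
      proof -
        have "0 < max A B" using 1 by linarith
        then show "ln (max A B) \<le> r \<longleftrightarrow> max A B \<le> exp r" by (metis exp_le_cancel_iff exp_ln)
      qed
      also have "\<dots> \<longleftrightarrow> norm_near V r m n"
      proof
        assume "max A B \<le> exp r"
        then show "norm_near V r m n"
          unfolding norm_near_def
        proof (intro ballI conjI)
          fix x assume x: "x \<in> vcarrier V"
          have "B * n x \<le> exp r * n x" "A * m x \<le> exp r * m x"
            using \<open>max A B \<le> exp r\<close> is_normD(1)[OF m x] is_normD(1)[OF n x]
            by (auto intro: mult_right_mono)
          then show "m x \<le> exp r * n x" "n x \<le> exp r * m x" using A(2)[OF x] B(2)[OF x] by linarith+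
        qed
      next
        assume "norm_near V r m n"
        then show "max A B \<le> exp r"
          unfolding A_def B_def by (auto simp: norm_near_def intro!: op_norm_le MN)
      qed
      finally show ?thesis .
    qed
    then show ?thesis using 1 om by simp
  qed
  then show "0 \<le> omega V m n" "0 \<le> r \<Longrightarrow> omega V m n \<le> r \<longleftrightarrow> norm_near V r m n" by auto
qed

lemma omega_near:
  fixes V :: "('k::rc_scalar, 'v::ab_group_add, 'z) vspace_scheme"
  assumes "vec_space V" "fin_dim V" "is_norm V m" "is_norm V n"
  shows "omega V m n \<le> r \<Longrightarrow> norm_near V r m n"
  using omega_le_iff(2)[OF assms, of r] omega_le_iff(1)[OF assms] by linarith

lemma NormsD: "m \<in> Norms V \<Longrightarrow> is_norm V m" "m \<in> Norms V \<Longrightarrow> m \<in> extensional (vcarrier V)"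
  by (auto simp: Norms_def)

lemma Norms_eqI: "m \<in> Norms V \<Longrightarrow> n \<in> Norms V \<Longrightarrow> (\<And>x. x \<in> vcarrier V \<Longrightarrow> m x = n x) \<Longrightarrow> m = n"
  by (auto simp: Norms_def intro: extensionalityI)

lemma Metric_space_dist_on:
  assumes "\<And>x y. x \<in> A \<Longrightarrow> y \<in> A \<Longrightarrow> 0 \<le> d x y" "\<And>x y. x \<in> A \<Longrightarrow> y \<in> A \<Longrightarrow> d x y = d y x"
    "\<And>x. x \<in> A \<Longrightarrow> d x x = 0" "\<And>x y. x \<in> A \<Longrightarrow> y \<in> A \<Longrightarrow> d x y = 0 \<Longrightarrow> x = y"
    "\<And>x y z. x \<in> A \<Longrightarrow> y \<in> A \<Longrightarrow> z \<in> A \<Longrightarrow> d x z \<le> d x y + d y z"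
  shows "Metric_space A (dist_on A d)"
  using assms unfolding Metric_space_def dist_on_def by auto

lemma Metric_space_dist_onD:
  assumes "Metric_space A (dist_on A d)"
  shows "x \<in> A \<Longrightarrow> y \<in> A \<Longrightarrow> 0 \<le> d x y" "x \<in> A \<Longrightarrow> y \<in> A \<Longrightarrow> d x y = d y x"
    "x \<in> A \<Longrightarrow> d x x = 0" "x \<in> A \<Longrightarrow> y \<in> A \<Longrightarrow> d x y = 0 \<Longrightarrow> x = y"
    "x \<in> A \<Longrightarrow> y \<in> A \<Longrightarrow> z \<in> A \<Longrightarrow> d x z \<le> d x y + d y z"
  using assms unfolding Metric_space_def dist_on_def by (smt (verit))+

lemma omega_metric:
  fixes V :: "('k::rc_scalar, 'v::ab_group_add, 'z) vspace_scheme"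
  assumes V: "vec_space V" and fd: "fin_dim V"
  shows "Metric_space (Norms V) (dist_on (Norms V) (omega V))"
proof (rule Metric_space_dist_on)
  fix m n p assume m: "m \<in> Norms V" and n: "n \<in> Norms V" and p: "p \<in> Norms V"
  note om = omega_le_iff[OF V fd NormsD(1) NormsD(1)]
  show "0 \<le> omega V m n" using om(1) m n by blast
  show "omega V m n = omega V n m" by (simp add: omega_def max.commute)
  show "omega V m m = 0" using om(1)[OF m m] om(2)[OF m m, of 0] norm_near_refl[of V m] by simp
  show "m = n" if "omega V m n = 0"
    using om(2)[OF m n, of 0] that by (intro Norms_eqI[OF m n]) (auto simp: norm_near_def intro: antisym)
  have "norm_near V (omega V m n + omega V n p) m p"
    by (rule norm_near_trans[of V _ m n]) (intro omega_near[OF V fd] NormsD(1) m n p order_refl)+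
  then show "omega V m p \<le> omega V m n + omega V n p"
    using om(2)[OF m p] om(1)[OF m n] om(1)[OF n p] by simp
qed

text \<open>A norm is controlled up to a factor by its values on a finite set: on a basis they bound it,
  which makes it Lipschitz, and then a fine enough net of the unit ball suffices.\<close>

lemma norm_near_finite_test:
  fixes V :: "('k::rc_scalar, 'v::ab_group_add, 'z) vspace_scheme"
  assumes V: "vec_space V" and fd: "fin_dim V" and m: "is_norm V m" and r: "r > 0"
  obtains X \<eta> where "finite X" "X \<subseteq> vcarrier V" "\<eta> > 0"
    "\<And>n. is_norm V n \<Longrightarrow> (\<And>x. x \<in> X \<Longrightarrow> \<bar>n x - m x\<bar> < \<eta>) \<Longrightarrow> norm_near V r m n"
proof -
  obtain k b c where b: "coord_basis V k b c" using fd has_dim_coord_basis[OF V] unfolding fin_dim_def by metis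
  note bV = coord_basisD(1)[OF b]
  obtain K where K: "K > 0" "\<And>x. x \<in> vcarrier V \<Longrightarrow> (\<Sum>i<k. norm (c i x)) \<le> K * m x"
    using coords_le_norm[OF V m b] by blast
  \<comment> \<open>For \<open>n\<close> within 1 of \<open>m\<close> on the basis, coordinates at most \<open>\<tau>\<close> force values at most \<open>\<tau> * M\<close>.\<close>
  define M where "M = (\<Sum>i<k. m (b i) + 1) + 1"
  have M: "M \<ge> 1" unfolding M_def using is_normD(1)[OF m bV]
    by (auto intro!: sum_nonneg add_nonneg_nonneg)
  define s where "s = 1 - exp (- r)"
  have s: "s > 0" "s < 1" using r by (auto simp: s_def)
  define \<tau> where "\<tau> = s / (4 * M)"
  have \<tau>: "\<tau> > 0" using s M by (simp add: \<tau>_def)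
  obtain N :: "'k set" where N: "finite N" "\<And>a. norm a \<le> K \<Longrightarrow> \<exists>d\<in>N. norm (a - d) < \<tau>"
    using finite_net_scalars[OF \<tau>] by blast
  define Y where "Y = (\<lambda>a. \<Sum>i<k. vscale V (a i) (b i)) ` (PiE {..<k} (\<lambda>_. N))"
  have comb: "(\<Sum>i<k. vscale V (a i) (b i)) \<in> vcarrier V" for a
    by (rule vs_closed(6)[OF V]) (simp add: vs_closed[OF V] bV)
  show thesis
  proof (rule that[of "Y \<union> b ` {..<k}" "s / 2"])
    show "finite (Y \<union> b ` {..<k})" unfolding Y_def using N by (auto intro: finite_PiE)
    show "Y \<union> b ` {..<k} \<subseteq> vcarrier V" unfolding Y_def using comb bV by auto
    show "s / 2 > 0" using s by simp
    fix n assume n: "is_norm V n" and close: "\<And>x. x \<in> Y \<union> b ` {..<k} \<Longrightarrow> \<bar>n x - m x\<bar> < s / 2"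
    have nb: "n (b i) \<le> m (b i) + 1" if "i < k" for i
    proof -
      have "\<bar>n (b i) - m (b i)\<bar> < s / 2" using close that by blast
      then show ?thesis using s by linarith
    qed
    have small: "m z \<le> \<tau> * M \<and> n z \<le> \<tau> * M" if z: "z \<in> vcarrier V" "\<And>i. i < k \<Longrightarrow> norm (c i z) \<le> \<tau>" for z
    proof -
      have "p z \<le> \<tau> * M" if p: "is_norm V p" "\<And>i. i < k \<Longrightarrow> p (b i) \<le> m (b i) + 1" for p
      proof -
        have "p z \<le> (\<Sum>i<k. norm (c i z) * p (b i))" by (rule norm_le_coords[OF V p(1) b z(1)])
        also have "\<dots> \<le> (\<Sum>i<k. \<tau> * (m (b i) + 1))"
          using z(2) p(2) is_normD(1)[OF p(1) bV] \<tau> by (intro sum_mono mult_mono) auto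
        also have "\<dots> \<le> \<tau> * M" using \<tau> by (simp add: M_def sum_distrib_left[symmetric])
        finally show ?thesis .
      qed
      then show ?thesis using m n nb by simp
    qed
    have unit: "\<bar>n x - m x\<bar> \<le> s" if x: "x \<in> vcarrier V" "m x = 1" for x
    proof -
      have "norm (c i x) \<le> K" if "i < k" for i
      proof -
        have "norm (c i x) \<le> (\<Sum>i<k. norm (c i x))" using that by (intro member_le_sum) auto
        then show ?thesis using K(2)[OF x(1)] x(2) by simp
      qed
      then have "\<forall>i\<in>{..<k}. \<exists>d\<in>N. norm (c i x - d) < \<tau>" using N(2) by simp
      then obtain d where d: "\<And>i. i < k \<Longrightarrow> d i \<in> N" "\<And>i. i < k \<Longrightarrow> norm (c i x - d i) < \<tau>"
        by (metis lessThan_iff)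
      define y where "y = (\<Sum>i<k. vscale V (d i) (b i))"
      have y: "y \<in> vcarrier V" unfolding y_def by (rule comb)
      have "y = (\<Sum>i<k. vscale V (restrict d {..<k} i) (b i))" by (simp add: y_def)
      then have yY: "y \<in> Y" unfolding Y_def using d by (intro image_eqI[of _ _ "restrict d {..<k}"]) auto
      have cy: "c i y = d i" if "i < k" for i unfolding y_def by (rule coord_basis_sum_coord[OF V b that])
      have "norm (c i (x - y)) \<le> \<tau>" if "i < k" for i
        using lin_functional_algebra(3)[OF V coord_basisD(2)[OF b that] x(1) y] cy[OF that] d(2)[OF that]
        by simp
      then have "m (x - y) \<le> \<tau> * M" "n (x - y) \<le> \<tau> * M"
        using small[OF vs_closed(3)[OF V x(1) y]] by auto
      then have "\<bar>m x - m y\<bar> \<le> s / 4" "\<bar>n x - n y\<bar> \<le> s / 4"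
        using norm_algebra(6)[OF V m x(1) y] norm_algebra(6)[OF V n x(1) y] M by (auto simp: \<tau>_def)
      moreover have "\<bar>n y - m y\<bar> < s / 2" using close yY by blast
      ultimately show ?thesis by linarith
    qed
    show "norm_near V r m n"
    proof (rule norm_near_diffI[OF _ m])
      show "0 \<le> r" using r by simp
      fix x assume x: "x \<in> vcarrier V"
      show "\<bar>n x - m x\<bar> \<le> (1 - exp (- r)) * m x"
      proof (cases "x = 0")
        case True
        then show ?thesis using norm_algebra(1)[OF V m] norm_algebra(1)[OF V n] by simp
      next
        case False
        then have pos: "m x > 0" using is_normD(1,2)[OF m x] by (simp add: less_le)
        let ?a = "of_real (inverse (m x)) :: 'k"
        have a: "norm ?a = inverse (m x)" using pos by (simp add: norm_inverse)
        have "\<bar>n (vscale V ?a x) - m (vscale V ?a x)\<bar> \<le> s"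
          using unit[OF vs_closed(5)[OF V x]] is_normD(3)[OF m x, of ?a] a pos by simp
        then have *: "\<bar>inverse (m x) * n x - 1\<bar> \<le> s"
          using pos unfolding is_normD(3)[OF m x] is_normD(3)[OF n x] a by simp
        have "n x - m x = m x * (inverse (m x) * n x - 1)" using pos by (simp add: field_simps)
        then have "\<bar>n x - m x\<bar> = m x * \<bar>inverse (m x) * n x - 1\<bar>" using pos by (simp add: abs_mult)
        also have "\<dots> \<le> m x * s" using * pos by (intro mult_left_mono) auto
        finally show ?thesis by (simp add: s_def mult.commute)
      qed
    qed
  qed
qed

text \<open>Evaluation at a point is continuous for \<open>\<omega>\<close>, and by the finite test a ball for \<open>\<omega>\<close> contains a
  neighbourhood for pointwise convergence.\<close>

lemma norm_topology_eq_omega: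
  fixes V :: "('k::rc_scalar, 'v::ab_group_add, 'z) vspace_scheme"
  assumes V: "vec_space V" and fd: "fin_dim V"
  shows "norm_topology V = metric_topology (Norms V) (omega V)"
proof -
  interpret M: Metric_space "Norms V" "dist_on (Norms V) (omega V)" by (rule omega_metric[OF V fd])
  have T: "metric_topology (Norms V) (omega V) = M.mtopology" by (simp add: metric_topology_def)
  have ball: "n \<in> M.mball m r \<longleftrightarrow> m \<in> Norms V \<and> n \<in> Norms V \<and> omega V m n < r" for m n r
    by (auto simp: M.in_mball dist_on_def)
  have sub: "Norms V \<subseteq> topspace (powertop_real (vcarrier V))" by (auto simp: Norms_def PiE_def)
  have top: "topspace (norm_topology V) = Norms V" using sub by (auto simp: norm_topology_def)
  have eval: "continuous_map (norm_topology V) euclideanreal (\<lambda>m. m x)" if "x \<in> vcarrier V" for x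
    unfolding norm_topology_def
    by (intro continuous_map_from_subtopology continuous_map_product_projection that)
  have "continuous_map M.mtopology (norm_topology V) id"
    unfolding norm_topology_def continuous_map_in_subtopology
  proof
    show "continuous_map M.mtopology (powertop_real (vcarrier V)) id"
      unfolding continuous_map_componentwise
    proof (intro conjI ballI)
      show "id ` topspace M.mtopology \<subseteq> extensional (vcarrier V)" using NormsD(2) by auto
      fix x assume x: "x \<in> vcarrier V"
      show "continuous_map M.mtopology euclideanreal (\<lambda>m. id m x)"
        unfolding continuous_map_def
      proof (intro conjI allI impI)
        fix U :: "real set" assume "openin euclideanreal U"
        then have U: "open U" by simp
        show "openin M.mtopology {m \<in> topspace M.mtopology. id m x \<in> U}"
          unfolding M.openin_mtopology
        proof (intro conjI allI impI)
          fix m assume "m \<in> {m \<in> topspace M.mtopology. id m x \<in> U}"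
          then have m: "m \<in> Norms V" "m x \<in> U" by auto
          obtain e where e: "e > 0" "\<And>y. \<bar>y - m x\<bar> < e \<Longrightarrow> y \<in> U"
            using U m(2) by (metis open_real)
          have m0: "m x \<ge> 0" using is_normD(1)[OF NormsD(1)[OF m(1)] x] .
          \<comment> \<open>A change of the norm by a factor at most \<open>exp r\<close> moves its value at \<open>x\<close> by less than \<open>e\<close>.\<close>
          define r where "r = ln (1 + e / (m x + 1))"
          have er: "exp r = 1 + e / (m x + 1)" using e m0 by (simp add: r_def add_pos_nonneg)
          have "e / (m x + 1) > 0" using e m0 by simp
          then have r: "r > 0" unfolding r_def by (intro ln_gt_zero) simp
          have "n \<in> Norms V \<and> n x \<in> U" if "n \<in> M.mball m r" for n
          proof -
            have n: "n \<in> Norms V" "omega V m n \<le> r" using that unfolding ball by auto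
            have "norm_near V r m n" by (rule omega_near[OF V fd NormsD(1)[OF m(1)] NormsD(1)[OF n(1)] n(2)])
            then have "\<bar>n x - m x\<bar> \<le> (exp r - 1) * m x"
              using norm_near_diffD NormsD(1)[OF m(1)] x r by (metis less_imp_le)
            also have "\<dots> < e" using e m0 by (simp add: er field_simps)
            finally show ?thesis using e n by blast
          qed
          then show "\<exists>r>0. M.mball m r \<subseteq> {m \<in> topspace M.mtopology. id m x \<in> U}" using r by auto
        qed auto
      qed auto
    qed
  qed auto
  then have 1: "openin M.mtopology U" if "openin (norm_topology V) U" for U
  proof -
    have "openin M.mtopology {x \<in> topspace M.mtopology. id x \<in> U}"
      using \<open>continuous_map M.mtopology (norm_topology V) id\<close> that by (rule openin_continuous_map_preimage)
    moreover have "{x \<in> topspace M.mtopology. id x \<in> U} = U" using openin_subset[OF that] top by auto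
    ultimately show ?thesis by simp
  qed
  have 2: "openin (norm_topology V) U" if U: "openin M.mtopology U" for U
  proof (subst openin_subopen, intro ballI)
    fix m assume m: "m \<in> U"
    then have mN: "m \<in> Norms V" using U M.openin_mtopology by blast
    obtain r where r: "r > 0" "M.mball m r \<subseteq> U" using U m M.openin_mtopology by blast
    obtain X \<eta> where X: "finite X" "X \<subseteq> vcarrier V" "\<eta> > 0"
      "\<And>n. is_norm V n \<Longrightarrow> (\<And>x. x \<in> X \<Longrightarrow> \<bar>n x - m x\<bar> < \<eta>) \<Longrightarrow> norm_near V (r / 2) m n"
      using norm_near_finite_test[OF V fd NormsD(1)[OF mN], of "r / 2"] r by auto
    define W where "W = topspace (norm_topology V) \<inter> (\<Inter>x\<in>X. {n \<in> topspace (norm_topology V). n x \<in> {m x - \<eta> <..< m x + \<eta>}})"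
    have "openin (norm_topology V) W"
      unfolding W_def
    proof (cases "X = {}")
      case False
      have "openin (norm_topology V) (\<Inter>x\<in>X. {n \<in> topspace (norm_topology V). n x \<in> {m x - \<eta> <..< m x + \<eta>}})"
        using X(1,2) False
        by (intro openin_INT2 openin_continuous_map_preimage[OF eval]) auto
      then show "openin (norm_topology V) (topspace (norm_topology V) \<inter>
          (\<Inter>x\<in>X. {n \<in> topspace (norm_topology V). n x \<in> {m x - \<eta> <..< m x + \<eta>}}))"
        by (rule openin_Int[OF openin_topspace])
    qed simp
    moreover have "m \<in> W" using mN X(3) by (auto simp: W_def top)
    moreover have "W \<subseteq> U"
    proof
      fix n assume n: "n \<in> W"
      then have nN: "n \<in> Norms V" by (simp add: W_def top)
      have "\<bar>n x - m x\<bar> < \<eta>" if "x \<in> X" for x using n that by (auto simp: W_def abs_less_iff)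
      then have "norm_near V (r / 2) m n" using X(4) NormsD(1)[OF nN] by blast
      then have "omega V m n \<le> r / 2"
        by (intro iffD2[OF omega_le_iff(2)[OF V fd NormsD(1)[OF mN] NormsD(1)[OF nN]]]) (use r in auto)
      then have "n \<in> M.mball m r" unfolding ball using r mN nN by simp
      then show "n \<in> U" using r(2) by blast
    qed
    ultimately show "\<exists>T. openin (norm_topology V) T \<and> m \<in> T \<and> T \<subseteq> U" by blast
  qed
  show ?thesis unfolding T topology_eq using 1 2 by blast
qed

section \<open>Metrics, their topologies and quotients\<close>

lemma openin_metric_topology:
  assumes "Metric_space B (dist_on B w)"
  shows "openin (metric_topology B w) U \<longleftrightarrow> U \<subseteq> B \<and> (\<forall>x\<in>U. \<exists>r>0. \<forall>y\<in>B. w x y < r \<longrightarrow> y \<in> U)"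
proof -
  interpret Metric_space B "dist_on B w" by fact
  have "mball x r \<subseteq> U \<longleftrightarrow> (\<forall>y\<in>B. w x y < r \<longrightarrow> y \<in> U)" if "x \<in> B" for x r
    using that by (auto simp: mball_def dist_on_def)
  then show ?thesis unfolding metric_topology_def openin_mtopology by (auto simp: subset_iff)
qed

lemma topspace_metric_topology:
  "Metric_space B (dist_on B w) \<Longrightarrow> topspace (metric_topology B w) = B"
  by (simp add: metric_topology_def Metric_space.topspace_mtopology)

lemma metric_topology_subset:
  assumes B: "Metric_space B (dist_on B w)" and "A \<subseteq> B"
  shows "metric_topology A w = subtopology (metric_topology B w) A"
proof -
  interpret S: Submetric B "dist_on B w" A using assms by (simp add: Submetric_def Submetric_axioms_def)
  have A: "Metric_space A (dist_on A w)"
    using Metric_space_dist_onD[OF B] \<open>A \<subseteq> B\<close> by (intro Metric_space_dist_on) (meson subsetD)+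
  have "openin (metric_topology A w) U \<longleftrightarrow> openin S.sub.mtopology U" for U
  proof -
    have "S.sub.mball x r \<subseteq> U \<longleftrightarrow> (\<forall>y\<in>A. w x y < r \<longrightarrow> y \<in> U)" if "x \<in> A" for x r
      using that \<open>A \<subseteq> B\<close> by (auto simp: S.sub.mball_def dist_on_def)
    then show ?thesis
      unfolding openin_metric_topology[OF A] S.sub.openin_mtopology by (auto simp: subset_iff)
  qed
  then show ?thesis by (simp add: topology_eq metric_topology_def S.mtopology_submetric)
qed

lemma dense_subset_metric:
  assumes B: "Metric_space B (dist_on B w)" and "A \<subseteq> A'" "A' \<subseteq> B"
    and "\<And>x e. x \<in> A' \<Longrightarrow> e > 0 \<Longrightarrow> \<exists>y\<in>A. w x y < e"
  shows "dense_subset (metric_topology B w) A A'"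
proof -
  interpret Metric_space B "dist_on B w" by fact
  have "\<exists>y\<in>A. y \<in> mball x e" if "x \<in> A'" "e > 0" for x e
  proof -
    have "\<exists>y\<in>A. w x y < e" using assms(4) that by blast
    then obtain y where "y \<in> A" "w x y < e" by blast
    moreover have "x \<in> B" "y \<in> B" using that \<open>y \<in> A\<close> assms(2,3) by auto
    ultimately show ?thesis by (auto simp: mball_def dist_on_def)
  qed
  then show ?thesis using assms(2,3)
    unfolding dense_subset_def metric_topology_def metric_closure_of by blast
qed

text \<open>All distances of interest are infima of the constants \<open>C\<close> for which two points are in
  relation \<open>R C\<close>. Such a function is a metric compatible with a given one as soon as the
  relation is symmetric and transitive up to \<open>\<epsilon>\<close>, and small values of one distance force small
  values of the other. Points at distance 0 coincide because they do so for the given metric.\<close>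

lemma compatible_metric_from_relation:
  assumes B: "Metric_space B (dist_on B w)" and AB: "A \<subseteq> B"
    and char: "\<And>x y r. x \<in> A \<Longrightarrow> y \<in> A \<Longrightarrow> d x y < r \<longleftrightarrow> (\<exists>C. 0 \<le> C \<and> C < r \<and> R C x y)"
    and sym: "\<And>x y C. x \<in> A \<Longrightarrow> y \<in> A \<Longrightarrow> R C x y \<Longrightarrow> R C y x"
    and tri: "\<And>x y z C D e. x \<in> A \<Longrightarrow> y \<in> A \<Longrightarrow> z \<in> A \<Longrightarrow> 0 \<le> C \<Longrightarrow> 0 \<le> D \<Longrightarrow> R C x y \<Longrightarrow> R D y z \<Longrightarrow>
      e > 0 \<Longrightarrow> R (C + D + e) x z"
    and wd: "\<And>x e. x \<in> A \<Longrightarrow> e > 0 \<Longrightarrow> \<exists>\<delta>>0. \<forall>y\<in>A. w x y < \<delta> \<longrightarrow> d x y < e"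
    and dw: "\<And>x e. x \<in> A \<Longrightarrow> e > 0 \<Longrightarrow> \<exists>\<delta>>0. \<forall>y\<in>A. d x y < \<delta> \<longrightarrow> w x y < e"
  shows "compatible_metric (metric_topology B w) A d"
proof -
  note W = Metric_space_dist_onD[OF B]
  have nonneg: "0 \<le> d x y" if "x \<in> A" "y \<in> A" for x y
    using char[OF that, of 0] by (meson not_le)
  have M: "Metric_space A (dist_on A d)"
  proof (rule Metric_space_dist_on)
    show "0 \<le> d x y" if "x \<in> A" "y \<in> A" for x y using nonneg that .
    have le: "d y x \<le> d x y" if "x \<in> A" "y \<in> A" for x y
    proof (rule ccontr)
      assume "\<not> d y x \<le> d x y"
      then have "d x y < d y x" by simp
      then have "d y x < d y x" using char that sym by meson
      then show False by simp
    qed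
    then show "d x y = d y x" if "x \<in> A" "y \<in> A" for x y using that by (meson antisym)
    show "d x x = 0" if x: "x \<in> A" for x
    proof -
      have "d x x \<le> e" if "e > 0" for e
        using wd[OF x that] W(3)[of x] x AB by (metis less_imp_le subsetD)
      then show ?thesis using nonneg[OF x x] by (meson antisym dense_ge)
    qed
    show "x = y" if xy: "x \<in> A" "y \<in> A" and 0: "d x y = 0" for x y
    proof -
      have "w x y \<le> e" if "e > 0" for e using dw[OF xy(1) that] xy 0 by (metis less_imp_le)
      then have "w x y \<le> 0" by (meson dense_ge)
      then show ?thesis using W(1)[of x y] W(4)[of x y] xy AB by (simp add: subset_iff)
    qed
    show "d x z \<le> d x y + d y z" if xyz: "x \<in> A" "y \<in> A" "z \<in> A" for x y z
    proof (rule field_le_epsilon)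
      fix e :: real assume e: "e > 0"
      obtain C where C: "0 \<le> C" "C < d x y + e / 3" "R C x y" using char[OF xyz(1,2)] e by (metis less_add_same_cancel1 zero_less_divide_iff zero_less_numeral)
      obtain D where D: "0 \<le> D" "D < d y z + e / 3" "R D y z" using char[OF xyz(2,3)] e by (metis less_add_same_cancel1 zero_less_divide_iff zero_less_numeral)
      have "R (C + D + e / 3) x z" using tri[OF xyz C(1) D(1) C(3) D(3)] e by simp
      moreover have "0 \<le> C + D + e / 3" "C + D + e / 3 < d x y + d y z + e" using C D e by auto
      ultimately show "d x z \<le> d x y + d y z + e" using char[OF xyz(1,3)] by (meson less_imp_le)
    qed
  qed
  have A: "Metric_space A (dist_on A w)"
    using W AB by (intro Metric_space_dist_on) (meson subsetD)+
  have "openin (metric_topology A d) U \<longleftrightarrow> openin (metric_topology A w) U" for U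
    unfolding openin_metric_topology[OF A] openin_metric_topology[OF M]
  proof (intro conj_cong refl ball_cong iffI)
    fix x assume U: "U \<subseteq> A" and x: "x \<in> U"
    then have xA: "x \<in> A" by blast
    { assume "\<exists>r>0. \<forall>y\<in>A. d x y < r \<longrightarrow> y \<in> U"
      then obtain r where "r > 0" "\<forall>y\<in>A. d x y < r \<longrightarrow> y \<in> U" by blast
      then show "\<exists>r>0. \<forall>y\<in>A. w x y < r \<longrightarrow> y \<in> U" using wd[OF xA, of r] by meson }
    { assume "\<exists>r>0. \<forall>y\<in>A. w x y < r \<longrightarrow> y \<in> U"
      then obtain r where "r > 0" "\<forall>y\<in>A. w x y < r \<longrightarrow> y \<in> U" by blast
      then show "\<exists>r>0. \<forall>y\<in>A. d x y < r \<longrightarrow> y \<in> U" using dw[OF xA, of r] by meson }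
  qed
  then show ?thesis
    using M metric_topology_subset[OF B AB] by (simp add: compatible_metric_def topology_eq)
qed

text \<open>In a bounded set, any point serves as base point for all others.\<close>

lemma unif_equiv_from_based:
  assumes "\<And>x0 K e. x0 \<in> A \<Longrightarrow> e > 0 \<Longrightarrow> \<exists>\<delta>>0. \<forall>x\<in>A. \<forall>y\<in>A. w x0 x \<le> K \<longrightarrow>
      (w x y < \<delta> \<longrightarrow> d x y < e) \<and> (d x y < \<delta> \<longrightarrow> w x y < e)"
  shows "unif_equiv_on_bounded A d w"
  unfolding unif_equiv_on_bounded_def
proof (intro allI impI)
  fix S assume S: "S \<subseteq> A" and "\<exists>C. \<forall>x\<in>S. \<forall>y\<in>S. w x y \<le> C"
  then obtain K where K: "\<forall>x\<in>S. \<forall>y\<in>S. w x y \<le> K" by blast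
  have *: "\<exists>\<delta>>0. \<forall>x\<in>S. \<forall>y\<in>S. (w x y < \<delta> \<longrightarrow> d x y < e) \<and> (d x y < \<delta> \<longrightarrow> w x y < e)" if e: "e > 0" for e
  proof (cases "S = {}")
    case True
    then show ?thesis using zero_less_one by blast
  next
    case False
    then obtain x0 where x0: "x0 \<in> S" by blast
    obtain \<delta> where "\<delta> > 0" "\<forall>x\<in>A. \<forall>y\<in>A. w x0 x \<le> K \<longrightarrow>
      (w x y < \<delta> \<longrightarrow> d x y < e) \<and> (d x y < \<delta> \<longrightarrow> w x y < e)"
      using assms[of x0 e K] x0 S e by blast
    then show ?thesis using K x0 S by (intro exI[of _ \<delta>]) blast
  qed
  show "unif_finer_on S d w \<and> unif_finer_on S w d" unfolding unif_finer_on_def using * by meson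
qed

text \<open>The quotient of a metric space by a group of isometries: the infimum over two orbits may be
  taken with one point fixed, so it is a pseudometric, and a metric if orbits at distance 0 coincide;
  its topology is the quotient topology. Here the group enters only through its orbits \<open>orb\<close>.\<close>

lemma orbit_metric:
  fixes w :: "'a \<Rightarrow> 'a \<Rightarrow> real" and orb :: "'a \<Rightarrow> 'a set"
  defines "wq \<equiv> \<lambda>P Q. Inf {w p q | p q. p \<in> P \<and> q \<in> Q}"
  assumes B: "Metric_space B (dist_on B w)"
    and self: "\<And>p. p \<in> B \<Longrightarrow> p \<in> orb p" and sub: "\<And>p. p \<in> B \<Longrightarrow> orb p \<subseteq> B"
    and eq: "\<And>p q. p \<in> B \<Longrightarrow> q \<in> orb p \<Longrightarrow> orb q = orb p"
    and inv: "\<And>p q p'. p \<in> B \<Longrightarrow> q \<in> B \<Longrightarrow> p' \<in> orb p \<Longrightarrow> \<exists>q'\<in>orb q. w p' q' \<le> w p q"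
    and sep: "\<And>p q. p \<in> B \<Longrightarrow> q \<in> B \<Longrightarrow> (\<And>e. e > 0 \<Longrightarrow> \<exists>q'\<in>orb q. w p q' < e) \<Longrightarrow> orb p = orb q"
  shows "\<And>p q r. p \<in> B \<Longrightarrow> q \<in> B \<Longrightarrow> wq (orb p) (orb q) < r \<longleftrightarrow> (\<exists>q'\<in>orb q. w p q' < r)"
    and "Metric_space (orb ` B) (dist_on (orb ` B) wq)"
    and "quotient_topology (metric_topology B w) orb = metric_topology (orb ` B) wq"
proof -
  note W = Metric_space_dist_onD[OF B]
  show less: "wq (orb p) (orb q) < r \<longleftrightarrow> (\<exists>q'\<in>orb q. w p q' < r)" if pq: "p \<in> B" "q \<in> B" for p q r
  proof -
    let ?S = "{w p' q' | p' q'. p' \<in> orb p \<and> q' \<in> orb q}"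
    have "?S \<noteq> {}" using self pq by blast
    moreover have "bdd_below ?S" using W(1) sub pq by (intro bdd_belowI[of _ 0]) blast
    ultimately have "wq (orb p) (orb q) < r \<longleftrightarrow> (\<exists>s\<in>?S. s < r)"
      unfolding wq_def by (rule cInf_less_iff)
    also have "\<dots> \<longleftrightarrow> (\<exists>q'\<in>orb q. w p q' < r)"
    proof
      assume "\<exists>s\<in>?S. s < r"
      then obtain p' q' where p': "p' \<in> orb p" and q': "q' \<in> orb q" and lt: "w p' q' < r" by blast
      have "p' \<in> B" "q' \<in> B" "p \<in> orb p'" using p' q' sub pq eq self by blast+
      then obtain q'' where "q'' \<in> orb q'" "w p q'' \<le> w p' q'" using inv by blast
      then show "\<exists>q'\<in>orb q. w p q' < r" using lt eq[OF pq(2) q'] by (metis le_less_trans)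
    next
      assume "\<exists>q'\<in>orb q. w p q' < r"
      then show "\<exists>s\<in>?S. s < r" using self[OF pq(1)] by blast
    qed
    finally show ?thesis .
  qed
  have nonneg: "0 \<le> wq (orb p) (orb q)" if "p \<in> B" "q \<in> B" for p q
    using less[OF that, of 0] W(1)[OF that(1)] sub[OF that(2)] by (meson not_le subsetD)
  show M: "Metric_space (orb ` B) (dist_on (orb ` B) wq)"
  proof (rule Metric_space_dist_on)
    fix P Q S assume "P \<in> orb ` B" "Q \<in> orb ` B" "S \<in> orb ` B"
    then obtain p q s where p: "p \<in> B" "P = orb p" and q: "q \<in> B" "Q = orb q" and s: "s \<in> B" "S = orb s"
      by blast
    show "0 \<le> wq P Q" using nonneg p q by simp
    have "{w p q | p q. p \<in> P \<and> q \<in> Q} = {w p q | p q. p \<in> Q \<and> q \<in> P}"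
      using W(2) sub p q by (smt (verit) Collect_cong subsetD)
    then show "wq P Q = wq Q P" by (simp add: wq_def)
    have "wq P P < e" if "e > 0" for e using less[OF p(1) p(1)] p W(3) self that by metis
    then have "\<not> 0 < wq (orb p) (orb p)" using p(2) by blast
    then show "wq P P = 0" using nonneg[OF p(1) p(1)] p(2) by simp
    show "P = Q" if "wq P Q = 0"
      using sep[OF p(1) q(1)] less[OF p(1) q(1)] that p(2) q(2) by metis
    show "wq P S \<le> wq P Q + wq Q S"
    proof (rule field_le_epsilon)
      fix e :: real assume e: "e > 0"
      have "wq P Q < wq P Q + e / 2" "wq Q S < wq Q S + e / 2" using e by auto
      then obtain q' where q': "q' \<in> orb q" "w p q' < wq P Q + e / 2" using less[OF p(1) q(1)] p q by metis
      have q'B: "q' \<in> B" "orb q' = Q" using q' sub eq q by blast+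
      then obtain s' where s': "s' \<in> orb s" "w q' s' < wq Q S + e / 2"
        using less[OF q'B(1) s(1)] \<open>wq Q S < wq Q S + e / 2\<close> s by metis
      have "w p s' \<le> w p q' + w q' s'" using W(5) p q'B s' sub s by blast
      then have "w p s' < wq P Q + wq Q S + e" using q' s' by linarith
      then show "wq P S \<le> wq P Q + wq Q S + e" using less[OF p(1) s(1)] s' p s by (metis less_imp_le)
    qed
  qed
  show "quotient_topology (metric_topology B w) orb = metric_topology (orb ` B) wq"
    unfolding topology_eq
  proof
    fix U
    have "openin (quotient_topology (metric_topology B w) orb) U \<longleftrightarrow>
        U \<subseteq> orb ` B \<and> (\<forall>p\<in>B. orb p \<in> U \<longrightarrow> (\<exists>r>0. \<forall>q\<in>B. w p q < r \<longrightarrow> orb q \<in> U))"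
      unfolding openin_quotient_topology topspace_metric_topology[OF B] openin_metric_topology[OF B]
      by (simp add: Ball_def imp_conjL)
    also have "\<dots> \<longleftrightarrow> U \<subseteq> orb ` B \<and> (\<forall>p\<in>B. orb p \<in> U \<longrightarrow> (\<exists>r>0. \<forall>q\<in>B. wq (orb p) (orb q) < r \<longrightarrow> orb q \<in> U))"
    proof -
      have "(\<forall>q\<in>B. w p q < r \<longrightarrow> orb q \<in> U) \<longleftrightarrow> (\<forall>q\<in>B. wq (orb p) (orb q) < r \<longrightarrow> orb q \<in> U)"
        if p: "p \<in> B" for p r
      proof
        assume *: "\<forall>q\<in>B. w p q < r \<longrightarrow> orb q \<in> U"
        show "\<forall>q\<in>B. wq (orb p) (orb q) < r \<longrightarrow> orb q \<in> U"
        proof (intro ballI impI)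
          fix q assume q: "q \<in> B" "wq (orb p) (orb q) < r"
          then obtain q' where q': "q' \<in> orb q" "w p q' < r" using less[OF p q(1)] by blast
          then have "orb q' \<in> U" using * sub[OF q(1)] by blast
          then show "orb q \<in> U" using eq[OF q(1) q'(1)] by simp
        qed
      next
        assume *: "\<forall>q\<in>B. wq (orb p) (orb q) < r \<longrightarrow> orb q \<in> U"
        show "\<forall>q\<in>B. w p q < r \<longrightarrow> orb q \<in> U" using * less[OF p] self by blast
      qed
      then show ?thesis by simp
    qed
    also have "\<dots> \<longleftrightarrow> openin (metric_topology (orb ` B) wq) U"
      unfolding openin_metric_topology[OF M] Set.ball_simps(9)
    proof (rule conj_cong[OF refl])
      define X where "X P \<longleftrightarrow> (\<exists>r>0. \<forall>q\<in>B. wq P (orb q) < r \<longrightarrow> orb q \<in> U)" for P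
      assume "U \<subseteq> orb ` B"
      then have "(\<forall>p\<in>B. orb p \<in> U \<longrightarrow> X (orb p)) \<longleftrightarrow> (\<forall>P\<in>U. X P)" by blast
      then show "(\<forall>p\<in>B. orb p \<in> U \<longrightarrow> (\<exists>r>0. \<forall>q\<in>B. wq (orb p) (orb q) < r \<longrightarrow> orb q \<in> U)) \<longleftrightarrow>
        (\<forall>P\<in>U. \<exists>r>0. \<forall>q\<in>B. wq P (orb q) < r \<longrightarrow> orb q \<in> U)" unfolding X_def .
    qed
    finally show "openin (quotient_topology (metric_topology B w) orb) U = openin (metric_topology (orb ` B) wq) U" .
  qed
qed

section \<open>The action of the general linear group\<close>

lemma GL_D:
  assumes "\<Delta> \<in> GL V"
  shows "lin_map V V \<Delta>" "inj_on \<Delta> (vcarrier V)" "\<Delta> ` vcarrier V = vcarrier V"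
    "x \<in> vcarrier V \<Longrightarrow> \<Delta> x \<in> vcarrier V"
    "x \<in> vcarrier V \<Longrightarrow> inv_into (vcarrier V) \<Delta> (\<Delta> x) = x"
    "x \<in> vcarrier V \<Longrightarrow> \<Delta> (inv_into (vcarrier V) \<Delta> x) = x"
    "x \<in> vcarrier V \<Longrightarrow> inv_into (vcarrier V) \<Delta> x \<in> vcarrier V"
  using assms unfolding GL_def bij_betw_def
  by (auto simp: f_inv_into_f inv_into_into)

lemma GL_injI:
  assumes V: "vec_space V" and fd: "fin_dim V" and T: "lin_map V V T" and "inj_on T (vcarrier V)"
  shows "T \<in> GL V"
proof -
  obtain k where "has_dim V k" using fd by (auto simp: fin_dim_def)
  then have "T ` vcarrier V = vcarrier V" using lin_map_inj_imp_surj[OF V V _ _ T] assms(4) by blast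
  then show ?thesis using T assms(4) by (simp add: GL_def bij_betw_def)
qed

lemma GL_id: "(\<lambda>x. x) \<in> GL V"
  by (auto simp: GL_def lin_map_def bij_betw_def)

lemma GL_inv:
  assumes V: "vec_space V" and D: "\<Delta> \<in> GL V"
  shows "inv_into (vcarrier V) \<Delta> \<in> GL V"
proof -
  have "lin_map (V\<lparr>vcarrier := \<Delta> ` vcarrier V\<rparr>) V (inv_into (vcarrier V) \<Delta>)"
    by (rule lin_map_inv_into[OF V GL_D(1,2)[OF D]])
  then have "lin_map V V (inv_into (vcarrier V) \<Delta>)" by (simp add: GL_D(3)[OF D])
  moreover have "bij_betw (inv_into (vcarrier V) \<Delta>) (vcarrier V) (vcarrier V)"
    using D by (simp add: GL_def bij_betw_inv_into)
  ultimately show ?thesis by (simp add: GL_def)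
qed

lemma GL_comp: "\<Delta> \<in> GL V \<Longrightarrow> \<Gamma> \<in> GL V \<Longrightarrow> (\<lambda>x. \<Delta> (\<Gamma> x)) \<in> GL V"
  unfolding GL_def using lin_map_comp[of V V \<Gamma> V \<Delta>] bij_betw_trans[of \<Gamma> "vcarrier V" "vcarrier V" \<Delta> "vcarrier V"]
  by (auto simp: comp_def)

lemma is_norm_pullback:
  assumes V: "vec_space V" and T: "lin_map V W T" and inj: "inj_on T (vcarrier V)"
    and n: "is_norm W n"
  shows "is_norm V (\<lambda>x. n (T x))"
  unfolding is_norm_def
proof (intro conjI ballI allI)
  fix x assume x: "x \<in> vcarrier V"
  note Tx = lin_mapD(1)[OF T x]
  show "0 \<le> n (T x)" using is_normD(1)[OF n Tx] .
  show "n (T x) = 0 \<longleftrightarrow> x = 0"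
    using is_normD(2)[OF n Tx] inj lin_map_inj_on_iff[OF V T] x lin_map_algebra(1)[OF V T] by auto
  show "n (T (vscale V c x)) = norm c * n (T x)" for c
    using lin_mapD(3)[OF T x] is_normD(3)[OF n Tx] by simp
  fix y assume y: "y \<in> vcarrier V"
  show "n (T (x + y)) \<le> n (T x) + n (T y)"
    using lin_mapD(2)[OF T x y] is_normD(4)[OF n Tx lin_mapD(1)[OF T y]] by simp
qed

lemma restrict_in_Norms:
  assumes "vec_space V" "is_norm V m"
  shows "restrict m (vcarrier V) \<in> Norms V"
  using assms(2) vs_closed[OF assms(1)] unfolding Norms_def is_norm_def by simp

lemma adjoint_in_dual:
  assumes V: "vec_space V" and T: "lin_map V W T" and f: "f \<in> vcarrier (alg_dual W)"
  shows "adjoint V T f \<in> vcarrier (alg_dual V)"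
  using f lin_mapD[OF T] vs_closed[OF V]
  unfolding alg_dual_carrier by (simp add: lin_functional_def adjoint_def)

lemma adjoint_lin_map:
  assumes V: "vec_space V" and T: "lin_map V W T"
  shows "lin_map (alg_dual W) (alg_dual V) (adjoint V T)"
  unfolding lin_map_def
  using adjoint_in_dual[OF assms]
  by (auto simp: adjoint_def alg_dual_def fun_scale_def fun_eq_iff)

lemma adjoint_comp:
  "lin_map V V \<Gamma> \<Longrightarrow> adjoint V \<Gamma> (adjoint V \<Delta> f) = adjoint V (\<lambda>x. \<Delta> (\<Gamma> x)) f"
  by (auto simp: adjoint_def lin_map_def)

lemma adjoint_id:
  assumes "f \<in> vcarrier (alg_dual V)" "\<And>x. x \<in> vcarrier V \<Longrightarrow> T x = x"
  shows "adjoint V T f = f"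
  using assms by (auto simp: adjoint_def alg_dual_carrier lin_functional_def fun_eq_iff)

lemma adjoint_inv_cancel:
  assumes V: "vec_space V" and D: "\<Delta> \<in> GL V" and f: "f \<in> vcarrier (alg_dual V)"
  shows "adjoint V \<Delta> (adjoint V (inv_into (vcarrier V) \<Delta>) f) = f"
    "adjoint V (inv_into (vcarrier V) \<Delta>) (adjoint V \<Delta> f) = f"
  unfolding adjoint_comp[OF GL_D(1)[OF D]] adjoint_comp[OF GL_D(1)[OF GL_inv[OF V D]]]
  by (auto intro!: adjoint_id[OF f] simp: GL_D(5,6)[OF D])

lemma adjoint_GL:
  assumes V: "vec_space V" and D: "\<Delta> \<in> GL V"
  shows "adjoint V \<Delta> \<in> GL (alg_dual V)"
proof -
  have "bij_betw (adjoint V \<Delta>) (vcarrier (alg_dual V)) (vcarrier (alg_dual V))"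
    by (rule bij_betw_byWitness[where f' = "adjoint V (inv_into (vcarrier V) \<Delta>)"])
      (use adjoint_inv_cancel[OF assms] adjoint_in_dual[OF V GL_D(1)[OF D]]
        adjoint_in_dual[OF V GL_D(1)[OF GL_inv[OF V D]]] in auto)
  then show ?thesis using adjoint_lin_map[OF V GL_D(1)[OF D]] by (simp add: GL_def)
qed

text \<open>The action without inverses and restrictions.\<close>

lemma orbit_iff:
  assumes V: "vec_space V" and m: "m \<in> Norms V"
  shows "n \<in> orbit V m \<longleftrightarrow> n \<in> Norms V \<and> (\<exists>\<Delta>\<in>GL V. \<forall>x\<in>vcarrier V. n (\<Delta> x) = m x)"
proof
  assume "n \<in> orbit V m"
  then obtain \<Delta> where D: "\<Delta> \<in> GL V" and n: "n = act V \<Delta> m" by (auto simp: orbit_def)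
  have "n \<in> Norms V"
    unfolding n act_def
    using restrict_in_Norms[OF V is_norm_pullback[OF V GL_D(1,2)[OF GL_inv[OF V D]] NormsD(1)[OF m]]] .
  moreover have "n (\<Delta> x) = m x" if "x \<in> vcarrier V" for x
    using that GL_D(4,5)[OF D that] by (simp add: n act_def)
  ultimately show "n \<in> Norms V \<and> (\<exists>\<Delta>\<in>GL V. \<forall>x\<in>vcarrier V. n (\<Delta> x) = m x)" using D by blast
next
  assume "n \<in> Norms V \<and> (\<exists>\<Delta>\<in>GL V. \<forall>x\<in>vcarrier V. n (\<Delta> x) = m x)"
  then obtain \<Delta> where n: "n \<in> Norms V" and D: "\<Delta> \<in> GL V" and eq: "\<forall>x\<in>vcarrier V. n (\<Delta> x) = m x" by blast
  have "n = act V \<Delta> m"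
  proof (rule extensionalityI[OF NormsD(2)[OF n]])
    show "act V \<Delta> m \<in> extensional (vcarrier V)" by (simp add: act_def)
    fix x assume x: "x \<in> vcarrier V"
    then show "n x = act V \<Delta> m x"
      using eq GL_D(6,7)[OF D x] by (metis act_def restrict_apply')
  qed
  then show "n \<in> orbit V m" using D by (simp add: orbit_def)
qed

lemma orbit2_iff:
  assumes V: "vec_space V" and m: "m \<in> Norms V" and n: "n \<in> Norms (alg_dual V)"
  shows "(m', n') \<in> orbit2 V (m, n) \<longleftrightarrow> m' \<in> Norms V \<and> n' \<in> Norms (alg_dual V) \<and>
    (\<exists>\<Delta>\<in>GL V. (\<forall>x\<in>vcarrier V. m' (\<Delta> x) = m x) \<and> (\<forall>f\<in>vcarrier (alg_dual V). n' f = n (adjoint V \<Delta> f)))"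
    (is "?L \<longleftrightarrow> ?R")
proof
  assume ?L
  then obtain \<Delta> where D: "\<Delta> \<in> GL V" and m': "m' = act V \<Delta> m" and n': "n' = act_dual V \<Delta> n"
    by (auto simp: orbit2_def)
  have "m' \<in> Norms V"
    unfolding m' act_def
    using restrict_in_Norms[OF V is_norm_pullback[OF V GL_D(1,2)[OF GL_inv[OF V D]] NormsD(1)[OF m]]] .
  moreover have "n' \<in> Norms (alg_dual V)"
    unfolding n' act_dual_def
    using restrict_in_Norms[OF vec_space_alg_dual[OF V] is_norm_pullback[OF vec_space_alg_dual[OF V] GL_D(1,2)[OF adjoint_GL[OF V D]] NormsD(1)[OF n]]] .
  moreover have "m' (\<Delta> x) = m x" if "x \<in> vcarrier V" for x
    using that GL_D(4,5)[OF D that] by (simp add: m' act_def)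
  moreover have "n' f = n (adjoint V \<Delta> f)" if "f \<in> vcarrier (alg_dual V)" for f
    using that by (simp add: n' act_dual_def)
  ultimately show ?R using D by blast
next
  assume ?R
  then obtain \<Delta> where m': "m' \<in> Norms V" and n': "n' \<in> Norms (alg_dual V)" and D: "\<Delta> \<in> GL V"
    and eq: "\<forall>x\<in>vcarrier V. m' (\<Delta> x) = m x" "\<forall>f\<in>vcarrier (alg_dual V). n' f = n (adjoint V \<Delta> f)" by blast
  have "m' = act V \<Delta> m"
  proof (rule extensionalityI[OF NormsD(2)[OF m']])
    show "act V \<Delta> m \<in> extensional (vcarrier V)" by (simp add: act_def)
    fix x assume x: "x \<in> vcarrier V"
    then show "m' x = act V \<Delta> m x"
      using eq GL_D(6,7)[OF D x] by (metis act_def restrict_apply')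
  qed
  moreover have "n' = act_dual V \<Delta> n"
    by (rule extensionalityI[OF NormsD(2)[OF n']]) (use eq in \<open>auto simp: act_dual_def\<close>)
  ultimately show ?L using D by (simp add: orbit2_def)
qed

lemma norm_tendsto_of_coords:
  fixes V :: "('k::rc_scalar, 'v::ab_group_add, 'z) vspace_scheme"
  assumes V: "vec_space V" and p: "is_norm V p" and b: "coord_basis V k b c"
    and y: "\<And>j. y j \<in> vcarrier V" and z: "z \<in> vcarrier V"
    and lim: "\<And>i. i < k \<Longrightarrow> (\<lambda>j. c i (y j)) \<longlonglongrightarrow> c i z"
  shows "(\<lambda>j::nat. p (y j)) \<longlonglongrightarrow> p z"
proof (rule LIM_zero_cancel, rule Lim_null_comparison)
  have "\<bar>p (y j) - p z\<bar> \<le> (\<Sum>i<k. norm (c i (y j) - c i z) * p (b i))" for j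
  proof -
    have "\<bar>p (y j) - p z\<bar> \<le> p (y j - z)" by (rule norm_algebra(6)[OF V p y z])
    also have "\<dots> \<le> (\<Sum>i<k. norm (c i (y j - z)) * p (b i))"
      by (rule norm_le_coords[OF V p b vs_closed(3)[OF V y z]])
    also have "\<dots> = (\<Sum>i<k. norm (c i (y j) - c i z) * p (b i))"
      by (rule sum.cong) (auto simp: lin_functional_algebra(3)[OF V coord_basisD(2)[OF b] y z])
    finally show ?thesis .
  qed
  then show "\<forall>\<^sub>F j in sequentially. norm (p (y j) - p z) \<le> (\<Sum>i<k. norm (c i (y j) - c i z) * p (b i))"
    by simp
  have "(\<lambda>j. \<Sum>i<k. norm (c i (y j) - c i z) * p (b i)) \<longlonglongrightarrow> (\<Sum>i<k. norm (c i z - c i z) * p (b i))"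
    using lim by (intro tendsto_intros) auto
  then show "(\<lambda>j. \<Sum>i<k. norm (c i (y j) - c i z) * p (b i)) \<longlonglongrightarrow> 0" by simp
qed

text \<open>The matrices of the maps are bounded and have a convergent subsequence. The limit also governs the
  adjoint maps, whose matrices are the transposed ones.\<close>

lemma bounded_maps_limit:
  fixes V :: "('k::rc_scalar, 'v::ab_group_add, 'z) vspace_scheme"
  assumes V: "vec_space V" and fd: "fin_dim V" and n: "is_norm V n"
    and T: "\<And>j. lin_map V V (T j)" and bd: "\<And>j x. x \<in> vcarrier V \<Longrightarrow> n (T j x) \<le> K * m x"
  obtains r \<Delta> where "strict_mono (r :: nat \<Rightarrow> nat)" "lin_map V V \<Delta>"
    "\<And>p x. is_norm V p \<Longrightarrow> x \<in> vcarrier V \<Longrightarrow> (\<lambda>j. p (T (r j) x)) \<longlonglongrightarrow> p (\<Delta> x)"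
    "\<And>q f. is_norm (alg_dual V) q \<Longrightarrow> f \<in> vcarrier (alg_dual V) \<Longrightarrow>
      (\<lambda>j. q (adjoint V (T (r j)) f)) \<longlonglongrightarrow> q (adjoint V \<Delta> f)"
proof -
  obtain k b c where b: "coord_basis V k b c" using fd has_dim_coord_basis[OF V] unfolding fin_dim_def by metis
  note bV = coord_basisD(1)[OF b]
  obtain L where L: "L > 0" "\<And>x. x \<in> vcarrier V \<Longrightarrow> (\<Sum>i<k. norm (c i x)) \<le> L * n x"
    using coords_le_norm[OF V n b] by blast
  define a where "a j il = c (fst il) (T j (b (snd il)))" for j il
  define M where "M = L * (\<Sum>l<k. \<bar>K * m (b l)\<bar>)"
  have "norm (a j il) \<le> M" if "il \<in> {..<k} \<times> {..<k}" for j il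
  proof -
    obtain i l where il: "il = (i, l)" "i < k" "l < k" using \<open>il \<in> {..<k} \<times> {..<k}\<close> by auto
    have "norm (a j il) \<le> (\<Sum>i<k. norm (c i (T j (b l))))"
      using member_le_sum[of i "{..<k}" "\<lambda>i. norm (c i (T j (b l)))"] il(2) by (simp add: a_def il(1))
    also have "\<dots> \<le> L * n (T j (b l))" by (rule L(2)[OF lin_mapD(1)[OF T bV[OF il(3)]]])
    also have "\<dots> \<le> L * (K * m (b l))" using L(1) bd[OF bV[OF il(3)]] by (intro mult_left_mono) auto
    also have "\<dots> \<le> M" unfolding M_def
    proof (rule mult_left_mono)
      have "K * m (b l) \<le> \<bar>K * m (b l)\<bar>" by simp
      also have "\<dots> \<le> (\<Sum>l<k. \<bar>K * m (b l)\<bar>)"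
        using il(3) by (intro member_le_sum[of l "{..<k}" "\<lambda>l. \<bar>K * m (b l)\<bar>"]) auto
      finally show "K * m (b l) \<le> (\<Sum>l<k. \<bar>K * m (b l)\<bar>)" .
    qed (use L in simp)
    finally show ?thesis .
  qed
  then obtain r e where r: "strict_mono (r :: nat \<Rightarrow> nat)"
    and e: "\<And>il. il \<in> {..<k} \<times> {..<k} \<Longrightarrow> (\<lambda>j. a (r j) il) \<longlonglongrightarrow> e il"
    using bounded_family_convergent_subseq[of "{..<k} \<times> {..<k}" a M] by (metis finite_cartesian_product finite_lessThan)
  define d where "d l = (\<Sum>i<k. vscale V (e (i, l)) (b i))" for l
  have d: "d l \<in> vcarrier V" for l
    unfolding d_def by (rule vs_closed(6)[OF V]) (simp add: vs_closed[OF V] bV)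
  define \<Delta> where "\<Delta> x = (\<Sum>l<k. vscale V (c l x) (d l))" for x
  have \<Delta>: "lin_map V V \<Delta>" unfolding \<Delta>_def by (rule lin_comb_lin_map[OF V coord_basisD(2)[OF b] d])
  have \<Delta>b: "\<Delta> (b l) = d l" if l: "l < k" for l
  proof -
    have "\<Delta> (b l) = (\<Sum>l'<k. if l' = l then d l' else 0)"
      unfolding \<Delta>_def by (rule sum.cong) (auto simp: coord_basisD(3)[OF b _ l] vs_algebra[OF V])
    then show ?thesis using l by simp
  qed
  have coord: "c i (S x) = (\<Sum>l<k. c l x * c i (S (b l)))" if S: "lin_map V V S" and x: "x \<in> vcarrier V" and i: "i < k" for S x i
  proof -
    have "c i (S x) = c i (\<Sum>l<k. vscale V (c l x) (S (b l)))"
      using coord_basis_lin_map_expand[OF V b S x] by simp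
    also have "\<dots> = (\<Sum>l<k. c i (vscale V (c l x) (S (b l))))"
      by (rule lin_functional_algebra(6)[OF V coord_basisD(2)[OF b i]])
        (simp add: vs_closed[OF V] lin_mapD(1)[OF S] bV)
    also have "\<dots> = (\<Sum>l<k. c l x * c i (S (b l)))"
      by (rule sum.cong) (auto simp: lin_functional_algebra(5)[OF V coord_basisD(2)[OF b i]] lin_mapD(1)[OF S] bV)
    finally show ?thesis .
  qed
  have entry: "(\<lambda>j. c i (T (r j) (b l))) \<longlonglongrightarrow> c i (\<Delta> (b l))" if "i < k" "l < k" for i l
  proof -
    have "c i (\<Delta> (b l)) = e (i, l)"
      unfolding \<Delta>b[OF that(2)] d_def by (rule coord_basis_sum_coord[OF V b that(1)])
    then show ?thesis using e[of "(i, l)"] that by (simp add: a_def)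
  qed
  show thesis
  proof (rule that[OF r \<Delta>])
    fix p x assume p: "is_norm V p" and x: "x \<in> vcarrier V"
    show "(\<lambda>j. p (T (r j) x)) \<longlonglongrightarrow> p (\<Delta> x)"
    proof (rule norm_tendsto_of_coords[OF V p b])
      show "T (r j) x \<in> vcarrier V" for j by (rule lin_mapD(1)[OF T x])
      show "\<Delta> x \<in> vcarrier V" by (rule lin_mapD(1)[OF \<Delta> x])
      fix i assume i: "i < k"
      show "(\<lambda>j. c i (T (r j) x)) \<longlonglongrightarrow> c i (\<Delta> x)"
        unfolding coord[OF T x i] coord[OF \<Delta> x i] using entry[OF i] by (intro tendsto_intros) auto
    qed
  next
    fix q f assume q: "is_norm (alg_dual V) q" and f: "f \<in> vcarrier (alg_dual V)"
    then have lf: "lin_functional V f" by (simp add: alg_dual_carrier)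
    show "(\<lambda>j. q (adjoint V (T (r j)) f)) \<longlonglongrightarrow> q (adjoint V \<Delta> f)"
    proof (rule norm_tendsto_of_coords[OF vec_space_alg_dual[OF V] q coord_basis_alg_dual[OF V b]])
      show "adjoint V (T (r j)) f \<in> vcarrier (alg_dual V)" for j by (rule adjoint_in_dual[OF V T f])
      show "adjoint V \<Delta> f \<in> vcarrier (alg_dual V)" by (rule adjoint_in_dual[OF V \<Delta> f])
      fix l assume l: "l < k"
      have ev: "bidual_eval V (b l) (adjoint V S f) = (\<Sum>i<k. c i (S (b l)) * f (b i))" if S: "lin_map V V S" for S
        using adjoint_in_dual[OF V S f] coord_basis_functional_expand[OF V b lf lin_mapD(1)[OF S bV[OF l]]]
        by (simp add: bidual_eval_def adjoint_def bV[OF l])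
      show "(\<lambda>j. bidual_eval V (b l) (adjoint V (T (r j)) f)) \<longlonglongrightarrow> bidual_eval V (b l) (adjoint V \<Delta> f)"
        unfolding ev[OF T] ev[OF \<Delta>] using entry[OF _ l] by (intro tendsto_intros) auto
    qed
  qed
qed

section \<open>Embeddings, ages and balls\<close>

lemma EmbD:
  assumes "T \<in> Emb X Y"
  shows "lin_map X Y T" "x \<in> vcarrier X \<Longrightarrow> vnorm Y (T x) = vnorm X x"
    "x \<in> vcarrier X \<Longrightarrow> T x \<in> vcarrier Y"
  using assms by (auto simp: Emb_def lin_map_def)

lemma Emb_inj:
  assumes X: "normed_space X" and Y: "normed_space Y" and T: "T \<in> Emb X Y"
  shows "inj_on T (vcarrier X)"
  unfolding lin_map_inj_on_iff[OF normed_spaceD(1)[OF X] EmbD(1)[OF T]]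
  using EmbD(2)[OF T] is_normD(2)[OF normed_spaceD(2)[OF X]]
    norm_algebra(1)[OF normed_spaceD(1)[OF Y] normed_spaceD(2)[OF Y]] by metis

lemma Emb_comp: "S \<in> Emb X Y \<Longrightarrow> T \<in> Emb Y Z \<Longrightarrow> (\<lambda>x. T (S x)) \<in> Emb X Z"
  by (auto simp: Emb_def lin_map_def)

lemma Emb_inv:
  assumes X: "normed_space X" and Y: "normed_space Y" and T: "T \<in> Emb X Y"
  shows "inv_into (vcarrier X) T \<in> Emb (Y\<lparr>vcarrier := T ` vcarrier X\<rparr>) X"
proof -
  note inj = Emb_inj[OF assms]
  have "lin_map (Y\<lparr>vcarrier := T ` vcarrier X\<rparr>) X (inv_into (vcarrier X) T)"
    by (rule lin_map_inv_into[OF normed_spaceD(1)[OF X] EmbD(1)[OF T] inj])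
  then show ?thesis using inj EmbD(2)[OF T] by (auto simp: Emb_def)
qed

lemma AgeI:
  "C \<subseteq> vcarrier F \<Longrightarrow> module.subspace (vscale F) C \<Longrightarrow> fin_dim (F\<lparr>vcarrier := C\<rparr>) \<Longrightarrow> F\<lparr>vcarrier := C\<rparr> \<in> Age F"
  by (auto simp: Age_def)

lemma AgeD:
  assumes F: "normed_space F" and U: "U \<in> Age F"
  shows "normed_space U" "fin_dim U" "vcarrier U \<subseteq> vcarrier F" "vscale U = vscale F" "vnorm U = vnorm F"
    "F\<lparr>vcarrier := vcarrier U\<rparr> = U"
proof -
  obtain C where C: "U = F\<lparr>vcarrier := C\<rparr>" "C \<subseteq> vcarrier F" "module.subspace (vscale F) C"
    "fin_dim (F\<lparr>vcarrier := C\<rparr>)" using U by (auto simp: Age_def)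
  show "normed_space U" unfolding C(1) by (rule normed_space_subcarrier[OF F C(3,2)])
  show "fin_dim U" "vcarrier U \<subseteq> vcarrier F" "vscale U = vscale F" "vnorm U = vnorm F"
    "F\<lparr>vcarrier := vcarrier U\<rparr> = U" using C by auto
qed

lemma Emb_Age: "T \<in> Emb V U \<Longrightarrow> U \<in> Age F \<Longrightarrow> T \<in> Emb V F"
  by (auto simp: Emb_def lin_map_def Age_def subset_iff)

lemma image_in_Age:
  assumes F: "normed_space F" and V: "vec_space V" and k: "has_dim V k"
    and T: "lin_map V F T" and inj: "inj_on T (vcarrier V)"
  shows "F\<lparr>vcarrier := T ` vcarrier V\<rparr> \<in> Age F" "has_dim (F\<lparr>vcarrier := T ` vcarrier V\<rparr>) k"
proof -
  show k': "has_dim (F\<lparr>vcarrier := T ` vcarrier V\<rparr>) k"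
    by (rule has_dim_image[OF V normed_spaceD(1)[OF F] k T inj])
  show "F\<lparr>vcarrier := T ` vcarrier V\<rparr> \<in> Age F"
    using k' subspace_image_lin_map[OF V normed_spaceD(1)[OF F] T] lin_mapD(1)[OF T]
    by (intro AgeI) (auto simp: fin_dim_def)
qed

lemma Emb_image_Age:
  assumes F: "normed_space F" and X: "normed_space X" "has_dim X k" and T: "T \<in> Emb X F"
  shows "F\<lparr>vcarrier := T ` vcarrier X\<rparr> \<in> Age F" "has_dim (F\<lparr>vcarrier := T ` vcarrier X\<rparr>) k"
  using image_in_Age[OF F normed_spaceD(1)[OF X(1)] X(2) EmbD(1)[OF T] Emb_inj[OF X(1) F T]] by auto

lemma isometric_Emb:
  assumes "normed_space X" "normed_space Y" "isometric X Y"
  obtains a b where "a \<in> Emb X Y" "a ` vcarrier X = vcarrier Y" "b \<in> Emb Y X" "b ` vcarrier Y = vcarrier X"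
proof -
  obtain a where a: "a \<in> Emb X Y" "a ` vcarrier X = vcarrier Y" using assms(3) by (auto simp: isometric_def)
  have "inv_into (vcarrier X) a \<in> Emb (Y\<lparr>vcarrier := a ` vcarrier X\<rparr>) X" by (rule Emb_inv[OF assms(1,2) a(1)])
  then have "inv_into (vcarrier X) a \<in> Emb Y X" using a(2) by simp
  moreover have "inv_into (vcarrier X) a ` vcarrier Y = vcarrier X"
    using a(2) Emb_inj[OF assms(1,2) a(1)] by (metis bij_betw_def bij_betw_inv_into)
  ultimately show thesis using that a by blast
qed

lemma Emb_approxD:
  assumes "T \<in> Emb_approx \<delta> X Y"
  shows "lin_map X Y T" "x \<in> vcarrier X \<Longrightarrow> inverse (1 + \<delta>) * vnorm X x \<le> vnorm Y (T x)"
    "x \<in> vcarrier X \<Longrightarrow> vnorm Y (T x) \<le> (1 + \<delta>) * vnorm X x"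
  using assms by (auto simp: Emb_approx_def)

lemma Emb_approx_mono:
  assumes X: "is_norm X (vnorm X)" and T: "T \<in> Emb_approx \<delta> X Y" and "0 \<le> \<delta>" "\<delta> \<le> \<delta>'"
  shows "T \<in> Emb_approx \<delta>' X Y"
proof -
  have "inverse (1 + \<delta>') * vnorm X x \<le> vnorm Y (T x) \<and> vnorm Y (T x) \<le> (1 + \<delta>') * vnorm X x"
    if x: "x \<in> vcarrier X" for x
  proof -
    have "inverse (1 + \<delta>') * vnorm X x \<le> inverse (1 + \<delta>) * vnorm X x"
      "(1 + \<delta>) * vnorm X x \<le> (1 + \<delta>') * vnorm X x"
      using is_normD(1)[OF X x] assms(3,4) by (auto intro!: mult_right_mono)
    then show ?thesis using Emb_approxD(2,3)[OF T x] by linarith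
  qed
  then show ?thesis using Emb_approxD(1)[OF T] by (simp add: Emb_approx_def)
qed

lemma Emb_imp_approx:
  assumes X: "is_norm X (vnorm X)" and T: "T \<in> Emb X Y" and "0 \<le> \<delta>"
  shows "T \<in> Emb_approx \<delta> X Y"
proof -
  have "T \<in> Emb_approx 0 X Y" using T by (simp add: Emb_def Emb_approx_def)
  then show ?thesis using Emb_approx_mono[OF X] assms(3) by blast
qed

lemma Emb_approx_comp_Emb: "S \<in> Emb_approx \<delta> X Y \<Longrightarrow> T \<in> Emb Y Z \<Longrightarrow> (\<lambda>x. T (S x)) \<in> Emb_approx \<delta> X Z"
  by (auto simp: Emb_def Emb_approx_def lin_map_def)

lemma Emb_comp_approx:
  assumes S: "S \<in> Emb X Y" and T: "T \<in> Emb_approx \<delta> Y Z"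
  shows "(\<lambda>x. T (S x)) \<in> Emb_approx \<delta> X Z"
  using lin_map_comp[OF EmbD(1)[OF S] Emb_approxD(1)[OF T]] Emb_approxD(2,3)[OF T EmbD(3)[OF S]] EmbD(2)[OF S]
  by (simp add: Emb_approx_def)

lemma unit_ball_subset: "unit_ball U \<subseteq> vcarrier U"
  by (auto simp: unit_ball_def)

text \<open>The infima and suprema in the Hausdorff distance are those of bounded nonempty sets, since 0 belongs
  to every unit ball.\<close>

lemma ball_distD:
  assumes F: "normed_space F" and U: "U \<in> Age F" and W: "W \<in> Age F" and lt: "ball_dist F U W < r"
  shows "x \<in> unit_ball U \<Longrightarrow> \<exists>y\<in>unit_ball W. vnorm F (x - y) < r"
    "x \<in> unit_ball W \<Longrightarrow> \<exists>y\<in>unit_ball U. vnorm F (x - y) < r"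
proof -
  note V = normed_spaceD(1)[OF F] and nF = normed_spaceD(2)[OF F]
  note N = is_normD(1)[OF nF vs_closed(3)[OF V]]
  have gen: "\<exists>y\<in>unit_ball Q. vnorm F (x - y) < r"
    if P: "P \<in> Age F" and Q: "Q \<in> Age F" and sup: "(SUP a\<in>unit_ball P. INF b\<in>unit_ball Q. norm_dist F a b) < r"
      and x: "x \<in> unit_ball P" for P Q x
  proof -
    have 0: "0 \<in> unit_ball Q" by (rule zero_in_unit_ball[OF AgeD(1)[OF F Q]])
    have sub: "unit_ball P \<subseteq> vcarrier F" "unit_ball Q \<subseteq> vcarrier F"
      using order_trans[OF unit_ball_subset AgeD(3)[OF F P]] order_trans[OF unit_ball_subset AgeD(3)[OF F Q]] .
    have nd: "norm_dist F a b = vnorm F (a - b)" if "a \<in> unit_ball P" "b \<in> unit_ball Q" for a b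
      using that sub by (auto simp: norm_dist_def dist_on_def)
    have bdd: "bdd_below (norm_dist F a ` unit_ball Q)" if "a \<in> unit_ball P" for a
      using nd[OF that] N that sub by (intro bdd_belowI2[of _ 0]) (auto simp: subset_iff)
    have "bdd_above ((\<lambda>a. INF b\<in>unit_ball Q. norm_dist F a b) ` unit_ball P)"
    proof (rule bdd_aboveI2)
      fix a assume a: "a \<in> unit_ball P"
      have "(INF b\<in>unit_ball Q. norm_dist F a b) \<le> norm_dist F a 0" by (rule cINF_lower[OF bdd[OF a] 0])
      also have "\<dots> \<le> 1" using nd[OF a 0] a AgeD(5)[OF F P] by (simp add: unit_ball_def)
      finally show "(INF b\<in>unit_ball Q. norm_dist F a b) \<le> 1" .
    qed
    from cSUP_upper[OF x this] have "(INF b\<in>unit_ball Q. norm_dist F x b) < r" using sup by linarith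
    then obtain y where "y \<in> unit_ball Q" "norm_dist F x y < r"
      using cINF_less_iff[OF _ bdd[OF x]] 0 by blast
    then show ?thesis using nd[OF x] by auto
  qed
  have sym: "norm_dist F a b = norm_dist F b a" for a b
    using norm_algebra(3)[OF V nF] by (auto simp: norm_dist_def dist_on_def)
  show "x \<in> unit_ball U \<Longrightarrow> \<exists>y\<in>unit_ball W. vnorm F (x - y) < r"
    using gen[OF U W] lt by (simp add: ball_dist_def hausdorff_dist_def)
  have "(SUP b\<in>unit_ball W. INF a\<in>unit_ball U. norm_dist F b a) =
      (SUP b\<in>unit_ball W. INF a\<in>unit_ball U. norm_dist F a b)"
    by (intro SUP_cong INF_cong refl sym)
  then show "x \<in> unit_ball W \<Longrightarrow> \<exists>y\<in>unit_ball U. vnorm F (x - y) < r"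
    using gen[OF W U] lt by (simp add: ball_dist_def hausdorff_dist_def)
qed

lemma ball_dist_le:
  assumes F: "normed_space F" and U: "U \<in> Age F" and W: "W \<in> Age F"
    and uw: "\<And>x. x \<in> unit_ball U \<Longrightarrow> \<exists>y\<in>unit_ball W. vnorm F (x - y) \<le> r"
    and wu: "\<And>x. x \<in> unit_ball W \<Longrightarrow> \<exists>y\<in>unit_ball U. vnorm F (x - y) \<le> r"
  shows "ball_dist F U W \<le> r"
proof -
  note V = normed_spaceD(1)[OF F] and nF = normed_spaceD(2)[OF F]
  note N = is_normD(1)[OF nF vs_closed(3)[OF V]]
  have sub: "unit_ball P \<subseteq> vcarrier F" if "P \<in> Age F" for P
    using order_trans[OF unit_ball_subset AgeD(3)[OF F that]] .
  have gen: "(SUP a\<in>unit_ball P. INF b\<in>unit_ball Q. norm_dist F a b) \<le> r"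
    if P: "P \<in> Age F" and Q: "Q \<in> Age F" and *: "\<And>x. x \<in> unit_ball P \<Longrightarrow> \<exists>y\<in>unit_ball Q. vnorm F (x - y) \<le> r"
    for P Q
  proof (rule cSUP_least)
    show "unit_ball P \<noteq> {}" using zero_in_unit_ball[OF AgeD(1)[OF F P]] by blast
    fix a assume a: "a \<in> unit_ball P"
    obtain y where y: "y \<in> unit_ball Q" "vnorm F (a - y) \<le> r" using *[OF a] by blast
    have "bdd_below (norm_dist F a ` unit_ball Q)"
      using N a sub[OF P] sub[OF Q] by (intro bdd_belowI2[of _ 0]) (auto simp: norm_dist_def dist_on_def subset_iff)
    moreover have "norm_dist F a y \<le> r"
      using y a sub[OF P] sub[OF Q] by (auto simp: norm_dist_def dist_on_def)
    ultimately show "(INF b\<in>unit_ball Q. norm_dist F a b) \<le> r" using y(1) by (metis cINF_lower2)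
  qed
  have sym: "norm_dist F a b = norm_dist F b a" for a b
    using norm_algebra(3)[OF V nF] by (auto simp: norm_dist_def dist_on_def)
  have "(SUP b\<in>unit_ball W. INF a\<in>unit_ball U. norm_dist F b a) =
      (SUP b\<in>unit_ball W. INF a\<in>unit_ball U. norm_dist F a b)"
    by (intro SUP_cong INF_cong refl sym)
  then show ?thesis
    using gen[OF U W uw] gen[OF W U wu] by (simp add: ball_dist_def hausdorff_dist_def)
qed

section \<open>Homogeneity and transfer\<close>

text \<open>In a Fraisse space, embeddings of two nearby norms on one space can be aligned by an
  isometry of the whole space: composing one embedding with the inverse of the other is an
  approximate isometry between finite-dimensional subspaces.\<close>

lemma fraisse_align:
  fixes F :: "('k::rc_scalar, 'w::ab_group_add) nspace"
  assumes F: "fraisse F" and e: "\<epsilon> > 0"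
  obtains \<delta> where "\<delta> > 0"
    "\<And>(V :: ('k, 'v::ab_group_add, 'z) vspace_scheme) m n T U. vec_space V \<Longrightarrow> has_dim V k \<Longrightarrow>
      is_norm V m \<Longrightarrow> is_norm V n \<Longrightarrow> norm_near V \<delta> m n \<Longrightarrow>
      T \<in> Emb (with_norm V m) F \<Longrightarrow> U \<in> Emb (with_norm V n) F \<Longrightarrow>
      \<exists>g\<in>Emb F F. g ` vcarrier F = vcarrier F \<and> (\<forall>x\<in>vcarrier V. vnorm F (g (U x) - T x) \<le> \<epsilon> * n x)"
proof -
  have F': "normed_space F" using F by (simp add: fraisse_def banach_space_def)
  obtain \<delta>F where dF: "\<delta>F > 0" and fr: "\<And>X \<gamma> \<eta>. X \<in> Age F \<Longrightarrow> has_dim X k \<Longrightarrow> \<gamma> \<in> Emb_approx \<delta>F X F \<Longrightarrow>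
      \<eta> \<in> Emb_approx \<delta>F X F \<Longrightarrow> \<exists>g\<in>Emb F F. g ` vcarrier F = vcarrier F \<and> op_norm X F (\<lambda>x. g (\<eta> x) - \<gamma> x) \<le> \<epsilon>"
    using F e unfolding fraisse_def by meson
  show thesis
  proof (rule that[of "ln (1 + \<delta>F)"])
    show "ln (1 + \<delta>F) > 0" using dF by simp
    fix V :: "('k, 'v, 'z) vspace_scheme" and m n T U
    assume V: "vec_space V" and k: "has_dim V k" and m: "is_norm V m" and n: "is_norm V n"
      and near: "norm_near V (ln (1 + \<delta>F)) m n"
      and T: "T \<in> Emb (with_norm V m) F" and U: "U \<in> Emb (with_norm V n) F"
    have near': "m x \<le> (1 + \<delta>F) * n x" "n x \<le> (1 + \<delta>F) * m x" if "x \<in> vcarrier V" for x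
      using near that dF by (auto simp: norm_near_def)
    have Vn: "normed_space (with_norm V n)" by (rule normed_space_with_norm[OF V n])
    define X where "X = F\<lparr>vcarrier := U ` vcarrier V\<rparr>"
    have X: "X \<in> Age F" "has_dim X k" unfolding X_def using Emb_image_Age[OF F' Vn _ U] k by auto
    note XN = AgeD(1,2)[OF F' X(1)]
    have inj: "inj_on U (vcarrier V)" using Emb_inj[OF Vn F' U] by simp
    define V' where "V' = inv_into (vcarrier V) U"
    have V': "V' (U x) = x" if "x \<in> vcarrier V" for x using that inj by (simp add: V'_def)
    have linV': "lin_map X V V'" unfolding X_def V'_def
      using EmbD(1)[OF U] by (intro lin_map_inv_into[OF V _ inj]) simp
    \<comment> \<open>The map \<open>T \<circ> U\<^sup>-\<^sup>1\<close> is compared with the inclusion of the image of \<open>U\<close>.\<close>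
    define \<gamma> where "\<gamma> y = T (V' y)" for y
    have lin\<gamma>: "lin_map X F \<gamma>" unfolding \<gamma>_def using lin_map_comp[OF linV'] EmbD(1)[OF T] by simp
    have g: "vnorm F (\<gamma> (U x)) = m x" "vnorm F (U x) = n x" if "x \<in> vcarrier V" for x
      using that V'[OF that] EmbD(2)[OF T] EmbD(2)[OF U] by (auto simp: \<gamma>_def)
    have lower: "inverse (1 + \<delta>F) * n x \<le> m x" if "x \<in> vcarrier V" for x
      using near'(2)[OF that] dF by (simp add: field_simps)
    have "\<gamma> \<in> Emb_approx \<delta>F X F"
      unfolding Emb_approx_def using lin\<gamma> near'(1) lower g by (auto simp: X_def)
    moreover have id: "(\<lambda>x. x) \<in> Emb X F"
      using AgeD(3)[OF F' X(1)] by (auto simp: Emb_def lin_map_def X_def)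
    then have "(\<lambda>x. x) \<in> Emb_approx \<delta>F X F"
      using dF by (intro Emb_imp_approx normed_spaceD XN) auto
    ultimately obtain h where h: "h \<in> Emb F F" "h ` vcarrier F = vcarrier F"
      and op: "op_norm X F (\<lambda>x. h x - \<gamma> x) \<le> \<epsilon>" using fr[OF X] by meson
    have lin: "lin_map X F (\<lambda>x. h x - \<gamma> x)"
      using lin_map_comp[OF EmbD(1)[OF id] EmbD(1)[OF h(1)]]
      by (intro lin_map_diff[OF normed_spaceD(1)[OF F'] _ lin\<gamma>]) simp
    obtain B where "\<And>x. x \<in> vcarrier X \<Longrightarrow> vnorm F (h x - \<gamma> x) \<le> B * vnorm X x"
      using lin_map_bounded[OF normed_spaceD(1)[OF XN(1)] XN(2) normed_spaceD(2)[OF XN(1)]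
        normed_spaceD(1)[OF F'] normed_spaceD(2)[OF F'] lin] by metis
    note bound = op_norm_bound(2)[OF XN(1) F' lin this]
    have "vnorm F (h (U x) - T x) \<le> \<epsilon> * n x" if x: "x \<in> vcarrier V" for x
    proof -
      have "vnorm F (h (U x) - \<gamma> (U x)) \<le> op_norm X F (\<lambda>x. h x - \<gamma> x) * vnorm X (U x)"
        by (rule bound) (use x in \<open>auto simp: X_def\<close>)
      also have "\<dots> \<le> \<epsilon> * n x"
        using op g(2)[OF x] is_normD(1)[OF n x] by (auto simp: X_def intro: mult_right_mono)
      finally show ?thesis by (simp add: \<gamma>_def V'[OF x])
    qed
    then show "\<exists>g\<in>Emb F F. g ` vcarrier F = vcarrier F \<and>
        (\<forall>x\<in>vcarrier V. vnorm F (g (U x) - T x) \<le> \<epsilon> * n x)" using h by blast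
  qed
qed

text \<open>If the unit ball of \<open>W\<close> is close to that of the image of an embedding \<open>T\<close>, then \<open>T\<close>
  is close to a linear map into \<open>W\<close>: move the images of a basis into \<open>W\<close>.\<close>

lemma perturb_into_near_subspace:
  fixes V :: "('k::rc_scalar, 'v::ab_group_add, 'z) vspace_scheme"
  assumes V: "vec_space V" and fd: "fin_dim V" and m: "is_norm V m" and s: "s > 0"
  obtains \<delta> where "\<delta> > 0"
    "\<And>(F :: ('k, 'w::ab_group_add) nspace) T W. normed_space F \<Longrightarrow> T \<in> Emb (with_norm V m) F \<Longrightarrow> W \<in> Age F \<Longrightarrow>
      ball_dist F (F\<lparr>vcarrier := T ` vcarrier V\<rparr>) W < \<delta> \<Longrightarrow>
      \<exists>L. lin_map V W L \<and> (\<forall>x\<in>vcarrier V. vnorm F (T x - L x) \<le> s * m x)"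
proof -
  obtain k b c where b: "coord_basis V k b c" using fd has_dim_coord_basis[OF V] unfolding fin_dim_def by metis
  note bV = coord_basisD(1)[OF b]
  have k: "has_dim V k" by (rule coord_basis_imp_has_dim[OF V b])
  obtain K where K: "K > 0" "\<And>x. x \<in> vcarrier V \<Longrightarrow> (\<Sum>i<k. norm (c i x)) \<le> K * m x"
    using coords_le_norm[OF V m b] by blast
  define M where "M = (\<Sum>i<k. m (b i)) + 1"
  have bpos: "m (b i) > 0" if i: "i < k" for i
  proof -
    have "b i \<noteq> 0"
      using coord_basisD(3)[OF b i i] lin_functional_algebra(1)[OF V coord_basisD(2)[OF b i]] by auto
    then show ?thesis using is_normD(1,2)[OF m bV[OF i]] by (simp add: less_le)
  qed
  have M: "M > 0" unfolding M_def using bpos by (smt (verit) lessThan_iff sum_nonneg)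
  have bM: "m (b i) \<le> M" if "i < k" for i
    unfolding M_def using member_le_sum[of i "{..<k}" "\<lambda>i. m (b i)"] bpos that by (simp add: less_imp_le add_increasing2)
  \<comment> \<open>The errors at the basis vectors, at most \<open>M * \<delta>\<close>, add up to at most \<open>K * M * \<delta> * m x\<close> at \<open>x\<close>.\<close>
  define \<delta> where "\<delta> = s / (K * M)"
  have \<delta>: "\<delta> > 0" using s K M by (simp add: \<delta>_def)
  show thesis
  proof (rule that[OF \<delta>])
    fix F :: "('k, 'w) nspace" and T W
    assume F: "normed_space F" and T: "T \<in> Emb (with_norm V m) F" and W: "W \<in> Age F"
      and bd: "ball_dist F (F\<lparr>vcarrier := T ` vcarrier V\<rparr>) W < \<delta>"
    note FV = normed_spaceD(1)[OF F] and Fn = normed_spaceD(2)[OF F]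
    have Vm: "normed_space (with_norm V m)" by (rule normed_space_with_norm[OF V m])
    have U: "F\<lparr>vcarrier := T ` vcarrier V\<rparr> \<in> Age F" using Emb_image_Age(1)[OF F Vm _ T] k by simp
    have Tl: "lin_map V F T" using EmbD(1)[OF T] by simp
    note WV = normed_spaceD(1)[OF AgeD(1)[OF F W]]
    have "\<exists>w\<in>vcarrier W. vnorm F (T (b i) - w) \<le> m (b i) * \<delta>" if i: "i < k" for i
    proof -
      let ?a = "of_real (inverse (m (b i))) :: 'k" and ?t = "of_real (m (b i)) :: 'k"
      have ab: "vscale V ?a (b i) \<in> vcarrier V" using vs_closed(5)[OF V bV[OF i]] .
      have "T (vscale V ?a (b i)) \<in> unit_ball (F\<lparr>vcarrier := T ` vcarrier V\<rparr>)"
        using EmbD(2)[OF T, of "vscale V ?a (b i)"] ab is_normD(3)[OF m bV[OF i], of ?a] bpos[OF i]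
        by (simp add: unit_ball_def norm_inverse)
      then obtain y where y: "y \<in> unit_ball W" "vnorm F (T (vscale V ?a (b i)) - y) < \<delta>"
        using ball_distD(1)[OF F U W bd] by blast
      have yW: "y \<in> vcarrier W" using y(1) by (simp add: unit_ball_def)
      have yF: "y \<in> vcarrier F" using yW AgeD(3)[OF F W] by blast
      have "T (b i) = vscale F ?t (T (vscale V ?a (b i)))"
        using lin_mapD(3)[OF Tl bV[OF i], of ?a] bpos[OF i]
        by (simp add: vs_algebra(7,8)[OF FV] flip: of_real_mult)
      then have "T (b i) - vscale F ?t y = vscale F ?t (T (vscale V ?a (b i)) - y)"
        by (simp add: vs_algebra[OF FV])
      then have "vnorm F (T (b i) - vscale F ?t y) = m (b i) * vnorm F (T (vscale V ?a (b i)) - y)"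
        using is_normD(3)[OF Fn vs_closed(3)[OF FV lin_mapD(1)[OF Tl ab] yF], of ?t] bpos[OF i] by simp
      also have "\<dots> \<le> m (b i) * \<delta>" using y(2) bpos[OF i] by (intro mult_left_mono) auto
      finally show ?thesis
        using vs_closed(5)[OF WV yW, of ?t] AgeD(4)[OF F W] by (intro bexI[of _ "vscale F ?t y"]) auto
    qed
    then obtain w where w: "\<And>i. i < k \<Longrightarrow> w i \<in> vcarrier W" "\<And>i. i < k \<Longrightarrow> vnorm F (T (b i) - w i) \<le> m (b i) * \<delta>"
      by metis
    define L where "L x = (\<Sum>i<k. vscale W (c i x) (w i))" for x
    have L: "lin_map V W L" unfolding L_def by (rule lin_comb_lin_map[OF WV coord_basisD(2)[OF b] w(1)])
    have "vnorm F (T x - L x) \<le> s * m x" if x: "x \<in> vcarrier V" for x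
    proof -
      have mem: "T (b i) - w i \<in> vcarrier F" if "i < k" for i
        using vs_closed(3)[OF FV lin_mapD(1)[OF Tl bV[OF that]]] w(1)[OF that] AgeD(3)[OF F W] by blast
      have "T x - L x = (\<Sum>i<k. vscale F (c i x) (T (b i) - w i))"
        unfolding L_def coord_basis_lin_map_expand[OF V b Tl x] AgeD(4)[OF F W]
        by (simp add: vs_algebra(2)[OF FV] sum_subtractf)
      then have "vnorm F (T x - L x) \<le> (\<Sum>i<k. norm (c i x) * vnorm F (T (b i) - w i))"
        using norm_lin_comb_le[OF FV Fn, of "{..<k}" "\<lambda>i. T (b i) - w i" "\<lambda>i. c i x"] mem by simp
      also have "\<dots> \<le> (\<Sum>i<k. norm (c i x) * (M * \<delta>))"
      proof (intro sum_mono mult_left_mono)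
        fix i assume "i \<in> {..<k}"
        then have i: "i < k" by simp
        have "m (b i) * \<delta> \<le> M * \<delta>" using bM[OF i] \<delta> by (intro mult_right_mono) auto
        then show "vnorm F (T (b i) - w i) \<le> M * \<delta>" using w(2)[OF i] by linarith
      qed simp
      also have "\<dots> = (\<Sum>i<k. norm (c i x)) * (M * \<delta>)" by (simp add: sum_distrib_right)
      also have "\<dots> \<le> (K * m x) * (M * \<delta>)" using K(2)[OF x] M \<delta> by (intro mult_right_mono) auto
      also have "\<dots> = s * m x" using K M by (simp add: \<delta>_def)
      finally show ?thesis .
    qed
    then show "\<exists>L. lin_map V W L \<and> (\<forall>x\<in>vcarrier V. vnorm F (T x - L x) \<le> s * m x)" using L by blast
  qed
qed

text \<open>The map close to \<open>T\<close> pulls the norm of \<open>W\<close> back to a norm on \<open>V\<close>, which is close to the norm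
  \<open>m\<close> that is pulled back by \<open>T\<close>.\<close>

lemma norm_from_near_subspace:
  fixes V :: "('k::rc_scalar, 'v::ab_group_add, 'z) vspace_scheme"
  assumes V: "vec_space V" and fd: "fin_dim V" and m: "is_norm V m" and e: "e > 0"
  obtains \<delta> where "\<delta> > 0"
    "\<And>(F :: ('k, 'w::ab_group_add) nspace) T W. normed_space F \<Longrightarrow> T \<in> Emb (with_norm V m) F \<Longrightarrow> W \<in> Age F \<Longrightarrow>
      ball_dist F (F\<lparr>vcarrier := T ` vcarrier V\<rparr>) W < \<delta> \<Longrightarrow>
      \<exists>n\<in>Norms V. omega V m n < e \<and> Emb (with_norm V n) W \<noteq> {}"
proof -
  define s where "s = 1 - exp (- (e / 2))"
  have s: "s > 0" "s < 1" using e by (auto simp: s_def)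
  obtain \<delta> where \<delta>: "\<delta> > 0" and pert: "\<And>(F :: ('k, 'w) nspace) T W. normed_space F \<Longrightarrow>
      T \<in> Emb (with_norm V m) F \<Longrightarrow> W \<in> Age F \<Longrightarrow> ball_dist F (F\<lparr>vcarrier := T ` vcarrier V\<rparr>) W < \<delta> \<Longrightarrow>
      \<exists>L. lin_map V W L \<and> (\<forall>x\<in>vcarrier V. vnorm F (T x - L x) \<le> s * m x)"
    by (rule perturb_into_near_subspace[OF V fd m s(1)]) (rule that)
  show thesis
  proof (rule that[OF \<delta>])
    fix F :: "('k, 'w) nspace" and T W
    assume F: "normed_space F" and T: "T \<in> Emb (with_norm V m) F" and W: "W \<in> Age F"
      and bd: "ball_dist F (F\<lparr>vcarrier := T ` vcarrier V\<rparr>) W < \<delta>"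
    note WN = AgeD[OF F W]
    obtain L where L: "lin_map V W L" and near: "\<And>x. x \<in> vcarrier V \<Longrightarrow> vnorm F (T x - L x) \<le> s * m x"
      using pert[OF F T W bd] by blast
    have close: "\<bar>vnorm W (L x) - m x\<bar> \<le> s * m x" if x: "x \<in> vcarrier V" for x
    proof -
      have "L x \<in> vcarrier F" using lin_mapD(1)[OF L x] WN(3) by blast
      then have "\<bar>vnorm F (T x) - vnorm F (L x)\<bar> \<le> vnorm F (T x - L x)"
        using EmbD(3)[OF T, of x] x by (intro norm_algebra(6)[OF normed_spaceD[OF F]]) auto
      then show ?thesis using near[OF x] EmbD(2)[OF T, of x] x WN(5) by (simp add: abs_minus_commute)
    qed
    have inj: "inj_on L (vcarrier V)"
      unfolding lin_map_inj_on_iff[OF V L]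
    proof (intro ballI impI)
      fix x assume x: "x \<in> vcarrier V" and "L x = 0"
      then have "m x \<le> s * m x"
        using close[OF x] norm_algebra(1)[OF normed_spaceD[OF WN(1)]] is_normD(1)[OF m x] by simp
      then have "(1 - s) * m x \<le> 0" by (simp add: algebra_simps)
      then have "m x \<le> 0" using s(2) by (simp add: mult_le_0_iff)
      then show "x = 0" using is_normD(1,2)[OF m x] by simp
    qed
    define n where "n = restrict (\<lambda>x. vnorm W (L x)) (vcarrier V)"
    have n: "n \<in> Norms V" unfolding n_def
      by (intro restrict_in_Norms[OF V] is_norm_pullback[OF V L inj] normed_spaceD WN(1))
    have "norm_near V (e / 2) m n"
      by (rule norm_near_diffI[OF _ m]) (use e close in \<open>auto simp: n_def s_def\<close>)
    then have "omega V m n \<le> e / 2" by (rule iffD2[OF omega_le_iff(2)[OF V fd m NormsD(1)[OF n]], rotated]) (use e in simp)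
    then have "omega V m n < e" using e by simp
    moreover have "L \<in> Emb (with_norm V n) W" using L by (simp add: Emb_def n_def)
    ultimately show "\<exists>n\<in>Norms V. omega V m n < e \<and> Emb (with_norm V n) W \<noteq> {}" using n by blast
  qed
qed

text \<open>The comparison of \<open>E\<close> with its limit rests on one property, in both directions: finitely many
  finite-dimensional subspaces of \<open>F\<close> that have isometric copies in \<open>G\<close> can be moved to \<open>G\<close> by
  one approximate isometry that is close to an isometry on each of them.\<close>

definition transfers ::
    "('k::real_normed_field, 'v::ab_group_add) nspace \<Rightarrow> ('k, 'w::ab_group_add) nspace \<Rightarrow> bool" where
  "transfers F G \<longleftrightarrow>
     (\<forall>\<U> \<epsilon>. finite \<U> \<and> \<U> \<subseteq> Age F \<and> (\<forall>U\<in>\<U>. Emb U G \<noteq> {}) \<and> \<epsilon> > 0 \<longrightarrow>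
       (\<exists>Y\<in>Age F. (\<forall>U\<in>\<U>. vcarrier U \<subseteq> vcarrier Y) \<and>
         (\<exists>S\<in>Emb_approx \<epsilon> Y G. \<forall>U\<in>\<U>. \<exists>a\<in>Emb U G. \<forall>x\<in>vcarrier U. vnorm G (S x - a x) \<le> \<epsilon> * vnorm F x)))"

lemma transfersD:
  assumes "transfers F G" "finite \<U>" "\<U> \<subseteq> Age F" "\<And>U. U \<in> \<U> \<Longrightarrow> Emb U G \<noteq> {}" "\<epsilon> > 0"
  obtains Y S where "Y \<in> Age F" "\<And>U. U \<in> \<U> \<Longrightarrow> vcarrier U \<subseteq> vcarrier Y" "S \<in> Emb_approx \<epsilon> Y G"
    "\<And>U. U \<in> \<U> \<Longrightarrow> \<exists>a\<in>Emb U G. \<forall>x\<in>vcarrier U. vnorm G (S x - a x) \<le> \<epsilon> * vnorm F x"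
  using assms unfolding transfers_def by metis

lemma Age_common:
  assumes F: "normed_space F" and "finite \<U>" "\<U> \<subseteq> Age F"
  obtains Y where "Y \<in> Age F" "\<And>U. U \<in> \<U> \<Longrightarrow> vcarrier U \<subseteq> vcarrier Y"
proof -
  have "C \<subseteq> vcarrier F \<and> fin_dim (F\<lparr>vcarrier := C\<rparr>)" if "C \<in> vcarrier ` \<U>" for C
    using that AgeD(2,3,6)[OF F] assms(3) by fastforce
  then obtain Y where "Y \<subseteq> vcarrier F" "module.subspace (vscale F) Y" "fin_dim (F\<lparr>vcarrier := Y\<rparr>)"
    "\<And>C. C \<in> vcarrier ` \<U> \<Longrightarrow> C \<subseteq> Y"
    using finite_dim_subspaces_common[OF normed_spaceD(1)[OF F], of "vcarrier ` \<U>"] assms(2) by (metis finite_imageI)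
  then show thesis using that[of "F\<lparr>vcarrier := Y\<rparr>"] AgeI[of Y F] by simp
qed

text \<open>An isometry on a common superspace of the given subspaces is an isometry on each of them.\<close>

lemma transfers_if_Age_embeds:
  assumes F: "normed_space F" and G: "normed_space G" and emb: "\<And>Y. Y \<in> Age F \<Longrightarrow> Emb Y G \<noteq> {}"
  shows "transfers F G"
  unfolding transfers_def
proof (intro allI impI, elim conjE)
  fix \<U> \<epsilon> assume "finite \<U>" "\<U> \<subseteq> Age F" "(0::real) < \<epsilon>"
  then obtain Y where Y: "Y \<in> Age F" "\<And>U. U \<in> \<U> \<Longrightarrow> vcarrier U \<subseteq> vcarrier Y" using Age_common[OF F] by metis
  obtain S where S: "S \<in> Emb Y G" using emb[OF Y(1)] by blast
  have "S \<in> Emb_approx \<epsilon> Y G"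
    using Emb_imp_approx[OF normed_spaceD(2)[OF AgeD(1)[OF F Y(1)]] S] \<open>0 < \<epsilon>\<close> by simp
  moreover have "\<exists>a\<in>Emb U G. \<forall>x\<in>vcarrier U. vnorm G (S x - a x) \<le> \<epsilon> * vnorm F x" if "U \<in> \<U>" for U
  proof (intro bexI ballI)
    have U: "U \<in> Age F" using that \<open>\<U> \<subseteq> Age F\<close> by blast
    show "S \<in> Emb U G"
      using S Y(2)[OF that] AgeD(4,5)[OF F U] AgeD(4,5)[OF F Y(1)] unfolding Emb_def lin_map_def
      by (simp add: subset_iff)
    fix x assume "x \<in> vcarrier U"
    then show "vnorm G (S x - S x) \<le> \<epsilon> * vnorm F x"
      using norm_algebra(1)[OF normed_spaceD(1)[OF G] normed_spaceD(2)[OF G]] \<open>0 < \<epsilon>\<close> AgeD(3)[OF F U]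
        is_normD(1)[OF normed_spaceD(2)[OF F]] by (simp add: subset_iff)
  qed
  ultimately show "\<exists>Y\<in>Age F. (\<forall>U\<in>\<U>. vcarrier U \<subseteq> vcarrier Y) \<and>
     (\<exists>S\<in>Emb_approx \<epsilon> Y G. \<forall>U\<in>\<U>. \<exists>a\<in>Emb U G. \<forall>x\<in>vcarrier U. vnorm G (S x - a x) \<le> \<epsilon> * vnorm F x)"
    using Y by blast
qed

lemma near_identity_Emb_approx:
  assumes X: "normed_space X" and L: "lin_map X Y L" and \<delta>: "\<delta> > 0"
    and near: "\<And>x. x \<in> vcarrier X \<Longrightarrow> \<bar>vnorm Y (L x) - vnorm X x\<bar> \<le> (1 - inverse (1 + \<delta>)) * vnorm X x"
  shows "L \<in> Emb_approx \<delta> X Y"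
proof -
  have "inverse (1 + \<delta>) * vnorm X x \<le> vnorm Y (L x) \<and> vnorm Y (L x) \<le> (1 + \<delta>) * vnorm X x"
    if x: "x \<in> vcarrier X" for x
  proof -
    have "1 - inverse (1 + \<delta>) \<le> \<delta>"
      using \<delta> by (simp add: field_simps)
    then have "(1 - inverse (1 + \<delta>)) * vnorm X x \<le> \<delta> * vnorm X x"
      using is_normD(1)[OF normed_spaceD(2)[OF X] x] by (rule mult_right_mono)
    then show ?thesis using near[OF x] by (auto simp: abs_le_iff algebra_simps)
  qed
  then show ?thesis using L by (simp add: Emb_approx_def)
qed

text \<open>From the limit back to \<open>E\<close>: density gives an approximate isometry into a member of the age,
  and amalgamation, applied once for each subspace, corrects it.\<close>

lemma transfers_from_limit:
  fixes E :: "('k::rc_scalar, 'v::ab_group_add) nspace" and Ehat :: "('k, 'w::ab_group_add) nspace"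
  assumes E: "normed_space E" and am: "amalgamation_class (Age E)" and lim: "fraisse_limit (Age E) Ehat"
  shows "transfers Ehat E"
  unfolding transfers_def
proof (intro allI impI, elim conjE)
  fix \<U> \<epsilon> assume fin: "finite \<U>" and Uage: "\<U> \<subseteq> Age Ehat" and Uemb: "\<forall>U\<in>\<U>. Emb U E \<noteq> {}" and e: "(0::real) < \<epsilon>"
  have H: "normed_space Ehat" using lim by (simp add: fraisse_limit_def fraisse_def banach_space_def)
  note EV = normed_spaceD(1)[OF E] and En = normed_spaceD(2)[OF E]
  define good where "good \<delta> k \<longleftrightarrow> (\<forall>X\<in>Age E. \<forall>Y\<in>Age E. \<forall>Z\<in>Age E. has_dim X k \<longrightarrow>
        (\<forall>\<gamma>\<in>Emb_approx \<delta> X Y. \<forall>\<eta>\<in>Emb_approx \<delta> X Z.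
           \<exists>V\<in>Age E. \<exists>i\<in>Emb Y V. \<exists>j\<in>Emb Z V. op_norm X V (\<lambda>x. i (\<gamma> x) - j (\<eta> x)) \<le> \<epsilon>))" for \<delta> k
  have "\<forall>U\<in>\<U>. \<exists>k. has_dim U k" using AgeD(2)[OF H] Uage by (auto simp: fin_dim_def)
  then obtain k where k: "\<And>U. U \<in> \<U> \<Longrightarrow> has_dim U (k U)" by metis
  have "\<forall>k. \<exists>\<delta>>0. good \<delta> k" using am e unfolding amalgamation_class_def good_def by simp
  then obtain d where d: "\<And>k. d k > 0" "\<And>k. good (d k) k" by metis
  define \<delta> where "\<delta> = Min (insert \<epsilon> ((\<lambda>U. d (k U)) ` \<U>))"
  have \<delta>: "\<delta> > 0" "\<delta> \<le> \<epsilon>" "\<And>U. U \<in> \<U> \<Longrightarrow> \<delta> \<le> d (k U)"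
    unfolding \<delta>_def using fin d(1) e by auto
  obtain Y where Y: "Y \<in> Age Ehat" "\<And>U. U \<in> \<U> \<Longrightarrow> vcarrier U \<subseteq> vcarrier Y" using Age_common[OF H fin Uage] by metis
  note YN = AgeD[OF H Y(1)]
  define s where "s = 1 - inverse (1 + \<delta>)"
  have s: "s > 0" using \<delta>(1) by (simp add: s_def field_simps)
  obtain \<delta>' where \<delta>': "\<delta>' > 0" and pert: "\<And>T W. T \<in> Emb (with_norm Y (vnorm Y)) Ehat \<Longrightarrow> W \<in> Age Ehat \<Longrightarrow>
      ball_dist Ehat (Ehat\<lparr>vcarrier := T ` vcarrier Y\<rparr>) W < \<delta>' \<Longrightarrow>
      \<exists>L. lin_map Y W L \<and> (\<forall>x\<in>vcarrier Y. vnorm Ehat (T x - L x) \<le> s * vnorm Y x)"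
    using perturb_into_near_subspace[OF normed_spaceD(1)[OF YN(1)] YN(2) normed_spaceD(2)[OF YN(1)] s] H by metis
  obtain W X where W: "W \<in> Age Ehat" "X \<in> Age E" "isometric W X" "ball_dist Ehat Y W < \<delta>'"
    using lim Y(1) \<delta>' unfolding fraisse_limit_def by meson
  have idY: "(\<lambda>x. x) \<in> Emb (with_norm Y (vnorm Y)) Ehat" using YN(3,4,5) by (auto simp: Emb_def lin_map_def)
  obtain L where L: "lin_map Y W L" "\<And>x. x \<in> vcarrier Y \<Longrightarrow> vnorm Ehat (x - L x) \<le> s * vnorm Y x"
    using pert[OF idY W(1)] W(4) YN(6) by auto
  note WN = AgeD[OF H W(1)]
  have LH: "L x \<in> vcarrier Ehat" if "x \<in> vcarrier Y" for x using lin_mapD(1)[OF L(1) that] WN(3) by blast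
  have "L \<in> Emb_approx \<delta> Y W"
  proof (rule near_identity_Emb_approx[OF YN(1) L(1) \<delta>(1)])
    fix x assume x: "x \<in> vcarrier Y"
    have xH: "x \<in> vcarrier Ehat" using x YN(3) by blast
    have "\<bar>vnorm Ehat x - vnorm Ehat (L x)\<bar> \<le> vnorm Ehat (x - L x)"
      by (rule norm_algebra(6)[OF normed_spaceD[OF H] xH LH[OF x]])
    then show "\<bar>vnorm W (L x) - vnorm Y x\<bar> \<le> (1 - inverse (1 + \<delta>)) * vnorm Y x"
      using L(2)[OF x] YN(5) WN(5) by (simp add: s_def abs_minus_commute)
  qed
  moreover obtain a0 where "a0 \<in> Emb W X" using W(3) by (auto simp: isometric_def)
  ultimately have start: "(\<lambda>x. a0 (L x)) \<in> Emb_approx \<delta> Y X" by (rule Emb_approx_comp_Emb)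
  \<comment> \<open>The approximate isometry \<open>S\<close> stays \<open>\<delta>\<close>-isometric, since it is only composed with isometries.\<close>
  have "\<exists>Z\<in>Age E. \<exists>S\<in>Emb_approx \<delta> Y Z. \<forall>U\<in>\<V>. \<exists>a\<in>Emb U Z. \<forall>x\<in>vcarrier U. vnorm E (S x - a x) \<le> \<epsilon> * vnorm Ehat x"
    if "\<V> \<subseteq> \<U>" for \<V>
    using finite_subset[OF that fin] that
  proof (induction \<V> rule: finite_induct)
    case empty
    then show ?case using start W(2) by blast
  next
    case (insert U \<V>)
    then obtain Z S where Z: "Z \<in> Age E" and S: "S \<in> Emb_approx \<delta> Y Z"
      and near: "\<And>U. U \<in> \<V> \<Longrightarrow> \<exists>a\<in>Emb U Z. \<forall>x\<in>vcarrier U. vnorm E (S x - a x) \<le> \<epsilon> * vnorm Ehat x" by auto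
    have U: "U \<in> \<U>" "U \<in> Age Ehat" using insert.prems Uage by auto
    note UN = AgeD[OF H U(2)] and ZN = AgeD[OF E Z]
    obtain b where b: "b \<in> Emb U E" using Uemb U by blast
    \<comment> \<open>Amalgamate \<open>Z\<close> with the copy \<open>P\<close> of \<open>U\<close> in \<open>E\<close> over \<open>P\<close>, along \<open>S \<circ> b\<^sup>-\<^sup>1\<close> and the identity.\<close>
    define P where "P = E\<lparr>vcarrier := b ` vcarrier U\<rparr>"
    have P: "P \<in> Age E" "has_dim P (k U)" unfolding P_def using Emb_image_Age[OF E UN(1) k[OF U(1)] b] by auto
    note PN = AgeD[OF E P(1)]
    define b' where "b' = inv_into (vcarrier U) b"
    have b': "b' \<in> Emb P U" unfolding b'_def P_def by (rule Emb_inv[OF UN(1) E b])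
    have b'b: "b' (b x) = x" if "x \<in> vcarrier U" for x
      using that Emb_inj[OF UN(1) E b] by (simp add: b'_def)
    have "S \<in> Emb_approx \<delta> U Z"
      using S Y(2)[OF U(1)] UN(4,5) YN(4,5) unfolding Emb_approx_def lin_map_def by (simp add: subset_iff)
    then have \<gamma>: "(\<lambda>y. S (b' y)) \<in> Emb_approx (d (k U)) P Z"
      using Emb_approx_mono[OF normed_spaceD(2)[OF PN(1)] Emb_comp_approx[OF b']] \<delta>(1) \<delta>(3)[OF U(1)]
      by (metis less_imp_le)
    have "(\<lambda>y. y) \<in> Emb P P" by (auto simp: Emb_def lin_map_def)
    then have "(\<lambda>y. y) \<in> Emb_approx (d (k U)) P P"
      using Emb_imp_approx[OF normed_spaceD(2)[OF PN(1)]] d(1) by (metis less_imp_le)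
    then obtain V i j where V: "V \<in> Age E" and i: "i \<in> Emb Z V" and j: "j \<in> Emb P V"
      and op: "op_norm P V (\<lambda>x. i (S (b' x)) - j x) \<le> \<epsilon>"
      using d(2)[of "k U"] \<gamma> P Z unfolding good_def by meson
    note VN = AgeD[OF E V]
    have lin: "lin_map P V (\<lambda>x. i (S (b' x)) - j x)"
      using lin_map_comp[OF Emb_approxD(1)[OF \<gamma>] EmbD(1)[OF i]]
      by (intro lin_map_diff[OF normed_spaceD(1)[OF VN(1)] _ EmbD(1)[OF j]]) simp
    obtain B where "\<And>x. x \<in> vcarrier P \<Longrightarrow> vnorm V (i (S (b' x)) - j x) \<le> B * vnorm P x"
      using lin_map_bounded[OF normed_spaceD(1)[OF PN(1)] PN(2) normed_spaceD(2)[OF PN(1)]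
        normed_spaceD[OF VN(1)] lin] by metis
    note bound = op_norm_bound(2)[OF PN(1) VN(1) lin this]
    have jb: "vnorm E (i (S x) - j (b x)) \<le> \<epsilon> * vnorm Ehat x" if x: "x \<in> vcarrier U" for x
    proof -
      have "vnorm V (i (S (b' (b x))) - j (b x)) \<le> op_norm P V (\<lambda>x. i (S (b' x)) - j x) * vnorm P (b x)"
        by (rule bound) (use x in \<open>auto simp: P_def\<close>)
      also have "\<dots> \<le> \<epsilon> * vnorm P (b x)"
        using op EmbD(2)[OF b x] is_normD(1)[OF normed_spaceD(2)[OF UN(1)] x] PN(5) by (intro mult_right_mono) auto
      finally show ?thesis using b'b[OF x] EmbD(2)[OF b x] PN(5) UN(5) VN(5) by simp
    qed
    have jbE: "(\<lambda>x. j (b x)) \<in> Emb U V"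
    proof -
      have "b \<in> Emb U P" using b by (auto simp: Emb_def lin_map_def P_def)
      then show ?thesis using j by (rule Emb_comp)
    qed
    have S': "(\<lambda>x. i (S x)) \<in> Emb_approx \<delta> Y V" by (rule Emb_approx_comp_Emb[OF S i])
    have near': "\<exists>a\<in>Emb U' V. \<forall>x\<in>vcarrier U'. vnorm E (i (S x) - a x) \<le> \<epsilon> * vnorm Ehat x"
      if "U' \<in> insert U \<V>" for U'
    proof (cases "U' = U")
      case True
      show ?thesis unfolding True by (rule bexI[OF _ jbE]) (simp add: jb)
    next
      case False
      then have U': "U' \<in> \<V>" "U' \<in> \<U>" using that insert.prems by auto
      obtain a where a: "a \<in> Emb U' Z" "\<forall>x\<in>vcarrier U'. vnorm E (S x - a x) \<le> \<epsilon> * vnorm Ehat x"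
        using near[OF U'(1)] by blast
      have "vnorm E (i (S x) - i (a x)) = vnorm E (S x - a x)" if x: "x \<in> vcarrier U'" for x
      proof -
        have "S x \<in> vcarrier Z" "a x \<in> vcarrier Z"
          using lin_mapD(1)[OF Emb_approxD(1)[OF S]] Y(2)[OF U'(2)] x EmbD(3)[OF a(1) x] by auto
        then show ?thesis
          using lin_map_algebra(3)[OF normed_spaceD(1)[OF ZN(1)] EmbD(1)[OF i], of "S x" "a x"]
            EmbD(2)[OF i vs_closed(3)[OF normed_spaceD(1)[OF ZN(1)], of "S x" "a x"]] ZN(5) VN(5) by simp
      qed
      then show ?thesis using Emb_comp[OF a(1) i] a(2) by (intro bexI[of _ "\<lambda>x. i (a x)"]) auto
    qed
    show ?case by (rule bexI[OF _ V], rule bexI[OF _ S']) (use near' in simp)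
  qed
  from this[OF subset_refl] obtain Z S where Z: "Z \<in> Age E" and S: "S \<in> Emb_approx \<delta> Y Z"
    and near: "\<forall>U\<in>\<U>. \<exists>a\<in>Emb U Z. \<forall>x\<in>vcarrier U. vnorm E (S x - a x) \<le> \<epsilon> * vnorm Ehat x" by blast
  have "S \<in> Emb_approx \<epsilon> Y Z"
    by (rule Emb_approx_mono[OF normed_spaceD(2)[OF YN(1)] S]) (use \<delta> in auto)
  then have "S \<in> Emb_approx \<epsilon> Y E"
    using AgeD(3,4,5)[OF E Z] unfolding Emb_approx_def lin_map_def by (auto simp: subset_iff)
  moreover have "\<forall>U\<in>\<U>. \<exists>a\<in>Emb U E. \<forall>x\<in>vcarrier U. vnorm E (S x - a x) \<le> \<epsilon> * vnorm Ehat x"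
    using near Emb_Age[OF _ Z] by blast
  ultimately show "\<exists>Y\<in>Age Ehat. (\<forall>U\<in>\<U>. vcarrier U \<subseteq> vcarrier Y) \<and>
     (\<exists>S\<in>Emb_approx \<epsilon> Y E. \<forall>U\<in>\<U>. \<exists>a\<in>Emb U E. \<forall>x\<in>vcarrier U. vnorm E (S x - a x) \<le> \<epsilon> * vnorm Ehat x)"
    using Y by blast
qed

section \<open>Spaces of norms\<close>

lemma Norms_inD: "m \<in> Norms_in V F \<Longrightarrow> m \<in> Norms V" "m \<in> Norms_in V F \<Longrightarrow> Emb (with_norm V m) F \<noteq> {}"
  by (auto simp: Norms_in_def)

text \<open>A copy of a member of the age that is close to the image of \<open>V\<close> in the limit induces a norm close
  to \<open>m\<close>, and that norm is realised in \<open>E\<close>.\<close>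

lemma Norms_in_dense:
  fixes E :: "('k::rc_scalar, 'e::ab_group_add) nspace" and Ehat :: "('k, 'w::ab_group_add) nspace"
    and V :: "('k, 'v::ab_group_add, 'z) vspace_scheme"
  assumes E: "normed_space E" and lim: "fraisse_limit (Age E) Ehat"
    and V: "vec_space V" and fd: "fin_dim V" and m: "m \<in> Norms_in V Ehat" and e: "\<epsilon> > 0"
  obtains n where "n \<in> Norms_in V E" "omega V m n < \<epsilon>"
proof -
  have H: "normed_space Ehat" using lim by (simp add: fraisse_limit_def fraisse_def banach_space_def)
  have mn: "is_norm V m" using NormsD(1)[OF Norms_inD(1)[OF m]] .
  obtain T where T: "T \<in> Emb (with_norm V m) Ehat" using Norms_inD(2)[OF m] by blast
  obtain \<delta> where \<delta>: "\<delta> > 0" and near: "\<And>W. W \<in> Age Ehat \<Longrightarrow>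
      ball_dist Ehat (Ehat\<lparr>vcarrier := T ` vcarrier V\<rparr>) W < \<delta> \<Longrightarrow>
      \<exists>n\<in>Norms V. omega V m n < \<epsilon> \<and> Emb (with_norm V n) W \<noteq> {}"
    using norm_from_near_subspace[OF V fd mn e] H T by metis
  obtain k where k: "has_dim V k" using fd by (auto simp: fin_dim_def)
  have "Ehat\<lparr>vcarrier := T ` vcarrier V\<rparr> \<in> Age Ehat"
    using Emb_image_Age(1)[OF H normed_space_with_norm[OF V mn] _ T] k by simp
  then obtain W X where W: "W \<in> Age Ehat" "X \<in> Age E" "isometric W X"
    "ball_dist Ehat (Ehat\<lparr>vcarrier := T ` vcarrier V\<rparr>) W < \<delta>"
    using lim \<delta> unfolding fraisse_limit_def by meson
  obtain n L where n: "n \<in> Norms V" "omega V m n < \<epsilon>" and L: "L \<in> Emb (with_norm V n) W"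
    using near[OF W(1,4)] by blast
  obtain a where a: "a \<in> Emb W X" using W(3) by (auto simp: isometric_def)
  have "(\<lambda>x. a (L x)) \<in> Emb (with_norm V n) E" by (rule Emb_Age[OF Emb_comp[OF L a] W(2)])
  then show thesis using that n by (auto simp: Norms_in_def)
qed

lemma Age_Emb_limit:
  assumes E: "normed_space E" and lim: "fraisse_limit (Age E) Ehat" and Y: "Y \<in> Age E"
  shows "Emb Y Ehat \<noteq> {}"
proof -
  have H: "normed_space Ehat" using lim by (simp add: fraisse_limit_def fraisse_def banach_space_def)
  obtain U where U: "U \<in> Age Ehat" "isometric U Y" using lim Y by (auto simp: fraisse_limit_def)
  obtain b where "b \<in> Emb Y U" using isometric_Emb[OF AgeD(1)[OF H U(1)] AgeD(1)[OF E Y] U(2)] by metis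
  then show ?thesis using Emb_Age[OF _ U(1)] by blast
qed

lemma Norms_in_limit:
  assumes E: "normed_space E" and lim: "fraisse_limit (Age E) Ehat" and V: "vec_space V" "fin_dim V"
  shows "Norms_in V E \<subseteq> Norms_in V Ehat"
proof
  fix m assume m: "m \<in> Norms_in V E"
  then obtain T where T: "T \<in> Emb (with_norm V m) E" using Norms_inD(2) by blast
  obtain k where k: "has_dim V k" using V(2) by (auto simp: fin_dim_def)
  have U: "E\<lparr>vcarrier := T ` vcarrier V\<rparr> \<in> Age E"
    using Emb_image_Age(1)[OF E normed_space_with_norm[OF V(1) NormsD(1)[OF Norms_inD(1)[OF m]]] _ T] k by simp
  obtain a where a: "a \<in> Emb (E\<lparr>vcarrier := T ` vcarrier V\<rparr>) Ehat" using Age_Emb_limit[OF E lim U] by blast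
  have "T \<in> Emb (with_norm V m) (E\<lparr>vcarrier := T ` vcarrier V\<rparr>)" using T by (auto simp: Emb_def lin_map_def)
  from Emb_comp[OF this a] show "m \<in> Norms_in V Ehat" using Norms_inD(1)[OF m] by (auto simp: Norms_in_def)
qed

text \<open>Composition with \<open>T\<close> turns an isometry close to \<open>S\<close> on the image of \<open>T\<close> into an embedding close to
  \<open>S \<circ> T\<close>.\<close>

lemma transfer_embedding:
  assumes T: "T \<in> Emb (with_norm V m) F"
    and a: "\<exists>a\<in>Emb (F\<lparr>vcarrier := T ` vcarrier V\<rparr>) G. \<forall>x\<in>T ` vcarrier V. vnorm G (S x - a x) \<le> \<epsilon> * vnorm F x"
  obtains T' where "T' \<in> Emb (with_norm V m) G" "\<And>x. x \<in> vcarrier V \<Longrightarrow> vnorm G (S (T x) - T' x) \<le> \<epsilon> * m x"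
proof -
  obtain a where a: "a \<in> Emb (F\<lparr>vcarrier := T ` vcarrier V\<rparr>) G"
    "\<forall>x\<in>T ` vcarrier V. vnorm G (S x - a x) \<le> \<epsilon> * vnorm F x" using a by blast
  have "T \<in> Emb (with_norm V m) (F\<lparr>vcarrier := T ` vcarrier V\<rparr>)" using T by (auto simp: Emb_def lin_map_def)
  from Emb_comp[OF this a(1)] show thesis
    using a(2) EmbD(2)[OF T] by (intro that[of "\<lambda>x. a (T x)"]) auto
qed

lemma image_embeds:
  assumes F: "normed_space F" and V: "vec_space V" and m: "is_norm V m" and T: "T \<in> Emb (with_norm V m) F"
    and G: "Emb (with_norm V m) G \<noteq> {}"
  shows "Emb (F\<lparr>vcarrier := T ` vcarrier V\<rparr>) G \<noteq> {}"
proof -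
  have "inv_into (vcarrier V) T \<in> Emb (F\<lparr>vcarrier := T ` vcarrier V\<rparr>) (with_norm V m)"
    using Emb_inv[OF normed_space_with_norm[OF V m] F T] by simp
  then show ?thesis using G Emb_comp by blast
qed

text \<open>Applied to the images of two embeddings, the transfer property yields an approximate isometry
  \<open>S\<close> for which \<open>S \<circ> T\<close> and \<open>S \<circ> U\<close> are close to embeddings.\<close>

lemma transfer_two_embeddings:
  fixes V :: "('k::rc_scalar, 'v::ab_group_add, 'z) vspace_scheme"
    and F :: "('k, 'w::ab_group_add) nspace" and G :: "('k, 'u::ab_group_add) nspace"
  assumes tr: "transfers F G" and V: "vec_space V" and fd: "fin_dim V" and F: "normed_space F"
    and m: "m \<in> Norms_in V G" and n: "n \<in> Norms_in V G"
    and T: "T \<in> Emb (with_norm V m) F" and U: "U \<in> Emb (with_norm V n) F" and \<epsilon>: "\<epsilon> > 0"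
  obtains Y S T' U' where "Y \<in> Age F" "S \<in> Emb_approx \<epsilon> Y G"
    "T ` vcarrier V \<subseteq> vcarrier Y" "U ` vcarrier V \<subseteq> vcarrier Y"
    "T' \<in> Emb (with_norm V m) G" "\<And>x. x \<in> vcarrier V \<Longrightarrow> vnorm G (S (T x) - T' x) \<le> \<epsilon> * m x"
    "U' \<in> Emb (with_norm V n) G" "\<And>x. x \<in> vcarrier V \<Longrightarrow> vnorm G (S (U x) - U' x) \<le> \<epsilon> * n x"
proof -
  note mn = NormsD(1)[OF Norms_inD(1)[OF m]] and nn = NormsD(1)[OF Norms_inD(1)[OF n]]
  obtain k where k: "has_dim V k" using fd by (auto simp: fin_dim_def)
  let ?PT = "F\<lparr>vcarrier := T ` vcarrier V\<rparr>" and ?PU = "F\<lparr>vcarrier := U ` vcarrier V\<rparr>"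
  have ages: "{?PT, ?PU} \<subseteq> Age F"
    using Emb_image_Age(1)[OF F normed_space_with_norm[OF V mn] _ T] Emb_image_Age(1)[OF F normed_space_with_norm[OF V nn] _ U] k by simp
  have embs: "Emb P G \<noteq> {}" if "P \<in> {?PT, ?PU}" for P
    using that image_embeds[OF F V mn T Norms_inD(2)[OF m]] image_embeds[OF F V nn U Norms_inD(2)[OF n]] by auto
  obtain Y S where Y: "Y \<in> Age F" "\<And>P. P \<in> {?PT, ?PU} \<Longrightarrow> vcarrier P \<subseteq> vcarrier Y" and S: "S \<in> Emb_approx \<epsilon> Y G"
    and near: "\<And>P. P \<in> {?PT, ?PU} \<Longrightarrow> \<exists>a\<in>Emb P G. \<forall>x\<in>vcarrier P. vnorm G (S x - a x) \<le> \<epsilon> * vnorm F x"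
    using transfersD[OF tr _ ages embs \<epsilon>] by (metis finite.emptyI finite.insertI)
  have sub: "T ` vcarrier V \<subseteq> vcarrier Y" "U ` vcarrier V \<subseteq> vcarrier Y" using Y(2)[of ?PT] Y(2)[of ?PU] by simp_all
  obtain T' where T': "T' \<in> Emb (with_norm V m) G" "\<And>x. x \<in> vcarrier V \<Longrightarrow> vnorm G (S (T x) - T' x) \<le> \<epsilon> * m x"
    using transfer_embedding[OF T, of G S \<epsilon>] near[of ?PT] by auto
  obtain U' where U': "U' \<in> Emb (with_norm V n) G" "\<And>x. x \<in> vcarrier V \<Longrightarrow> vnorm G (S (U x) - U' x) \<le> \<epsilon> * n x"
    using transfer_embedding[OF U, of G S \<epsilon>] near[of ?PU] by auto
  show thesis by (rule that[OF Y(1) S sub T' U'])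
qed

definition partial_rel ::
    "('k::real_normed_field, 'v::ab_group_add) nspace \<Rightarrow> ('k, 'w::ab_group_add) nspace \<Rightarrow>
     real \<Rightarrow> ('v \<Rightarrow> real) \<Rightarrow> ('v \<Rightarrow> real) \<Rightarrow> bool" where
  "partial_rel X F C m n \<longleftrightarrow> (\<exists>T\<in>Emb (with_norm X m) F. \<exists>U\<in>Emb (with_norm X n) F.
     \<forall>x\<in>vcarrier X. vnorm F (T x - U x) \<le> C * vnorm X x)"

text \<open>Strict inequalities are preserved by infima that are not attained. A nonnegative \<open>C\<close> in the relation
  is the same as a bound for the operator norm.\<close>

lemma partial_dist_less_iff:
  fixes X :: "('k::rc_scalar, 'v::ab_group_add) nspace" and F :: "('k, 'w::ab_group_add) nspace"
  assumes X: "normed_space X" and fd: "fin_dim X" and F: "normed_space F"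
    and m: "m \<in> Norms_in X F" and n: "n \<in> Norms_in X F"
  shows "partial_dist X F m n < r \<longleftrightarrow> (\<exists>C. 0 \<le> C \<and> C < r \<and> partial_rel X F C m n)"
proof -
  let ?S = "{op_norm X F (\<lambda>x. T x - U x) | T U. T \<in> Emb (with_norm X m) F \<and> U \<in> Emb (with_norm X n) F}"
  have op: "0 \<le> op_norm X F (\<lambda>x. T x - U x) \<and>
      (\<forall>x\<in>vcarrier X. vnorm F (T x - U x) \<le> op_norm X F (\<lambda>x. T x - U x) * vnorm X x)"
    if T: "T \<in> Emb (with_norm X m) F" and U: "U \<in> Emb (with_norm X n) F" for T U
  proof -
    have lin: "lin_map X F (\<lambda>x. T x - U x)"
      using EmbD(1)[OF T] EmbD(1)[OF U] by (intro lin_map_diff[OF normed_spaceD(1)[OF F]]) simp_all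
    obtain B where "\<And>x. x \<in> vcarrier X \<Longrightarrow> vnorm F (T x - U x) \<le> B * vnorm X x"
      using lin_map_bounded[OF normed_spaceD(1)[OF X] fd normed_spaceD(2)[OF X] normed_spaceD[OF F] lin] by metis
    from op_norm_bound[OF X F lin this] show ?thesis by blast
  qed
  have "?S \<noteq> {}" using Norms_inD(2)[OF m] Norms_inD(2)[OF n] by blast
  moreover have "bdd_below ?S" using op by (intro bdd_belowI[of _ 0]) auto
  ultimately have "partial_dist X F m n < r \<longleftrightarrow> (\<exists>s\<in>?S. s < r)" unfolding partial_dist_def by (rule cInf_less_iff)
  also have "\<dots> \<longleftrightarrow> (\<exists>C. 0 \<le> C \<and> C < r \<and> partial_rel X F C m n)"
  proof
    assume "\<exists>s\<in>?S. s < r"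
    then show "\<exists>C. 0 \<le> C \<and> C < r \<and> partial_rel X F C m n" using op unfolding partial_rel_def by blast
  next
    assume "\<exists>C. 0 \<le> C \<and> C < r \<and> partial_rel X F C m n"
    then obtain C T U where C: "0 \<le> C" "C < r" and TU: "T \<in> Emb (with_norm X m) F" "U \<in> Emb (with_norm X n) F"
      and bd: "\<forall>x\<in>vcarrier X. vnorm F (T x - U x) \<le> C * vnorm X x" unfolding partial_rel_def by blast
    have "op_norm X F (\<lambda>x. T x - U x) \<le> C" by (rule op_norm_le[OF X C(1)]) (use bd in blast)
    then have "op_norm X F (\<lambda>x. T x - U x) < r" using C by simp
    then show "\<exists>s\<in>?S. s < r" using TU by blast
  qed
  finally show ?thesis .
qed

lemma partial_rel_sym:
  assumes F: "normed_space F" and R: "partial_rel X F C m n"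
  shows "partial_rel X F C n m"
proof -
  obtain T U where TU: "T \<in> Emb (with_norm X m) F" "U \<in> Emb (with_norm X n) F"
    "\<forall>x\<in>vcarrier X. vnorm F (T x - U x) \<le> C * vnorm X x" using R unfolding partial_rel_def by blast
  have "vnorm F (U x - T x) = vnorm F (T x - U x)" if "x \<in> vcarrier X" for x
    using EmbD(3)[OF TU(1)] EmbD(3)[OF TU(2)] that by (intro norm_algebra(3)[OF normed_spaceD[OF F]]) auto
  then show ?thesis unfolding partial_rel_def using TU by metis
qed

text \<open>The two embeddings of the middle norm are aligned by an isometry, which is also applied to the
  embedding of the last norm.\<close>

lemma partial_rel_triangle:
  fixes X :: "('k::rc_scalar, 'v::ab_group_add) nspace" and F :: "('k, 'w::ab_group_add) nspace"
  assumes X: "normed_space X" and fd: "fin_dim X" and F: "fraisse F" and n: "is_norm X n"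
    and R: "partial_rel X F C m n" and S: "partial_rel X F D n p" and e: "e > 0"
  shows "partial_rel X F (C + D + e) m p"
proof -
  have F': "normed_space F" using F by (simp add: fraisse_def banach_space_def)
  note FN = normed_spaceD[OF F']
  obtain T U where T: "T \<in> Emb (with_norm X m) F" and U: "U \<in> Emb (with_norm X n) F"
    and TU: "\<And>x. x \<in> vcarrier X \<Longrightarrow> vnorm F (T x - U x) \<le> C * vnorm X x" using R unfolding partial_rel_def by blast
  obtain U' P where U': "U' \<in> Emb (with_norm X n) F" and P: "P \<in> Emb (with_norm X p) F"
    and UP: "\<And>x. x \<in> vcarrier X \<Longrightarrow> vnorm F (U' x - P x) \<le> D * vnorm X x" using S unfolding partial_rel_def by blast
  obtain B where B: "B \<ge> 0" "\<And>x. x \<in> vcarrier X \<Longrightarrow> n x \<le> B * vnorm X x"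
    using norms_equivalent[OF normed_spaceD(1)[OF X] fd normed_spaceD(2)[OF X] n] by blast
  define e' where "e' = e / (B + 1)"
  have e': "e' > 0" using e B by (simp add: e'_def)
  obtain k where k: "has_dim X k" using fd by (auto simp: fin_dim_def)
  obtain \<delta> where \<delta>: "\<delta> > 0" and al: "\<And>T U. norm_near X \<delta> n n \<Longrightarrow> T \<in> Emb (with_norm X n) F \<Longrightarrow> U \<in> Emb (with_norm X n) F \<Longrightarrow>
      \<exists>g\<in>Emb F F. g ` vcarrier F = vcarrier F \<and> (\<forall>x\<in>vcarrier X. vnorm F (g (U x) - T x) \<le> e' * n x)"
    using fraisse_align[OF F e', of k] normed_spaceD(1)[OF X] k n by metis
  have "norm_near X \<delta> n n" by (rule norm_near_mono[OF norm_near_refl _ n n]) (use \<delta> in simp)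
  from al[OF this U U'] obtain g where g: "g \<in> Emb F F"
    and gU: "\<And>x. x \<in> vcarrier X \<Longrightarrow> vnorm F (g (U' x) - U x) \<le> e' * n x" by blast
  have "vnorm F (T x - g (P x)) \<le> (C + D + e) * vnorm X x" if x: "x \<in> vcarrier X" for x
  proof -
    have mem: "T x \<in> vcarrier F" "U x \<in> vcarrier F" "U' x \<in> vcarrier F" "P x \<in> vcarrier F"
      using EmbD(3)[OF T] EmbD(3)[OF U] EmbD(3)[OF U'] EmbD(3)[OF P] x by auto
    note gm = EmbD(3)[OF g]
    have 1: "vnorm F (g (U' x) - g (P x)) = vnorm F (U' x - P x)"
      using lin_map_algebra(3)[OF FN(1) EmbD(1)[OF g], of "U' x" "P x"] EmbD(2)[OF g vs_closed(3)[OF FN(1)], of "U' x" "P x"] mem by simp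
    have eq: "T x - g (P x) = (T x - U x) + ((U x - g (U' x)) + (g (U' x) - g (P x)))" by simp
    have "vnorm F (T x - g (P x)) \<le> vnorm F (T x - U x) + (vnorm F (U x - g (U' x)) + vnorm F (g (U' x) - g (P x)))"
      unfolding eq
      by (rule order_trans[OF is_normD(4)[OF FN(2)] add_left_mono[OF is_normD(4)[OF FN(2)]]])
        (use mem gm vs_closed[OF FN(1)] in auto)
    also have "vnorm F (U x - g (U' x)) = vnorm F (g (U' x) - U x)"
      using mem gm by (intro norm_algebra(3)[OF FN]) auto
    also have "\<dots> \<le> e' * (B * vnorm X x)"
      using order_trans[OF gU[OF x] mult_left_mono[OF B(2)[OF x]]] e' by simp
    also have "\<dots> \<le> e * vnorm X x"
    proof -
      have "e' * B \<le> e" using e B by (simp add: e'_def field_simps)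
      from mult_right_mono[OF this is_normD(1)[OF normed_spaceD(2)[OF X] x]] show ?thesis by (simp add: mult.assoc)
    qed
    finally show ?thesis using TU[OF x] UP[OF x] 1 by (simp add: algebra_simps)
  qed
  then show ?thesis unfolding partial_rel_def by (intro bexI[OF _ T] bexI[OF _ Emb_comp[OF P g]]) simp
qed

text \<open>Alignment turns closeness for \<open>\<omega>\<close> into closeness for \<open>\<partial>\<close>; conversely two embeddings
  at a small distance induce nearby norms. The constants only depend on the \<open>\<omega>\<close>-distance of one
  of the two norms to a base point.\<close>

lemma partial_dist_equiv:
  fixes X :: "('k::rc_scalar, 'v::ab_group_add) nspace" and F :: "('k, 'w::ab_group_add) nspace"
  assumes X: "normed_space X" and fd: "fin_dim X" and F: "fraisse F"
    and m0: "m0 \<in> Norms X" and e: "e > 0"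
  shows "\<exists>\<delta>>0. \<forall>m\<in>Norms_in X F. \<forall>n\<in>Norms_in X F. omega X m0 m \<le> K \<longrightarrow>
      (omega X m n < \<delta> \<longrightarrow> partial_dist X F m n < e) \<and> (partial_dist X F m n < \<delta> \<longrightarrow> omega X m n < e)"
proof -
  have F': "normed_space F" using F by (simp add: fraisse_def banach_space_def)
  note XV = normed_spaceD(1)[OF X] and XN = normed_spaceD(2)[OF X] and FN = normed_spaceD[OF F']
  note m0n = NormsD(1)[OF m0]
  obtain k where k: "has_dim X k" using fd by (auto simp: fin_dim_def)
  obtain B where B: "B \<ge> 0" "\<And>x. x \<in> vcarrier X \<Longrightarrow> m0 x \<le> B * vnorm X x"
    using norms_equivalent[OF XV fd XN m0n] by blast
  obtain B' where B': "B' \<ge> 0" "\<And>x. x \<in> vcarrier X \<Longrightarrow> vnorm X x \<le> B' * m0 x"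
    using norms_equivalent[OF XV fd m0n XN] by blast
  define M where "M = exp (1 + K) * B + 1"
  have M: "M > 0" using B by (simp add: M_def add_nonneg_pos)
  obtain \<delta>1 where \<delta>1: "\<delta>1 > 0" and al: "\<And>m n T U. is_norm X m \<Longrightarrow> is_norm X n \<Longrightarrow> norm_near X \<delta>1 m n \<Longrightarrow>
      T \<in> Emb (with_norm X m) F \<Longrightarrow> U \<in> Emb (with_norm X n) F \<Longrightarrow>
      \<exists>g\<in>Emb F F. g ` vcarrier F = vcarrier F \<and> (\<forall>x\<in>vcarrier X. vnorm F (g (U x) - T x) \<le> e / 2 / M * n x)"
    using fraisse_align[OF F, of "e / 2 / M" k] XV k e M by (metis divide_pos_pos zero_less_numeral)
  define s where "s = 1 - exp (- (e / 2))"
  have s: "s > 0" using e by (simp add: s_def)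
  define M' where "M' = B' * exp K + 1"
  have M': "M' > 0" using B' by (simp add: M'_def add_nonneg_pos)
  define \<delta> where "\<delta> = min (min \<delta>1 1) (s / M')"
  have \<delta>: "\<delta> > 0" "\<delta> \<le> \<delta>1" "\<delta> \<le> 1" "\<delta> \<le> s / M'" using \<delta>1 s M' by (auto simp: \<delta>_def)
  show ?thesis
  proof (intro exI conjI ballI impI)
    show "\<delta> > 0" by fact
    fix m n assume m: "m \<in> Norms_in X F" and n: "n \<in> Norms_in X F" and Km: "omega X m0 m \<le> K"
    note mn = NormsD(1)[OF Norms_inD(1)[OF m]] and nn = NormsD(1)[OF Norms_inD(1)[OF n]]
    have near0: "norm_near X K m0 m" by (rule omega_near[OF XV fd m0n mn Km])
    { assume lt: "omega X m n < \<delta>"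
      have nd: "norm_near X \<delta>1 m n" "norm_near X 1 m n"
        by (rule omega_near[OF XV fd mn nn]; use lt \<delta> in simp)+
      obtain T U where T: "T \<in> Emb (with_norm X m) F" and U: "U \<in> Emb (with_norm X n) F"
        using Norms_inD(2)[OF m] Norms_inD(2)[OF n] by blast
      obtain g where g: "g \<in> Emb F F" and gU: "\<And>x. x \<in> vcarrier X \<Longrightarrow> vnorm F (g (U x) - T x) \<le> e / 2 / M * n x"
        using al[OF mn nn nd(1) T U] by blast
      have "vnorm F (g (U x) - T x) \<le> e / 2 * vnorm X x" if x: "x \<in> vcarrier X" for x
      proof -
        have 1: "n x \<le> exp 1 * m x" "m x \<le> exp K * m0 x" using nd(2) near0 x by (auto simp: norm_near_def)
        have "n x \<le> exp (1 + K) * m0 x"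
          using order_trans[OF 1(1) mult_left_mono[OF 1(2)]] by (simp add: exp_add mult.assoc)
        also have "\<dots> \<le> exp (1 + K) * (B * vnorm X x)" using B(2)[OF x] by simp
        also have "\<dots> \<le> M * vnorm X x" using is_normD(1)[OF XN x] by (simp add: M_def algebra_simps)
        finally have "e / 2 / M * n x \<le> e / 2 / M * (M * vnorm X x)" using e M by (intro mult_left_mono) auto
        also have "\<dots> = e / 2 * vnorm X x" using M by simp
        finally have *: "e / 2 / M * n x \<le> e / 2 * vnorm X x" .
        show ?thesis by (rule order_trans[OF gU[OF x] *])
      qed
      then have "partial_rel X F (e / 2) n m"
        unfolding partial_rel_def by (intro bexI[OF _ Emb_comp[OF U g]] bexI[OF _ T]) simp
      then have "partial_rel X F (e / 2) m n" by (rule partial_rel_sym[OF F'])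
      then show "partial_dist X F m n < e"
        unfolding partial_dist_less_iff[OF X fd F' m n] using e by (intro exI[of _ "e / 2"]) simp }
    { assume "partial_dist X F m n < \<delta>"
      then obtain C T U where C: "0 \<le> C" "C < \<delta>" and T: "T \<in> Emb (with_norm X m) F" and U: "U \<in> Emb (with_norm X n) F"
        and TU: "\<And>x. x \<in> vcarrier X \<Longrightarrow> vnorm F (T x - U x) \<le> C * vnorm X x"
        unfolding partial_dist_less_iff[OF X fd F' m n] partial_rel_def by blast
      have "\<bar>n x - m x\<bar> \<le> s * m x" if x: "x \<in> vcarrier X" for x
      proof -
        have "\<bar>vnorm F (T x) - vnorm F (U x)\<bar> \<le> vnorm F (T x - U x)"
          using EmbD(3)[OF T] EmbD(3)[OF U] x by (intro norm_algebra(6)[OF FN]) auto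
        then have "\<bar>n x - m x\<bar> \<le> C * vnorm X x"
          using TU[OF x] EmbD(2)[OF T, of x] EmbD(2)[OF U, of x] x by (simp add: abs_minus_commute)
        also have "\<dots> \<le> \<delta> * vnorm X x" using C is_normD(1)[OF XN x] by (intro mult_right_mono) auto
        also have "\<dots> \<le> \<delta> * (M' * m x)"
        proof (rule mult_left_mono)
          have "m0 x \<le> exp K * m x" using near0 x by (simp add: norm_near_def)
          then have "B' * m0 x \<le> B' * (exp K * m x)" using B'(1) by (rule mult_left_mono)
          then show "vnorm X x \<le> M' * m x" using B'(2)[OF x] is_normD(1)[OF mn x] by (simp add: M'_def algebra_simps)
        qed (use \<delta> in simp)
        also have "\<dots> \<le> s * m x"
          using \<delta>(4) M' is_normD(1)[OF mn x] by (simp add: mult.assoc[symmetric] mult_right_mono pos_le_divide_eq)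
        finally show ?thesis .
      qed
      then have "norm_near X (e / 2) m n" by (intro norm_near_diffI[OF _ mn]) (use e in \<open>auto simp: s_def\<close>)
      then have "omega X m n \<le> e / 2" by (rule iffD2[OF omega_le_iff(2)[OF XV fd mn nn], rotated]) (use e in simp)
      then show "omega X m n < e" using e by simp }
  qed
qed

lemma partial_rel_transfer:
  fixes X :: "('k::rc_scalar, 'v::ab_group_add) nspace"
    and F :: "('k, 'w::ab_group_add) nspace" and G :: "('k, 'u::ab_group_add) nspace"
  assumes tr: "transfers F G" and X: "normed_space X" and fd: "fin_dim X" and F: "normed_space F" and G: "normed_space G"
    and m: "m \<in> Norms_in X G" and n: "n \<in> Norms_in X G" and C: "C \<ge> 0" and R: "partial_rel X F C m n" and e: "e > 0"
  shows "partial_rel X G (C + e) m n"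
proof -
  note XV = normed_spaceD(1)[OF X] and XN = normed_spaceD(2)[OF X] and GN = normed_spaceD[OF G]
  note mn = NormsD(1)[OF Norms_inD(1)[OF m]] and nn = NormsD(1)[OF Norms_inD(1)[OF n]]
  obtain T U where T: "T \<in> Emb (with_norm X m) F" and U: "U \<in> Emb (with_norm X n) F"
    and TU: "\<And>x. x \<in> vcarrier X \<Longrightarrow> vnorm F (T x - U x) \<le> C * vnorm X x" using R unfolding partial_rel_def by blast
  obtain B where B: "B \<ge> 0" "\<And>x. x \<in> vcarrier X \<Longrightarrow> m x \<le> B * vnorm X x"
    using norms_equivalent[OF XV fd XN mn] by blast
  obtain B' where B': "B' \<ge> 0" "\<And>x. x \<in> vcarrier X \<Longrightarrow> n x \<le> B' * vnorm X x"
    using norms_equivalent[OF XV fd XN nn] by blast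
  define \<epsilon> where "\<epsilon> = e / (C + B + B' + 1)"
  have \<epsilon>: "\<epsilon> > 0" using e C B B' by (simp add: \<epsilon>_def)
  have \<epsilon>e: "\<epsilon> * (C + B + B') \<le> e" using e C B B' by (simp add: \<epsilon>_def field_simps)
  obtain Y S T' U' where Y: "Y \<in> Age F" and S: "S \<in> Emb_approx \<epsilon> Y G"
    and sub: "T ` vcarrier X \<subseteq> vcarrier Y" "U ` vcarrier X \<subseteq> vcarrier Y"
    and T': "T' \<in> Emb (with_norm X m) G" "\<And>x. x \<in> vcarrier X \<Longrightarrow> vnorm G (S (T x) - T' x) \<le> \<epsilon> * m x"
    and U': "U' \<in> Emb (with_norm X n) G" "\<And>x. x \<in> vcarrier X \<Longrightarrow> vnorm G (S (U x) - U' x) \<le> \<epsilon> * n x"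
    by (rule transfer_two_embeddings[OF tr XV fd F m n T U \<epsilon>]) (rule that)
  note YN = AgeD[OF F Y]
  have "vnorm G (T' x - U' x) \<le> (C + e) * vnorm X x" if x: "x \<in> vcarrier X" for x
  proof -
    have mY: "T x \<in> vcarrier Y" "U x \<in> vcarrier Y" using sub x by auto
    note SG = lin_mapD(1)[OF Emb_approxD(1)[OF S]]
    have mG: "T' x \<in> vcarrier G" "U' x \<in> vcarrier G" using EmbD(3)[OF T'(1)] EmbD(3)[OF U'(1)] x by auto
    have eq: "T' x - U' x = (T' x - S (T x)) + ((S (T x) - S (U x)) + (S (U x) - U' x))" by simp
    have "vnorm G (T' x - U' x) \<le> vnorm G (T' x - S (T x)) + (vnorm G (S (T x) - S (U x)) + vnorm G (S (U x) - U' x))"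
      unfolding eq
      by (rule order_trans[OF is_normD(4)[OF GN(2)] add_left_mono[OF is_normD(4)[OF GN(2)]]])
        (use mG SG mY vs_closed[OF GN(1)] in auto)
    also have "vnorm G (T' x - S (T x)) = vnorm G (S (T x) - T' x)"
      using mG SG mY by (intro norm_algebra(3)[OF GN]) auto
    also have "S (T x) - S (U x) = S (T x - U x)"
      using lin_map_algebra(3)[OF normed_spaceD(1)[OF YN(1)] Emb_approxD(1)[OF S] mY] by simp
    also have "vnorm G (S (T x - U x)) \<le> (1 + \<epsilon>) * vnorm F (T x - U x)"
      using Emb_approxD(3)[OF S vs_closed(3)[OF normed_spaceD(1)[OF YN(1)] mY]] YN(5) by simp
    also have "\<dots> \<le> (1 + \<epsilon>) * (C * vnorm X x)" using TU[OF x] \<epsilon> by (intro mult_left_mono) auto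
    also have "vnorm G (S (T x) - T' x) \<le> \<epsilon> * (B * vnorm X x)"
      using T'(2)[OF x] mult_left_mono[OF B(2)[OF x], of \<epsilon>] \<epsilon> by linarith
    also have "vnorm G (S (U x) - U' x) \<le> \<epsilon> * (B' * vnorm X x)"
      using U'(2)[OF x] mult_left_mono[OF B'(2)[OF x], of \<epsilon>] \<epsilon> by linarith
    finally have "vnorm G (T' x - U' x) \<le> C * vnorm X x + (\<epsilon> * (C + B + B')) * vnorm X x" by (simp add: algebra_simps)
    also have "\<dots> \<le> (C + e) * vnorm X x"
      using mult_right_mono[OF \<epsilon>e is_normD(1)[OF XN x]] by (simp add: algebra_simps)
    finally show ?thesis .
  qed
  then show ?thesis unfolding partial_rel_def using T'(1) U'(1) by blast
qed

text \<open>Two infima of constants agree if each of the relations implies the other one up to \<open>\<epsilon>\<close>; this is one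
  of the inequalities.\<close>

lemma dist_le_of_rel:
  assumes "\<And>r. (d::real) < r \<longleftrightarrow> (\<exists>C. 0 \<le> C \<and> C < r \<and> R C)" "\<And>r. d' < r \<longleftrightarrow> (\<exists>C. 0 \<le> C \<and> C < r \<and> R' C)"
    and "\<And>C e. 0 \<le> C \<Longrightarrow> R C \<Longrightarrow> e > 0 \<Longrightarrow> R' (C + e)"
  shows "d' \<le> d"
proof (rule field_le_epsilon)
  fix e :: real assume e: "e > 0"
  then have "d < d + e / 2" by simp
  then obtain C where C: "0 \<le> C" "C < d + e / 2" "R C" using assms(1) by blast
  then have "R' (C + e / 2)" using assms(3) e by simp
  moreover have "0 \<le> C + e / 2" "C + e / 2 < d + e" using C e by auto
  ultimately show "d' \<le> d + e" using assms(2) by (meson less_imp_le)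
qed

lemma spaces_of_norms:
  fixes E :: "('k::rc_scalar, 'e::ab_group_add) nspace" and Ehat :: "('k, 'b::ab_group_add) nspace"
    and X :: "('k, 'x::ab_group_add) nspace"
  assumes E: "normed_space E" and am: "amalgamation_class (Age E)" and lim: "fraisse_limit (Age E) Ehat"
    and X: "normed_space X" and fd: "fin_dim X"
  shows "compatible_metric (norm_topology X) (Norms_in X Ehat) (partial_dist X Ehat)"
    "unif_equiv_on_bounded (Norms_in X Ehat) (partial_dist X Ehat) (omega X)"
    "\<And>m n. m \<in> Norms_in X E \<Longrightarrow> n \<in> Norms_in X E \<Longrightarrow> partial_dist X E m n = partial_dist X Ehat m n"
    "dense_subset (norm_topology X) (Norms_in X E) (Norms_in X Ehat)"
proof -
  have fr: "fraisse Ehat" using lim by (simp add: fraisse_limit_def)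
  have H: "normed_space Ehat" using fr by (simp add: fraisse_def banach_space_def)
  note XV = normed_spaceD(1)[OF X]
  have top: "norm_topology X = metric_topology (Norms X) (omega X)" by (rule norm_topology_eq_omega[OF XV fd])
  note om = omega_metric[OF XV fd]
  have sub: "Norms_in X F \<subseteq> Norms X" for F :: "('k, 'c::ab_group_add) nspace" by (auto simp: Norms_in_def)
  note equiv = partial_dist_equiv[OF X fd fr]
  have loc: "\<exists>\<delta>>0. \<forall>n\<in>Norms_in X Ehat. (omega X m n < \<delta> \<longrightarrow> partial_dist X Ehat m n < e) \<and>
      (partial_dist X Ehat m n < \<delta> \<longrightarrow> omega X m n < e)" if m: "m \<in> Norms_in X Ehat" and e: "e > 0" for m e
    using equiv[OF Norms_inD(1)[OF m] e, of 0] Metric_space_dist_onD(3)[OF om Norms_inD(1)[OF m]] m by (metis order_refl)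
  show "compatible_metric (norm_topology X) (Norms_in X Ehat) (partial_dist X Ehat)"
    unfolding top
  proof (rule compatible_metric_from_relation[OF om sub])
    show "partial_dist X Ehat m n < r \<longleftrightarrow> (\<exists>C. 0 \<le> C \<and> C < r \<and> partial_rel X Ehat C m n)"
      if "m \<in> Norms_in X Ehat" "n \<in> Norms_in X Ehat" for m n r
      by (rule partial_dist_less_iff[OF X fd H that])
    show "partial_rel X Ehat C n m" if "partial_rel X Ehat C m n" for C m n by (rule partial_rel_sym[OF H that])
    show "partial_rel X Ehat (C + D + e) m p"
      if "n \<in> Norms_in X Ehat" "partial_rel X Ehat C m n" "partial_rel X Ehat D n p" "e > 0" for C D e m n p
      by (rule partial_rel_triangle[OF X fd fr NormsD(1)[OF Norms_inD(1)[OF that(1)]] that(2-4)])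
    show "\<exists>\<delta>>0. \<forall>n\<in>Norms_in X Ehat. omega X m n < \<delta> \<longrightarrow> partial_dist X Ehat m n < e"
      "\<exists>\<delta>>0. \<forall>n\<in>Norms_in X Ehat. partial_dist X Ehat m n < \<delta> \<longrightarrow> omega X m n < e"
      if "m \<in> Norms_in X Ehat" "e > 0" for m e using loc[OF that] by meson+
  qed
  show "unif_equiv_on_bounded (Norms_in X Ehat) (partial_dist X Ehat) (omega X)"
    by (rule unif_equiv_from_based) (rule equiv[OF Norms_inD(1)])
  note subE = Norms_in_limit[OF E lim XV fd]
  have t1: "transfers E Ehat" by (rule transfers_if_Age_embeds[OF E H Age_Emb_limit[OF E lim]])
  have t2: "transfers Ehat E" by (rule transfers_from_limit[OF E am lim])
  show "partial_dist X E m n = partial_dist X Ehat m n" if mn: "m \<in> Norms_in X E" "n \<in> Norms_in X E" for m n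
  proof (rule antisym)
    have mn': "m \<in> Norms_in X Ehat" "n \<in> Norms_in X Ehat" using mn subE by auto
    note iE = partial_dist_less_iff[OF X fd E mn] and iH = partial_dist_less_iff[OF X fd H mn']
    show "partial_dist X E m n \<le> partial_dist X Ehat m n"
      by (rule dist_le_of_rel[OF iH iE]) (rule partial_rel_transfer[OF t2 X fd H E mn])
    show "partial_dist X Ehat m n \<le> partial_dist X E m n"
      by (rule dist_le_of_rel[OF iE iH]) (rule partial_rel_transfer[OF t1 X fd E H mn'])
  qed
  show "dense_subset (norm_topology X) (Norms_in X E) (Norms_in X Ehat)"
    unfolding top by (rule dense_subset_metric[OF om subE sub]) (metis Norms_in_dense[OF E lim XV fd])
qed

section \<open>Banach--Mazur compacta\<close>

lemma orbit_self: "vec_space V \<Longrightarrow> m \<in> Norms V \<Longrightarrow> m \<in> orbit V m"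
  by (rule iffD2[OF orbit_iff]) (auto intro!: bexI[OF _ GL_id])

lemma orbit_subset: "vec_space V \<Longrightarrow> m \<in> Norms V \<Longrightarrow> orbit V m \<subseteq> Norms V"
  using orbit_iff by blast

lemma orbitE:
  assumes "vec_space V" "m \<in> Norms V" "n \<in> orbit V m"
  obtains \<Delta> where "n \<in> Norms V" "\<Delta> \<in> GL V" "\<And>x. x \<in> vcarrier V \<Longrightarrow> n (\<Delta> x) = m x"
    "\<And>x. x \<in> vcarrier V \<Longrightarrow> m (inv_into (vcarrier V) \<Delta> x) = n x"
proof -
  obtain \<Delta> where *: "n \<in> Norms V" "\<Delta> \<in> GL V" "\<forall>x\<in>vcarrier V. n (\<Delta> x) = m x"
    using assms orbit_iff by blast
  then have "m (inv_into (vcarrier V) \<Delta> x) = n x" if "x \<in> vcarrier V" for x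
    using GL_D(6,7)[OF *(2) that] by metis
  then show thesis using * that by blast
qed

lemma orbitI:
  "vec_space V \<Longrightarrow> m \<in> Norms V \<Longrightarrow> n \<in> Norms V \<Longrightarrow> \<Delta> \<in> GL V \<Longrightarrow> (\<And>x. x \<in> vcarrier V \<Longrightarrow> n (\<Delta> x) = m x) \<Longrightarrow>
    n \<in> orbit V m"
  unfolding orbit_iff by blast

lemma orbit_sym:
  assumes V: "vec_space V" and m: "m \<in> Norms V" and n: "n \<in> orbit V m"
  shows "m \<in> orbit V n"
proof -
  obtain \<Delta> where D: "n \<in> Norms V" "\<Delta> \<in> GL V" "\<And>x. x \<in> vcarrier V \<Longrightarrow> m (inv_into (vcarrier V) \<Delta> x) = n x"
    using orbitE[OF assms] by metis
  show ?thesis by (rule orbitI[OF V D(1) m GL_inv[OF V D(2)] D(3)])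
qed

lemma orbit_trans:
  assumes V: "vec_space V" and m: "m \<in> Norms V" and n: "n \<in> orbit V m" and p: "p \<in> orbit V n"
  shows "p \<in> orbit V m"
proof -
  obtain \<Delta> where D: "n \<in> Norms V" "\<Delta> \<in> GL V" "\<And>x. x \<in> vcarrier V \<Longrightarrow> n (\<Delta> x) = m x"
    using orbitE[OF V m n] by metis
  obtain \<Gamma> where G: "p \<in> Norms V" "\<Gamma> \<in> GL V" "\<And>x. x \<in> vcarrier V \<Longrightarrow> p (\<Gamma> x) = n x"
    using orbitE[OF V D(1) p] by metis
  show ?thesis by (rule orbitI[OF V m G(1) GL_comp[OF G(2) D(2)]]) (simp add: G(3) D(3) GL_D(4)[OF D(2)])
qed

lemma orbit_eq:
  assumes V: "vec_space V" and m: "m \<in> Norms V" and n: "n \<in> orbit V m"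
  shows "orbit V n = orbit V m"
proof -
  have nN: "n \<in> Norms V" using orbit_subset[OF V m] n by blast
  show ?thesis using orbit_trans[OF V m n] orbit_trans[OF V nN orbit_sym[OF V m n]] by blast
qed

text \<open>The general linear group acts by isometries of \<open>\<omega>\<close>.\<close>

lemma omega_orbit:
  fixes V :: "('k::rc_scalar, 'v::ab_group_add, 'z) vspace_scheme"
  assumes V: "vec_space V" and fd: "fin_dim V" and m: "m \<in> Norms V" and n: "n \<in> Norms V"
    and m': "m' \<in> Norms V" and n': "n' \<in> Norms V" and D: "\<Delta> \<in> GL V"
    and eq: "\<And>x. x \<in> vcarrier V \<Longrightarrow> m' (\<Delta> x) = m x" "\<And>x. x \<in> vcarrier V \<Longrightarrow> n' (\<Delta> x) = n x"
  shows "omega V m' n' \<le> omega V m n"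
proof -
  have near: "norm_near V (omega V m n) m n" by (rule omega_near[OF V fd NormsD(1)[OF m] NormsD(1)[OF n] order_refl])
  have "norm_near V (omega V m n) m' n'"
    unfolding norm_near_def
  proof
    fix y assume y: "y \<in> vcarrier V"
    let ?x = "inv_into (vcarrier V) \<Delta> y"
    have "?x \<in> vcarrier V" "m' y = m ?x" "n' y = n ?x"
      using eq[of ?x] GL_D(6,7)[OF D y] by auto
    then show "m' y \<le> exp (omega V m n) * n' y \<and> n' y \<le> exp (omega V m n) * m' y"
      using near by (simp add: norm_near_def)
  qed
  then show ?thesis
    using omega_le_iff(2)[OF V fd NormsD(1)[OF m'] NormsD(1)[OF n'] omega_le_iff(1)[OF V fd NormsD(1)[OF m] NormsD(1)[OF n]]]
    by blast
qed

lemma norm_near_limit: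
  assumes near: "\<And>j. norm_near V (e j) (p j) (q j)" and e: "e \<longlonglongrightarrow> 0"
    and x: "\<And>j. x j \<in> vcarrier V" and p: "(\<lambda>j::nat. p j (x j)) \<longlonglongrightarrow> a" and q: "(\<lambda>j. q j (x j)) \<longlonglongrightarrow> b"
  shows "a = b"
proof -
  have ee: "(\<lambda>j. exp (e j)) \<longlonglongrightarrow> exp 0" by (rule tendsto_exp[OF e])
  have 1: "p j (x j) \<le> exp (e j) * q j (x j)" "q j (x j) \<le> exp (e j) * p j (x j)" for j
    using near[of j] x[of j] by (auto simp: norm_near_def)
  have "a \<le> exp 0 * b" by (rule LIMSEQ_le[OF p tendsto_mult[OF ee q]]) (use 1 in auto)
  moreover have "b \<le> exp 0 * a" by (rule LIMSEQ_le[OF q tendsto_mult[OF ee p]]) (use 1 in auto)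
  ultimately show ?thesis by simp
qed

text \<open>Isomorphisms that carry \<open>n\<close> to norms closer and closer to \<open>m\<close> subconverge to one that carries \<open>n\<close> to
  \<open>m\<close>.\<close>

lemma orbit_separated:
  fixes V :: "('k::rc_scalar, 'v::ab_group_add, 'z) vspace_scheme"
  assumes V: "vec_space V" and fd: "fin_dim V" and m: "m \<in> Norms V" and n: "n \<in> Norms V"
    and near: "\<And>e. e > 0 \<Longrightarrow> \<exists>n'\<in>orbit V n. omega V m n' < e"
  shows "orbit V m = orbit V n"
proof -
  define e where "e j = inverse (real (Suc j))" for j
  have e: "e j > 0" "e j \<le> 1" for j by (auto simp: e_def divide_simps)
  have "\<forall>j. \<exists>n'\<in>orbit V n. omega V m n' < e j" using near e by blast
  then obtain n' where n': "\<And>j. n' j \<in> orbit V n" "\<And>j. omega V m (n' j) < e j" by metis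
  have "\<forall>j. \<exists>\<Delta>. n' j \<in> Norms V \<and> \<Delta> \<in> GL V \<and> (\<forall>x\<in>vcarrier V. n' j (\<Delta> x) = n x)"
    using n'(1) orbit_iff[OF V n] by blast
  then obtain \<Delta> where D: "\<And>j. n' j \<in> Norms V" "\<And>j. \<Delta> j \<in> GL V" "\<And>j x. x \<in> vcarrier V \<Longrightarrow> n' j (\<Delta> j x) = n x" by metis
  have nr: "norm_near V (e j) m (n' j)" for j
    by (rule omega_near[OF V fd NormsD(1)[OF m] NormsD(1)[OF D(1)]]) (use n'(2)[of j] in simp)
  have bd: "m (\<Delta> j x) \<le> exp 1 * n x" if x: "x \<in> vcarrier V" for j x
  proof -
    have "m (\<Delta> j x) \<le> exp (e j) * n x" using nr[of j] GL_D(4)[OF D(2) x, of j] D(3)[OF x, of j] unfolding norm_near_def by metis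
    also have "\<dots> \<le> exp 1 * n x" using e is_normD(1)[OF NormsD(1)[OF n] x] by (intro mult_right_mono) auto
    finally show ?thesis .
  qed
  obtain r \<Gamma> where r: "strict_mono (r :: nat \<Rightarrow> nat)" and \<Gamma>: "lin_map V V \<Gamma>"
    and lim: "\<And>p x. is_norm V p \<Longrightarrow> x \<in> vcarrier V \<Longrightarrow> (\<lambda>j. p (\<Delta> (r j) x)) \<longlonglongrightarrow> p (\<Gamma> x)"
    by (rule bounded_maps_limit[where T = \<Delta>, OF V fd NormsD(1)[OF m] GL_D(1)[OF D(2)] bd])
      (assumption, rule that)
  have er: "(\<lambda>j. e (r j)) \<longlonglongrightarrow> 0"
    using LIMSEQ_subseq_LIMSEQ[OF LIMSEQ_inverse_real_of_nat r] by (simp add: comp_def e_def)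
  have eq: "m (\<Gamma> x) = n x" if x: "x \<in> vcarrier V" for x
    by (rule norm_near_limit[of V "\<lambda>j. e (r j)" "\<lambda>_. m" "\<lambda>j. n' (r j)" "\<lambda>j. \<Delta> (r j) x"])
      (use nr er GL_D(4)[OF D(2) x] lim[OF NormsD(1)[OF m] x] D(3)[OF x] in auto)
  have "inj_on \<Gamma> (vcarrier V)"
    unfolding lin_map_inj_on_iff[OF V \<Gamma>]
    using eq is_normD(2)[OF NormsD(1)[OF n]] norm_algebra(1)[OF V NormsD(1)[OF m]] by metis
  then have "m \<in> orbit V n" using orbitI[OF V n m GL_injI[OF V fd \<Gamma>] eq] by blast
  then show ?thesis by (rule orbit_eq[OF V n])
qed

text \<open>The quotient metric for the quotient topology of the Banach--Mazur compactum.\<close>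

definition BM_omega :: "('k::real_normed_field, 'v::ab_group_add, 'z) vspace_scheme \<Rightarrow>
    ('v \<Rightarrow> real) set \<Rightarrow> ('v \<Rightarrow> real) set \<Rightarrow> real" where
  "BM_omega V P Q = Inf {omega V m n | m n. m \<in> P \<and> n \<in> Q}"

lemma BM_omega_metric:
  fixes V :: "('k::rc_scalar, 'v::ab_group_add, 'z) vspace_scheme"
  assumes V: "vec_space V" and fd: "fin_dim V"
  shows "\<And>m n r. m \<in> Norms V \<Longrightarrow> n \<in> Norms V \<Longrightarrow>
      BM_omega V (orbit V m) (orbit V n) < r \<longleftrightarrow> (\<exists>n'\<in>orbit V n. omega V m n' < r)"
    "Metric_space (orbit V ` Norms V) (dist_on (orbit V ` Norms V) (BM_omega V))"
    "quotient_topology (norm_topology V) (orbit V) = metric_topology (orbit V ` Norms V) (BM_omega V)"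
proof -
  have BM: "BM_omega V = (\<lambda>P Q. Inf {omega V p q | p q. p \<in> P \<and> q \<in> Q})" by (intro ext) (simp add: BM_omega_def)
  have inv: "\<exists>q'\<in>orbit V q. omega V p' q' \<le> omega V p q"
    if p: "p \<in> Norms V" and q: "q \<in> Norms V" and p': "p' \<in> orbit V p" for p q p'
  proof -
    obtain \<Delta> where D: "p' \<in> Norms V" "\<Delta> \<in> GL V" "\<And>x. x \<in> vcarrier V \<Longrightarrow> p' (\<Delta> x) = p x"
      using orbitE[OF V p p'] by metis
    have q': "act V \<Delta> q \<in> orbit V q" using D(2) by (simp add: orbit_def)
    have "act V \<Delta> q (\<Delta> x) = q x" if "x \<in> vcarrier V" for x using GL_D(4,5)[OF D(2) that] by (simp add: act_def)
    then have "omega V p' (act V \<Delta> q) \<le> omega V p q"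
      using orbit_subset[OF V q] q' by (intro omega_orbit[OF V fd p q D(1) _ D(2,3)]) auto
    then show ?thesis using q' by blast
  qed
  note om = orbit_metric[OF omega_metric[OF V fd], of "orbit V", OF orbit_self[OF V] orbit_subset[OF V] orbit_eq[OF V] inv
    orbit_separated[OF V fd]]
  show "BM_omega V (orbit V m) (orbit V n) < r \<longleftrightarrow> (\<exists>n'\<in>orbit V n. omega V m n' < r)"
    if "m \<in> Norms V" "n \<in> Norms V" for m n r
    unfolding BM by (rule om(1)) (use that in auto)
  show "Metric_space (orbit V ` Norms V) (dist_on (orbit V ` Norms V) (BM_omega V))"
    unfolding BM by (rule om(2)) auto
  show "quotient_topology (norm_topology V) (orbit V) = metric_topology (orbit V ` Norms V) (BM_omega V)"
    unfolding norm_topology_eq_omega[OF V fd] BM by (rule om(3)) auto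
qed

lemma Emb_orbit:
  assumes D: "\<Delta> \<in> GL V" and eq: "\<And>x. x \<in> vcarrier V \<Longrightarrow> n (\<Delta> x) = m x"
  shows "U \<in> Emb (with_norm V n) F \<Longrightarrow> (\<lambda>x. U (\<Delta> x)) \<in> Emb (with_norm V m) F"
  using lin_map_comp[OF GL_D(1)[OF D], of F U] GL_D(4)[OF D] eq by (simp add: Emb_def)

lemma Norms_in_orbit:
  assumes V: "vec_space V" and m: "m \<in> Norms_in V F" and n: "n \<in> orbit V m"
  shows "n \<in> Norms_in V F"
proof -
  obtain \<Delta> where D: "n \<in> Norms V" "\<Delta> \<in> GL V" "\<And>x. x \<in> vcarrier V \<Longrightarrow> m (inv_into (vcarrier V) \<Delta> x) = n x"
    using orbitE[OF V Norms_inD(1)[OF m] n] by metis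
  obtain T where "T \<in> Emb (with_norm V m) F" using Norms_inD(2)[OF m] by blast
  from Emb_orbit[OF GL_inv[OF V D(2)] D(3) this] show ?thesis using D(1) by (auto simp: Norms_in_def)
qed

text \<open>One half of the condition that the unit balls of the images of \<open>(V, m)\<close> under \<open>T\<close> and of \<open>(V, n)\<close>
  under \<open>U\<close> have Hausdorff distance at most \<open>C\<close>.\<close>

definition ball_near ::
    "('k, 'v, 'z) vspace_scheme \<Rightarrow> ('k, 'w::ab_group_add) nspace \<Rightarrow> ('v \<Rightarrow> 'w) \<Rightarrow> ('v \<Rightarrow> real) \<Rightarrow>
     ('v \<Rightarrow> 'w) \<Rightarrow> ('v \<Rightarrow> real) \<Rightarrow> real \<Rightarrow> bool" where
  "ball_near V F T m U n C \<longleftrightarrow>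
     (\<forall>x\<in>vcarrier V. m x \<le> 1 \<longrightarrow> (\<exists>y\<in>vcarrier V. n y \<le> 1 \<and> vnorm F (T x - U y) \<le> C))"

text \<open>The two subspaces are images of embeddings of norms from the given classes. Fixed representatives
  serve for all choices of subspaces, as \<open>gamma_rel_orbits\<close> shows.\<close>

definition gamma_rel ::
    "('k::real_normed_field, 'v::ab_group_add, 'z) vspace_scheme \<Rightarrow> ('k, 'w::ab_group_add) nspace \<Rightarrow> real \<Rightarrow>
     ('v \<Rightarrow> real) \<Rightarrow> ('v \<Rightarrow> real) \<Rightarrow> bool" where
  "gamma_rel V F C m n \<longleftrightarrow> (\<exists>T\<in>Emb (with_norm V m) F. \<exists>U\<in>Emb (with_norm V n) F.
     ball_near V F T m U n C \<and> ball_near V F U n T m C)"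

lemma gamma_rel_sym: "gamma_rel V F C m n \<Longrightarrow> gamma_rel V F C n m"
  unfolding gamma_rel_def by blast

text \<open>A change of coordinates is absorbed by the embedding.\<close>

lemma gamma_rel_orbit_left:
  assumes V: "vec_space V" and m: "m \<in> Norms V" and m': "m' \<in> orbit V m" and R: "gamma_rel V F C m n"
  shows "gamma_rel V F C m' n"
proof -
  obtain \<Delta> where D: "m' \<in> Norms V" "\<Delta> \<in> GL V" "\<And>x. x \<in> vcarrier V \<Longrightarrow> m' (\<Delta> x) = m x"
    "\<And>x. x \<in> vcarrier V \<Longrightarrow> m (inv_into (vcarrier V) \<Delta> x) = m' x"
    using orbitE[OF V m m'] by metis
  obtain T U where T: "T \<in> Emb (with_norm V m) F" and U: "U \<in> Emb (with_norm V n) F"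
    and b: "ball_near V F T m U n C" "ball_near V F U n T m C" using R unfolding gamma_rel_def by blast
  let ?T = "\<lambda>x. T (inv_into (vcarrier V) \<Delta> x)"
  have T': "?T \<in> Emb (with_norm V m') F" by (rule Emb_orbit[OF GL_inv[OF V D(2)] D(4) T])
  have "ball_near V F ?T m' U n C"
    using b(1) D(4) GL_D(7)[OF D(2)] unfolding ball_near_def by metis
  moreover have "ball_near V F U n ?T m' C"
    unfolding ball_near_def
  proof (intro ballI impI)
    fix y assume "y \<in> vcarrier V" "n y \<le> 1"
    then obtain x where x: "x \<in> vcarrier V" "m x \<le> 1" "vnorm F (U y - T x) \<le> C" using b(2) unfolding ball_near_def by blast
    then show "\<exists>z\<in>vcarrier V. m' z \<le> 1 \<and> vnorm F (U y - ?T z) \<le> C"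
      using D(3)[OF x(1)] GL_D(4,5)[OF D(2) x(1)] by (intro bexI[of _ "\<Delta> x"]) auto
  qed
  ultimately show ?thesis unfolding gamma_rel_def using T' U by (intro bexI[OF _ T'] bexI[OF _ U]) simp
qed

lemma gamma_rel_orbits:
  assumes V: "vec_space V" and m: "m \<in> Norms V" and n: "n \<in> Norms V"
  shows "(\<exists>m'\<in>orbit V m. \<exists>n'\<in>orbit V n. gamma_rel V F C m' n') \<longleftrightarrow> gamma_rel V F C m n"
proof
  assume "\<exists>m'\<in>orbit V m. \<exists>n'\<in>orbit V n. gamma_rel V F C m' n'"
  then obtain m' n' where m': "m' \<in> orbit V m" and n': "n' \<in> orbit V n" and R: "gamma_rel V F C m' n'" by blast
  have N: "m' \<in> Norms V" "n' \<in> Norms V" using orbit_subset[OF V] m n m' n' by blast+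
  have "gamma_rel V F C m n'" by (rule gamma_rel_orbit_left[OF V N(1) orbit_sym[OF V m m'] R])
  then have "gamma_rel V F C n m" by (rule gamma_rel_orbit_left[OF V N(2) orbit_sym[OF V n n'] gamma_rel_sym])
  then show "gamma_rel V F C m n" by (rule gamma_rel_sym)
next
  assume "gamma_rel V F C m n"
  then show "\<exists>m'\<in>orbit V m. \<exists>n'\<in>orbit V n. gamma_rel V F C m' n'" using orbit_self[OF V] m n by blast
qed

lemma ball_dist_of_ball_near:
  assumes F: "normed_space F" and V: "vec_space V" and k: "has_dim V k" and m: "is_norm V m" and n: "is_norm V n"
    and T: "T \<in> Emb (with_norm V m) F" and U: "U \<in> Emb (with_norm V n) F"
    and b: "ball_near V F T m U n C" "ball_near V F U n T m C"
  shows "ball_dist F (F\<lparr>vcarrier := T ` vcarrier V\<rparr>) (F\<lparr>vcarrier := U ` vcarrier V\<rparr>) \<le> C"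
proof (rule ball_dist_le[OF F])
  show "F\<lparr>vcarrier := T ` vcarrier V\<rparr> \<in> Age F" "F\<lparr>vcarrier := U ` vcarrier V\<rparr> \<in> Age F"
    using Emb_image_Age(1)[OF F normed_space_with_norm[OF V m] _ T] Emb_image_Age(1)[OF F normed_space_with_norm[OF V n] _ U] k
    by auto
  have *: "\<exists>y\<in>unit_ball (F\<lparr>vcarrier := Q ` vcarrier V\<rparr>). vnorm F (x - y) \<le> C"
    if P: "P \<in> Emb (with_norm V p) F" and Q: "Q \<in> Emb (with_norm V q) F" and b: "ball_near V F P p Q q C"
      and x: "x \<in> unit_ball (F\<lparr>vcarrier := P ` vcarrier V\<rparr>)" for P Q p q x
  proof -
    obtain z where z: "z \<in> vcarrier V" "x = P z" "p z \<le> 1" using x EmbD(2)[OF P] by (auto simp: unit_ball_def)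
    then obtain y where y: "y \<in> vcarrier V" "q y \<le> 1" "vnorm F (P z - Q y) \<le> C" using b unfolding ball_near_def by blast
    then show ?thesis using z EmbD(2)[OF Q, of y] by (intro bexI[of _ "Q y"]) (auto simp: unit_ball_def)
  qed
  show "\<exists>y\<in>unit_ball (F\<lparr>vcarrier := U ` vcarrier V\<rparr>). vnorm F (x - y) \<le> C"
    if "x \<in> unit_ball (F\<lparr>vcarrier := T ` vcarrier V\<rparr>)" for x by (rule *[OF T U b(1) that])
  show "\<exists>y\<in>unit_ball (F\<lparr>vcarrier := T ` vcarrier V\<rparr>). vnorm F (x - y) \<le> C"
    if "x \<in> unit_ball (F\<lparr>vcarrier := U ` vcarrier V\<rparr>)" for x by (rule *[OF U T b(2) that])
qed

lemma gamma_dist_less_iff: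
  fixes F :: "('k::rc_scalar, 'w::ab_group_add) nspace" and m n :: "(nat \<Rightarrow> 'k) \<Rightarrow> real" and k :: nat
  defines "V \<equiv> coord_space k :: ('k, nat \<Rightarrow> 'k) vspace"
  assumes F: "normed_space F" and m: "m \<in> Norms_in V F" and n: "n \<in> Norms_in V F"
  shows "gamma_dist k F (orbit V m) (orbit V n) < r \<longleftrightarrow> (\<exists>C. 0 \<le> C \<and> C < r \<and> gamma_rel V F C m n)"
proof -
  have V: "vec_space V" and k: "has_dim V k" unfolding V_def by (rule vec_space_coord_space has_dim_coord_space)+
  note mN = Norms_inD(1)[OF m] and nN = Norms_inD(1)[OF n]
  note FN = normed_spaceD[OF F]
  define good where "good U P \<longleftrightarrow> U \<in> Age F \<and> has_dim U k \<and> (\<exists>m\<in>P. isometric U (with_norm V m))" for U P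
  let ?S = "{ball_dist F U W | U W. good U (orbit V m) \<and> good W (orbit V n)}"
  have gd: "gamma_dist k F (orbit V m) (orbit V n) = Inf ?S"
    unfolding gamma_dist_def V_def[symmetric] good_def by (rule arg_cong[of _ _ Inf]) blast
  have goodI: "good (F\<lparr>vcarrier := T ` vcarrier V\<rparr>) (orbit V p)"
    if p: "p \<in> Norms V" and T: "T \<in> Emb (with_norm V p) F" for T p
  proof -
    have Vp: "normed_space (with_norm V p)" by (rule normed_space_with_norm[OF V NormsD(1)[OF p]])
    have "inv_into (vcarrier V) T \<in> Emb (F\<lparr>vcarrier := T ` vcarrier V\<rparr>) (with_norm V p)"
      using Emb_inv[OF Vp F T] by simp
    moreover have "inv_into (vcarrier V) T ` (T ` vcarrier V) = vcarrier V"
      using Emb_inj[OF Vp F T] by simp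
    ultimately have "isometric (F\<lparr>vcarrier := T ` vcarrier V\<rparr>) (with_norm V p)"
      unfolding isometric_def by (intro bexI) auto
    then show ?thesis unfolding good_def using Emb_image_Age[OF F Vp _ T] k orbit_self[OF V p] by auto
  qed
  have goodE: "\<exists>p\<in>P. \<exists>T\<in>Emb (with_norm V p) F. T ` vcarrier V = vcarrier U"
    if g: "good U P" and P: "P \<subseteq> Norms V" for U P
  proof -
    obtain p where p: "p \<in> P" "isometric U (with_norm V p)" and U: "U \<in> Age F" using g unfolding good_def by blast
    have Vp: "normed_space (with_norm V p)" using p P by (intro normed_space_with_norm[OF V NormsD(1)]) auto
    obtain b where b: "b \<in> Emb (with_norm V p) U" "b ` vcarrier V = vcarrier U"
      using isometric_Emb[OF AgeD(1)[OF F U] Vp p(2)] by (metis with_norm_sel(1))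
    show ?thesis using p(1) Emb_Age[OF b(1) U] b(2) by blast
  qed
  have nonneg: "0 \<le> ball_dist F U W" if "good U P" "good W Q" for U W P Q
  proof (rule ccontr)
    assume "\<not> 0 \<le> ball_dist F U W"
    then have lt: "ball_dist F U W < 0" by simp
    have U: "U \<in> Age F" and W: "W \<in> Age F" using that unfolding good_def by auto
    obtain y where "y \<in> unit_ball W" "vnorm F (0 - y) < 0"
      using ball_distD(1)[OF F U W lt zero_in_unit_ball[OF AgeD(1)[OF F U]]] by blast
    moreover from this have "y \<in> vcarrier F" using AgeD(3)[OF F W] by (auto simp: unit_ball_def)
    ultimately show False
      using is_normD(1)[OF FN(2) vs_closed(3)[OF FN(1) vs_closed(1)[OF FN(1)]], of y] by simp
  qed
  obtain T0 U0 where "T0 \<in> Emb (with_norm V m) F" "U0 \<in> Emb (with_norm V n) F"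
    using Norms_inD(2)[OF m] Norms_inD(2)[OF n] by blast
  then have "?S \<noteq> {}" using goodI mN nN by blast
  moreover have "bdd_below ?S" using nonneg by (intro bdd_belowI[of _ 0]) auto
  ultimately have "gamma_dist k F (orbit V m) (orbit V n) < r \<longleftrightarrow> (\<exists>s\<in>?S. s < r)" unfolding gd by (rule cInf_less_iff)
  also have "\<dots> \<longleftrightarrow> (\<exists>C. 0 \<le> C \<and> C < r \<and> gamma_rel V F C m n)"
  proof
    assume "\<exists>s\<in>?S. s < r"
    then obtain U W where U: "good U (orbit V m)" and W: "good W (orbit V n)" and lt: "ball_dist F U W < r" by blast
    \<comment> \<open>The infima in the Hausdorff distance need not be attained, so a slightly larger constant is used.\<close>
    define C where "C = (ball_dist F U W + r) / 2"
    have C: "0 \<le> C" "C < r" "ball_dist F U W < C" using nonneg[OF U W] lt by (auto simp: C_def)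
    obtain p T where p: "p \<in> orbit V m" and T: "T \<in> Emb (with_norm V p) F" "T ` vcarrier V = vcarrier U"
      using goodE[OF U orbit_subset[OF V mN]] by blast
    obtain q Q where q: "q \<in> orbit V n" and Q: "Q \<in> Emb (with_norm V q) F" "Q ` vcarrier V = vcarrier W"
      using goodE[OF W orbit_subset[OF V nN]] by blast
    have UA: "U \<in> Age F" and WA: "W \<in> Age F" using U W unfolding good_def by auto
    have "\<exists>y\<in>vcarrier V. q y \<le> 1 \<and> vnorm F (T x - Q y) \<le> C" if x: "x \<in> vcarrier V" "p x \<le> 1" for x
    proof -
      have "T x \<in> unit_ball U" using x T EmbD(2)[OF T(1), of x] AgeD(5)[OF F UA] by (auto simp: unit_ball_def)
      then obtain z where z: "z \<in> unit_ball W" "vnorm F (T x - z) < C" using ball_distD(1)[OF F UA WA C(3)] by blast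
      then obtain y where "y \<in> vcarrier V" "z = Q y" using Q(2) by (auto simp: unit_ball_def)
      then show ?thesis using z EmbD(2)[OF Q(1), of y] AgeD(5)[OF F WA] by (intro bexI[of _ y]) (auto simp: unit_ball_def)
    qed
    moreover have "\<exists>y\<in>vcarrier V. p y \<le> 1 \<and> vnorm F (Q x - T y) \<le> C" if x: "x \<in> vcarrier V" "q x \<le> 1" for x
    proof -
      have "Q x \<in> unit_ball W" using x Q EmbD(2)[OF Q(1), of x] AgeD(5)[OF F WA] by (auto simp: unit_ball_def)
      then obtain z where z: "z \<in> unit_ball U" "vnorm F (Q x - z) < C" using ball_distD(2)[OF F UA WA C(3)] by blast
      then obtain y where "y \<in> vcarrier V" "z = T y" using T(2) by (auto simp: unit_ball_def)
      then show ?thesis using z EmbD(2)[OF T(1), of y] AgeD(5)[OF F UA] by (intro bexI[of _ y]) (auto simp: unit_ball_def)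
    qed
    ultimately have "gamma_rel V F C p q"
      unfolding gamma_rel_def ball_near_def by (intro bexI[OF _ T(1)] bexI[OF _ Q(1)]) simp
    then have "gamma_rel V F C m n" using gamma_rel_orbits[OF V mN nN, of F C] p q by blast
    then show "\<exists>C. 0 \<le> C \<and> C < r \<and> gamma_rel V F C m n" using C by blast
  next
    assume "\<exists>C. 0 \<le> C \<and> C < r \<and> gamma_rel V F C m n"
    then obtain C T U where C: "0 \<le> C" "C < r" and T: "T \<in> Emb (with_norm V m) F" and U: "U \<in> Emb (with_norm V n) F"
      and b: "ball_near V F T m U n C" "ball_near V F U n T m C" unfolding gamma_rel_def by blast
    have "ball_dist F (F\<lparr>vcarrier := T ` vcarrier V\<rparr>) (F\<lparr>vcarrier := U ` vcarrier V\<rparr>) < r"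
      using ball_dist_of_ball_near[OF F V k NormsD(1)[OF mN] NormsD(1)[OF nN] T U b] C by simp
    then show "\<exists>s\<in>?S. s < r" using goodI[OF mN T] goodI[OF nN U] by blast
  qed
  finally show ?thesis .
qed

text \<open>Again the two embeddings of the middle norm are aligned, which costs at most \<open>e\<close> on its unit ball.\<close>

lemma gamma_rel_triangle:
  fixes V :: "('k::rc_scalar, 'v::ab_group_add, 'z) vspace_scheme" and F :: "('k, 'w::ab_group_add) nspace"
  assumes V: "vec_space V" and k: "has_dim V k" and F: "fraisse F" and n: "is_norm V n"
    and R: "gamma_rel V F C m n" and S: "gamma_rel V F D n p" and e: "e > 0"
  shows "gamma_rel V F (C + D + e) m p"
proof -
  have F': "normed_space F" using F by (simp add: fraisse_def banach_space_def)
  note FN = normed_spaceD[OF F']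
  obtain T U where T: "T \<in> Emb (with_norm V m) F" and U: "U \<in> Emb (with_norm V n) F"
    and TU: "ball_near V F T m U n C" "ball_near V F U n T m C" using R unfolding gamma_rel_def by blast
  obtain U' P where U': "U' \<in> Emb (with_norm V n) F" and P: "P \<in> Emb (with_norm V p) F"
    and UP: "ball_near V F U' n P p D" "ball_near V F P p U' n D" using S unfolding gamma_rel_def by blast
  obtain \<delta> where \<delta>: "\<delta> > 0" and al: "\<And>T U. norm_near V \<delta> n n \<Longrightarrow> T \<in> Emb (with_norm V n) F \<Longrightarrow> U \<in> Emb (with_norm V n) F \<Longrightarrow>
      \<exists>g\<in>Emb F F. g ` vcarrier F = vcarrier F \<and> (\<forall>x\<in>vcarrier V. vnorm F (g (U x) - T x) \<le> e * n x)"
    using fraisse_align[OF F e, of k] V k n by metis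
  have "norm_near V \<delta> n n" by (rule norm_near_mono[OF norm_near_refl _ n n]) (use \<delta> in simp)
  from al[OF this U U'] obtain g where g: "g \<in> Emb F F"
    and gU: "\<And>x. x \<in> vcarrier V \<Longrightarrow> vnorm F (g (U' x) - U x) \<le> e * n x" by blast
  have key: "vnorm F (T x - g (P z)) \<le> C + D + e"
    if x: "x \<in> vcarrier V" and y: "y \<in> vcarrier V" "n y \<le> 1" and z: "z \<in> vcarrier V"
      and xy: "vnorm F (T x - U y) \<le> C" and yz: "vnorm F (U' y - P z) \<le> D" for x y z
  proof -
    have mem: "T x \<in> vcarrier F" "U y \<in> vcarrier F" "U' y \<in> vcarrier F" "P z \<in> vcarrier F"
      using EmbD(3)[OF T] EmbD(3)[OF U] EmbD(3)[OF U'] EmbD(3)[OF P] x y z by auto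
    note gm = EmbD(3)[OF g]
    have 1: "vnorm F (g (U' y) - g (P z)) = vnorm F (U' y - P z)"
      using lin_map_algebra(3)[OF FN(1) EmbD(1)[OF g], of "U' y" "P z"] EmbD(2)[OF g vs_closed(3)[OF FN(1)], of "U' y" "P z"] mem by simp
    have eq: "T x - g (P z) = (T x - U y) + ((U y - g (U' y)) + (g (U' y) - g (P z)))" by simp
    have "vnorm F (T x - g (P z)) \<le> vnorm F (T x - U y) + (vnorm F (U y - g (U' y)) + vnorm F (g (U' y) - g (P z)))"
      unfolding eq
      by (rule order_trans[OF is_normD(4)[OF FN(2)] add_left_mono[OF is_normD(4)[OF FN(2)]]])
        (use mem gm vs_closed[OF FN(1)] in auto)
    also have "vnorm F (U y - g (U' y)) = vnorm F (g (U' y) - U y)"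
      using mem gm by (intro norm_algebra(3)[OF FN]) auto
    also have "\<dots> \<le> e * 1" using order_trans[OF gU[OF y(1)] mult_left_mono[OF y(2)]] e by simp
    finally show ?thesis using xy yz 1 by simp
  qed
  have comm: "vnorm F (a - b) = vnorm F (b - a)" if "a \<in> vcarrier F" "b \<in> vcarrier F" for a b
    by (rule norm_algebra(3)[OF FN that])
  have "ball_near V F T m (\<lambda>x. g (P x)) p (C + D + e)"
    using TU(1) UP(1) key unfolding ball_near_def by meson
  moreover have "ball_near V F (\<lambda>x. g (P x)) p T m (C + D + e)"
    unfolding ball_near_def
  proof (intro ballI impI)
    fix z assume z: "z \<in> vcarrier V" "p z \<le> 1"
    then obtain y where y: "y \<in> vcarrier V" "n y \<le> 1" "vnorm F (P z - U' y) \<le> D" using UP(2) unfolding ball_near_def by blast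
    then obtain x where x: "x \<in> vcarrier V" "m x \<le> 1" "vnorm F (U y - T x) \<le> C" using TU(2) unfolding ball_near_def by blast
    have mem: "T x \<in> vcarrier F" "U y \<in> vcarrier F" "U' y \<in> vcarrier F" "P z \<in> vcarrier F" "g (P z) \<in> vcarrier F"
      using EmbD(3)[OF T] EmbD(3)[OF U] EmbD(3)[OF U'] EmbD(3)[OF P] EmbD(3)[OF g] x y z by auto
    have "vnorm F (T x - g (P z)) \<le> C + D + e"
      by (rule key[OF x(1) y(1,2) z(1)]) (use x(3) y(3) comm mem in auto)
    then show "\<exists>x\<in>vcarrier V. m x \<le> 1 \<and> vnorm F (g (P z) - T x) \<le> C + D + e" using x comm mem by metis
  qed
  ultimately show ?thesis unfolding gamma_rel_def by (intro bexI[OF _ T] bexI[OF _ Emb_comp[OF P g]]) simp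
qed

lemma norm_diff_three:
  assumes "normed_space F" "a \<in> vcarrier F" "b \<in> vcarrier F" "c \<in> vcarrier F"
  shows "vnorm F (a - c) \<le> vnorm F (a - b) + vnorm F (b - c)"
  using is_normD(4)[OF normed_spaceD(2)[OF assms(1)], of "a - b" "b - c"] vs_closed(3)[OF normed_spaceD(1)[OF assms(1)]] assms
  by simp

lemma shrink_norm:
  fixes V :: "('k::real_normed_field, 'v::ab_group_add, 'z) vspace_scheme"
  assumes V: "vec_space V" and p: "is_norm V p" and r: "r \<ge> 0" and x: "x \<in> vcarrier V"
  defines "y \<equiv> vscale V (of_real (exp (- r)) :: 'k) x"
  shows "y \<in> vcarrier V" "p y = exp (- r) * p x" "p (x - y) = (1 - exp (- r)) * p x"
proof -
  show "y \<in> vcarrier V" unfolding y_def by (rule vs_closed(5)[OF V x])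
  show "p y = exp (- r) * p x" unfolding y_def by (simp add: is_normD(3)[OF p x])
  have "x - y = vscale V (of_real (1 - exp (- r))) x" unfolding y_def by (simp add: vs_algebra[OF V])
  then have "p (x - y) = norm (of_real (1 - exp (- r)) :: 'k) * p x" using is_normD(3)[OF p x] by simp
  then show "p (x - y) = (1 - exp (- r)) * p x" unfolding norm_of_real using r by simp
qed

text \<open>A vector of the unit ball of \<open>p\<close> is shrunk by \<open>exp (- r)\<close> to lie in the unit ball of \<open>q\<close>; this
  moves it by at most \<open>exp r - 1\<close>.\<close>

lemma ball_near_of_close:
  fixes V :: "('k::rc_scalar, 'v::ab_group_add, 'z) vspace_scheme" and F :: "('k, 'w::ab_group_add) nspace"
  assumes V: "vec_space V" and F: "normed_space F" and P: "P \<in> Emb (with_norm V p) F" and Q: "Q \<in> Emb (with_norm V q) F"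
    and q: "is_norm V q" and r: "r \<ge> 0" and pq: "\<And>x. x \<in> vcarrier V \<Longrightarrow> q x \<le> exp r * p x"
    and d: "\<And>x. x \<in> vcarrier V \<Longrightarrow> p x \<le> 1 \<Longrightarrow> vnorm F (P x - Q x) \<le> d" and C: "d + (exp r - 1) \<le> C"
  shows "ball_near V F P p Q q C"
  unfolding ball_near_def
proof (intro ballI impI)
  fix x assume x: "x \<in> vcarrier V" "p x \<le> 1"
  let ?y = "vscale V (of_real (exp (- r))) x"
  note sh = shrink_norm[OF V q r x(1)]
  note PF = EmbD(3)[OF P, simplified] and QF = EmbD(3)[OF Q, simplified]
  have qx: "q x \<le> exp r" using order_trans[OF pq[OF x(1)] mult_left_mono[OF x(2), of "exp r"]] by simp
  have "exp (- r) * q x \<le> exp (- r) * exp r" using qx by simp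
  then have qy: "q ?y \<le> 1" using sh(2) by (simp flip: exp_add)
  have "vnorm F (P x - Q ?y) \<le> vnorm F (P x - Q x) + vnorm F (Q x - Q ?y)"
    by (rule norm_diff_three[OF F PF[OF x(1)] QF[OF x(1)] QF[OF sh(1)]])
  also have "vnorm F (Q x - Q ?y) = (1 - exp (- r)) * q x"
    using lin_map_algebra(3)[OF V _ x(1) sh(1), of F Q] EmbD(1)[OF Q] EmbD(2)[OF Q, of "x - ?y"]
      vs_closed(3)[OF V x(1) sh(1)] sh(3) by simp
  also have "\<dots> \<le> (1 - exp (- r)) * exp r" using qx r by (intro mult_left_mono) auto
  also have "\<dots> = exp r - 1" by (simp add: algebra_simps flip: exp_add)
  finally have "vnorm F (P x - Q ?y) \<le> C" using d[OF x] C by linarith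
  then show "\<exists>y\<in>vcarrier V. q y \<le> 1 \<and> vnorm F (P x - Q y) \<le> C" using qy sh(1) by blast
qed

text \<open>After alignment the embeddings differ by at most \<open>e / 2\<close> on either unit ball, and the other half is
  spent on passing from one unit ball to the other one.\<close>

lemma gamma_rel_of_omega:
  fixes V :: "('k::rc_scalar, 'v::ab_group_add, 'z) vspace_scheme" and F :: "('k, 'w::ab_group_add) nspace"
  assumes V: "vec_space V" and k: "has_dim V k" and F: "fraisse F" and m: "m \<in> Norms_in V F" and e: "e > 0"
  shows "\<exists>\<delta>>0. \<forall>n\<in>Norms_in V F. omega V m n < \<delta> \<longrightarrow> gamma_rel V F e m n"
proof -
  have F': "normed_space F" using F by (simp add: fraisse_def banach_space_def)
  note FN = normed_spaceD[OF F']
  have fd: "fin_dim V" using k by (auto simp: fin_dim_def)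
  note mn = NormsD(1)[OF Norms_inD(1)[OF m]]
  obtain \<delta>1 where \<delta>1: "\<delta>1 > 0" and al: "\<And>n T U. is_norm V n \<Longrightarrow> norm_near V \<delta>1 m n \<Longrightarrow>
      T \<in> Emb (with_norm V m) F \<Longrightarrow> U \<in> Emb (with_norm V n) F \<Longrightarrow>
      \<exists>g\<in>Emb F F. g ` vcarrier F = vcarrier F \<and> (\<forall>x\<in>vcarrier V. vnorm F (g (U x) - T x) \<le> e / 4 * n x)"
    using fraisse_align[OF F, of "e / 4" k] V k mn e by (metis divide_pos_pos zero_less_numeral)
  define r where "r = min \<delta>1 (min (ln 2) (ln (1 + e / 2)))"
  have r: "r > 0" "r \<le> \<delta>1" using \<delta>1 e by (auto simp: r_def)
  have "exp r \<le> exp (ln 2)" "exp r \<le> exp (ln (1 + e / 2))" unfolding exp_le_cancel_iff by (auto simp: r_def)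
  then have er: "exp r \<le> 2" "exp r - 1 \<le> e / 2" using e by auto
  show ?thesis
  proof (intro exI conjI ballI impI)
    show "r > 0" by fact
    fix n assume n: "n \<in> Norms_in V F" and lt: "omega V m n < r"
    note nn = NormsD(1)[OF Norms_inD(1)[OF n]]
    have near: "norm_near V r m n" by (rule omega_near[OF V fd mn nn]) (use lt in simp)
    have nr: "m x \<le> exp r * n x" "n x \<le> exp r * m x" if "x \<in> vcarrier V" for x using near that by (auto simp: norm_near_def)
    obtain T U where T: "T \<in> Emb (with_norm V m) F" and U: "U \<in> Emb (with_norm V n) F"
      using Norms_inD(2)[OF m] Norms_inD(2)[OF n] by blast
    obtain g where g: "g \<in> Emb F F" and gU: "\<And>x. x \<in> vcarrier V \<Longrightarrow> vnorm F (g (U x) - T x) \<le> e / 4 * n x"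
      using al[OF nn norm_near_mono[OF near r(2) mn nn] T U] by blast
    have U': "(\<lambda>x. g (U x)) \<in> Emb (with_norm V n) F" by (rule Emb_comp[OF U g])
    note TF = EmbD(3)[OF T, simplified] and UF = EmbD(3)[OF U', simplified]
    have d: "vnorm F (g (U x) - T x) \<le> e / 2" if x: "x \<in> vcarrier V" "n x \<le> 2" for x
    proof -
      have "e / 4 * n x \<le> e / 4 * 2" using x(2) e by (intro mult_left_mono) auto
      then show ?thesis using gU[OF x(1)] by simp
    qed
    have "ball_near V F T m (\<lambda>x. g (U x)) n e"
    proof (rule ball_near_of_close[OF V F' T U' nn less_imp_le[OF r(1)] nr(2)])
      fix x assume x: "x \<in> vcarrier V" "m x \<le> 1"
      have "n x \<le> exp r * 1" by (rule order_trans[OF nr(2)[OF x(1)] mult_left_mono[OF x(2)]]) simp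
      then show "vnorm F (T x - g (U x)) \<le> e / 2"
        using d[OF x(1)] er norm_algebra(3)[OF FN TF[OF x(1)] UF[OF x(1)]] by simp
    qed (use er in auto)
    moreover have "ball_near V F (\<lambda>x. g (U x)) n T m e"
      by (rule ball_near_of_close[OF V F' U' T mn less_imp_le[OF r(1)] nr(1), where d = "e / 2"]) (use d er in auto)
    ultimately show "gamma_rel V F e m n" unfolding gamma_rel_def by (intro bexI[OF _ T] bexI[OF _ U']) simp
  qed
qed

text \<open>The perturbed embedding into the image of \<open>U\<close> is injective, hence onto by equality of dimensions. So
  the norm that it induces differs from \<open>n\<close> by a change of coordinates.\<close>

lemma omega_of_gamma_rel:
  fixes V :: "('k::rc_scalar, 'v::ab_group_add, 'z) vspace_scheme" and F :: "('k, 'w::ab_group_add) nspace"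
  assumes V: "vec_space V" and k: "has_dim V k" and F: "normed_space F" and m: "m \<in> Norms V" and e: "e > 0"
  shows "\<exists>\<delta>>0. \<forall>n\<in>Norms V. \<forall>C<\<delta>. gamma_rel V F C m n \<longrightarrow> (\<exists>n'\<in>orbit V n. omega V m n' < e)"
proof -
  have fd: "fin_dim V" using k by (auto simp: fin_dim_def)
  note mn = NormsD(1)[OF m]
  obtain \<delta> where \<delta>: "\<delta> > 0" and near: "\<And>T W. T \<in> Emb (with_norm V m) F \<Longrightarrow> W \<in> Age F \<Longrightarrow>
      ball_dist F (F\<lparr>vcarrier := T ` vcarrier V\<rparr>) W < \<delta> \<Longrightarrow>
      \<exists>n\<in>Norms V. omega V m n < e \<and> Emb (with_norm V n) W \<noteq> {}"
    using norm_from_near_subspace[OF V fd mn e] F by metis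
  show ?thesis
  proof (intro exI conjI ballI allI impI)
    show "\<delta> > 0" by fact
    fix n C assume n: "n \<in> Norms V" and C: "C < \<delta>" and R: "gamma_rel V F C m n"
    obtain T U where T: "T \<in> Emb (with_norm V m) F" and U: "U \<in> Emb (with_norm V n) F"
      and b: "ball_near V F T m U n C" "ball_near V F U n T m C" using R unfolding gamma_rel_def by blast
    note Vn = normed_space_with_norm[OF V NormsD(1)[OF n]]
    define W where "W = F\<lparr>vcarrier := U ` vcarrier V\<rparr>"
    have W: "W \<in> Age F" unfolding W_def using Emb_image_Age(1)[OF F Vn _ U] k by auto
    have "ball_dist F (F\<lparr>vcarrier := T ` vcarrier V\<rparr>) W < \<delta>"
      using ball_dist_of_ball_near[OF F V k mn NormsD(1)[OF n] T U b] C by (simp add: W_def)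
    then obtain n' L where n': "n' \<in> Norms V" and lt: "omega V m n' < e" and L': "L \<in> Emb (with_norm V n') W"
      using near[OF T W] by blast
    have L: "lin_map V W L" and Ln: "\<And>x. x \<in> vcarrier V \<Longrightarrow> vnorm F (L x) = n' x"
      using EmbD(1,2)[OF L'] AgeD(5)[OF F W] by auto
    have inj: "inj_on L (vcarrier V)"
      using Emb_inj[OF normed_space_with_norm[OF V NormsD(1)[OF n']] AgeD(1)[OF F W] L'] by simp
    have Uinj: "inj_on U (vcarrier V)" using Emb_inj[OF Vn F U] by simp
    have Ul: "lin_map V F U" using EmbD(1)[OF U] by simp
    \<comment> \<open>Since \<open>L\<close> and \<open>U\<close> have the same image, \<open>n'\<close> belongs to the class of \<open>n\<close>.\<close>
    define \<Delta> where "\<Delta> x = inv_into (vcarrier V) U (L x)" for x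
    have "lin_map W V (inv_into (vcarrier V) U)" unfolding W_def by (rule lin_map_inv_into[OF V Ul Uinj])
    then have \<Delta>l: "lin_map V V \<Delta>" unfolding \<Delta>_def by (rule lin_map_comp[OF L])
    have U\<Delta>: "U (\<Delta> x) = L x" if "x \<in> vcarrier V" for x
      unfolding \<Delta>_def using lin_mapD(1)[OF L that] by (intro f_inv_into_f) (simp add: W_def)
    have "inj_on \<Delta> (vcarrier V)"
      using U\<Delta> inj unfolding inj_on_def by metis
    then have \<Delta>: "\<Delta> \<in> GL V" by (rule GL_injI[OF V fd \<Delta>l])
    have "n \<in> orbit V n'"
    proof (rule orbitI[OF V n' n \<Delta>])
      fix x assume x: "x \<in> vcarrier V"
      show "n (\<Delta> x) = n' x"
        using EmbD(2)[OF U, of "\<Delta> x"] lin_mapD(1)[OF \<Delta>l x] U\<Delta>[OF x] x Ln[OF x] by simp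
    qed
    then show "\<exists>n'\<in>orbit V n. omega V m n' < e" using lt orbit_sym[OF V n'] by blast
  qed
qed

lemma gamma_rel_transfer:
  fixes V :: "('k::rc_scalar, 'v::ab_group_add, 'z) vspace_scheme"
    and F :: "('k, 'w::ab_group_add) nspace" and G :: "('k, 'u::ab_group_add) nspace"
  assumes tr: "transfers F G" and V: "vec_space V" and k: "has_dim V k" and F: "normed_space F" and G: "normed_space G"
    and m: "m \<in> Norms_in V G" and n: "n \<in> Norms_in V G" and C: "C \<ge> 0" and R: "gamma_rel V F C m n" and e: "e > 0"
  shows "gamma_rel V G (C + e) m n"
proof -
  note GN = normed_spaceD[OF G]
  have fd: "fin_dim V" using k by (auto simp: fin_dim_def)
  obtain T U where T: "T \<in> Emb (with_norm V m) F" and U: "U \<in> Emb (with_norm V n) F"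
    and b: "ball_near V F T m U n C" "ball_near V F U n T m C" using R unfolding gamma_rel_def by blast
  define \<epsilon> where "\<epsilon> = e / (C + 2)"
  have \<epsilon>: "\<epsilon> > 0" "\<epsilon> * (C + 2) = e" using e C by (auto simp: \<epsilon>_def)
  obtain Y S T' U' where Y: "Y \<in> Age F" and S: "S \<in> Emb_approx \<epsilon> Y G"
    and sub: "T ` vcarrier V \<subseteq> vcarrier Y" "U ` vcarrier V \<subseteq> vcarrier Y"
    and T': "T' \<in> Emb (with_norm V m) G" "\<And>x. x \<in> vcarrier V \<Longrightarrow> vnorm G (S (T x) - T' x) \<le> \<epsilon> * m x"
    and U': "U' \<in> Emb (with_norm V n) G" "\<And>x. x \<in> vcarrier V \<Longrightarrow> vnorm G (S (U x) - U' x) \<le> \<epsilon> * n x"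
    by (rule transfer_two_embeddings[OF tr V fd F m n T U \<epsilon>(1)]) (rule that)
  note YN = AgeD[OF F Y]
  have key: "vnorm G (P' x - Q' y) \<le> C + e"
    if P: "P ` vcarrier V \<subseteq> vcarrier Y" and P': "P' \<in> Emb (with_norm V p) G" "\<And>x. x \<in> vcarrier V \<Longrightarrow> vnorm G (S (P x) - P' x) \<le> \<epsilon> * p x"
      and Q: "Q ` vcarrier V \<subseteq> vcarrier Y" and Q': "Q' \<in> Emb (with_norm V q) G" "\<And>x. x \<in> vcarrier V \<Longrightarrow> vnorm G (S (Q x) - Q' x) \<le> \<epsilon> * q x"
      and x: "x \<in> vcarrier V" "p x \<le> 1" and y: "y \<in> vcarrier V" "q y \<le> 1" and xy: "vnorm F (P x - Q y) \<le> C"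
    for P P' Q Q' p q x y
  proof -
    have mY: "P x \<in> vcarrier Y" "Q y \<in> vcarrier Y" using P Q x y by auto
    have mS: "S (P x) \<in> vcarrier G" "S (Q y) \<in> vcarrier G" using lin_mapD(1)[OF Emb_approxD(1)[OF S]] mY by auto
    have mG: "P' x \<in> vcarrier G" "Q' y \<in> vcarrier G" using EmbD(3)[OF P'(1)] EmbD(3)[OF Q'(1)] x y by auto
    have "vnorm G (P' x - Q' y) \<le> vnorm G (P' x - S (P x)) + vnorm G (S (P x) - Q' y)"
      by (rule norm_diff_three[OF G mG(1) mS(1) mG(2)])
    also have "vnorm G (S (P x) - Q' y) \<le> vnorm G (S (P x) - S (Q y)) + vnorm G (S (Q y) - Q' y)"
      by (rule norm_diff_three[OF G mS mG(2)])
    also have "vnorm G (P' x - S (P x)) = vnorm G (S (P x) - P' x)" by (rule norm_algebra(3)[OF GN mG(1) mS(1)])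
    also have "S (P x) - S (Q y) = S (P x - Q y)"
      using lin_map_algebra(3)[OF normed_spaceD(1)[OF YN(1)] Emb_approxD(1)[OF S] mY] by simp
    also have "vnorm G (S (P x - Q y)) \<le> (1 + \<epsilon>) * vnorm F (P x - Q y)"
      using Emb_approxD(3)[OF S vs_closed(3)[OF normed_spaceD(1)[OF YN(1)] mY]] YN(5) by simp
    also have "\<dots> \<le> (1 + \<epsilon>) * C" using xy \<epsilon>(1) by (intro mult_left_mono) auto
    also have "vnorm G (S (P x) - P' x) \<le> \<epsilon> * 1"
      by (rule order_trans[OF P'(2)[OF x(1)] mult_left_mono[OF x(2)]]) (use \<epsilon> in simp)
    also have "vnorm G (S (Q y) - Q' y) \<le> \<epsilon> * 1"
      by (rule order_trans[OF Q'(2)[OF y(1)] mult_left_mono[OF y(2)]]) (use \<epsilon> in simp)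
    finally have "vnorm G (P' x - Q' y) \<le> C + \<epsilon> * (C + 2)" by (simp add: algebra_simps)
    then show ?thesis using \<epsilon>(2) by simp
  qed
  have "ball_near V G T' m U' n (C + e)"
    using b(1) key[OF sub(1) T' sub(2) U'] unfolding ball_near_def by meson
  moreover have "ball_near V G U' n T' m (C + e)"
    using b(2) key[OF sub(2) U' sub(1) T'] unfolding ball_near_def by meson
  ultimately show ?thesis unfolding gamma_rel_def using T'(1) U'(1) by blast
qed

lemma Banach_Mazur_compacta:
  fixes E :: "('k::rc_scalar, 'e::ab_group_add) nspace" and Ehat :: "('k, 'b::ab_group_add) nspace"
  assumes E: "normed_space E" and am: "amalgamation_class (Age E)" and lim: "fraisse_limit (Age E) Ehat"
  shows "compatible_metric (BM_topology TYPE('k) k) (BM_in k Ehat) (gamma_dist k Ehat)"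
    "\<And>P Q. P \<in> BM_in k E \<Longrightarrow> Q \<in> BM_in k E \<Longrightarrow> gamma_dist k Ehat P Q = gamma_dist k E P Q"
    "dense_subset (BM_topology TYPE('k) k) (BM_in k E) (BM_in k Ehat)"
proof -
  define V where "V = (coord_space k :: ('k, nat \<Rightarrow> 'k) vspace)"
  have V: "vec_space V" and k: "has_dim V k" unfolding V_def by (rule vec_space_coord_space has_dim_coord_space)+
  have fd: "fin_dim V" using k by (auto simp: fin_dim_def)
  have fr: "fraisse Ehat" using lim by (simp add: fraisse_limit_def)
  have H: "normed_space Ehat" using fr by (simp add: fraisse_def banach_space_def)
  note om = BM_omega_metric[OF V fd]
  have top: "BM_topology TYPE('k) k = metric_topology (orbit V ` Norms V) (BM_omega V)"
    unfolding BM_topology_def V_def[symmetric] by (rule om(3))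
  have BM_in: "BM_in k F = orbit V ` Norms_in V F" for F :: "('k, 'c::ab_group_add) nspace"
    by (simp add: BM_in_def V_def)
  have sub: "BM_in k F \<subseteq> orbit V ` Norms V" for F :: "('k, 'c::ab_group_add) nspace"
    unfolding BM_in by (auto simp: Norms_in_def)
  show "compatible_metric (BM_topology TYPE('k) k) (BM_in k Ehat) (gamma_dist k Ehat)"
    unfolding top
  proof (rule compatible_metric_from_relation[OF om(2) sub, where R = "\<lambda>C P Q. \<exists>m\<in>P. \<exists>n\<in>Q. gamma_rel V Ehat C m n"])
    fix P Q r assume "P \<in> BM_in k Ehat" "Q \<in> BM_in k Ehat"
    then obtain m n where m: "m \<in> Norms_in V Ehat" "P = orbit V m" and n: "n \<in> Norms_in V Ehat" "Q = orbit V n"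
      unfolding BM_in by blast
    note rel = gamma_rel_orbits[OF V Norms_inD(1)[OF m(1)] Norms_inD(1)[OF n(1)]]
    show "gamma_dist k Ehat P Q < r \<longleftrightarrow> (\<exists>C. 0 \<le> C \<and> C < r \<and> (\<exists>m\<in>P. \<exists>n\<in>Q. gamma_rel V Ehat C m n))"
      unfolding m(2) n(2) rel using gamma_dist_less_iff[OF H, of m k n r] m(1) n(1) by (simp add: V_def)
  next
    fix P Q C assume "\<exists>m\<in>P. \<exists>n\<in>Q. gamma_rel V Ehat C m n"
    then show "\<exists>m\<in>Q. \<exists>n\<in>P. gamma_rel V Ehat C m n" using gamma_rel_sym by blast
  next
    fix P Q S C D e assume "P \<in> BM_in k Ehat" "Q \<in> BM_in k Ehat" "S \<in> BM_in k Ehat"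
      and PQ: "\<exists>m\<in>P. \<exists>n\<in>Q. gamma_rel V Ehat C m n" and QS: "\<exists>m\<in>Q. \<exists>n\<in>S. gamma_rel V Ehat D m n" and e: "(0::real) < e"
    then obtain m n p where m: "m \<in> Norms V" "P = orbit V m" and n: "n \<in> Norms V" "Q = orbit V n"
      and p: "p \<in> Norms V" "S = orbit V p" unfolding BM_in using Norms_inD(1) by blast
    have "gamma_rel V Ehat C m n" "gamma_rel V Ehat D n p"
      using PQ QS unfolding m(2) n(2) p(2) gamma_rel_orbits[OF V m(1) n(1)] gamma_rel_orbits[OF V n(1) p(1)] by auto
    from gamma_rel_triangle[OF V k fr NormsD(1)[OF n(1)] this e]
    show "\<exists>m\<in>P. \<exists>n\<in>S. gamma_rel V Ehat (C + D + e) m n"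
      unfolding m(2) p(2) gamma_rel_orbits[OF V m(1) p(1)] .
  next
    fix P e assume "P \<in> BM_in k Ehat" and e: "(0::real) < e"
    then obtain m where m: "m \<in> Norms_in V Ehat" "P = orbit V m" unfolding BM_in by blast
    note mN = Norms_inD(1)[OF m(1)]
    obtain \<delta> where \<delta>: "\<delta> > 0" "\<And>n. n \<in> Norms_in V Ehat \<Longrightarrow> omega V m n < \<delta> \<Longrightarrow> gamma_rel V Ehat (e / 2) m n"
      using gamma_rel_of_omega[OF V k fr m(1), of "e / 2"] e by (metis half_gt_zero)
    have "gamma_dist k Ehat P Q < e" if Q: "Q \<in> BM_in k Ehat" and lt: "BM_omega V P Q < \<delta>" for Q
    proof -
      obtain n where n: "n \<in> Norms_in V Ehat" "Q = orbit V n" using Q unfolding BM_in by blast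
      obtain n' where n': "n' \<in> orbit V n" "omega V m n' < \<delta>"
        using lt om(1)[OF mN Norms_inD(1)[OF n(1)]] unfolding m(2) n(2) by blast
      have n'': "n' \<in> Norms_in V Ehat" "orbit V n' = Q"
        using Norms_in_orbit[OF V n(1) n'(1)] orbit_eq[OF V Norms_inD(1)[OF n(1)] n'(1)] n(2) by auto
      have "gamma_rel V Ehat (e / 2) m n'" by (rule \<delta>(2)[OF n''(1) n'(2)])
      moreover have "0 \<le> e / 2" "e / 2 < e" using e by auto
      ultimately have "gamma_dist k Ehat (orbit V m) (orbit V n') < e"
        using gamma_dist_less_iff[OF H, of m k n' e] m(1) n''(1) unfolding V_def by blast
      then show ?thesis using m(2) n''(2) by simp
    qed
    then show "\<exists>\<delta>>0. \<forall>Q\<in>BM_in k Ehat. BM_omega V P Q < \<delta> \<longrightarrow> gamma_dist k Ehat P Q < e" using \<delta>(1) by blast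
    obtain \<delta>' where \<delta>': "\<delta>' > 0" "\<And>n C. n \<in> Norms V \<Longrightarrow> C < \<delta>' \<Longrightarrow> gamma_rel V Ehat C m n \<Longrightarrow> \<exists>n'\<in>orbit V n. omega V m n' < e"
      using omega_of_gamma_rel[OF V k H mN e] by blast
    have "BM_omega V P Q < e" if Q: "Q \<in> BM_in k Ehat" and lt: "gamma_dist k Ehat P Q < \<delta>'" for Q
    proof -
      obtain n where n: "n \<in> Norms_in V Ehat" "Q = orbit V n" using Q unfolding BM_in by blast
      have "gamma_dist k Ehat (orbit V m) (orbit V n) < \<delta>'" using lt m(2) n(2) by simp
      then obtain C where "C < \<delta>'" "gamma_rel V Ehat C m n"
        using gamma_dist_less_iff[OF H, of m k n \<delta>'] m(1) n(1) unfolding V_def by blast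
      then have "\<exists>n'\<in>orbit V n. omega V m n' < e" using \<delta>'(2) Norms_inD(1)[OF n(1)] by blast
      then show ?thesis unfolding m(2) n(2) using om(1)[OF mN Norms_inD(1)[OF n(1)]] by blast
    qed
    then show "\<exists>\<delta>>0. \<forall>Q\<in>BM_in k Ehat. gamma_dist k Ehat P Q < \<delta> \<longrightarrow> BM_omega V P Q < e" using \<delta>'(1) by blast
  qed
  note subE = Norms_in_limit[OF E lim V fd]
  have t1: "transfers E Ehat" by (rule transfers_if_Age_embeds[OF E H Age_Emb_limit[OF E lim]])
  have t2: "transfers Ehat E" by (rule transfers_from_limit[OF E am lim])
  show "gamma_dist k Ehat P Q = gamma_dist k E P Q" if PQ: "P \<in> BM_in k E" "Q \<in> BM_in k E" for P Q
  proof -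
    obtain m n where m: "m \<in> Norms_in V E" "P = orbit V m" and n: "n \<in> Norms_in V E" "Q = orbit V n"
      using PQ unfolding BM_in by blast
    have m': "m \<in> Norms_in V Ehat" and n': "n \<in> Norms_in V Ehat" using m n subE by auto
    have iE: "gamma_dist k E P Q < r \<longleftrightarrow> (\<exists>C. 0 \<le> C \<and> C < r \<and> gamma_rel V E C m n)" for r
      unfolding m(2) n(2) using gamma_dist_less_iff[OF E, of m k n r] m(1) n(1) by (simp add: V_def)
    have iH: "gamma_dist k Ehat P Q < r \<longleftrightarrow> (\<exists>C. 0 \<le> C \<and> C < r \<and> gamma_rel V Ehat C m n)" for r
      unfolding m(2) n(2) using gamma_dist_less_iff[OF H, of m k n r] m' n' by (simp add: V_def)
    show ?thesis
    proof (rule antisym)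
      show "gamma_dist k Ehat P Q \<le> gamma_dist k E P Q"
        by (rule dist_le_of_rel[OF iE iH]) (rule gamma_rel_transfer[OF t1 V k E H m' n'])
      show "gamma_dist k E P Q \<le> gamma_dist k Ehat P Q"
        by (rule dist_le_of_rel[OF iH iE]) (rule gamma_rel_transfer[OF t2 V k H E m(1) n(1)])
    qed
  qed
  show "dense_subset (BM_topology TYPE('k) k) (BM_in k E) (BM_in k Ehat)"
    unfolding top
  proof (rule dense_subset_metric[OF om(2) _ sub])
    show "BM_in k E \<subseteq> BM_in k Ehat" unfolding BM_in using subE by blast
    fix P e assume "P \<in> BM_in k Ehat" and e: "(0::real) < e"
    then obtain m where m: "m \<in> Norms_in V Ehat" "P = orbit V m" unfolding BM_in by blast
    obtain n where n: "n \<in> Norms_in V E" "omega V m n < e" using Norms_in_dense[OF E lim V fd m(1) e] by blast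
    have "BM_omega V P (orbit V n) < e"
      unfolding m(2) using om(1)[OF Norms_inD(1)[OF m(1)] Norms_inD(1)[OF n(1)]] n(2) orbit_self[OF V Norms_inD(1)[OF n(1)]] by blast
    then show "\<exists>Q\<in>BM_in k E. BM_omega V P Q < e" unfolding BM_in using n(1) by blast
  qed
qed

section \<open>The Hahn--Banach theorem and the dual norm\<close>

definition sublinear_on :: "('k::real_normed_field, 'v::ab_group_add, 'z) vspace_scheme \<Rightarrow> ('v \<Rightarrow> real) \<Rightarrow> bool" where
  "sublinear_on V q \<longleftrightarrow>
     (\<forall>x\<in>vcarrier V. \<forall>y\<in>vcarrier V. q (x + y) \<le> q x + q y) \<and>
     (\<forall>r\<ge>0. \<forall>x\<in>vcarrier V. q (vscale V (of_real r) x) = r * q x)"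

lemma sublinear_onD:
  assumes "sublinear_on V q"
  shows "x \<in> vcarrier V \<Longrightarrow> y \<in> vcarrier V \<Longrightarrow> q (x + y) \<le> q x + q y"
    "r \<ge> 0 \<Longrightarrow> x \<in> vcarrier V \<Longrightarrow> q (vscale V (of_real r) x) = r * q x"
  using assms by (auto simp: sublinear_on_def)

lemma sublinear_onI:
  fixes V :: "('k::real_normed_field, 'v::ab_group_add, 'z) vspace_scheme"
  assumes V: "vec_space V"
    and tri: "\<And>x y. x \<in> vcarrier V \<Longrightarrow> y \<in> vcarrier V \<Longrightarrow> q (x + y) \<le> q x + q y"
    and hom: "\<And>r x. r > 0 \<Longrightarrow> x \<in> vcarrier V \<Longrightarrow> q (vscale V (of_real r) x) \<le> r * q x"
    and zero: "q 0 = 0"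
  shows "sublinear_on V q"
  unfolding sublinear_on_def
proof (intro conjI ballI allI impI)
  show "q (x + y) \<le> q x + q y" if "x \<in> vcarrier V" "y \<in> vcarrier V" for x y using tri that .
  fix r :: real and x assume r: "0 \<le> r" and x: "x \<in> vcarrier V"
  show "q (vscale V (of_real r) x) = r * q x"
  proof (cases "r = 0")
    case True
    then show ?thesis by (simp add: vs_algebra(9)[OF V] zero)
  next
    case False
    then have r: "r > 0" using r by simp
    have x': "vscale V (of_real r) x \<in> vcarrier V" by (rule vs_closed(5)[OF V x])
    have eq: "vscale V (of_real (inverse r)) (vscale V (of_real r) x) = x"
      using r by (simp add: vs_algebra(7,8)[OF V])
    have "q (vscale V (of_real (inverse r)) (vscale V (of_real r) x)) \<le> inverse r * q (vscale V (of_real r) x)"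
      by (rule hom[OF _ x']) (use r in simp)
    then have "q x \<le> inverse r * q (vscale V (of_real r) x)" unfolding eq .
    then have "r * q x \<le> q (vscale V (of_real r) x)" using r by (simp add: field_simps)
    then show ?thesis using hom[OF r x] by simp
  qed
qed

lemma sublinear_on_zero_neg:
  fixes V :: "('k::real_normed_field, 'v::ab_group_add, 'z) vspace_scheme"
  assumes V: "vec_space V" and q: "sublinear_on V q"
  shows "q 0 = 0" "x \<in> vcarrier V \<Longrightarrow> - q (- x) \<le> q x"
proof -
  show 0: "q 0 = 0" using sublinear_onD(2)[OF q order_refl vs_closed(1)[OF V]] by (simp add: vs_algebra[OF V])
  show "- q (- x) \<le> q x" if x: "x \<in> vcarrier V"
    using sublinear_onD(1)[OF q x vs_closed(4)[OF V x]] 0 by simp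
qed

text \<open>A minimal sublinear functional \<open>q\<close> is linear: \<open>x \<mapsto> INF t\<ge>0. q (x + t x0) - t q(x0)\<close> is
  sublinear and below \<open>q\<close>, hence equal to \<open>q\<close>, and its value at \<open>-x0\<close> is at most \<open>-q(x0)\<close>. Minimal
  functionals exist below every sublinear one by Zorn's lemma.\<close>

lemma odd_sublinear_below:
  fixes V :: "('k::real_normed_field, 'v::ab_group_add, 'z) vspace_scheme"
  assumes V: "vec_space V" and p: "sublinear_on V p"
  obtains q where "sublinear_on V q" "\<And>x. x \<in> vcarrier V \<Longrightarrow> q x \<le> p x"
    "\<And>x. x \<in> vcarrier V \<Longrightarrow> q (- x) = - q x"
proof -
  let ?C = "vcarrier V"
  note cl = vs_closed[OF V]
  define A where "A = {q \<in> extensional ?C. sublinear_on V q \<and> (\<forall>x\<in>?C. q x \<le> p x)}"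
  define P where "P q q' \<longleftrightarrow> (\<forall>x\<in>?C. q' x \<le> q x)" for q q' :: "'v \<Rightarrow> real"
  have restr: "sublinear_on V (restrict q ?C) \<longleftrightarrow> sublinear_on V q" for q
    unfolding sublinear_on_def using cl by simp
  have lower: "- p (- x) \<le> q x" if "q \<in> A" "x \<in> ?C" for q x
    using sublinear_on_zero_neg(2)[OF V, of q x] that cl(4)[of x] by (force simp: A_def)
  have "\<exists>m\<in>A. \<forall>a\<in>A. P m a \<longrightarrow> a = m"
  proof (rule predicate_Zorn)
    show "partial_order_on A (relation_of P A)"
    proof (rule partial_order_on_relation_ofI)
      show "P a a" for a by (simp add: P_def)
      show "P a c" if "P a b" "P b c" for a b c using that unfolding P_def by (meson order_trans)
      show "a = b" if "a \<in> A" "b \<in> A" "P a b" "P b a" for a b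
        using that by (intro extensionalityI[of a ?C b]) (auto simp: A_def P_def intro: antisym)
    qed
    fix K assume K: "K \<in> Chains (relation_of P A)"
    have KA: "K \<subseteq> A" using K by (auto simp: Chains_def relation_of_def)
    have chain: "P a b \<or> P b a" if "a \<in> K" "b \<in> K" for a b using K that by (auto simp: Chains_def relation_of_def)
    show "\<exists>u\<in>A. \<forall>a\<in>K. P a u"
    proof (cases "K = {}")
      case True
      have "restrict p ?C \<in> A" using p restr by (simp add: A_def)
      then show ?thesis using True by blast
    next
      case False
      define u where "u x = (INF q\<in>K. q x)" for x
      have bdd: "bdd_below ((\<lambda>q. q x) ` K)" if "x \<in> ?C" for x
        using lower[OF _ that] KA by (intro bdd_belowI2[of _ "- p (- x)"]) auto
      have u_le: "u x \<le> q x" if "x \<in> ?C" "q \<in> K" for x q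
        unfolding u_def by (rule cINF_lower[OF bdd[OF that(1)] that(2)])
      have u_eps: "\<exists>q\<in>K. q x < u x + e" if "x \<in> ?C" "e > 0" for x e
      proof -
        have "u x < u x + e" using that by simp
        then show ?thesis unfolding u_def using cINF_less_iff[OF False bdd[OF that(1)]] by blast
      qed
      have sub: "sublinear_on V q" if "q \<in> K" for q using that KA by (auto simp: A_def)
      have "sublinear_on V u"
      proof (rule sublinear_onI[OF V])
        fix x y assume x: "x \<in> ?C" and y: "y \<in> ?C"
        show "u (x + y) \<le> u x + u y"
        proof (rule field_le_epsilon)
          fix e :: real assume "e > 0"
          then obtain q1 q2 where q: "q1 \<in> K" "q1 x < u x + e / 2" "q2 \<in> K" "q2 y < u y + e / 2"
            using u_eps[OF x, of "e / 2"] u_eps[OF y, of "e / 2"] by auto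
          obtain q where q': "q \<in> K" "q x \<le> q1 x" "q y \<le> q2 y"
            using chain[OF q(1,3)] q(1,3) x y unfolding P_def by auto
          have "u (x + y) \<le> q (x + y)" by (rule u_le[OF cl(2)[OF x y] q'(1)])
          also have "\<dots> \<le> q x + q y" by (rule sublinear_onD(1)[OF sub[OF q'(1)] x y])
          finally show "u (x + y) \<le> u x + u y + e" using q q' by linarith
        qed
      next
        fix r :: real and x assume r: "r > 0" and x: "x \<in> ?C"
        show "u (vscale V (of_real r) x) \<le> r * u x"
        proof (rule field_le_epsilon)
          fix e :: real assume "e > 0"
          then obtain q where q: "q \<in> K" "q x < u x + e / r" using u_eps[OF x, of "e / r"] r by auto
          have "u (vscale V (of_real r) x) \<le> q (vscale V (of_real r) x)" by (rule u_le[OF cl(5)[OF x] q(1)])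
          also have "\<dots> = r * q x" using sublinear_onD(2)[OF sub[OF q(1)] _ x] r by simp
          also have "\<dots> \<le> r * (u x + e / r)" using q(2) r by simp
          finally show "u (vscale V (of_real r) x) \<le> r * u x + e" using r by (simp add: algebra_simps)
        qed
      next
        have "(\<lambda>q. q 0) ` K = (\<lambda>q. 0) ` K" using sublinear_on_zero_neg(1)[OF V sub] by (intro image_cong) auto
        then show "u 0 = 0" unfolding u_def using False by simp
      qed
      moreover have "u x \<le> p x" if "x \<in> ?C" for x
      proof -
        obtain q where q: "q \<in> K" using False by blast
        then have "q x \<le> p x" using KA that by (auto simp: A_def)
        then show ?thesis using u_le[OF that q] by simp
      qed
      ultimately have "restrict u ?C \<in> A" using restr by (simp add: A_def)
      moreover have "P a (restrict u ?C)" if "a \<in> K" for a using u_le that by (simp add: P_def)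
      ultimately show ?thesis by blast
    qed
  qed
  then obtain m where mA: "m \<in> A" and min: "\<forall>a\<in>A. P m a \<longrightarrow> a = m" by (rule bexE)
  have m: "sublinear_on V m" and mp: "\<And>x. x \<in> ?C \<Longrightarrow> m x \<le> p x" using mA by (auto simp: A_def)
  have "m (- x0) = - m x0" if x0: "x0 \<in> ?C" for x0
  proof -
    define h where "h x t = m (x + vscale V (of_real t) x0) - t * m x0" for x and t :: real
    \<comment> \<open>This function is sublinear and below \<open>m\<close>, so it equals \<open>m\<close> by minimality.\<close>
    define v where "v x = (INF t\<in>{0..}. h x t)" for x
    have hlow: "- m (- x) \<le> h x t" if x: "x \<in> ?C" and t: "t \<ge> 0" for x t
    proof -
      have mem: "x + vscale V (of_real t) x0 \<in> ?C" by (intro cl(2,5) x x0)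
      have "t * m x0 = m ((x + vscale V (of_real t) x0) + - x)"
        using sublinear_onD(2)[OF m t x0] by simp
      also have "\<dots> \<le> m (x + vscale V (of_real t) x0) + m (- x)"
        by (rule sublinear_onD(1)[OF m mem cl(4)[OF x]])
      finally show ?thesis by (simp add: h_def)
    qed
    have bdd: "bdd_below (h x ` {0..})" if "x \<in> ?C" for x
      using hlow[OF that] by (intro bdd_belowI2[of _ "- m (- x)"]) auto
    have v_le: "v x \<le> h x t" if "x \<in> ?C" "t \<ge> 0" for x t
      unfolding v_def by (rule cINF_lower[OF bdd[OF that(1)]]) (use that in simp)
    have v_eps: "\<exists>t\<ge>0. h x t < v x + e" if "x \<in> ?C" "e > 0" for x e
    proof -
      have "v x < v x + e" using that by simp
      moreover have "{0::real..} \<noteq> {}" by auto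
      ultimately show ?thesis unfolding v_def using cINF_less_iff[OF _ bdd[OF that(1)]] by (metis atLeast_iff)
    qed
    have "sublinear_on V v"
    proof (rule sublinear_onI[OF V])
      fix x y assume x: "x \<in> ?C" and y: "y \<in> ?C"
      show "v (x + y) \<le> v x + v y"
      proof (rule field_le_epsilon)
        fix e :: real assume "e > 0"
        then obtain s t where st: "s \<ge> 0" "h x s < v x + e / 2" "t \<ge> 0" "h y t < v y + e / 2"
          using v_eps[OF x, of "e / 2"] v_eps[OF y, of "e / 2"] by auto
        have mem: "x + vscale V (of_real s) x0 \<in> ?C" "y + vscale V (of_real t) x0 \<in> ?C" by (intro cl(2,5) x y x0)+
        have "v (x + y) \<le> h (x + y) (s + t)" by (rule v_le[OF cl(2)[OF x y]]) (use st in simp)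
        also have "\<dots> = m ((x + vscale V (of_real s) x0) + (y + vscale V (of_real t) x0)) - (s + t) * m x0"
          by (simp add: h_def vs_algebra[OF V] algebra_simps)
        also have "\<dots> \<le> h x s + h y t"
          using sublinear_onD(1)[OF m mem] by (simp add: h_def algebra_simps)
        finally show "v (x + y) \<le> v x + v y + e" using st by linarith
      qed
    next
      fix r :: real and x assume r: "r > 0" and x: "x \<in> ?C"
      show "v (vscale V (of_real r) x) \<le> r * v x"
      proof (rule field_le_epsilon)
        fix e :: real assume "e > 0"
        then obtain t where t: "t \<ge> 0" "h x t < v x + e / r" using v_eps[OF x, of "e / r"] r by auto
        have mem: "x + vscale V (of_real t) x0 \<in> ?C" by (intro cl(2,5) x x0)
        have "v (vscale V (of_real r) x) \<le> h (vscale V (of_real r) x) (r * t)"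
          by (rule v_le[OF cl(5)[OF x]]) (use r t in simp)
        also have "\<dots> = m (vscale V (of_real r) (x + vscale V (of_real t) x0)) - r * (t * m x0)"
          by (simp add: h_def vs_algebra[OF V] algebra_simps)
        also have "\<dots> = r * h x t" using sublinear_onD(2)[OF m _ mem] r by (simp add: h_def algebra_simps)
        also have "\<dots> \<le> r * (v x + e / r)" using t(2) r by simp
        finally show "v (vscale V (of_real r) x) \<le> r * v x + e" using r by (simp add: algebra_simps)
      qed
    next
      have "h 0 t = 0" if "t \<ge> 0" for t using sublinear_onD(2)[OF m that x0] by (simp add: h_def)
      then have "h 0 ` {0..} = {0}" by force
      then show "v 0 = 0" unfolding v_def by simp
    qed
    moreover have vm: "v x \<le> m x" if "x \<in> ?C" for x
      using v_le[OF that order_refl] by (simp add: h_def vs_algebra[OF V])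
    ultimately have "restrict v ?C \<in> A" using restr mp by (force simp: A_def intro: order_trans)
    moreover have "P m (restrict v ?C)" using vm by (simp add: P_def)
    ultimately have "restrict v ?C = m" using min by blast
    then have "m (- x0) = v (- x0)" using cl(4)[OF x0] by (metis restrict_apply')
    also have "\<dots> \<le> h (- x0) 1" by (rule v_le[OF cl(4)[OF x0]]) simp
    also have "\<dots> = - m x0" by (simp add: h_def vs_algebra[OF V] sublinear_on_zero_neg(1)[OF V m])
    finally show ?thesis using sublinear_on_zero_neg(2)[OF V m x0] by simp
  qed
  then show thesis by (intro that[OF m mp])
qed

text \<open>Extension of functionals with preservation of the norm. The real part of the extension is
  a linear functional below \<open>x \<mapsto> INF y\<in>Y. C * \<parallel>x - y\<parallel> + Re (u y)\<close>; in the complex case the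
  imaginary part is determined by it.\<close>

theorem Hahn_Banach_extension:
  fixes F :: "('k::rc_scalar, 'w::ab_group_add) nspace"
  assumes F: "normed_space F" and Y: "Y \<subseteq> vcarrier F" "module.subspace (vscale F) Y"
    and add: "\<And>x y. x \<in> Y \<Longrightarrow> y \<in> Y \<Longrightarrow> u (x + y) = u x + u y"
    and scale: "\<And>c x. x \<in> Y \<Longrightarrow> u (vscale F c x) = c * u x"
    and C: "C \<ge> 0" and bd: "\<And>x. x \<in> Y \<Longrightarrow> norm (u x) \<le> C * vnorm F x"
  obtains f where "lin_functional F f" "\<And>x. x \<in> Y \<Longrightarrow> f x = u x"
    "\<And>x. x \<in> vcarrier F \<Longrightarrow> norm (f x) \<le> C * vnorm F x"
proof -
  note FV = normed_spaceD(1)[OF F] and FN = normed_spaceD(2)[OF F]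
  note cl = vs_closed[OF FV] and al = vs_algebra[OF FV]
  have YV: "vec_space (F\<lparr>vcarrier := Y\<rparr>)" by (rule vec_space_subcarrier[OF FV Y(2)])
  note Ycl = vs_closed[OF YV, simplified]
  obtain \<phi> :: "'k \<Rightarrow> complex" and I :: 'k where
    \<phi>add: "\<And>x y. \<phi> (x + y) = \<phi> x + \<phi> y" and \<phi>mult: "\<And>x y. \<phi> (x * y) = \<phi> x * \<phi> y"
    and \<phi>norm: "\<And>x. norm (\<phi> x) = norm x" and \<phi>real: "\<And>r. \<phi> (of_real r) = of_real r"
    and "range \<phi> = \<real> \<or> range \<phi> = UNIV"
    and dec: "\<And>c. c = of_real (Re (\<phi> c)) + I * of_real (Im (\<phi> c))"
    and IRe: "\<And>c. I * of_real (Re (\<phi> (I * c))) = - (I * of_real (Im (\<phi> c)))"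
    and ReI: "\<And>r. Re (\<phi> (I * of_real r)) = 0" and II: "I = 0 \<or> I * I = - 1"
    by (rule rc_scalar_real_imag) (rule that)
  have \<phi>0: "\<phi> 0 = 0" using \<phi>norm[of 0] by simp
  define R where "R c = Re (\<phi> c)" for c
  have Radd: "R (x + y) = R x + R y" for x y by (simp add: R_def \<phi>add)
  have Rscale: "R (of_real r * c) = r * R c" for r c by (simp add: R_def \<phi>mult \<phi>real)
  have Rle: "\<bar>R c\<bar> \<le> norm c" for c unfolding R_def using abs_Re_le_cmod[of "\<phi> c"] \<phi>norm by simp
  have Rneg: "R (- c) = - R c" for c using Rscale[of "-1" c] by simp
  have N0: "0 \<le> vnorm F x" if "x \<in> vcarrier F" for x by (rule is_normD(1)[OF FN that])
  have uneg: "u (- y) = - u y" if "y \<in> Y" for y using scale[OF that, of "-1"] by (simp add: al)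
  define h where "h x y = C * vnorm F (x - y) + R (u y)" for x y
  define p where "p x = (INF y\<in>Y. h x y)" for x
  have hlow: "- C * vnorm F x \<le> h x y" if x: "x \<in> vcarrier F" and y: "y \<in> Y" for x y
  proof -
    have yF: "y \<in> vcarrier F" using y Y(1) by blast
    have "- R (u y) \<le> C * vnorm F y" using Rle[of "u y"] bd[OF y] by linarith
    also have "\<dots> \<le> C * (vnorm F (x - y) + vnorm F x)"
      using norm_algebra(5)[OF FV FN yF x] norm_algebra(3)[OF FV FN yF x] C by (intro mult_left_mono) auto
    finally show ?thesis by (simp add: h_def algebra_simps)
  qed
  have bdd: "bdd_below (h x ` Y)" if "x \<in> vcarrier F" for x
    using hlow[OF that] by (intro bdd_belowI2[of _ "- C * vnorm F x"]) auto
  have p_le: "p x \<le> h x y" if "x \<in> vcarrier F" "y \<in> Y" for x y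
    unfolding p_def by (rule cINF_lower[OF bdd[OF that(1)] that(2)])
  have p_eps: "\<exists>y\<in>Y. h x y < p x + e" if "x \<in> vcarrier F" "e > 0" for x e
  proof -
    have "p x < p x + e" using that by simp
    moreover have "Y \<noteq> {}" using Ycl(1) by blast
    ultimately show ?thesis unfolding p_def using cINF_less_iff[OF _ bdd[OF that(1)]] by blast
  qed
  have "sublinear_on F p"
  proof (rule sublinear_onI[OF FV])
    fix x x' assume x: "x \<in> vcarrier F" and x': "x' \<in> vcarrier F"
    show "p (x + x') \<le> p x + p x'"
    proof (rule field_le_epsilon)
      fix e :: real assume "e > 0"
      then obtain y y' where y: "y \<in> Y" "h x y < p x + e / 2" "y' \<in> Y" "h x' y' < p x' + e / 2"
        using p_eps[OF x, of "e / 2"] p_eps[OF x', of "e / 2"] by auto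
      have mem: "x - y \<in> vcarrier F" "x' - y' \<in> vcarrier F" using cl(3) x x' y Y(1) by auto
      have "p (x + x') \<le> h (x + x') (y + y')" by (rule p_le[OF cl(2)[OF x x'] Ycl(2)[OF y(1,3)]])
      also have "\<dots> = C * vnorm F ((x - y) + (x' - y')) + R (u y) + R (u y')"
        unfolding h_def add[OF y(1,3)] Radd by (simp add: algebra_simps)
      also have "\<dots> \<le> h x y + h x' y'"
        using mult_left_mono[OF is_normD(4)[OF FN mem] C] by (simp add: h_def algebra_simps)
      finally show "p (x + x') \<le> p x + p x' + e" using y by linarith
    qed
  next
    fix r :: real and x assume r: "r > 0" and x: "x \<in> vcarrier F"
    show "p (vscale F (of_real r) x) \<le> r * p x"
    proof (rule field_le_epsilon)
      fix e :: real assume "e > 0"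
      then obtain y where y: "y \<in> Y" "h x y < p x + e / r" using p_eps[OF x, of "e / r"] r by auto
      have mem: "x - y \<in> vcarrier F" using cl(3) x y Y(1) by auto
      have "p (vscale F (of_real r) x) \<le> h (vscale F (of_real r) x) (vscale F (of_real r) y)"
        by (rule p_le[OF cl(5)[OF x] Ycl(5)[OF y(1)]])
      also have "\<dots> = C * vnorm F (vscale F (of_real r) (x - y)) + r * R (u y)"
        by (simp add: h_def al scale[OF y(1)] Rscale)
      also have "\<dots> = r * h x y" using is_normD(3)[OF FN mem, of "of_real r"] r by (simp add: h_def algebra_simps)
      also have "\<dots> \<le> r * (p x + e / r)" using y(2) r by simp
      finally show "p (vscale F (of_real r) x) \<le> r * p x + e" using r by (simp add: algebra_simps)
    qed
  next
    have u0: "u 0 = 0" using scale[OF Ycl(1), of 0] by (simp add: al)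
    have "p 0 \<le> 0" using p_le[OF cl(1) Ycl(1)] by (simp add: h_def u0 R_def \<phi>0 norm_algebra(1)[OF FV FN])
    moreover have "0 \<le> p 0" unfolding p_def
      using hlow[OF cl(1)] Ycl(1) by (intro cINF_greatest) (auto simp: norm_algebra(1)[OF FV FN])
    ultimately show "p 0 = 0" by simp
  qed
  then obtain q where q: "sublinear_on F q" and qp: "\<And>x. x \<in> vcarrier F \<Longrightarrow> q x \<le> p x"
    and qneg: "\<And>x. x \<in> vcarrier F \<Longrightarrow> q (- x) = - q x" using odd_sublinear_below[OF FV] by blast
  have qadd: "q (x + y) = q x + q y" if x: "x \<in> vcarrier F" and y: "y \<in> vcarrier F" for x y
  proof (rule antisym)
    show "q (x + y) \<le> q x + q y" by (rule sublinear_onD(1)[OF q x y])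
    have "q (- x + - y) \<le> q (- x) + q (- y)" by (rule sublinear_onD(1)[OF q cl(4)[OF x] cl(4)[OF y]])
    moreover have "- x + - y = - (x + y)" by simp
    ultimately show "q x + q y \<le> q (x + y)" using qneg[OF x] qneg[OF y] qneg[OF cl(2)[OF x y]] by simp
  qed
  have qscale: "q (vscale F (of_real r) x) = r * q x" if x: "x \<in> vcarrier F" for r x
  proof (cases "r \<ge> 0")
    case True
    then show ?thesis by (rule sublinear_onD(2)[OF q _ x])
  next
    case False
    have "vscale F (of_real r) x = - vscale F (of_real (- r)) x" by (simp add: al)
    then have "q (vscale F (of_real r) x) = - q (vscale F (of_real (- r)) x)" using qneg[OF cl(5)[OF x]] by metis
    also have "\<dots> = r * q x" using sublinear_onD(2)[OF q _ x, of "- r"] False by simp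
    finally show ?thesis .
  qed
  define f where "f x = (if x \<in> vcarrier F then of_real (q x) - I * of_real (q (vscale F I x)) else 0)" for x
  have fadd: "f (x + y) = f x + f y" if x: "x \<in> vcarrier F" and y: "y \<in> vcarrier F" for x y
    using x y cl by (simp add: f_def qadd al algebra_simps)
  have fr: "f (vscale F (of_real r) x) = of_real r * f x" if x: "x \<in> vcarrier F" for r x
  proof -
    have "vscale F I (vscale F (of_real r) x) = vscale F (of_real r) (vscale F I x)" by (simp add: al mult.commute)
    then show ?thesis using x cl(5) by (simp add: f_def qscale algebra_simps)
  qed
  have fI: "f (vscale F I x) = I * f x" if x: "x \<in> vcarrier F" for x
    using II
  proof
    assume "I = 0"
    then show ?thesis using qscale[OF cl(1), of 0] cl(1) by (simp add: f_def al)
  next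
    assume I: "I * I = - 1"
    have "q (vscale F I (vscale F I x)) = - q x" using qneg[OF x] by (simp add: al I)
    moreover have "I * (I * of_real (q (vscale F I x))) = - of_real (q (vscale F I x))"
      by (simp add: I mult.assoc[symmetric])
    ultimately show ?thesis using x cl(5) by (simp add: f_def right_diff_distrib)
  qed
  have fscale: "f (vscale F c x) = c * f x" if x: "x \<in> vcarrier F" for c x
  proof -
    define a b where "a = Re (\<phi> c)" and "b = Im (\<phi> c)"
    have c: "c = of_real a + I * of_real b" unfolding a_def b_def by (rule dec)
    have "vscale F c x = vscale F (of_real a) x + vscale F (of_real b) (vscale F I x)"
      by (simp add: c al mult.commute)
    then have "f (vscale F c x) = of_real a * f x + of_real b * (I * f x)"
      using fadd fr fI x cl(5) by simp
    then show ?thesis by (simp add: c algebra_simps)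
  qed
  show thesis
  proof (rule that[of f])
    show "lin_functional F f" unfolding lin_functional_def using fadd fscale by (simp add: f_def)
    show "f y = u y" if y: "y \<in> Y" for y
    proof -
      \<comment> \<open>Applied to \<open>z\<close> and to \<open>- z\<close>, this inequality shows that \<open>q\<close> extends the real part of \<open>u\<close>.\<close>
      have le: "q z \<le> R (u z)" if z: "z \<in> Y" for z
      proof -
        have zF: "z \<in> vcarrier F" using z Y(1) by blast
        have "q z \<le> h z z" using qp[OF zF] p_le[OF zF z] by simp
        then show ?thesis by (simp add: h_def norm_algebra(1)[OF FV FN])
      qed
      have qu: "q z = R (u z)" if z: "z \<in> Y" for z
        using le[OF z] le[OF Ycl(4)[OF z]] qneg[of z] uneg[OF z] Rneg z Y(1) by (auto simp: subset_iff)
      have yF: "y \<in> vcarrier F" using y Y(1) by blast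
      have "f y = of_real (R (u y)) - I * of_real (R (I * u y))"
        using yF qu[OF y] qu[OF Ycl(5)[OF y, of I]] scale[OF y, of I] by (simp add: f_def)
      also have "\<dots> = u y" using dec[of "u y"] IRe[of "u y"] by (simp add: R_def)
      finally show ?thesis .
    qed
    show "norm (f x) \<le> C * vnorm F x" if x: "x \<in> vcarrier F" for x
    proof (cases "f x = 0")
      case True
      then show ?thesis using C N0[OF x] by simp
    next
      case False
      \<comment> \<open>Multiplication by the unit scalar \<open>c\<close> makes the value real, so that it is the value of \<open>q\<close>.\<close>
      define c where "c = of_real (norm (f x)) / f x"
      have c1: "norm c = 1" using False by (simp add: c_def norm_divide)
      have fc: "f (vscale F c x) = of_real (norm (f x))" using False fscale[OF x] by (simp add: c_def)
      have cx: "vscale F c x \<in> vcarrier F" by (rule cl(5)[OF x])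
      have Rf: "R (f z) = q z" if z: "z \<in> vcarrier F" for z
      proof -
        have "f z = of_real (q z) + - (I * of_real (q (vscale F I z)))" using z by (simp add: f_def)
        moreover have "R (I * of_real r) = 0" for r by (simp add: R_def ReI)
        moreover have "R (of_real r) = r" for r by (simp add: R_def \<phi>real)
        ultimately show ?thesis by (simp only: Radd Rneg)
      qed
      have "norm (f x) = q (vscale F c x)" using Rf[OF cx] fc by (simp add: R_def \<phi>real)
      also have "\<dots> \<le> h (vscale F c x) 0" using qp[OF cx] p_le[OF cx Ycl(1)] by simp
      also have "\<dots> = C * vnorm F x"
        using scale[OF Ycl(1), of 0] is_normD(3)[OF FN x, of c] c1 by (simp add: h_def al R_def \<phi>0)
      finally show ?thesis .
    qed
  qed
qed

lemma norm_dual_iff: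
  "f \<in> vcarrier (norm_dual F) \<longleftrightarrow> lin_functional F f \<and> (\<exists>C. \<forall>x\<in>vcarrier F. norm (f x) \<le> C * vnorm F x)"
  by (simp add: norm_dual_def)

text \<open>The dual norm is the operator norm for maps into the field, as a normed space over itself.\<close>

lemma norm_dual_bound:
  fixes F :: "('k::rc_scalar, 'w::ab_group_add) nspace"
  assumes F: "normed_space F" and f: "f \<in> vcarrier (norm_dual F)"
  shows "0 \<le> vnorm (norm_dual F) f" "x \<in> vcarrier F \<Longrightarrow> norm (f x) \<le> vnorm (norm_dual F) f * vnorm F x"
proof -
  define K :: "('k, 'k) nspace" where "K = \<lparr>vcarrier = UNIV, vscale = (*), vnorm = norm\<rparr>"
  have vK: "vector_space ((*) :: 'k \<Rightarrow> 'k \<Rightarrow> 'k)" by unfold_locales (auto simp: algebra_simps)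
  have "module.subspace ((*) :: 'k \<Rightarrow> 'k \<Rightarrow> 'k) UNIV"
    using vK module.subspace_UNIV by (simp add: module_iff_vector_space[symmetric])
  then have K: "normed_space K"
    using vK by (simp add: K_def normed_space_def vec_space_def is_norm_def norm_mult norm_triangle_ineq)
  have op: "vnorm (norm_dual F) f = op_norm F K f" by (simp add: norm_dual_def op_norm_def K_def)
  have lin: "lin_map F K f" using f by (simp add: norm_dual_iff lin_map_def lin_functional_def K_def)
  obtain C where "\<forall>x\<in>vcarrier F. norm (f x) \<le> C * vnorm F x" using f by (auto simp: norm_dual_iff)
  then have C: "vnorm K (f x) \<le> C * vnorm F x" if "x \<in> vcarrier F" for x using that by (simp add: K_def)
  show "0 \<le> vnorm (norm_dual F) f" unfolding op by (rule op_norm_bound(1)[OF F K lin C])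
  show "norm (f x) \<le> vnorm (norm_dual F) f * vnorm F x" if "x \<in> vcarrier F"
    unfolding op using op_norm_bound(2)[OF F K lin C that] by (simp add: K_def)
qed

lemma norm_dual_le:
  fixes F :: "('k::rc_scalar, 'w::ab_group_add) nspace"
  assumes F: "normed_space F" and f: "lin_functional F f" and C: "C \<ge> 0"
    and bd: "\<And>x. x \<in> vcarrier F \<Longrightarrow> norm (f x) \<le> C * vnorm F x"
  shows "f \<in> vcarrier (norm_dual F)" "vnorm (norm_dual F) f \<le> C"
proof -
  show "f \<in> vcarrier (norm_dual F)" using f bd by (auto simp: norm_dual_iff)
  have "norm (f x) \<le> C" if "x \<in> unit_ball F" for x
    using bd[of x] that C mult_left_le[of "vnorm F x" C] by (auto simp: unit_ball_def)
  then show "vnorm (norm_dual F) f \<le> C"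
    using zero_in_unit_ball[OF F] by (simp add: norm_dual_def) (metis cSUP_least empty_iff)
qed

lemma normed_space_norm_dual:
  fixes F :: "('k::rc_scalar, 'w::ab_group_add) nspace"
  assumes F: "normed_space F"
  shows "normed_space (norm_dual F)"
proof -
  let ?D = "norm_dual F"
  have sel: "vscale ?D = fun_scale" by (simp add: norm_dual_def)
  have lf: "lin_functional F f" if "f \<in> vcarrier ?D" for f using that by (simp add: norm_dual_iff)
  have N0: "0 \<le> vnorm F x" if "x \<in> vcarrier F" for x by (rule is_normD(1)[OF normed_spaceD(2)[OF F] that])
  have addc: "f + g \<in> vcarrier ?D \<and> vnorm ?D (f + g) \<le> vnorm ?D f + vnorm ?D g"
    if f: "f \<in> vcarrier ?D" and g: "g \<in> vcarrier ?D" for f g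
  proof -
    have "lin_functional F (f + g)" using lf[OF f] lf[OF g] by (simp add: lin_functional_def algebra_simps)
    moreover have "norm ((f + g) x) \<le> (vnorm ?D f + vnorm ?D g) * vnorm F x" if x: "x \<in> vcarrier F" for x
      using norm_triangle_ineq[of "f x" "g x"] norm_dual_bound(2)[OF F f x] norm_dual_bound(2)[OF F g x]
      by (simp add: algebra_simps)
    ultimately show ?thesis
      using norm_dual_le[OF F, of "f + g" "vnorm ?D f + vnorm ?D g"] norm_dual_bound(1)[OF F f] norm_dual_bound(1)[OF F g] by simp
  qed
  have scalec: "fun_scale c f \<in> vcarrier ?D \<and> vnorm ?D (fun_scale c f) \<le> norm c * vnorm ?D f"
    if f: "f \<in> vcarrier ?D" for c f
  proof -
    have "lin_functional F (fun_scale c f)" using lf[OF f] by (simp add: lin_functional_def fun_scale_def algebra_simps)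
    moreover have "norm (fun_scale c f x) \<le> (norm c * vnorm ?D f) * vnorm F x" if x: "x \<in> vcarrier F" for x
      using mult_left_mono[OF norm_dual_bound(2)[OF F f x], of "norm c"] by (simp add: fun_scale_def norm_mult mult.assoc)
    ultimately show ?thesis
      using norm_dual_le[OF F, of "fun_scale c f" "norm c * vnorm ?D f"] norm_dual_bound(1)[OF F f] by simp
  qed
  have zero: "0 \<in> vcarrier ?D \<and> vnorm ?D 0 \<le> 0"
    using norm_dual_le[OF F, of "0 :: 'w \<Rightarrow> 'k" 0] by (simp add: lin_functional_def)
  have V: "vec_space ?D"
    unfolding vec_space_def sel
  proof
    show v: "vector_space (fun_scale :: 'k \<Rightarrow> ('w \<Rightarrow> 'k) \<Rightarrow> 'w \<Rightarrow> 'k)" by (rule vector_space_fun_scale)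
    then have m: "module (fun_scale :: 'k \<Rightarrow> ('w \<Rightarrow> 'k) \<Rightarrow> 'w \<Rightarrow> 'k)" by (simp add: module_iff_vector_space)
    show "module.subspace fun_scale (vcarrier ?D)"
      by (rule module.subspaceI[OF m]) (use zero addc scalec in auto)
  qed
  have "is_norm ?D (vnorm ?D)"
    unfolding is_norm_def sel
  proof (intro conjI ballI allI)
    fix f assume f: "f \<in> vcarrier ?D"
    show "0 \<le> vnorm ?D f" by (rule norm_dual_bound(1)[OF F f])
    show "vnorm ?D f = 0 \<longleftrightarrow> f = 0"
    proof
      assume "vnorm ?D f = 0"
      then have "f x = 0" if "x \<in> vcarrier F" for x using norm_dual_bound(2)[OF F f that] by simp
      moreover have "f x = 0" if "x \<notin> vcarrier F" for x using lf[OF f] that by (simp add: lin_functional_def)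
      ultimately show "f = 0" unfolding fun_eq_iff zero_fun_def by blast
    next
      assume "f = 0"
      then show "vnorm ?D f = 0" using zero norm_dual_bound(1)[OF F f] by simp
    qed
    show "vnorm ?D (fun_scale c f) = norm c * vnorm ?D f" for c
    proof (cases "c = 0")
      case True
      then have "fun_scale c f = 0" by (auto simp: fun_scale_def)
      moreover have "vnorm ?D 0 = 0" using zero norm_dual_bound(1)[OF F, of 0] by simp
      ultimately show ?thesis using True by simp
    next
      case False
      have cf: "fun_scale c f \<in> vcarrier ?D" using scalec[OF f] by blast
      have "f = fun_scale (inverse c) (fun_scale c f)" using False by (auto simp: fun_scale_def)
      then have "vnorm ?D f \<le> norm (inverse c) * vnorm ?D (fun_scale c f)" using scalec[OF cf, of "inverse c"] by simp
      then have "norm c * vnorm ?D f \<le> vnorm ?D (fun_scale c f)" using False by (simp add: norm_inverse norm_divide field_simps)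
      then show ?thesis using scalec[OF f, of c] by simp
    qed
    show "vnorm ?D (f + g) \<le> vnorm ?D f + vnorm ?D g" if "g \<in> vcarrier ?D" for g using addc[OF f that] by blast
  qed
  then show ?thesis using V by (simp add: normed_space_def)
qed

text \<open>The functional \<open>c y \<mapsto> c * \<parallel>y\<parallel>\<close> on the line spanned by \<open>y\<close> is extended.\<close>

lemma norming_functional:
  fixes F :: "('k::rc_scalar, 'w::ab_group_add) nspace"
  assumes F: "normed_space F" and y: "y \<in> vcarrier F"
  obtains f where "f \<in> vcarrier (norm_dual F)" "vnorm (norm_dual F) f \<le> 1" "f y = of_real (vnorm F y)"
proof (cases "y = 0")
  case True
  have "lin_functional F (\<lambda>_. 0 :: 'k)" by (simp add: lin_functional_def)
  then have "(\<lambda>_. 0 :: 'k) \<in> vcarrier (norm_dual F)" "vnorm (norm_dual F) (\<lambda>_. 0 :: 'k) \<le> 1"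
    using norm_dual_le[OF F, of "\<lambda>_. 0" 1] is_normD(1)[OF normed_spaceD(2)[OF F]] by auto
  then show thesis using that True norm_algebra(1)[OF normed_spaceD(1)[OF F] normed_spaceD(2)[OF F]] by force
next
  case False
  note FV = normed_spaceD(1)[OF F] and FN = normed_spaceD(2)[OF F]
  define Y where "Y = range (\<lambda>c. vscale F c y)"
  have inj: "c = d" if "vscale F c y = vscale F d y" for c d
    using that False vector_space.scale_cancel_right[OF vec_space_vector_space[OF FV]] by blast
  define u where "u z = (THE c. z = vscale F c y) * of_real (vnorm F y)" for z
  have u: "u (vscale F c y) = c * of_real (vnorm F y)" for c
  proof -
    have "(THE d. vscale F c y = vscale F d y) = c" using inj by (intro the_equality) auto
    then show ?thesis by (simp add: u_def)
  qed
  have sub: "module.subspace (vscale F) Y"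
  proof (rule module.subspaceI[OF vec_space_module[OF FV]])
    have "vscale F 0 y = 0" by (simp add: vs_algebra[OF FV])
    then show "0 \<in> Y" unfolding Y_def by (metis rangeI)
    show "a + b \<in> Y" if "a \<in> Y" "b \<in> Y" for a b
      using that unfolding Y_def by (auto simp: vs_algebra(4)[OF FV, symmetric])
    show "vscale F c a \<in> Y" if "a \<in> Y" for a c using that unfolding Y_def by (auto simp: vs_algebra(7)[OF FV])
  qed
  have YF: "Y \<subseteq> vcarrier F" using vs_closed(5)[OF FV y] by (auto simp: Y_def)
  have y0: "0 \<le> vnorm F y" by (rule is_normD(1)[OF FN y])
  obtain f where f: "lin_functional F f" "\<And>x. x \<in> Y \<Longrightarrow> f x = u x" "\<And>x. x \<in> vcarrier F \<Longrightarrow> norm (f x) \<le> 1 * vnorm F x"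
  proof (rule Hahn_Banach_extension[OF F YF sub, of u 1])
    show "u (a + b) = u a + u b" if "a \<in> Y" "b \<in> Y" for a b
      using that unfolding Y_def by (auto simp: u vs_algebra(4)[OF FV, symmetric] algebra_simps)
    show "u (vscale F c a) = c * u a" if "a \<in> Y" for a c using that unfolding Y_def by (auto simp: u vs_algebra(7)[OF FV])
    show "norm (u a) \<le> 1 * vnorm F a" if "a \<in> Y" for a
      using that unfolding Y_def by (auto simp: u norm_mult is_normD(3)[OF FN y] y0)
  qed (use that in auto)
  have "y \<in> Y" unfolding Y_def using vs_algebra(8)[OF FV, of y] by (metis rangeI)
  then have "f y = of_real (vnorm F y)" using f(2) u[of 1] by (simp add: vs_algebra[OF FV])
  then show thesis using that norm_dual_le[OF F f(1) _ f(3)] by simp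
qed

section \<open>Pairs of norms\<close>

lemma orbit2E:
  assumes "vec_space V" "m \<in> Norms V" "n \<in> Norms (alg_dual V)" "(m', n') \<in> orbit2 V (m, n)"
  obtains \<Delta> where "m' \<in> Norms V" "n' \<in> Norms (alg_dual V)" "\<Delta> \<in> GL V" "\<And>x. x \<in> vcarrier V \<Longrightarrow> m' (\<Delta> x) = m x"
    "\<And>f. f \<in> vcarrier (alg_dual V) \<Longrightarrow> n' f = n (adjoint V \<Delta> f)"
  using orbit2_iff[OF assms(1-3)] assms(4) by blast

lemma orbit2I:
  assumes "vec_space V" "m \<in> Norms V" "n \<in> Norms (alg_dual V)" "m' \<in> Norms V" "n' \<in> Norms (alg_dual V)" "\<Delta> \<in> GL V"
    "\<And>x. x \<in> vcarrier V \<Longrightarrow> m' (\<Delta> x) = m x" "\<And>f. f \<in> vcarrier (alg_dual V) \<Longrightarrow> n' f = n (adjoint V \<Delta> f)"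
  shows "(m', n') \<in> orbit2 V (m, n)"
  using orbit2_iff[OF assms(1-3)] assms(4-8) by blast

abbreviation Norm_pairs where "Norm_pairs V \<equiv> Norms V \<times> Norms (alg_dual V)"

lemma orbit2_self:
  assumes V: "vec_space V" and p: "p \<in> Norm_pairs V"
  shows "p \<in> orbit2 V p"
proof -
  obtain m n where mn: "p = (m, n)" "m \<in> Norms V" "n \<in> Norms (alg_dual V)" using p by auto
  show ?thesis unfolding mn(1)
    by (rule orbit2I[OF V mn(2,3) mn(2,3) GL_id]) (simp_all add: adjoint_id)
qed

lemma orbit2_subset:
  assumes V: "vec_space V" and p: "p \<in> Norm_pairs V"
  shows "orbit2 V p \<subseteq> Norm_pairs V"
proof -
  obtain m n where mn: "p = (m, n)" "m \<in> Norms V" "n \<in> Norms (alg_dual V)" using p by auto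
  show ?thesis unfolding mn(1) using orbit2_iff[OF V mn(2,3)] by auto
qed

lemma orbit2_sym:
  assumes V: "vec_space V" and p: "p \<in> Norm_pairs V" and q: "q \<in> orbit2 V p"
  shows "p \<in> orbit2 V q"
proof -
  obtain m n where mn: "p = (m, n)" "m \<in> Norms V" "n \<in> Norms (alg_dual V)" using p by auto
  obtain m' n' where q': "q = (m', n')" by (cases q)
  obtain \<Delta> where D: "m' \<in> Norms V" "n' \<in> Norms (alg_dual V)" "\<Delta> \<in> GL V" "\<And>x. x \<in> vcarrier V \<Longrightarrow> m' (\<Delta> x) = m x"
    "\<And>f. f \<in> vcarrier (alg_dual V) \<Longrightarrow> n' f = n (adjoint V \<Delta> f)"
    using orbit2E[OF V mn(2,3)] q unfolding q' mn(1) by metis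
  show ?thesis unfolding q' mn(1)
  proof (rule orbit2I[OF V D(1,2) mn(2,3) GL_inv[OF V D(3)]])
    show "m (inv_into (vcarrier V) \<Delta> x) = m' x" if "x \<in> vcarrier V" for x
      using D(4)[OF GL_D(7)[OF D(3) that]] GL_D(6)[OF D(3) that] by simp
    show "n f = n' (adjoint V (inv_into (vcarrier V) \<Delta>) f)" if "f \<in> vcarrier (alg_dual V)" for f
      using D(5)[OF adjoint_in_dual[OF V GL_D(1)[OF GL_inv[OF V D(3)]] that]] adjoint_inv_cancel(1)[OF V D(3) that] by simp
  qed
qed

lemma orbit2_trans:
  assumes V: "vec_space V" and p: "p \<in> Norm_pairs V" and q: "q \<in> orbit2 V p" and r: "r \<in> orbit2 V q"
  shows "r \<in> orbit2 V p"
proof -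
  obtain m n where mn: "p = (m, n)" "m \<in> Norms V" "n \<in> Norms (alg_dual V)" using p by auto
  obtain m' n' where q': "q = (m', n')" by (cases q)
  obtain m'' n'' where r': "r = (m'', n'')" by (cases r)
  obtain \<Delta> where D: "m' \<in> Norms V" "n' \<in> Norms (alg_dual V)" "\<Delta> \<in> GL V" "\<And>x. x \<in> vcarrier V \<Longrightarrow> m' (\<Delta> x) = m x"
    "\<And>f. f \<in> vcarrier (alg_dual V) \<Longrightarrow> n' f = n (adjoint V \<Delta> f)"
    using orbit2E[OF V mn(2,3)] q unfolding q' mn(1) by metis
  obtain \<Gamma> where G: "m'' \<in> Norms V" "n'' \<in> Norms (alg_dual V)" "\<Gamma> \<in> GL V" "\<And>x. x \<in> vcarrier V \<Longrightarrow> m'' (\<Gamma> x) = m' x"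
    "\<And>f. f \<in> vcarrier (alg_dual V) \<Longrightarrow> n'' f = n' (adjoint V \<Gamma> f)"
    using orbit2E[OF V D(1,2)] r unfolding q' r' by metis
  show ?thesis unfolding r' mn(1)
  proof (rule orbit2I[OF V mn(2,3) G(1,2) GL_comp[OF G(3) D(3)]])
    show "m'' (\<Gamma> (\<Delta> x)) = m x" if "x \<in> vcarrier V" for x using G(4)[OF GL_D(4)[OF D(3) that]] D(4)[OF that] by simp
    show "n'' f = n (adjoint V (\<lambda>x. \<Gamma> (\<Delta> x)) f)" if "f \<in> vcarrier (alg_dual V)" for f
      using G(5)[OF that] D(5)[OF adjoint_in_dual[OF V GL_D(1)[OF G(3)] that]] adjoint_comp[OF GL_D(1)[OF D(3)]] by metis
  qed
qed

lemma orbit2_eq: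
  assumes V: "vec_space V" and p: "p \<in> Norm_pairs V" and q: "q \<in> orbit2 V p"
  shows "orbit2 V q = orbit2 V p"
proof -
  have q': "q \<in> Norm_pairs V" using orbit2_subset[OF V p] q by blast
  show ?thesis using orbit2_trans[OF V p q] orbit2_trans[OF V q' orbit2_sym[OF V p q]] by blast
qed

lemma fin_dim_alg_dual: "vec_space V \<Longrightarrow> fin_dim V \<Longrightarrow> fin_dim (alg_dual V)"
  using has_dim_alg_dual by (auto simp: fin_dim_def)

lemma omega2_metric:
  fixes V :: "('k::rc_scalar, 'v::ab_group_add, 'z) vspace_scheme"
  assumes V: "vec_space V" and fd: "fin_dim V"
  shows "Metric_space (Norm_pairs V) (dist_on (Norm_pairs V) (omega2 V))"
proof (rule Metric_space_dist_on)
  note W1 = Metric_space_dist_onD[OF omega_metric[OF V fd]]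
  note W2 = Metric_space_dist_onD[OF omega_metric[OF vec_space_alg_dual[OF V] fin_dim_alg_dual[OF V fd]]]
  fix p q r assume p: "p \<in> Norm_pairs V" and q: "q \<in> Norm_pairs V" and r: "r \<in> Norm_pairs V"
  have pqr: "fst p \<in> Norms V" "snd p \<in> Norms (alg_dual V)" "fst q \<in> Norms V" "snd q \<in> Norms (alg_dual V)"
    "fst r \<in> Norms V" "snd r \<in> Norms (alg_dual V)" using p q r by auto
  show "0 \<le> omega2 V p q" using W1(1)[OF pqr(1,3)] W2(1)[OF pqr(2,4)] by (simp add: omega2_def)
  show "omega2 V p q = omega2 V q p" using W1(2)[OF pqr(1,3)] W2(2)[OF pqr(2,4)] by (simp add: omega2_def)
  show "omega2 V p p = 0" using W1(3)[OF pqr(1)] W2(3)[OF pqr(2)] by (simp add: omega2_def)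
  show "p = q" if "omega2 V p q = 0"
  proof -
    have "omega V (fst p) (fst q) = 0" "omega (alg_dual V) (snd p) (snd q) = 0"
      using that W1(1)[OF pqr(1,3)] W2(1)[OF pqr(2,4)] by (auto simp: omega2_def)
    then show ?thesis using W1(4)[OF pqr(1,3)] W2(4)[OF pqr(2,4)] by (simp add: prod_eq_iff)
  qed
  show "omega2 V p r \<le> omega2 V p q + omega2 V q r"
    using W1(5)[OF pqr(1,3,5)] W2(5)[OF pqr(2,4,6)] by (simp add: omega2_def)
qed

text \<open>The maps that carry \<open>q\<close> to norms close to \<open>n\<close> are the adjoints of those that carry \<open>p\<close> to norms close
  to \<open>m\<close>, so one convergent subsequence serves for both.\<close>

lemma orbit2_separated:
  fixes V :: "('k::rc_scalar, 'v::ab_group_add, 'z) vspace_scheme"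
  assumes V: "vec_space V" and fd: "fin_dim V" and P: "P \<in> Norm_pairs V" and Q: "Q \<in> Norm_pairs V"
    and near: "\<And>e. e > 0 \<Longrightarrow> \<exists>Q'\<in>orbit2 V Q. omega2 V P Q' < e"
  shows "orbit2 V P = orbit2 V Q"
proof -
  note V' = vec_space_alg_dual[OF V] and fd' = fin_dim_alg_dual[OF V fd]
  obtain m n where P': "P = (m, n)" and m: "m \<in> Norms V" and n: "n \<in> Norms (alg_dual V)" using P by auto
  obtain p q where Q': "Q = (p, q)" and p: "p \<in> Norms V" and q: "q \<in> Norms (alg_dual V)" using Q by auto
  define e where "e j = inverse (real (Suc j))" for j
  have e: "e j > 0" "e j \<le> 1" for j by (auto simp: e_def divide_simps)
  have "\<forall>j. \<exists>p' q' \<Delta>. omega2 V (m, n) (p', q') < e j \<and> p' \<in> Norms V \<and> q' \<in> Norms (alg_dual V) \<and> \<Delta> \<in> GL V \<and>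
      (\<forall>x\<in>vcarrier V. p' (\<Delta> x) = p x) \<and> (\<forall>f\<in>vcarrier (alg_dual V). q' f = q (adjoint V \<Delta> f))"
  proof
    fix j
    obtain p' q' where "(p', q') \<in> orbit2 V (p, q)" "omega2 V (m, n) (p', q') < e j"
      using near[OF e(1)[of j]] unfolding P' Q' by auto
    then show "\<exists>p' q' \<Delta>. omega2 V (m, n) (p', q') < e j \<and> p' \<in> Norms V \<and> q' \<in> Norms (alg_dual V) \<and> \<Delta> \<in> GL V \<and>
      (\<forall>x\<in>vcarrier V. p' (\<Delta> x) = p x) \<and> (\<forall>f\<in>vcarrier (alg_dual V). q' f = q (adjoint V \<Delta> f))"
      unfolding orbit2_iff[OF V p q] by blast
  qed
  then obtain p' q' \<Delta> where lt: "\<And>j. omega2 V (m, n) (p' j, q' j) < e j" and p': "\<And>j. p' j \<in> Norms V"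
    and q': "\<And>j. q' j \<in> Norms (alg_dual V)" and D: "\<And>j. \<Delta> j \<in> GL V"
    and eqp: "\<And>j x. x \<in> vcarrier V \<Longrightarrow> p' j (\<Delta> j x) = p x"
    and eqq: "\<And>j f. f \<in> vcarrier (alg_dual V) \<Longrightarrow> q' j f = q (adjoint V (\<Delta> j) f)" by metis
  have nr: "norm_near V (e j) m (p' j)" "norm_near (alg_dual V) (e j) n (q' j)" for j
  proof -
    have "omega V m (p' j) \<ge> 0" "omega (alg_dual V) n (q' j) \<ge> 0"
      using omega_le_iff(1)[OF V fd NormsD(1)[OF m] NormsD(1)[OF p']] omega_le_iff(1)[OF V' fd' NormsD(1)[OF n] NormsD(1)[OF q']] by auto
    then have "omega V m (p' j) \<le> e j" "omega (alg_dual V) n (q' j) \<le> e j" using lt[of j] by (auto simp: omega2_def)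
    then show "norm_near V (e j) m (p' j)" "norm_near (alg_dual V) (e j) n (q' j)"
      using omega_near[OF V fd NormsD(1)[OF m] NormsD(1)[OF p']] omega_near[OF V' fd' NormsD(1)[OF n] NormsD(1)[OF q']] by auto
  qed
  have bd: "m (\<Delta> j x) \<le> exp 1 * p x" if x: "x \<in> vcarrier V" for j x
  proof -
    have "m (\<Delta> j x) \<le> exp (e j) * p x"
      using nr(1)[of j] GL_D(4)[OF D x, of j] eqp[OF x, of j] unfolding norm_near_def by metis
    also have "\<dots> \<le> exp 1 * p x" using e is_normD(1)[OF NormsD(1)[OF p] x] by (intro mult_right_mono) auto
    finally show ?thesis .
  qed
  obtain r \<Gamma> where r: "strict_mono (r :: nat \<Rightarrow> nat)" and \<Gamma>: "lin_map V V \<Gamma>"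
    and lim: "\<And>p x. is_norm V p \<Longrightarrow> x \<in> vcarrier V \<Longrightarrow> (\<lambda>j. p (\<Delta> (r j) x)) \<longlonglongrightarrow> p (\<Gamma> x)"
    and lim': "\<And>q f. is_norm (alg_dual V) q \<Longrightarrow> f \<in> vcarrier (alg_dual V) \<Longrightarrow>
      (\<lambda>j. q (adjoint V (\<Delta> (r j)) f)) \<longlonglongrightarrow> q (adjoint V \<Gamma> f)"
    by (rule bounded_maps_limit[where T = \<Delta>, OF V fd NormsD(1)[OF m] GL_D(1)[OF D] bd])
      (assumption, rule that)
  have er: "(\<lambda>j. e (r j)) \<longlonglongrightarrow> 0"
    using LIMSEQ_subseq_LIMSEQ[OF LIMSEQ_inverse_real_of_nat r] by (simp add: comp_def e_def)
  have eq: "m (\<Gamma> x) = p x" if x: "x \<in> vcarrier V" for x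
    by (rule norm_near_limit[of V "\<lambda>j. e (r j)" "\<lambda>_. m" "\<lambda>j. p' (r j)" "\<lambda>j. \<Delta> (r j) x"])
      (use nr er GL_D(4)[OF D x] lim[OF NormsD(1)[OF m] x] eqp[OF x] in auto)
  have eq': "n f = q (adjoint V \<Gamma> f)" if f: "f \<in> vcarrier (alg_dual V)" for f
    by (rule norm_near_limit[of "alg_dual V" "\<lambda>j. e (r j)" "\<lambda>_. n" "\<lambda>j. q' (r j)" "\<lambda>_. f"])
      (use nr er f lim'[OF NormsD(1)[OF q] f] eqq[OF f] in auto)
  have "inj_on \<Gamma> (vcarrier V)"
    unfolding lin_map_inj_on_iff[OF V \<Gamma>]
    using eq is_normD(2)[OF NormsD(1)[OF p]] norm_algebra(1)[OF V NormsD(1)[OF m]] by metis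
  then have "P \<in> orbit2 V Q" unfolding P' Q' using orbit2I[OF V p q m n GL_injI[OF V fd \<Gamma>] eq eq'] by blast
  then show ?thesis by (rule orbit2_eq[OF V Q])
qed

text \<open>On the second norms \<open>\<Delta>\<close> acts through the inverse of its adjoint, which is an element of the general
  linear group of the dual space. So the action is by isometries on both factors.\<close>

lemma omega2_quot_metric:
  fixes V :: "('k::rc_scalar, nat \<Rightarrow> 'k) vspace" and k :: nat
  defines "V \<equiv> coord_space k"
  shows "\<And>P Q r. P \<in> Norm_pairs V \<Longrightarrow> Q \<in> Norm_pairs V \<Longrightarrow>
      omega2_quot k (orbit2 V P) (orbit2 V Q) < r \<longleftrightarrow> (\<exists>Q'\<in>orbit2 V Q. omega2 V P Q' < r)"
    "Metric_space (orbit2 V ` Norm_pairs V) (dist_on (orbit2 V ` Norm_pairs V) (omega2_quot k))"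
proof -
  have V: "vec_space V" and k: "has_dim V k" unfolding V_def by (rule vec_space_coord_space has_dim_coord_space)+
  have fd: "fin_dim V" using k by (auto simp: fin_dim_def)
  note V' = vec_space_alg_dual[OF V] and fd' = fin_dim_alg_dual[OF V fd]
  have oq: "omega2_quot k = (\<lambda>P Q. Inf {omega2 V p q | p q. p \<in> P \<and> q \<in> Q})"
    by (intro ext) (simp add: omega2_quot_def V_def)
  have inv: "\<exists>Q'\<in>orbit2 V Q. omega2 V P' Q' \<le> omega2 V P Q"
    if P: "P \<in> Norm_pairs V" and Q: "Q \<in> Norm_pairs V" and P': "P' \<in> orbit2 V P" for P Q P'
  proof -
    obtain m n where P1: "P = (m, n)" and m: "m \<in> Norms V" and n: "n \<in> Norms (alg_dual V)" using P by auto
    obtain p q where Q1: "Q = (p, q)" and p: "p \<in> Norms V" and q: "q \<in> Norms (alg_dual V)" using Q by auto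
    obtain m' n' where P1': "P' = (m', n')" by (cases P')
    obtain \<Delta> where D: "m' \<in> Norms V" "n' \<in> Norms (alg_dual V)" "\<Delta> \<in> GL V" "\<And>x. x \<in> vcarrier V \<Longrightarrow> m' (\<Delta> x) = m x"
      "\<And>f. f \<in> vcarrier (alg_dual V) \<Longrightarrow> n' f = n (adjoint V \<Delta> f)"
      using orbit2E[OF V m n] P' unfolding P1 P1' by metis
    define p' q' where "p' = act V \<Delta> p" and "q' = act_dual V \<Delta> q"
    have Q': "(p', q') \<in> orbit2 V (p, q)" using D(3) by (auto simp: orbit2_def p'_def q'_def)
    have N: "p' \<in> Norms V" "q' \<in> Norms (alg_dual V)" using orbit2_subset[OF V, of "(p, q)"] p q Q' by auto
    have p'\<Delta>: "p' (\<Delta> x) = p x" if "x \<in> vcarrier V" for x using GL_D(4,5)[OF D(3) that] by (simp add: p'_def act_def)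
    have 1: "omega V m' p' \<le> omega V m p"
      by (rule omega_orbit[OF V fd m p D(1) N(1) D(3)]) (simp_all add: D(4) p'\<Delta>)
    let ?A = "inv_into (vcarrier (alg_dual V)) (adjoint V \<Delta>)"
    note A = adjoint_GL[OF V D(3)]
    have 2: "omega (alg_dual V) n' q' \<le> omega (alg_dual V) n q"
    proof (rule omega_orbit[OF V' fd' n q D(2) N(2) GL_inv[OF V' A]])
      fix f assume f: "f \<in> vcarrier (alg_dual V)"
      show "n' (?A f) = n f" using D(5)[OF GL_D(7)[OF A f]] GL_D(6)[OF A f] by simp
      show "q' (?A f) = q f" using GL_D(7)[OF A f] GL_D(6)[OF A f] by (simp add: q'_def act_dual_def)
    qed
    show ?thesis using Q' 1 2 by (intro bexI[of _ "(p', q')"]) (auto simp: omega2_def P1 Q1 P1')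
  qed
  note om = orbit_metric[OF omega2_metric[OF V fd], of "orbit2 V", OF orbit2_self[OF V] orbit2_subset[OF V] orbit2_eq[OF V] inv
    orbit2_separated[OF V fd]]
  show "omega2_quot k (orbit2 V P) (orbit2 V Q) < r \<longleftrightarrow> (\<exists>Q'\<in>orbit2 V Q. omega2 V P Q' < r)"
    if "P \<in> Norm_pairs V" "Q \<in> Norm_pairs V" for P Q r unfolding oq by (rule om(1)) (use that in auto)
  show "Metric_space (orbit2 V ` Norm_pairs V) (dist_on (orbit2 V ` Norm_pairs V) (omega2_quot k))"
    unfolding oq by (rule om(2)) auto
qed

section \<open>Operators of finite rank from the dual\<close>

text \<open>The point of \<open>V\<close> that represents \<open>T\<^sub>1\<^sup>* f\<close> in the bidual of \<open>V\<close>, and the operator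
  \<open>T\<^sub>0 \<circ> T\<^sub>1\<^sup>*\<close>.\<close>

definition dual_pt ::
    "('k::field, 'v::ab_group_add, 'z) vspace_scheme \<Rightarrow> (('v \<Rightarrow> 'k) \<Rightarrow> 'w) \<Rightarrow> ('w \<Rightarrow> 'k) \<Rightarrow> 'v" where
  "dual_pt V T1 f = inv_into (vcarrier V) (bidual_eval V) (adjoint (alg_dual V) T1 f)"

definition tens ::
    "('k::field, 'v::ab_group_add, 'z) vspace_scheme \<Rightarrow> ('v \<Rightarrow> 'w) \<Rightarrow> (('v \<Rightarrow> 'k) \<Rightarrow> 'u) \<Rightarrow> ('u \<Rightarrow> 'k) \<Rightarrow> 'w" where
  "tens V T0 T1 f = T0 (dual_pt V T1 f)"

text \<open>The identification of \<open>V\<close> with its bidual characterises the point by the values of all functionals at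
  it.\<close>

lemma dual_pt:
  fixes V :: "('k::field, 'v::ab_group_add, 'z) vspace_scheme" and F :: "('k, 'w::ab_group_add, 'y) vspace_scheme"
  assumes V: "vec_space V" and b: "coord_basis V k b c" and F: "vec_space F"
    and T1: "lin_map (alg_dual V) F T1" and f: "lin_functional F f"
  shows "dual_pt V T1 f \<in> vcarrier V" "\<phi> \<in> vcarrier (alg_dual V) \<Longrightarrow> \<phi> (dual_pt V T1 f) = f (T1 \<phi>)"
    "dual_pt V T1 f = (\<Sum>i<k. vscale V (f (T1 (c i))) (b i))"
    "w \<in> vcarrier V \<Longrightarrow> (\<And>\<phi>. \<phi> \<in> vcarrier (alg_dual V) \<Longrightarrow> \<phi> w = f (T1 \<phi>)) \<Longrightarrow> dual_pt V T1 f = w"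
proof -
  note V' = vec_space_alg_dual[OF V]
  have cm: "c i \<in> vcarrier (alg_dual V)" if "i < k" for i using coord_basisD(2)[OF b that] by (simp add: alg_dual_carrier)
  have inj: "inj_on (bidual_eval V) (vcarrier V)"
  proof (rule inj_onI)
    fix x y assume x: "x \<in> vcarrier V" and y: "y \<in> vcarrier V" and eq: "bidual_eval V x = bidual_eval V y"
    have cxy: "c i x = c i y" if "i < k" for i using fun_cong[OF eq, of "c i"] cm[OF that] by (simp add: bidual_eval_def)
    have "(\<Sum>i<k. vscale V (c i x) (b i)) = (\<Sum>i<k. vscale V (c i y) (b i))"
      by (rule sum.cong[OF refl], subst cxy) simp_all
    then show "x = y" unfolding coord_basisD(4)[OF b x] coord_basisD(4)[OF b y] .
  qed
  have uniq: "dual_pt V T1 f = w" if w: "w \<in> vcarrier V" and eq: "\<And>\<phi>. \<phi> \<in> vcarrier (alg_dual V) \<Longrightarrow> \<phi> w = f (T1 \<phi>)" for w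
  proof -
    have "adjoint (alg_dual V) T1 f = bidual_eval V w" using eq by (auto simp: adjoint_def bidual_eval_def)
    then show ?thesis unfolding dual_pt_def using inv_into_f_f[OF inj w] by simp
  qed
  define w where "w = (\<Sum>i<k. vscale V (f (T1 (c i))) (b i))"
  have w: "w \<in> vcarrier V" unfolding w_def
    by (rule vs_closed(6)[OF V]) (simp add: vs_closed[OF V] coord_basisD(1)[OF b])
  have eq: "\<phi> w = f (T1 \<phi>)" if \<phi>: "\<phi> \<in> vcarrier (alg_dual V)" for \<phi>
  proof -
    have l\<phi>: "lin_functional V \<phi>" using \<phi> by (simp add: alg_dual_carrier)
    have "f (T1 \<phi>) = f (\<Sum>i<k. vscale F (bidual_eval V (b i) \<phi>) (T1 (c i)))"
      using coord_basis_lin_map_expand[OF V' coord_basis_alg_dual[OF V b] T1 \<phi>] by simp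
    also have "\<dots> = (\<Sum>i<k. f (vscale F (bidual_eval V (b i) \<phi>) (T1 (c i))))"
      by (rule lin_functional_algebra(6)[OF F f]) (simp add: vs_closed[OF F] lin_mapD(1)[OF T1 cm])
    also have "\<dots> = (\<Sum>i<k. \<phi> (b i) * f (T1 (c i)))"
      using \<phi> by (intro sum.cong) (auto simp: lin_functional_algebra(5)[OF F f] lin_mapD(1)[OF T1 cm] bidual_eval_def)
    also have "\<dots> = (\<Sum>i<k. \<phi> (vscale V (f (T1 (c i))) (b i)))"
      by (intro sum.cong) (auto simp: lin_functional_algebra(5)[OF V l\<phi>] coord_basisD(1)[OF b])
    also have "\<dots> = \<phi> w" unfolding w_def
      by (rule lin_functional_algebra(6)[OF V l\<phi>, symmetric]) (simp add: vs_closed[OF V] coord_basisD(1)[OF b])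
    finally show ?thesis by simp
  qed
  have dw: "dual_pt V T1 f = w" by (rule uniq[OF w eq])
  show "dual_pt V T1 f \<in> vcarrier V" using w dw by simp
  show "\<phi> \<in> vcarrier (alg_dual V) \<Longrightarrow> \<phi> (dual_pt V T1 f) = f (T1 \<phi>)" using eq dw by simp
  show "dual_pt V T1 f = (\<Sum>i<k. vscale V (f (T1 (c i))) (b i))" using dw by (simp add: w_def)
  show "w \<in> vcarrier V \<Longrightarrow> (\<And>\<phi>. \<phi> \<in> vcarrier (alg_dual V) \<Longrightarrow> \<phi> w = f (T1 \<phi>)) \<Longrightarrow> dual_pt V T1 f = w" for w
    by (rule uniq)
qed

lemma norm_dualD: "f \<in> vcarrier (norm_dual F) \<Longrightarrow> lin_functional F f"
  by (simp add: norm_dual_iff)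

text \<open>The difference is split as \<open>(A\<^sub>0 - B\<^sub>0) \<circ> A\<^sub>1\<^sup>* + B\<^sub>0 \<circ> (A\<^sub>1\<^sup>* - B\<^sub>1\<^sup>*)\<close>. The sum of \<open>q (c i) * p (b i)\<close> comes
  from the expansion of a point \<open>T\<^sub>1\<^sup>* f\<close> in the basis.\<close>

lemma tens_diff_bound:
  fixes V :: "('k::rc_scalar, 'v::ab_group_add, 'z) vspace_scheme" and F :: "('k, 'w::ab_group_add) nspace"
  assumes V: "vec_space V" and b: "coord_basis V k b c" and F: "normed_space F"
    and A0: "lin_map V F A0" and B0: "lin_map V F B0" and A1: "lin_map (alg_dual V) F A1" and B1: "lin_map (alg_dual V) F B1"
    and p: "is_norm V p" and q: "is_norm (alg_dual V) q" and a: "a \<ge> 0" and \<epsilon>: "\<epsilon> \<ge> 0"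
    and d0: "\<And>x. x \<in> vcarrier V \<Longrightarrow> vnorm F (A0 x - B0 x) \<le> \<epsilon> * p x"
    and d1: "\<And>\<phi>. \<phi> \<in> vcarrier (alg_dual V) \<Longrightarrow> vnorm F (A1 \<phi> - B1 \<phi>) \<le> \<epsilon> * q \<phi>"
    and b0: "\<And>x. x \<in> vcarrier V \<Longrightarrow> vnorm F (B0 x) \<le> a * p x"
    and b1: "\<And>\<phi>. \<phi> \<in> vcarrier (alg_dual V) \<Longrightarrow> vnorm F (A1 \<phi>) \<le> a * q \<phi>"
    and f: "f \<in> vcarrier (norm_dual F)"
  shows "vnorm F (tens V A0 A1 f - tens V B0 B1 f) \<le> 2 * a * \<epsilon> * (\<Sum>i<k. q (c i) * p (b i)) * vnorm (norm_dual F) f"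
proof -
  note FV = normed_spaceD(1)[OF F]
  note lf = norm_dualD[OF f]
  let ?N = "vnorm (norm_dual F) f" and ?M = "\<Sum>i<k. q (c i) * p (b i)"
  have N0: "0 \<le> ?N" by (rule norm_dual_bound(1)[OF F f])
  have cm: "c i \<in> vcarrier (alg_dual V)" if "i < k" for i using coord_basisD(2)[OF b that] by (simp add: alg_dual_carrier)
  note bV = coord_basisD(1)[OF b]
  have pb: "0 \<le> p (b i)" if "i < k" for i using is_normD(1)[OF p bV[OF that]] .
  define wA wB where "wA = dual_pt V A1 f" and "wB = dual_pt V B1 f"
  have w: "wA \<in> vcarrier V" "wB \<in> vcarrier V"
    unfolding wA_def wB_def using dual_pt(1)[OF V b FV A1 lf] dual_pt(1)[OF V b FV B1 lf] by auto
  have pA: "p wA \<le> a * ?N * ?M"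
  proof -
    have "p wA \<le> (\<Sum>i<k. norm (f (A1 (c i))) * p (b i))"
      unfolding wA_def dual_pt(3)[OF V b FV A1 lf] by (rule norm_lin_comb_le[OF V p]) (simp add: bV)
    also have "\<dots> \<le> (\<Sum>i<k. (?N * (a * q (c i))) * p (b i))"
    proof (intro sum_mono mult_right_mono)
      fix i assume "i \<in> {..<k}"
      then have i: "i < k" by simp
      show "norm (f (A1 (c i))) \<le> ?N * (a * q (c i))"
        by (rule order_trans[OF norm_dual_bound(2)[OF F f lin_mapD(1)[OF A1 cm[OF i]]] mult_left_mono[OF b1[OF cm[OF i]] N0]])
    qed (simp add: pb)
    also have "\<dots> = a * ?N * ?M" by (simp add: sum_distrib_left algebra_simps)
    finally show ?thesis .
  qed
  have pAB: "p (wA - wB) \<le> \<epsilon> * ?N * ?M"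
  proof -
    have "wA - wB = (\<Sum>i<k. vscale V (f (A1 (c i)) - f (B1 (c i))) (b i))"
      unfolding wA_def wB_def dual_pt(3)[OF V b FV A1 lf] dual_pt(3)[OF V b FV B1 lf]
      by (simp add: vs_algebra(5)[OF V] sum_subtractf)
    then have "p (wA - wB) \<le> (\<Sum>i<k. norm (f (A1 (c i)) - f (B1 (c i))) * p (b i))"
      using norm_lin_comb_le[OF V p, of "{..<k}" b "\<lambda>i. f (A1 (c i)) - f (B1 (c i))"] bV by simp
    also have "\<dots> \<le> (\<Sum>i<k. (?N * (\<epsilon> * q (c i))) * p (b i))"
    proof (intro sum_mono mult_right_mono)
      fix i assume "i \<in> {..<k}"
      then have i: "i < k" by simp
      have mem: "A1 (c i) \<in> vcarrier F" "B1 (c i) \<in> vcarrier F" using lin_mapD(1)[OF A1 cm[OF i]] lin_mapD(1)[OF B1 cm[OF i]] by auto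
      have "norm (f (A1 (c i)) - f (B1 (c i))) = norm (f (A1 (c i) - B1 (c i)))"
        using lin_functional_algebra(3)[OF FV lf mem] by simp
      also have "\<dots> \<le> ?N * (\<epsilon> * q (c i))"
        by (rule order_trans[OF norm_dual_bound(2)[OF F f vs_closed(3)[OF FV mem]] mult_left_mono[OF d1[OF cm[OF i]] N0]])
      finally show "norm (f (A1 (c i)) - f (B1 (c i))) \<le> ?N * (\<epsilon> * q (c i))" .
    qed (simp add: pb)
    also have "\<dots> = \<epsilon> * ?N * ?M" by (simp add: sum_distrib_left algebra_simps)
    finally show ?thesis .
  qed
  have "vnorm F (A0 wA - B0 wB) \<le> vnorm F (A0 wA - B0 wA) + vnorm F (B0 wA - B0 wB)"
    by (rule norm_diff_three[OF F lin_mapD(1)[OF A0 w(1)] lin_mapD(1)[OF B0 w(1)] lin_mapD(1)[OF B0 w(2)]])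
  also have "vnorm F (A0 wA - B0 wA) \<le> \<epsilon> * (a * ?N * ?M)"
    by (rule order_trans[OF d0[OF w(1)] mult_left_mono[OF pA \<epsilon>]])
  also have "B0 wA - B0 wB = B0 (wA - wB)" using lin_map_algebra(3)[OF V B0 w] by simp
  also have "vnorm F (B0 (wA - wB)) \<le> a * (\<epsilon> * ?N * ?M)"
    by (rule order_trans[OF b0[OF vs_closed(3)[OF V w]] mult_left_mono[OF pAB a]])
  finally show ?thesis by (simp add: tens_def wA_def wB_def algebra_simps)
qed

text \<open>The functional \<open>f\<close> is prescribed on the range of \<open>T\<^sub>1\<close> by \<open>T\<^sub>1 \<phi> \<mapsto> \<phi> v\<close>, which is bounded by
  \<open>K\<close>, and extended by the Hahn--Banach theorem.\<close>

lemma functional_with_dual_pt: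
  fixes V :: "('k::rc_scalar, 'v::ab_group_add, 'z) vspace_scheme" and F :: "('k, 'w::ab_group_add) nspace"
  assumes V: "vec_space V" and b: "coord_basis V k b c" and F: "normed_space F"
    and n: "is_norm (alg_dual V) n" and T1: "T1 \<in> Emb (with_norm (alg_dual V) n) F"
    and v: "v \<in> vcarrier V" and K: "K \<ge> 0" and bd: "\<And>\<phi>. \<phi> \<in> vcarrier (alg_dual V) \<Longrightarrow> norm (\<phi> v) \<le> K * n \<phi>"
  obtains f where "f \<in> vcarrier (norm_dual F)" "vnorm (norm_dual F) f \<le> K" "dual_pt V T1 f = v"
proof -
  note FV = normed_spaceD(1)[OF F] and V' = vec_space_alg_dual[OF V]
  let ?W = "alg_dual V"
  have T1l: "lin_map ?W F T1" using EmbD(1)[OF T1] by simp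
  have inj: "inj_on T1 (vcarrier ?W)" using Emb_inj[OF normed_space_with_norm[OF V' n] F T1] by simp
  define J where "J = inv_into (vcarrier ?W) T1"
  have J: "J (T1 \<phi>) = \<phi>" if "\<phi> \<in> vcarrier ?W" for \<phi> using that inj by (simp add: J_def)
  obtain f where f: "lin_functional F f" "\<And>y. y \<in> T1 ` vcarrier ?W \<Longrightarrow> f y = J y v"
    "\<And>x. x \<in> vcarrier F \<Longrightarrow> norm (f x) \<le> K * vnorm F x"
  proof (rule Hahn_Banach_extension[OF F, of "T1 ` vcarrier ?W" "\<lambda>y. J y v" K])
    show "T1 ` vcarrier ?W \<subseteq> vcarrier F" using lin_mapD(1)[OF T1l] by blast
    show "module.subspace (vscale F) (T1 ` vcarrier ?W)" by (rule subspace_image_lin_map[OF V' FV T1l])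
    fix x assume "x \<in> T1 ` vcarrier ?W"
    then obtain \<phi> where \<phi>: "\<phi> \<in> vcarrier ?W" "x = T1 \<phi>" by blast
    show "norm (J x v) \<le> K * vnorm F x" using bd[OF \<phi>(1)] EmbD(2)[OF T1, of \<phi>] \<phi> J by simp
    show "J (vscale F d x) v = d * J x v" for d
      using lin_mapD(3)[OF T1l \<phi>(1), of d, symmetric] J[OF vs_closed(5)[OF V' \<phi>(1)]] J[OF \<phi>(1)] \<phi>(2) by (simp add: alg_dual_scale)
    fix y assume "y \<in> T1 ` vcarrier ?W"
    then obtain \<psi> where \<psi>: "\<psi> \<in> vcarrier ?W" "y = T1 \<psi>" by blast
    show "J (x + y) v = J x v + J y v"
      using lin_mapD(2)[OF T1l \<phi>(1) \<psi>(1), symmetric] J[OF vs_closed(2)[OF V' \<phi>(1) \<psi>(1)]] J[OF \<phi>(1)] J[OF \<psi>(1)] \<phi>(2) \<psi>(2) by simp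
  qed (use K that in auto)
  have "dual_pt V T1 f = v" by (rule dual_pt(4)[OF V b FV T1l f(1) v]) (simp add: f(2) J)
  then show thesis using that norm_dual_le[OF F f(1) K f(3)] by blast
qed

text \<open>The rank is \<open>k\<close> because \<open>T\<^sub>1\<^sup>*\<close> maps onto \<open>V\<close> and \<open>T\<^sub>0\<close> is injective.\<close>

lemma tens_linear_bounded:
  fixes V :: "('k::rc_scalar, 'v::ab_group_add, 'z) vspace_scheme" and F :: "('k, 'w::ab_group_add) nspace"
  assumes V: "vec_space V" and b: "coord_basis V k b c" and F: "normed_space F"
    and m: "is_norm V m" and n: "is_norm (alg_dual V) n"
    and T0: "T0 \<in> Emb (with_norm V m) F" and T1: "T1 \<in> Emb (with_norm (alg_dual V) n) F"
  shows "lin_map (norm_dual F) F (tens V T0 T1)" "bounded_map (norm_dual F) F (tens V T0 T1)"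
    "has_rank (norm_dual F) F (tens V T0 T1) k" "has_rank V F T0 k" "has_rank (alg_dual V) F T1 k"
proof -
  note FV = normed_spaceD(1)[OF F] and V' = vec_space_alg_dual[OF V]
  have k: "has_dim V k" by (rule coord_basis_imp_has_dim[OF V b])
  have T0l: "lin_map V F T0" using EmbD(1)[OF T0] by simp
  have T1l: "lin_map (alg_dual V) F T1" using EmbD(1)[OF T1] by simp
  note D = norm_dualD and ND = normed_space_norm_dual[OF F]
  have sel: "vscale (norm_dual F) = fun_scale" by (simp add: norm_dual_def)
  note dp = dual_pt[OF V b FV T1l]
  show "lin_map (norm_dual F) F (tens V T0 T1)"
    unfolding lin_map_def sel tens_def
  proof (intro conjI ballI allI)
    fix f assume f: "f \<in> vcarrier (norm_dual F)"
    show "T0 (dual_pt V T1 f) \<in> vcarrier F" by (rule lin_mapD(1)[OF T0l dp(1)[OF D[OF f]]])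
    fix d
    have "fun_scale d f \<in> vcarrier (norm_dual F)" using vs_closed(5)[OF normed_spaceD(1)[OF ND] f, of d] by (simp add: sel)
    then have "dual_pt V T1 (fun_scale d f) = vscale V d (dual_pt V T1 f)"
    proof (rule dp(4)[OF D])
      show "vscale V d (dual_pt V T1 f) \<in> vcarrier V" by (rule vs_closed(5)[OF V dp(1)[OF D[OF f]]])
      show "\<phi> (vscale V d (dual_pt V T1 f)) = fun_scale d f (T1 \<phi>)" if "\<phi> \<in> vcarrier (alg_dual V)" for \<phi>
        using lin_functional_algebra(5)[OF V _ dp(1)[OF D[OF f]], of \<phi> d] that dp(2)[OF D[OF f] that]
        by (simp add: alg_dual_carrier fun_scale_def)
    qed
    then show "T0 (dual_pt V T1 (fun_scale d f)) = vscale F d (T0 (dual_pt V T1 f))"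
      using lin_mapD(3)[OF T0l dp(1)[OF D[OF f]]] by simp
  next
    fix f g assume f: "f \<in> vcarrier (norm_dual F)" and g: "g \<in> vcarrier (norm_dual F)"
    have "f + g \<in> vcarrier (norm_dual F)" using vs_closed(2)[OF normed_spaceD(1)[OF ND] f g] .
    then have "dual_pt V T1 (f + g) = dual_pt V T1 f + dual_pt V T1 g"
    proof (rule dp(4)[OF D])
      show "dual_pt V T1 f + dual_pt V T1 g \<in> vcarrier V" by (rule vs_closed(2)[OF V dp(1)[OF D[OF f]] dp(1)[OF D[OF g]]])
      show "\<phi> (dual_pt V T1 f + dual_pt V T1 g) = (f + g) (T1 \<phi>)" if "\<phi> \<in> vcarrier (alg_dual V)" for \<phi>
        using lin_functional_algebra(2)[OF V _ dp(1)[OF D[OF f]] dp(1)[OF D[OF g]], of \<phi>] that dp(2)[OF D[OF f] that] dp(2)[OF D[OF g] that]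
        by (simp add: alg_dual_carrier)
    qed
    then show "T0 (dual_pt V T1 (f + g)) = T0 (dual_pt V T1 f) + T0 (dual_pt V T1 g)"
      using lin_mapD(2)[OF T0l dp(1)[OF D[OF f]] dp(1)[OF D[OF g]]] by simp
  qed
  have cm: "c i \<in> vcarrier (alg_dual V)" if "i < k" for i using coord_basisD(2)[OF b that] by (simp add: alg_dual_carrier)
  show "bounded_map (norm_dual F) F (tens V T0 T1)"
    unfolding bounded_map_def
  proof (intro exI ballI)
    fix f assume f: "f \<in> vcarrier (norm_dual F)"
    have "vnorm F (tens V T0 T1 f) = m (dual_pt V T1 f)"
      using EmbD(2)[OF T0, of "dual_pt V T1 f"] dp(1)[OF D[OF f]] by (simp add: tens_def)
    also have "\<dots> \<le> (\<Sum>i<k. norm (f (T1 (c i))) * m (b i))"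
      unfolding dp(3)[OF D[OF f]] by (rule norm_lin_comb_le[OF V m]) (simp add: coord_basisD(1)[OF b])
    also have "\<dots> \<le> (\<Sum>i<k. (vnorm (norm_dual F) f * n (c i)) * m (b i))"
      using norm_dual_bound(2)[OF F f lin_mapD(1)[OF T1l cm]] EmbD(2)[OF T1] cm is_normD(1)[OF m coord_basisD(1)[OF b]]
      by (intro sum_mono mult_right_mono) auto
    also have "\<dots> = (\<Sum>i<k. n (c i) * m (b i)) * vnorm (norm_dual F) f" by (simp add: sum_distrib_left algebra_simps)
    finally show "vnorm F (tens V T0 T1 f) \<le> (\<Sum>i<k. n (c i) * m (b i)) * vnorm (norm_dual F) f" .
  qed
  have inj0: "inj_on T0 (vcarrier V)" using Emb_inj[OF normed_space_with_norm[OF V m] F T0] by simp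
  have inj1: "inj_on T1 (vcarrier (alg_dual V))" using Emb_inj[OF normed_space_with_norm[OF V' n] F T1] by simp
  show r0: "has_rank V F T0 k" unfolding has_rank_def by (rule has_dim_image[OF V FV k T0l inj0])
  show "has_rank (alg_dual V) F T1 k" unfolding has_rank_def
    by (rule has_dim_image[OF V' FV has_dim_alg_dual[OF V k] T1l inj1])
  have "tens V T0 T1 ` vcarrier (norm_dual F) = T0 ` vcarrier V"
  proof
    show "tens V T0 T1 ` vcarrier (norm_dual F) \<subseteq> T0 ` vcarrier V" unfolding tens_def using dp(1)[OF D] by blast
    show "T0 ` vcarrier V \<subseteq> tens V T0 T1 ` vcarrier (norm_dual F)"
    proof
      fix y assume "y \<in> T0 ` vcarrier V"
      then obtain v where v: "v \<in> vcarrier V" "y = T0 v" by blast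
      have "\<exists>K\<ge>0. \<forall>\<phi>\<in>vcarrier (alg_dual V). norm (\<phi> v) \<le> K * n \<phi>"
      proof -
        obtain L where L: "L > 0" "\<And>\<phi>. \<phi> \<in> vcarrier (alg_dual V) \<Longrightarrow> (\<Sum>i<k. norm (bidual_eval V (b i) \<phi>)) \<le> L * n \<phi>"
          using coords_le_norm[OF V' n coord_basis_alg_dual[OF V b]] by blast
        let ?s = "\<Sum>i<k. norm (c i v)"
        have "norm (\<phi> v) \<le> (?s * L) * n \<phi>" if \<phi>: "\<phi> \<in> vcarrier (alg_dual V)" for \<phi>
        proof -
          have "norm (\<phi> v) \<le> (\<Sum>i<k. norm (c i v) * norm (\<phi> (b i)))"
            using coord_basis_functional_expand[OF V b _ v(1), of \<phi>] \<phi> norm_sum[of "\<lambda>i. c i v * \<phi> (b i)" "{..<k}"]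
            by (simp add: alg_dual_carrier norm_mult)
          also have "\<dots> \<le> (\<Sum>i<k. norm (c i v) * (L * n \<phi>))"
          proof (intro sum_mono mult_left_mono)
            fix i assume i: "i \<in> {..<k}"
            then have "norm (\<phi> (b i)) \<le> (\<Sum>i<k. norm (bidual_eval V (b i) \<phi>))"
              using member_le_sum[of i "{..<k}" "\<lambda>i. norm (bidual_eval V (b i) \<phi>)"] \<phi> by (simp add: bidual_eval_def)
            then show "norm (\<phi> (b i)) \<le> L * n \<phi>" using L(2)[OF \<phi>] by linarith
          qed simp
          finally show ?thesis unfolding sum_distrib_right[symmetric] by (simp add: mult.assoc)
        qed
        moreover have "0 \<le> ?s * L" using L(1) by (simp add: sum_nonneg)
        ultimately show ?thesis by blast
      qed
      then obtain K where K: "K \<ge> 0" "\<And>\<phi>. \<phi> \<in> vcarrier (alg_dual V) \<Longrightarrow> norm (\<phi> v) \<le> K * n \<phi>" by blast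
      obtain f where "f \<in> vcarrier (norm_dual F)" "dual_pt V T1 f = v"
        using functional_with_dual_pt[OF V b F n T1 v(1) K] by metis
      then show "y \<in> tens V T0 T1 ` vcarrier (norm_dual F)" using v(2) by (auto simp: tens_def)
    qed
  qed
  then show "has_rank (norm_dual F) F (tens V T0 T1) k" using r0 by (simp add: has_rank_def)
qed

text \<open>As for subspaces, fixed representatives of the two classes serve for all operators, as
  \<open>d_rel_orbits\<close> shows.\<close>

definition d_rel ::
    "('k::rc_scalar, 'v::ab_group_add, 'z) vspace_scheme \<Rightarrow> ('k, 'w::ab_group_add) nspace \<Rightarrow> real \<Rightarrow>
     ('k, 'v) norm_pair \<Rightarrow> ('k, 'v) norm_pair \<Rightarrow> bool" where
  "d_rel V F C P Q \<longleftrightarrow>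
     (\<exists>T0\<in>Emb (with_norm V (fst P)) F. \<exists>T1\<in>Emb (with_norm (alg_dual V) (snd P)) F.
      \<exists>U0\<in>Emb (with_norm V (fst Q)) F. \<exists>U1\<in>Emb (with_norm (alg_dual V) (snd Q)) F.
        \<forall>f\<in>vcarrier (norm_dual F). vnorm F (tens V T0 T1 f - tens V U0 U1 f) \<le> C * vnorm (norm_dual F) f)"

lemma d_relE:
  assumes "d_rel V F C (m, n) (p, q)"
  obtains T0 T1 U0 U1 where "T0 \<in> Emb (with_norm V m) F" "T1 \<in> Emb (with_norm (alg_dual V) n) F"
    "U0 \<in> Emb (with_norm V p) F" "U1 \<in> Emb (with_norm (alg_dual V) q) F"
    "\<And>f. f \<in> vcarrier (norm_dual F) \<Longrightarrow> vnorm F (tens V T0 T1 f - tens V U0 U1 f) \<le> C * vnorm (norm_dual F) f"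
  using assms unfolding d_rel_def by auto

lemma d_relI:
  assumes "T0 \<in> Emb (with_norm V m) F" "T1 \<in> Emb (with_norm (alg_dual V) n) F"
    "U0 \<in> Emb (with_norm V p) F" "U1 \<in> Emb (with_norm (alg_dual V) q) F"
    "\<And>f. f \<in> vcarrier (norm_dual F) \<Longrightarrow> vnorm F (tens V T0 T1 f - tens V U0 U1 f) \<le> C * vnorm (norm_dual F) f"
  shows "d_rel V F C (m, n) (p, q)"
  unfolding d_rel_def fst_conv snd_conv using assms(5)
  by (intro bexI[OF _ assms(1)] bexI[OF _ assms(2)] bexI[OF _ assms(3)] bexI[OF _ assms(4)]) simp

lemma tens_in_carrier:
  assumes V: "vec_space V" and b: "coord_basis V k b c" and F: "normed_space F"
    and T0: "T0 \<in> Emb (with_norm V m) F" and T1: "T1 \<in> Emb (with_norm (alg_dual V) n) F" and f: "f \<in> vcarrier (norm_dual F)"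
  shows "tens V T0 T1 f \<in> vcarrier F"
  unfolding tens_def using EmbD(3)[OF T0, of "dual_pt V T1 f"] dual_pt(1)[OF V b normed_spaceD(1)[OF F] _ norm_dualD[OF f], of T1] EmbD(1)[OF T1]
  by simp

lemma d_rel_sym:
  assumes V: "vec_space V" and b: "coord_basis V k b c" and F: "normed_space F" and R: "d_rel V F C P Q"
  shows "d_rel V F C Q P"
proof -
  obtain m n where P: "P = (m, n)" by (cases P)
  obtain p q where Q: "Q = (p, q)" by (cases Q)
  obtain T0 T1 U0 U1 where T: "T0 \<in> Emb (with_norm V m) F" "T1 \<in> Emb (with_norm (alg_dual V) n) F"
    "U0 \<in> Emb (with_norm V p) F" "U1 \<in> Emb (with_norm (alg_dual V) q) F"
    "\<And>f. f \<in> vcarrier (norm_dual F) \<Longrightarrow> vnorm F (tens V T0 T1 f - tens V U0 U1 f) \<le> C * vnorm (norm_dual F) f"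
    using R unfolding P Q by (rule d_relE) (rule that)
  show ?thesis unfolding P Q
  proof (rule d_relI[OF T(3,4,1,2)])
    fix f assume f: "f \<in> vcarrier (norm_dual F)"
    show "vnorm F (tens V U0 U1 f - tens V T0 T1 f) \<le> C * vnorm (norm_dual F) f"
      using T(5)[OF f] norm_algebra(3)[OF normed_spaceD[OF F] tens_in_carrier[OF V b F T(1,2) f] tens_in_carrier[OF V b F T(3,4) f]] by simp
  qed
qed

text \<open>For \<open>\<Delta>\<close> in the general linear group, the operators of the factors \<open>T\<^sub>0, T\<^sub>1\<close> and
  \<open>T\<^sub>0 \<circ> \<Delta>\<^sup>-\<^sup>1, T\<^sub>1 \<circ> \<Delta>\<^sup>*\<close> coincide.\<close>

lemma d_rel_orbit_left:
  assumes V: "vec_space V" and b: "coord_basis V k b c" and F: "normed_space F"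
    and P: "P \<in> Norm_pairs V" and P': "P' \<in> orbit2 V P" and R: "d_rel V F C P Q"
  shows "d_rel V F C P' Q"
proof -
  obtain m n where P1: "P = (m, n)" and m: "m \<in> Norms V" and n: "n \<in> Norms (alg_dual V)" using P by auto
  obtain p q where Q: "Q = (p, q)" by (cases Q)
  obtain m' n' where P1': "P' = (m', n')" by (cases P')
  obtain \<Delta> where D: "m' \<in> Norms V" "n' \<in> Norms (alg_dual V)" "\<Delta> \<in> GL V" "\<And>x. x \<in> vcarrier V \<Longrightarrow> m' (\<Delta> x) = m x"
    "\<And>f. f \<in> vcarrier (alg_dual V) \<Longrightarrow> n' f = n (adjoint V \<Delta> f)"
    using orbit2E[OF V m n] P' unfolding P1 P1' by metis
  obtain T0 T1 U0 U1 where T: "T0 \<in> Emb (with_norm V m) F" "T1 \<in> Emb (with_norm (alg_dual V) n) F"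
    "U0 \<in> Emb (with_norm V p) F" "U1 \<in> Emb (with_norm (alg_dual V) q) F"
    "\<And>f. f \<in> vcarrier (norm_dual F) \<Longrightarrow> vnorm F (tens V T0 T1 f - tens V U0 U1 f) \<le> C * vnorm (norm_dual F) f"
    using R unfolding P1 Q by (rule d_relE) (rule that)
  note FV = normed_spaceD(1)[OF F]
  let ?D = "inv_into (vcarrier V) \<Delta>"
  let ?T0 = "\<lambda>x. T0 (?D x)" and ?T1 = "\<lambda>f. T1 (adjoint V \<Delta> f)"
  have T0': "?T0 \<in> Emb (with_norm V m') F"
    by (rule Emb_orbit[OF GL_inv[OF V D(3)] _ T(1)]) (use D(4)[OF GL_D(7)[OF D(3)]] GL_D(6)[OF D(3)] in auto)
  have T1': "?T1 \<in> Emb (with_norm (alg_dual V) n') F"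
    by (rule Emb_orbit[OF adjoint_GL[OF V D(3)] _ T(2)]) (simp add: D(5))
  have "tens V ?T0 ?T1 f = tens V T0 T1 f" if f: "f \<in> vcarrier (norm_dual F)" for f
  proof -
    have T1l: "lin_map (alg_dual V) F T1" "lin_map (alg_dual V) F ?T1" using EmbD(1)[OF T(2)] EmbD(1)[OF T1'] by auto
    note lf = norm_dualD[OF f]
    note w = dual_pt(1)[OF V b FV T1l(1) lf]
    have "dual_pt V ?T1 f = \<Delta> (dual_pt V T1 f)"
    proof (rule dual_pt(4)[OF V b FV T1l(2) lf GL_D(4)[OF D(3) w]])
      fix \<phi> assume \<phi>: "\<phi> \<in> vcarrier (alg_dual V)"
      show "\<phi> (\<Delta> (dual_pt V T1 f)) = f (?T1 \<phi>)"
        using dual_pt(2)[OF V b FV T1l(1) lf adjoint_in_dual[OF V GL_D(1)[OF D(3)] \<phi>]] w by (simp add: adjoint_def)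
    qed
    then show ?thesis using GL_D(5)[OF D(3) w] by (simp add: tens_def)
  qed
  then show ?thesis unfolding P1' Q using T(5) by (intro d_relI[OF T0' T1' T(3,4)]) simp
qed

lemma d_rel_orbits:
  assumes V: "vec_space V" and b: "coord_basis V k b c" and F: "normed_space F" and P: "P \<in> Norm_pairs V" and Q: "Q \<in> Norm_pairs V"
  shows "(\<exists>P'\<in>orbit2 V P. \<exists>Q'\<in>orbit2 V Q. d_rel V F C P' Q') \<longleftrightarrow> d_rel V F C P Q"
proof
  assume "\<exists>P'\<in>orbit2 V P. \<exists>Q'\<in>orbit2 V Q. d_rel V F C P' Q'"
  then obtain P' Q' where P': "P' \<in> orbit2 V P" and Q': "Q' \<in> orbit2 V Q" and R: "d_rel V F C P' Q'" by blast
  have N: "P' \<in> Norm_pairs V" "Q' \<in> Norm_pairs V" using orbit2_subset[OF V P] orbit2_subset[OF V Q] P' Q' by auto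
  note left = d_rel_orbit_left[OF V b F]
  have "d_rel V F C P Q'" by (rule left[OF N(1) orbit2_sym[OF V P P'] R])
  then have "d_rel V F C Q' P" by (rule d_rel_sym[OF V b F])
  then have "d_rel V F C Q P" by (rule left[OF N(2) orbit2_sym[OF V Q Q']])
  then show "d_rel V F C P Q" by (rule d_rel_sym[OF V b F])
next
  assume "d_rel V F C P Q"
  then show "\<exists>P'\<in>orbit2 V P. \<exists>Q'\<in>orbit2 V Q. d_rel V F C P' Q'" using orbit2_self[OF V P] orbit2_self[OF V Q] by blast
qed

lemma d_dist_less_iff:
  fixes F :: "('k::rc_scalar, 'w::ab_group_add) nspace" and k :: nat and P Q :: "('k, nat \<Rightarrow> 'k) norm_pair"
  defines "V \<equiv> coord_space k :: ('k, nat \<Rightarrow> 'k) vspace"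
  assumes F: "normed_space F" and P: "P \<in> Norms_in V F \<times> Norms_in (alg_dual V) F"
    and Q: "Q \<in> Norms_in V F \<times> Norms_in (alg_dual V) F"
  shows "d_dist k F (orbit2 V P) (orbit2 V Q) < r \<longleftrightarrow> (\<exists>C. 0 \<le> C \<and> C < r \<and> d_rel V F C P Q)"
proof -
  have V: "vec_space V" and k: "has_dim V k" unfolding V_def by (rule vec_space_coord_space has_dim_coord_space)+
  have fd: "fin_dim V" using k by (auto simp: fin_dim_def)
  obtain b c where b: "coord_basis V k b c" using has_dim_coord_basis[OF V k] by metis
  note FV = normed_spaceD(1)[OF F] and ND = normed_space_norm_dual[OF F]
  have PN: "P \<in> Norm_pairs V" and QN: "Q \<in> Norm_pairs V" using P Q by (auto simp: Norms_in_def)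
  have facI: "tens V T0 T1 \<in> factored_ops k F (orbit2 V S)"
    if S: "S \<in> Norm_pairs V" and mn: "(m, n) \<in> orbit2 V S"
      and T0: "T0 \<in> Emb (with_norm V m) F" and T1: "T1 \<in> Emb (with_norm (alg_dual V) n) F" for S m n T0 T1
  proof -
    have N: "m \<in> Norms V" "n \<in> Norms (alg_dual V)" using orbit2_subset[OF V S] mn by auto
    note tl = tens_linear_bounded[OF V b F NormsD(1)[OF N(1)] NormsD(1)[OF N(2)] T0 T1]
    have "pullback_norm V F T0 = m"
      by (rule extensionalityI[OF _ NormsD(2)[OF N(1)]]) (use EmbD(2)[OF T0] in \<open>auto simp: pullback_norm_def\<close>)
    moreover have "pullback_norm (alg_dual V) F T1 = n"
      by (rule extensionalityI[OF _ NormsD(2)[OF N(2)]]) (use EmbD(2)[OF T1] in \<open>auto simp: pullback_norm_def\<close>)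
    ultimately show ?thesis
      unfolding factored_ops_def Let_def V_def[symmetric] mem_Collect_eq
      using tl mn EmbD(1)[OF T0] EmbD(1)[OF T1]
      by (intro conjI exI[of _ T0] exI[of _ T1]) (simp_all add: tens_def dual_pt_def)
  qed
  have facE: "lin_map (norm_dual F) F T \<and> bounded_map (norm_dual F) F T \<and>
      (\<exists>m n T0 T1. (m, n) \<in> orbit2 V S \<and> T0 \<in> Emb (with_norm V m) F \<and> T1 \<in> Emb (with_norm (alg_dual V) n) F \<and>
        (\<forall>f\<in>vcarrier (norm_dual F). T f = tens V T0 T1 f))"
    if TS: "T \<in> factored_ops k F (orbit2 V S)" for T S
  proof -
    obtain T0 T1 where T: "lin_map (norm_dual F) F T" "bounded_map (norm_dual F) F T"
      "lin_map V F T0" "lin_map (alg_dual V) F T1" "(pullback_norm V F T0, pullback_norm (alg_dual V) F T1) \<in> orbit2 V S"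
      "\<forall>f\<in>vcarrier (norm_dual F). T f = T0 (inv_into (vcarrier V) (bidual_eval V) (adjoint (alg_dual V) T1 f))"
      using TS unfolding factored_ops_def Let_def V_def[symmetric] mem_Collect_eq
      by (elim conjE exE) (rule that)
    have "T0 \<in> Emb (with_norm V (pullback_norm V F T0)) F" "T1 \<in> Emb (with_norm (alg_dual V) (pullback_norm (alg_dual V) F T1)) F"
      using T(3,4) by (auto simp: Emb_def pullback_norm_def)
    moreover have "\<forall>f\<in>vcarrier (norm_dual F). T f = tens V T0 T1 f" using T(6) by (simp add: tens_def dual_pt_def)
    ultimately show ?thesis using T(1,2,5) by blast
  qed
  let ?S = "{op_norm (norm_dual F) F (\<lambda>f. T f - U f) | T U. T \<in> factored_ops k F (orbit2 V P) \<and> U \<in> factored_ops k F (orbit2 V Q)}"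
  have op: "0 \<le> op_norm (norm_dual F) F (\<lambda>f. T f - U f) \<and>
      (\<forall>f\<in>vcarrier (norm_dual F). vnorm F (T f - U f) \<le> op_norm (norm_dual F) F (\<lambda>f. T f - U f) * vnorm (norm_dual F) f)"
    if T: "T \<in> factored_ops k F (orbit2 V P)" and U: "U \<in> factored_ops k F (orbit2 V Q)" for T U
  proof -
    have l: "lin_map (norm_dual F) F T" "lin_map (norm_dual F) F U" using facE[OF T] facE[OF U] by auto
    obtain B where B: "\<forall>f\<in>vcarrier (norm_dual F). vnorm F (T f) \<le> B * vnorm (norm_dual F) f" using facE[OF T] by (auto simp: bounded_map_def)
    obtain B' where B': "\<forall>f\<in>vcarrier (norm_dual F). vnorm F (U f) \<le> B' * vnorm (norm_dual F) f" using facE[OF U] by (auto simp: bounded_map_def)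
    have bd: "vnorm F (T f - U f) \<le> (B + B') * vnorm (norm_dual F) f" if f: "f \<in> vcarrier (norm_dual F)" for f
      using norm_algebra(4)[OF normed_spaceD[OF F] lin_mapD(1)[OF l(1) f] lin_mapD(1)[OF l(2) f]] B B' f
      by (fastforce simp: algebra_simps)
    show ?thesis using op_norm_bound[OF ND F lin_map_diff[OF FV l] bd] by blast
  qed
  have ex: "\<exists>T. T \<in> factored_ops k F (orbit2 V S)" if S: "S \<in> Norms_in V F \<times> Norms_in (alg_dual V) F" for S
  proof -
    obtain m n where mn: "S = (m, n)" "m \<in> Norms_in V F" "n \<in> Norms_in (alg_dual V) F" using S by auto
    have SN: "(m, n) \<in> Norm_pairs V" using mn by (auto simp: Norms_in_def)
    obtain T0 T1 where "T0 \<in> Emb (with_norm V m) F" "T1 \<in> Emb (with_norm (alg_dual V) n) F"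
      using Norms_inD(2)[OF mn(2)] Norms_inD(2)[OF mn(3)] by blast
    from facI[OF SN orbit2_self[OF V SN] this] show ?thesis unfolding mn(1) by blast
  qed
  have "?S \<noteq> {}" using ex[OF P] ex[OF Q] by blast
  moreover have "bdd_below ?S" using op by (intro bdd_belowI[of _ 0]) auto
  ultimately have "d_dist k F (orbit2 V P) (orbit2 V Q) < r \<longleftrightarrow> (\<exists>s\<in>?S. s < r)" unfolding d_dist_def by (rule cInf_less_iff)
  also have "\<dots> \<longleftrightarrow> (\<exists>C. 0 \<le> C \<and> C < r \<and> d_rel V F C P Q)"
  proof
    assume "\<exists>s\<in>?S. s < r"
    then obtain T U where T: "T \<in> factored_ops k F (orbit2 V P)" and U: "U \<in> factored_ops k F (orbit2 V Q)"
      and lt: "op_norm (norm_dual F) F (\<lambda>f. T f - U f) < r" by blast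
    let ?C = "op_norm (norm_dual F) F (\<lambda>f. T f - U f)"
    obtain m n T0 T1 where mn: "(m, n) \<in> orbit2 V P" "T0 \<in> Emb (with_norm V m) F" "T1 \<in> Emb (with_norm (alg_dual V) n) F"
      "\<forall>f\<in>vcarrier (norm_dual F). T f = tens V T0 T1 f" using facE[OF T] by blast
    obtain p q U0 U1 where pq: "(p, q) \<in> orbit2 V Q" "U0 \<in> Emb (with_norm V p) F" "U1 \<in> Emb (with_norm (alg_dual V) q) F"
      "\<forall>f\<in>vcarrier (norm_dual F). U f = tens V U0 U1 f" using facE[OF U] by blast
    have "d_rel V F ?C (m, n) (p, q)" by (rule d_relI[OF mn(2,3) pq(2,3)]) (use op[OF T U] mn(4) pq(4) in auto)
    then have "d_rel V F ?C P Q" using d_rel_orbits[OF V b F PN QN] mn(1) pq(1) by blast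
    then show "\<exists>C. 0 \<le> C \<and> C < r \<and> d_rel V F C P Q" using op[OF T U] lt by blast
  next
    assume "\<exists>C. 0 \<le> C \<and> C < r \<and> d_rel V F C P Q"
    then obtain C where C: "0 \<le> C" "C < r" and R: "d_rel V F C P Q" by blast
    obtain m n where P1: "P = (m, n)" by (cases P)
    obtain p q where Q1: "Q = (p, q)" by (cases Q)
    obtain T0 T1 U0 U1 where T: "T0 \<in> Emb (with_norm V m) F" "T1 \<in> Emb (with_norm (alg_dual V) n) F"
      "U0 \<in> Emb (with_norm V p) F" "U1 \<in> Emb (with_norm (alg_dual V) q) F"
      "\<And>f. f \<in> vcarrier (norm_dual F) \<Longrightarrow> vnorm F (tens V T0 T1 f - tens V U0 U1 f) \<le> C * vnorm (norm_dual F) f"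
      using R unfolding P1 Q1 by (rule d_relE) (rule that)
    have TP: "tens V T0 T1 \<in> factored_ops k F (orbit2 V P)" by (rule facI[OF PN _ T(1,2)]) (use orbit2_self[OF V PN] P1 in simp)
    have UQ: "tens V U0 U1 \<in> factored_ops k F (orbit2 V Q)" by (rule facI[OF QN _ T(3,4)]) (use orbit2_self[OF V QN] Q1 in simp)
    have "op_norm (norm_dual F) F (\<lambda>f. tens V T0 T1 f - tens V U0 U1 f) \<le> C" by (rule op_norm_le[OF ND C(1) T(5)])
    then have "op_norm (norm_dual F) F (\<lambda>f. tens V T0 T1 f - tens V U0 U1 f) < r" using C by simp
    then show "\<exists>s\<in>?S. s < r" using TP UQ by blast
  qed
  finally show ?thesis .
qed

text \<open>The two factors of an operator can be moved by independent isometries \<open>g\<close> and \<open>h\<close> of the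
  space: the result is \<open>g \<circ> T \<circ> h\<^sup>*\<close>, and the adjoint \<open>h\<^sup>*\<close> does not increase norms. So it suffices to
  align the factors one at a time.\<close>

lemma dual_compose_isometry:
  fixes F :: "('k::rc_scalar, 'w::ab_group_add) nspace"
  assumes F: "normed_space F" and h: "h \<in> Emb F F" and f: "f \<in> vcarrier (norm_dual F)"
  shows "adjoint F h f \<in> vcarrier (norm_dual F)" "vnorm (norm_dual F) (adjoint F h f) \<le> vnorm (norm_dual F) f"
proof -
  have "adjoint F h f \<in> vcarrier (alg_dual F)"
    using norm_dualD[OF f] by (intro adjoint_in_dual[OF normed_spaceD(1)[OF F] EmbD(1)[OF h]]) (simp add: alg_dual_carrier)
  then have lin: "lin_functional F (adjoint F h f)" by (simp add: alg_dual_carrier)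
  have "norm (adjoint F h f x) \<le> vnorm (norm_dual F) f * vnorm F x" if x: "x \<in> vcarrier F" for x
    using norm_dual_bound(2)[OF F f EmbD(3)[OF h x]] EmbD(2)[OF h x] x by (simp add: adjoint_def)
  then show "adjoint F h f \<in> vcarrier (norm_dual F)" "vnorm (norm_dual F) (adjoint F h f) \<le> vnorm (norm_dual F) f"
    using norm_dual_le[OF F lin norm_dual_bound(1)[OF F f]] by auto
qed

lemma tens_compose_isometries:
  fixes V :: "('k::rc_scalar, 'v::ab_group_add, 'z) vspace_scheme" and F :: "('k, 'w::ab_group_add) nspace"
  assumes V: "vec_space V" and b: "coord_basis V k b c" and F: "normed_space F" and h: "h \<in> Emb F F"
    and T1: "T1 \<in> Emb (with_norm (alg_dual V) n) F" and f: "f \<in> vcarrier (norm_dual F)"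
  shows "tens V (\<lambda>x. g (T0 x)) (\<lambda>\<phi>. h (T1 \<phi>)) f = g (tens V T0 T1 (adjoint F h f))"
proof -
  note FV = normed_spaceD(1)[OF F]
  have T1l: "lin_map (alg_dual V) F T1" using EmbD(1)[OF T1] by simp
  have hT1: "lin_map (alg_dual V) F (\<lambda>\<phi>. h (T1 \<phi>))" by (rule lin_map_comp[OF T1l EmbD(1)[OF h]])
  note lh = norm_dualD[OF dual_compose_isometry(1)[OF F h f]]
  have "dual_pt V (\<lambda>\<phi>. h (T1 \<phi>)) f = dual_pt V T1 (adjoint F h f)"
  proof (rule dual_pt(4)[OF V b FV hT1 norm_dualD[OF f] dual_pt(1)[OF V b FV T1l lh]])
    show "\<phi> (dual_pt V T1 (adjoint F h f)) = f (h (T1 \<phi>))" if "\<phi> \<in> vcarrier (alg_dual V)" for \<phi>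
      using dual_pt(2)[OF V b FV T1l lh that] lin_mapD(1)[OF T1l that] by (simp add: adjoint_def)
  qed
  then show ?thesis by (simp add: tens_def)
qed

text \<open>Here the tolerance \<open>\<delta>\<close> depends on the pairs only through the bound \<open>K\<close> for the distance of the first
  one to a base point.\<close>

lemma align_tens:
  fixes V :: "('k::rc_scalar, 'v::ab_group_add, 'z) vspace_scheme" and F :: "('k, 'w::ab_group_add) nspace"
  assumes V: "vec_space V" and b: "coord_basis V k b c" and F: "fraisse F"
    and m0: "is_norm V m0" and n0: "is_norm (alg_dual V) n0" and e: "e > 0"
  obtains \<delta> where "\<delta> > 0" "\<And>m n p q T0 T1 U0 U1. is_norm V m \<Longrightarrow> is_norm (alg_dual V) n \<Longrightarrow> is_norm V p \<Longrightarrow>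
    is_norm (alg_dual V) q \<Longrightarrow> norm_near V K m0 m \<Longrightarrow> norm_near (alg_dual V) K n0 n \<Longrightarrow>
    norm_near V \<delta> m p \<Longrightarrow> norm_near (alg_dual V) \<delta> n q \<Longrightarrow>
    T0 \<in> Emb (with_norm V m) F \<Longrightarrow> T1 \<in> Emb (with_norm (alg_dual V) n) F \<Longrightarrow>
    U0 \<in> Emb (with_norm V p) F \<Longrightarrow> U1 \<in> Emb (with_norm (alg_dual V) q) F \<Longrightarrow>
    \<exists>g\<in>Emb F F. \<exists>h\<in>Emb F F. \<forall>f\<in>vcarrier (norm_dual F).
      vnorm F (tens V T0 T1 f - tens V (\<lambda>x. g (U0 x)) (\<lambda>\<phi>. h (U1 \<phi>)) f) \<le> e * vnorm (norm_dual F) f"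
proof -
  have F': "normed_space F" using F by (simp add: fraisse_def banach_space_def)
  note FV = normed_spaceD(1)[OF F'] and FN = normed_spaceD(2)[OF F'] and V' = vec_space_alg_dual[OF V]
  have k: "has_dim V k" by (rule coord_basis_imp_has_dim[OF V b])
  have k': "has_dim (alg_dual V) k" by (rule has_dim_alg_dual[OF V k])
  have cm: "c i \<in> vcarrier (alg_dual V)" if "i < k" for i using coord_basisD(2)[OF b that] by (simp add: alg_dual_carrier)
  note bV = coord_basisD(1)[OF b]
  \<comment> \<open>A bound for the sum in \<open>tens_diff_bound\<close>, where \<open>p\<close> and \<open>q\<close> are within \<open>K + 1\<close> of the base point.\<close>
  define M where "M = (\<Sum>i<k. (exp (K + 1) * n0 (c i)) * (exp (K + 1) * m0 (b i)))"
  have M: "M \<ge> 0" unfolding M_def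
    using is_normD(1)[OF n0 cm] is_normD(1)[OF m0 bV] by (intro sum_nonneg mult_nonneg_nonneg) auto
  define \<epsilon> where "\<epsilon> = e / (2 * exp 1 * M + 1)"
  have den: "2 * exp 1 * M + 1 > 0" using M by (intro add_nonneg_pos mult_nonneg_nonneg) auto
  have \<epsilon>: "\<epsilon> > 0" "2 * exp 1 * \<epsilon> * M \<le> e" using e M den by (auto simp: \<epsilon>_def field_simps)
  obtain \<delta>1 where \<delta>1: "\<delta>1 > 0" and al: "\<And>m p T U. is_norm V m \<Longrightarrow> is_norm V p \<Longrightarrow> norm_near V \<delta>1 m p \<Longrightarrow>
      T \<in> Emb (with_norm V m) F \<Longrightarrow> U \<in> Emb (with_norm V p) F \<Longrightarrow>
      \<exists>g\<in>Emb F F. g ` vcarrier F = vcarrier F \<and> (\<forall>x\<in>vcarrier V. vnorm F (g (U x) - T x) \<le> \<epsilon> * p x)"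
    using fraisse_align[OF F \<epsilon>(1), of k] V k by metis
  obtain \<delta>2 where \<delta>2: "\<delta>2 > 0" and al': "\<And>m p T U. is_norm (alg_dual V) m \<Longrightarrow> is_norm (alg_dual V) p \<Longrightarrow> norm_near (alg_dual V) \<delta>2 m p \<Longrightarrow>
      T \<in> Emb (with_norm (alg_dual V) m) F \<Longrightarrow> U \<in> Emb (with_norm (alg_dual V) p) F \<Longrightarrow>
      \<exists>g\<in>Emb F F. g ` vcarrier F = vcarrier F \<and> (\<forall>x\<in>vcarrier (alg_dual V). vnorm F (g (U x) - T x) \<le> \<epsilon> * p x)"
    using fraisse_align[OF F \<epsilon>(1), of k] V' k' by metis
  define \<delta> where "\<delta> = min (min \<delta>1 \<delta>2) 1"
  have \<delta>: "\<delta> > 0" "\<delta> \<le> \<delta>1" "\<delta> \<le> \<delta>2" "\<delta> \<le> 1" using \<delta>1 \<delta>2 by (auto simp: \<delta>_def)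
  show thesis
  proof (rule that[OF \<delta>(1)])
    fix m n p q T0 T1 U0 U1
    assume mn: "is_norm V m" and nn: "is_norm (alg_dual V) n" and pn: "is_norm V p" and qn: "is_norm (alg_dual V) q"
      and Km: "norm_near V K m0 m" and Kn: "norm_near (alg_dual V) K n0 n"
      and mp: "norm_near V \<delta> m p" and nq: "norm_near (alg_dual V) \<delta> n q"
      and T: "T0 \<in> Emb (with_norm V m) F" "T1 \<in> Emb (with_norm (alg_dual V) n) F"
      and U: "U0 \<in> Emb (with_norm V p) F" "U1 \<in> Emb (with_norm (alg_dual V) q) F"
    obtain g where g: "g \<in> Emb F F" and gU: "\<And>x. x \<in> vcarrier V \<Longrightarrow> vnorm F (g (U0 x) - T0 x) \<le> \<epsilon> * p x"
      using al[OF mn pn norm_near_mono[OF mp \<delta>(2) mn pn] T(1) U(1)] by blast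
    obtain h where h: "h \<in> Emb F F" and hU: "\<And>x. x \<in> vcarrier (alg_dual V) \<Longrightarrow> vnorm F (h (U1 x) - T1 x) \<le> \<epsilon> * q x"
      using al'[OF nn qn norm_near_mono[OF nq \<delta>(3) nn qn] T(2) U(2)] by blast
    note gU0 = Emb_comp[OF U(1) g] and hU1 = Emb_comp[OF U(2) h]
    have lin: "lin_map V F T0" "lin_map V F (\<lambda>x. g (U0 x))" "lin_map (alg_dual V) F T1" "lin_map (alg_dual V) F (\<lambda>\<phi>. h (U1 \<phi>))"
      using EmbD(1)[OF T(1)] EmbD(1)[OF T(2)] EmbD(1)[OF gU0] EmbD(1)[OF hU1] by auto
    have n1: "n \<phi> \<le> exp 1 * q \<phi>" if "\<phi> \<in> vcarrier (alg_dual V)" for \<phi>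
      using norm_near_mono[OF nq \<delta>(4) nn qn] that by (simp add: norm_near_def)
    have p1: "p x \<le> exp (K + 1) * m0 x" if "x \<in> vcarrier V" for x
      using norm_near_trans[OF Km norm_near_mono[OF mp \<delta>(4) mn pn]] that by (simp add: norm_near_def)
    have q1: "q x \<le> exp (K + 1) * n0 x" if "x \<in> vcarrier (alg_dual V)" for x
      using norm_near_trans[OF Kn norm_near_mono[OF nq \<delta>(4) nn qn]] that by (simp add: norm_near_def)
    have qpM: "(\<Sum>i<k. q (c i) * p (b i)) \<le> M" unfolding M_def
      using p1[OF bV] q1[OF cm] is_normD(1)[OF n0 cm] is_normD(1)[OF pn bV]
      by (intro sum_mono mult_mono) auto
    show "\<exists>g\<in>Emb F F. \<exists>h\<in>Emb F F. \<forall>f\<in>vcarrier (norm_dual F).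
      vnorm F (tens V T0 T1 f - tens V (\<lambda>x. g (U0 x)) (\<lambda>\<phi>. h (U1 \<phi>)) f) \<le> e * vnorm (norm_dual F) f"
    proof (rule bexI[OF _ g], rule bexI[OF _ h], rule ballI)
      fix f assume f: "f \<in> vcarrier (norm_dual F)"
      let ?N = "vnorm (norm_dual F) f"
      have N0: "0 \<le> ?N" by (rule norm_dual_bound(1)[OF F' f])
      have "vnorm F (tens V T0 T1 f - tens V (\<lambda>x. g (U0 x)) (\<lambda>\<phi>. h (U1 \<phi>)) f) \<le> 2 * exp 1 * \<epsilon> * (\<Sum>i<k. q (c i) * p (b i)) * ?N"
      proof (rule tens_diff_bound[OF V b F' lin pn qn _ _ _ _ _ _ f])
        show "vnorm F (T0 x - g (U0 x)) \<le> \<epsilon> * p x" if x: "x \<in> vcarrier V" for x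
          using gU[OF x] norm_algebra(3)[OF FV FN lin_mapD(1)[OF lin(1) x] lin_mapD(1)[OF lin(2) x]] by simp
        show "vnorm F (T1 x - h (U1 x)) \<le> \<epsilon> * q x" if x: "x \<in> vcarrier (alg_dual V)" for x
          using hU[OF x] norm_algebra(3)[OF FV FN lin_mapD(1)[OF lin(3) x] lin_mapD(1)[OF lin(4) x]] by simp
        show "vnorm F (g (U0 x)) \<le> exp 1 * p x" if x: "x \<in> vcarrier V" for x
        proof -
          have "p x \<le> exp 1 * p x" using is_normD(1)[OF pn x] by (simp add: mult_le_cancel_right1)
          then show ?thesis using EmbD(2)[OF gU0] x by simp
        qed
        show "vnorm F (T1 \<phi>) \<le> exp 1 * q \<phi>" if "\<phi> \<in> vcarrier (alg_dual V)" for \<phi> using EmbD(2)[OF T(2)] n1 that by simp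
      qed (use \<epsilon> in auto)
      also have "\<dots> \<le> e * ?N"
      proof (rule mult_right_mono[OF _ N0])
        have "2 * exp 1 * \<epsilon> * (\<Sum>i<k. q (c i) * p (b i)) \<le> 2 * exp 1 * \<epsilon> * M"
          using qpM \<epsilon>(1) by (intro mult_left_mono) auto
        then show "2 * exp 1 * \<epsilon> * (\<Sum>i<k. q (c i) * p (b i)) \<le> e" using \<epsilon>(2) by linarith
      qed
      finally show "vnorm F (tens V T0 T1 f - tens V (\<lambda>x. g (U0 x)) (\<lambda>\<phi>. h (U1 \<phi>)) f) \<le> e * ?N" .
    qed
  qed
qed

lemma d_rel_of_omega:
  fixes V :: "('k::rc_scalar, 'v::ab_group_add, 'z) vspace_scheme" and F :: "('k, 'w::ab_group_add) nspace"
  assumes V: "vec_space V" and b: "coord_basis V k b c" and F: "fraisse F"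
    and m0: "is_norm V m0" and n0: "is_norm (alg_dual V) n0" and e: "e > 0"
  obtains \<delta> where "\<delta> > 0" "\<And>m n p q. m \<in> Norms_in V F \<Longrightarrow> n \<in> Norms_in (alg_dual V) F \<Longrightarrow> p \<in> Norms_in V F \<Longrightarrow>
    q \<in> Norms_in (alg_dual V) F \<Longrightarrow> norm_near V K m0 m \<Longrightarrow> norm_near (alg_dual V) K n0 n \<Longrightarrow>
    norm_near V \<delta> m p \<Longrightarrow> norm_near (alg_dual V) \<delta> n q \<Longrightarrow> d_rel V F e (m, n) (p, q)"
proof (rule align_tens[OF V b F m0 n0 e, of K], goal_cases)
  case (1 \<delta>)
  show thesis
  proof (rule that[OF 1(2)])
    fix m n p q
    assume m: "m \<in> Norms_in V F" and n: "n \<in> Norms_in (alg_dual V) F" and p: "p \<in> Norms_in V F"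
      and q: "q \<in> Norms_in (alg_dual V) F" and near: "norm_near V K m0 m" "norm_near (alg_dual V) K n0 n"
        "norm_near V \<delta> m p" "norm_near (alg_dual V) \<delta> n q"
    note nm = NormsD(1)[OF Norms_inD(1)]
    obtain T0 T1 U0 U1 where T: "T0 \<in> Emb (with_norm V m) F" "T1 \<in> Emb (with_norm (alg_dual V) n) F"
      and U: "U0 \<in> Emb (with_norm V p) F" "U1 \<in> Emb (with_norm (alg_dual V) q) F"
      using Norms_inD(2)[OF m] Norms_inD(2)[OF n] Norms_inD(2)[OF p] Norms_inD(2)[OF q] by blast
    from 1(3)[OF nm[OF m] nm[OF n] nm[OF p] nm[OF q] near T U]
    obtain g h where g: "g \<in> Emb F F" and h: "h \<in> Emb F F" and gh: "\<forall>f\<in>vcarrier (norm_dual F).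
      vnorm F (tens V T0 T1 f - tens V (\<lambda>x. g (U0 x)) (\<lambda>\<phi>. h (U1 \<phi>)) f) \<le> e * vnorm (norm_dual F) f" by blast
    show "d_rel V F e (m, n) (p, q)"
      by (rule d_relI[OF T Emb_comp[OF U(1) g] Emb_comp[OF U(2) h]]) (use gh in simp)
  qed
qed

text \<open>The two operators of the middle pair are aligned by \<open>g\<close> and \<open>h\<close>, which are also applied to the factors
  of the operator of the last pair.\<close>

lemma d_rel_triangle:
  fixes V :: "('k::rc_scalar, 'v::ab_group_add, 'z) vspace_scheme" and F :: "('k, 'w::ab_group_add) nspace"
  assumes V: "vec_space V" and b: "coord_basis V k b c" and F: "fraisse F" and Q: "Q \<in> Norm_pairs V"
    and R: "d_rel V F C P Q" and S: "d_rel V F D Q Z" and D: "D \<ge> 0" and e: "e > 0"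
  shows "d_rel V F (C + D + e) P Z"
proof -
  have F': "normed_space F" using F by (simp add: fraisse_def banach_space_def)
  note FV = normed_spaceD(1)[OF F']
  obtain m n where P: "P = (m, n)" by (cases P)
  obtain p q where Q1: "Q = (p, q)" and p: "p \<in> Norms V" and q: "q \<in> Norms (alg_dual V)" using Q by auto
  obtain r s where Z: "Z = (r, s)" by (cases Z)
  obtain T0 T1 U0 U1 where T: "T0 \<in> Emb (with_norm V m) F" "T1 \<in> Emb (with_norm (alg_dual V) n) F"
    and U: "U0 \<in> Emb (with_norm V p) F" "U1 \<in> Emb (with_norm (alg_dual V) q) F"
    and TU: "\<And>f. f \<in> vcarrier (norm_dual F) \<Longrightarrow> vnorm F (tens V T0 T1 f - tens V U0 U1 f) \<le> C * vnorm (norm_dual F) f"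
    using R unfolding P Q1 by (rule d_relE) (rule that)
  obtain U0' U1' R0 R1 where U': "U0' \<in> Emb (with_norm V p) F" "U1' \<in> Emb (with_norm (alg_dual V) q) F"
    and R': "R0 \<in> Emb (with_norm V r) F" "R1 \<in> Emb (with_norm (alg_dual V) s) F"
    and UR: "\<And>f. f \<in> vcarrier (norm_dual F) \<Longrightarrow> vnorm F (tens V U0' U1' f - tens V R0 R1 f) \<le> D * vnorm (norm_dual F) f"
    using S unfolding Q1 Z by (rule d_relE) (rule that)
  note pn = NormsD(1)[OF p] and qn = NormsD(1)[OF q]
  obtain \<delta> where \<delta>: "\<delta> > 0" and al: "norm_near V \<delta> p p \<Longrightarrow> norm_near (alg_dual V) \<delta> q q \<Longrightarrow>
      \<exists>g\<in>Emb F F. \<exists>h\<in>Emb F F. \<forall>f\<in>vcarrier (norm_dual F).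
        vnorm F (tens V U0 U1 f - tens V (\<lambda>x. g (U0' x)) (\<lambda>\<phi>. h (U1' \<phi>)) f) \<le> e * vnorm (norm_dual F) f"
  proof (rule align_tens[OF V b F pn qn e, of 0], goal_cases)
    case (1 \<delta>)
    show ?case by (rule that[OF 1(2)]) (rule 1(3)[OF pn qn pn qn norm_near_refl norm_near_refl _ _ U U'])
  qed
  have "norm_near V \<delta> p p" "norm_near (alg_dual V) \<delta> q q"
    using norm_near_mono[OF norm_near_refl _ pn pn] norm_near_mono[OF norm_near_refl _ qn qn] \<delta> by auto
  from al[OF this] obtain g h where g: "g \<in> Emb F F" and h: "h \<in> Emb F F"
    and gh: "\<And>f. f \<in> vcarrier (norm_dual F) \<Longrightarrow>
      vnorm F (tens V U0 U1 f - tens V (\<lambda>x. g (U0' x)) (\<lambda>\<phi>. h (U1' \<phi>)) f) \<le> e * vnorm (norm_dual F) f" by blast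
  note gU0' = Emb_comp[OF U'(1) g] and hU1' = Emb_comp[OF U'(2) h] and gR0 = Emb_comp[OF R'(1) g] and hR1 = Emb_comp[OF R'(2) h]
  show ?thesis unfolding P Z
  proof (rule d_relI[OF T gR0 hR1])
    fix f assume f: "f \<in> vcarrier (norm_dual F)"
    let ?N = "vnorm (norm_dual F) f"
    let ?t = "tens V T0 T1 f" and ?u = "tens V U0 U1 f" and ?u' = "tens V (\<lambda>x. g (U0' x)) (\<lambda>\<phi>. h (U1' \<phi>)) f"
      and ?r = "tens V (\<lambda>x. g (R0 x)) (\<lambda>\<phi>. h (R1 \<phi>)) f"
    have mem: "?t \<in> vcarrier F" "?u \<in> vcarrier F" "?u' \<in> vcarrier F" "?r \<in> vcarrier F"
      using tens_in_carrier[OF V b F' T f] tens_in_carrier[OF V b F' U f] tens_in_carrier[OF V b F' gU0' hU1' f]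
        tens_in_carrier[OF V b F' gR0 hR1 f] by auto
    have 1: "vnorm F (?u - ?u') \<le> e * ?N" by (rule gh[OF f])
    have 2: "vnorm F (?u' - ?r) \<le> D * ?N"
    proof -
      note fh = dual_compose_isometry[OF F' h f]
      let ?a = "tens V U0' U1' (adjoint F h f)" and ?b = "tens V R0 R1 (adjoint F h f)"
      have ab: "?a \<in> vcarrier F" "?b \<in> vcarrier F"
        using tens_in_carrier[OF V b F' U' fh(1)] tens_in_carrier[OF V b F' R' fh(1)] by auto
      have "?u' - ?r = g (?a - ?b)"
        using tens_compose_isometries[OF V b F' h U'(2) f, of g U0'] tens_compose_isometries[OF V b F' h R'(2) f, of g R0]
          lin_map_algebra(3)[OF FV EmbD(1)[OF g] ab] by simp
      then have "vnorm F (?u' - ?r) = vnorm F (?a - ?b)" using EmbD(2)[OF g vs_closed(3)[OF FV ab]] by simp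
      also have "\<dots> \<le> D * vnorm (norm_dual F) (adjoint F h f)" by (rule UR[OF fh(1)])
      also have "\<dots> \<le> D * ?N" by (rule mult_left_mono[OF fh(2) D])
      finally show ?thesis .
    qed
    have "vnorm F (?t - ?r) \<le> vnorm F (?t - ?u) + vnorm F (?u - ?r)" by (rule norm_diff_three[OF F' mem(1,2,4)])
    also have "vnorm F (?u - ?r) \<le> vnorm F (?u - ?u') + vnorm F (?u' - ?r)" by (rule norm_diff_three[OF F' mem(2,3,4)])
    finally show "vnorm F (?t - ?r) \<le> (C + D + e) * ?N" using 1 2 TU[OF f] by (simp add: algebra_simps)
  qed
qed

text \<open>Let the operators \<open>T = T\<^sub>0 \<circ> T\<^sub>1\<^sup>*\<close> and \<open>U = U\<^sub>0 \<circ> U\<^sub>1\<^sup>*\<close> be close. Choose functionals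
  \<open>f\<^sub>i\<close> with \<open>T\<^sub>1\<^sup>* f\<^sub>i = b\<^sub>i\<close> and let \<open>\<Delta> b\<^sub>i = U\<^sub>1\<^sup>* f\<^sub>i\<close>. Then \<open>U\<^sub>0 \<circ> \<Delta>\<close> is close to \<open>T\<^sub>0\<close>, and
  consequently \<open>\<Delta> \<circ> T\<^sub>1\<^sup>*\<close> is close to \<open>U\<^sub>1\<^sup>*\<close>, so that \<open>\<Delta>\<close> nearly carries the first pair of norms
  to the second one. The bounds only involve the first pair, through its distance to the base point.\<close>

lemma omega_of_d_rel:
  fixes V :: "('k::rc_scalar, 'v::ab_group_add, 'z) vspace_scheme" and F :: "('k, 'w::ab_group_add) nspace"
  assumes V: "vec_space V" and b: "coord_basis V k b c" and F: "normed_space F"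
    and m0: "is_norm V m0" and n0: "is_norm (alg_dual V) n0" and e: "e > 0"
  obtains \<delta> where "\<delta> > 0" "\<And>m n p q C. m \<in> Norms V \<Longrightarrow> n \<in> Norms (alg_dual V) \<Longrightarrow> p \<in> Norms V \<Longrightarrow>
    q \<in> Norms (alg_dual V) \<Longrightarrow> norm_near V K m0 m \<Longrightarrow> norm_near (alg_dual V) K n0 n \<Longrightarrow>
    0 \<le> C \<Longrightarrow> C < \<delta> \<Longrightarrow> d_rel V F C (m, n) (p, q) \<Longrightarrow>
    \<exists>p' q'. (p', q') \<in> orbit2 V (p, q) \<and> norm_near V e m p' \<and> norm_near (alg_dual V) e n q'"
proof -
  note FV = normed_spaceD(1)[OF F] and FN = normed_spaceD(2)[OF F] and V' = vec_space_alg_dual[OF V]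
  have k: "has_dim V k" by (rule coord_basis_imp_has_dim[OF V b])
  have fd: "fin_dim V" using k by (auto simp: fin_dim_def)
  have cm: "c i \<in> vcarrier (alg_dual V)" if "i < k" for i using coord_basisD(2)[OF b that] by (simp add: alg_dual_carrier)
  note bV = coord_basisD(1)[OF b]
  obtain L1 where L1: "L1 > 0" "\<And>x. x \<in> vcarrier V \<Longrightarrow> (\<Sum>i<k. norm (c i x)) \<le> L1 * m0 x"
    using coords_le_norm[OF V m0 b] by blast
  obtain L2 where L2: "L2 > 0" "\<And>\<phi>. \<phi> \<in> vcarrier (alg_dual V) \<Longrightarrow> (\<Sum>i<k. norm (bidual_eval V (b i) \<phi>)) \<le> L2 * n0 \<phi>"
    using coords_le_norm[OF V' n0 coord_basis_alg_dual[OF V b]] by blast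
  define L3 where "L3 = (\<Sum>i<k. (exp K * n0 (c i)) * (exp K * m0 (b i)))"
  have L3: "L3 \<ge> 0" unfolding L3_def
    using is_normD(1)[OF n0 cm] is_normD(1)[OF m0 bV] by (intro sum_nonneg mult_nonneg_nonneg) auto
  \<comment> \<open>One constant bounds coordinates by norms and norms of the basis vectors.\<close>
  define \<kappa> where "\<kappa> = L1 * exp K + L2 * exp K + L3"
  have "L1 * exp K > 0" "L2 * exp K > 0" using L1(1) L2(1) by simp_all
  then have \<kappa>: "\<kappa> > 0" "L1 * exp K \<le> \<kappa>" "L2 * exp K \<le> \<kappa>" "L3 \<le> \<kappa>"
    using L3 unfolding \<kappa>_def by linarith+
  \<comment> \<open>The final estimates are \<open>C * \<kappa>\<^sup>2\<close> for the first norms and \<open>C * (\<kappa>\<^sup>2 * exp e * (\<kappa> ^ 3 + 1))\<close> for the second ones.\<close>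
  define s where "s = 1 - exp (- e)"
  have s: "s > 0" "s < 1" using e by (auto simp: s_def)
  define M where "M = \<kappa>\<^sup>2 + \<kappa>\<^sup>2 * exp e * (\<kappa> ^ 3 + 1)"
  have M: "M > 0" "\<kappa>\<^sup>2 \<le> M" "\<kappa>\<^sup>2 * exp e * (\<kappa> ^ 3 + 1) \<le> M"
    using \<kappa>(1) by (auto simp: M_def add_pos_pos)
  show thesis
  proof (rule that[of "s / M"])
    show "s / M > 0" using s M by simp
    fix m n p q C
    assume m: "m \<in> Norms V" and n: "n \<in> Norms (alg_dual V)" and p: "p \<in> Norms V" and q: "q \<in> Norms (alg_dual V)"
      and Km: "norm_near V K m0 m" and Kn: "norm_near (alg_dual V) K n0 n" and C: "0 \<le> C" "C < s / M"
      and R: "d_rel V F C (m, n) (p, q)"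
    note mn = NormsD(1)[OF m] and nn = NormsD(1)[OF n] and pn = NormsD(1)[OF p]
    have CM: "C * M \<le> s" using C M by (simp add: pos_less_divide_eq less_imp_le)
    have b1: "(\<Sum>i<k. norm (c i x)) \<le> \<kappa> * m x" if x: "x \<in> vcarrier V" for x
    proof -
      have "m0 x \<le> exp K * m x" using Km x by (simp add: norm_near_def)
      then have "L1 * m0 x \<le> L1 * (exp K * m x)" using L1(1) by (intro mult_left_mono) auto
      also have "\<dots> \<le> \<kappa> * m x" using mult_right_mono[OF \<kappa>(2) is_normD(1)[OF mn x]] by (simp add: mult.assoc)
      finally show ?thesis using L1(2)[OF x] by linarith
    qed
    have b2: "(\<Sum>i<k. norm (\<phi> (b i))) \<le> \<kappa> * n \<phi>" if \<phi>: "\<phi> \<in> vcarrier (alg_dual V)" for \<phi>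
    proof -
      have "n0 \<phi> \<le> exp K * n \<phi>" using Kn \<phi> by (simp add: norm_near_def)
      then have "L2 * n0 \<phi> \<le> L2 * (exp K * n \<phi>)" using L2(1) by (intro mult_left_mono) auto
      also have "\<dots> \<le> \<kappa> * n \<phi>" using mult_right_mono[OF \<kappa>(3) is_normD(1)[OF nn \<phi>]] by (simp add: mult.assoc)
      finally have "L2 * n0 \<phi> \<le> \<kappa> * n \<phi>" .
      moreover have "(\<Sum>i<k. norm (\<phi> (b i))) \<le> L2 * n0 \<phi>" using L2(2)[OF \<phi>] \<phi> by (simp add: bidual_eval_def)
      ultimately show ?thesis by linarith
    qed
    have b3: "(\<Sum>i<k. n (c i) * m (b i)) \<le> \<kappa>"
    proof -
      have "(\<Sum>i<k. n (c i) * m (b i)) \<le> L3" unfolding L3_def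
        using Km Kn bV cm is_normD(1)[OF n0 cm] is_normD(1)[OF mn bV]
        by (intro sum_mono mult_mono) (auto simp: norm_near_def)
      then show ?thesis using \<kappa>(4) by linarith
    qed
    obtain T0 T1 U0 U1 where T: "T0 \<in> Emb (with_norm V m) F" "T1 \<in> Emb (with_norm (alg_dual V) n) F"
      and U: "U0 \<in> Emb (with_norm V p) F" "U1 \<in> Emb (with_norm (alg_dual V) q) F"
      and TU: "\<And>f. f \<in> vcarrier (norm_dual F) \<Longrightarrow> vnorm F (tens V T0 T1 f - tens V U0 U1 f) \<le> C * vnorm (norm_dual F) f"
      using R by (rule d_relE) (rule that)
    have T0: "lin_map V F T0" "\<And>x. x \<in> vcarrier V \<Longrightarrow> vnorm F (T0 x) = m x" using EmbD(1,2)[OF T(1)] by auto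
    have T1: "lin_map (alg_dual V) F T1" "\<And>x. x \<in> vcarrier (alg_dual V) \<Longrightarrow> vnorm F (T1 x) = n x" using EmbD(1,2)[OF T(2)] by auto
    have U0: "lin_map V F U0" "\<And>x. x \<in> vcarrier V \<Longrightarrow> vnorm F (U0 x) = p x" using EmbD(1,2)[OF U(1)] by auto
    have U1: "lin_map (alg_dual V) F U1" "\<And>x. x \<in> vcarrier (alg_dual V) \<Longrightarrow> vnorm F (U1 x) = q x" using EmbD(1,2)[OF U(2)] by auto
    have "\<exists>f. f \<in> vcarrier (norm_dual F) \<and> vnorm (norm_dual F) f \<le> \<kappa> \<and> dual_pt V T1 f = b i" if i: "i < k" for i
    proof -
      have "norm (\<phi> (b i)) \<le> \<kappa> * n \<phi>" if \<phi>: "\<phi> \<in> vcarrier (alg_dual V)" for \<phi>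
        using member_le_sum[of i "{..<k}" "\<lambda>i. norm (\<phi> (b i))"] i b2[OF \<phi>] by simp
      then show ?thesis using functional_with_dual_pt[OF V b F nn T(2) bV[OF i], of \<kappa>] \<kappa>(1) by (metis less_imp_le)
    qed
    then obtain f where f: "\<And>i. i < k \<Longrightarrow> f i \<in> vcarrier (norm_dual F)" "\<And>i. i < k \<Longrightarrow> vnorm (norm_dual F) (f i) \<le> \<kappa>"
      "\<And>i. i < k \<Longrightarrow> dual_pt V T1 (f i) = b i" by metis
    define d where "d i = dual_pt V U1 (f i)" for i
    have d: "d i \<in> vcarrier V" if "i < k" for i unfolding d_def by (rule dual_pt(1)[OF V b FV U1(1) norm_dualD[OF f(1)[OF that]]])
    define \<Delta> where "\<Delta> x = (\<Sum>i<k. vscale V (c i x) (d i))" for x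
    have \<Delta>l: "lin_map V V \<Delta>" unfolding \<Delta>_def by (rule lin_comb_lin_map[OF V coord_basisD(2)[OF b] d])
    have U0\<Delta>: "vnorm F (T0 x - U0 (\<Delta> x)) \<le> C * \<kappa>\<^sup>2 * m x" if x: "x \<in> vcarrier V" for x
    proof -
      have mem: "T0 (b i) - U0 (d i) \<in> vcarrier F" if "i < k" for i
        using vs_closed(3)[OF FV lin_mapD(1)[OF T0(1) bV[OF that]] lin_mapD(1)[OF U0(1) d[OF that]]] .
      have "U0 (\<Delta> x) = (\<Sum>i<k. U0 (vscale V (c i x) (d i)))"
        unfolding \<Delta>_def by (rule lin_map_algebra(4)[OF V U0(1)]) (simp add: vs_closed[OF V] d)
      also have "\<dots> = (\<Sum>i<k. vscale F (c i x) (U0 (d i)))" by (intro sum.cong) (auto simp: lin_mapD(3)[OF U0(1)] d)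
      finally have "T0 x - U0 (\<Delta> x) = (\<Sum>i<k. vscale F (c i x) (T0 (b i) - U0 (d i)))"
        using coord_basis_lin_map_expand[OF V b T0(1) x] by (simp add: vs_algebra(2)[OF FV] sum_subtractf)
      then have "vnorm F (T0 x - U0 (\<Delta> x)) \<le> (\<Sum>i<k. norm (c i x) * vnorm F (T0 (b i) - U0 (d i)))"
        using norm_lin_comb_le[OF FV FN, of "{..<k}" "\<lambda>i. T0 (b i) - U0 (d i)" "\<lambda>i. c i x"] mem by simp
      also have "\<dots> \<le> (\<Sum>i<k. norm (c i x) * (C * \<kappa>))"
      proof (intro sum_mono mult_left_mono)
        fix i assume "i \<in> {..<k}"
        then have i: "i < k" by simp
        have "vnorm F (T0 (b i) - U0 (d i)) \<le> C * vnorm (norm_dual F) (f i)"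
          using TU[OF f(1)[OF i]] f(3)[OF i] by (simp add: tens_def d_def)
        also have "\<dots> \<le> C * \<kappa>" by (rule mult_left_mono[OF f(2)[OF i] C(1)])
        finally show "vnorm F (T0 (b i) - U0 (d i)) \<le> C * \<kappa>" .
      qed simp
      also have "\<dots> = (\<Sum>i<k. norm (c i x)) * (C * \<kappa>)" by (simp only: sum_distrib_right)
      also have "\<dots> \<le> (\<kappa> * m x) * (C * \<kappa>)" using b1[OF x] C(1) \<kappa>(1) by (intro mult_right_mono) auto
      also have "\<dots> = C * \<kappa>\<^sup>2 * m x" by (simp add: power2_eq_square)
      finally show ?thesis .
    qed
    have close: "\<bar>p (\<Delta> x) - m x\<bar> \<le> s * m x" if x: "x \<in> vcarrier V" for x
    proof -
      note \<Delta>x = lin_mapD(1)[OF \<Delta>l x]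
      have "\<bar>m x - p (\<Delta> x)\<bar> \<le> vnorm F (T0 x - U0 (\<Delta> x))"
        using norm_algebra(6)[OF FV FN lin_mapD(1)[OF T0(1) x] lin_mapD(1)[OF U0(1) \<Delta>x]] T0(2)[OF x] U0(2)[OF \<Delta>x] by simp
      also have "\<dots> \<le> C * \<kappa>\<^sup>2 * m x" by (rule U0\<Delta>[OF x])
      also have "\<dots> \<le> s * m x"
      proof (rule mult_right_mono[OF _ is_normD(1)[OF mn x]])
        have "C * \<kappa>\<^sup>2 \<le> C * M" by (rule mult_left_mono[OF M(2) C(1)])
        then show "C * \<kappa>\<^sup>2 \<le> s" using CM by linarith
      qed
      finally show ?thesis by (simp add: abs_minus_commute)
    qed
    have near1: "norm_near V e m (\<lambda>x. p (\<Delta> x))"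
      by (rule norm_near_diffI[OF _ mn]) (use e close in \<open>auto simp: s_def\<close>)
    have "inj_on \<Delta> (vcarrier V)"
      unfolding lin_map_inj_on_iff[OF V \<Delta>l]
    proof (intro ballI impI)
      fix x assume x: "x \<in> vcarrier V" and "\<Delta> x = 0"
      then have "m x \<le> 0" using near1 norm_algebra(1)[OF V pn] by (auto simp: norm_near_def)
      then show "x = 0" using is_normD(1,2)[OF mn x] by simp
    qed
    then have \<Delta>: "\<Delta> \<in> GL V" by (rule GL_injI[OF V fd \<Delta>l])
    define \<Gamma> where "\<Gamma> = inv_into (vcarrier V) \<Delta>"
    have \<Gamma>: "\<Gamma> \<in> GL V" unfolding \<Gamma>_def by (rule GL_inv[OF V \<Delta>])
    have \<Delta>\<Gamma>: "\<Delta> (\<Gamma> x) = x" "\<Gamma> (\<Delta> x) = x" if "x \<in> vcarrier V" for x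
      unfolding \<Gamma>_def using GL_D(5,6)[OF \<Delta> that] by auto
    define p' where "p' = act V \<Gamma> p"
    define q' where "q' = act_dual V \<Gamma> q"
    have orb: "(p', q') \<in> orbit2 V (p, q)" using \<Gamma> by (auto simp: orbit2_def p'_def q'_def)
    have p': "p' x = p (\<Delta> x)" if x: "x \<in> vcarrier V" for x
    proof -
      have "inv_into (vcarrier V) \<Gamma> x = \<Delta> x"
        using GL_D(5)[OF \<Gamma> lin_mapD(1)[OF \<Delta>l x]] \<Delta>\<Gamma>(2)[OF x] by simp
      then show ?thesis using x by (simp add: p'_def act_def)
    qed
    have near1': "norm_near V e m p'" using near1 p' by (simp add: norm_near_def)
    have "norm_near (alg_dual V) e n q'"
    proof (rule norm_near_diffI[OF less_imp_le[OF e] nn])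
      fix \<psi> assume \<psi>: "\<psi> \<in> vcarrier (alg_dual V)"
      define \<xi> where "\<xi> = adjoint V \<Gamma> \<psi>"
      have \<xi>: "\<xi> \<in> vcarrier (alg_dual V)" unfolding \<xi>_def by (rule adjoint_in_dual[OF V GL_D(1)[OF \<Gamma>] \<psi>])
      have q'\<psi>: "q' \<psi> = vnorm F (U1 \<xi>)" using \<psi> U1(2)[OF \<xi>] by (simp add: q'_def act_dual_def \<xi>_def)
      have mem: "T1 \<psi> \<in> vcarrier F" "U1 \<xi> \<in> vcarrier F" using lin_mapD(1)[OF T1(1) \<psi>] lin_mapD(1)[OF U1(1) \<xi>] by auto
      note dm = vs_closed(3)[OF FV mem]
      \<comment> \<open>The difference of \<open>T\<^sub>1 \<psi>\<close> and \<open>U\<^sub>1 \<xi>\<close> is measured by a norming functional \<open>g\<close>, whose value is that of \<open>\<psi>\<close> at \<open>T\<^sub>1\<^sup>* g - \<Delta>\<^sup>-\<^sup>1 (U\<^sub>1\<^sup>* g)\<close>.\<close>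
      obtain g where g: "g \<in> vcarrier (norm_dual F)" "vnorm (norm_dual F) g \<le> 1" "g (T1 \<psi> - U1 \<xi>) = of_real (vnorm F (T1 \<psi> - U1 \<xi>))"
        using norming_functional[OF F dm] by metis
      note lg = norm_dualD[OF g(1)]
      define wT wU where "wT = dual_pt V T1 g" and "wU = dual_pt V U1 g"
      have w: "wT \<in> vcarrier V" "wU \<in> vcarrier V"
        unfolding wT_def wU_def using dual_pt(1)[OF V b FV T1(1) lg] dual_pt(1)[OF V b FV U1(1) lg] by auto
      define w' where "w' = wT - \<Gamma> wU"
      have \<Gamma>wU: "\<Gamma> wU \<in> vcarrier V" by (rule GL_D(4)[OF \<Gamma> w(2)])
      have w': "w' \<in> vcarrier V" unfolding w'_def by (rule vs_closed(3)[OF V w(1) \<Gamma>wU])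
      have l\<psi>: "lin_functional V \<psi>" using \<psi> by (simp add: alg_dual_carrier)
      have "g (T1 \<psi> - U1 \<xi>) = g (T1 \<psi>) - g (U1 \<xi>)" by (rule lin_functional_algebra(3)[OF FV lg mem])
      also have "\<dots> = \<psi> wT - \<xi> wU"
        unfolding wT_def wU_def using dual_pt(2)[OF V b FV T1(1) lg \<psi>] dual_pt(2)[OF V b FV U1(1) lg \<xi>] by simp
      also have "\<dots> = \<psi> w'"
        using lin_functional_algebra(3)[OF V l\<psi> w(1) \<Gamma>wU] w by (simp add: \<xi>_def adjoint_def w'_def)
      finally have gw: "\<psi> w' = of_real (vnorm F (T1 \<psi> - U1 \<xi>))" using g(3) by simp
      have mwT: "m wT \<le> \<kappa>"
      proof -
        have "m wT \<le> (\<Sum>i<k. norm (g (T1 (c i))) * m (b i))"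
          unfolding wT_def dual_pt(3)[OF V b FV T1(1) lg] by (rule norm_lin_comb_le[OF V mn]) (simp add: bV)
        also have "\<dots> \<le> (\<Sum>i<k. n (c i) * m (b i))"
        proof (intro sum_mono mult_right_mono)
          fix i assume "i \<in> {..<k}"
          then have i: "i < k" by simp
          have "norm (g (T1 (c i))) \<le> vnorm (norm_dual F) g * vnorm F (T1 (c i))"
            by (rule norm_dual_bound(2)[OF F g(1) lin_mapD(1)[OF T1(1) cm[OF i]]])
          also have "\<dots> \<le> 1 * vnorm F (T1 (c i))"
            by (rule mult_right_mono[OF g(2) is_normD(1)[OF FN lin_mapD(1)[OF T1(1) cm[OF i]]]])
          finally show "norm (g (T1 (c i))) \<le> n (c i)" using T1(2)[OF cm[OF i]] by simp
        qed (simp add: is_normD(1)[OF mn bV])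
        also have "\<dots> \<le> \<kappa>" by (rule b3)
        finally show ?thesis .
      qed
      have \<Delta>wT: "\<Delta> wT \<in> vcarrier V" by (rule lin_mapD(1)[OF \<Delta>l w(1)])
      have pw: "p (\<Delta> w') \<le> C * (\<kappa> ^ 3 + 1)"
      proof -
        have \<Delta>w': "\<Delta> w' = \<Delta> wT - wU"
          unfolding w'_def using lin_map_algebra(3)[OF V \<Delta>l w(1) \<Gamma>wU] \<Delta>\<Gamma>(1)[OF w(2)] by simp
        have FU: "U0 (\<Delta> wT) \<in> vcarrier F" "U0 wU \<in> vcarrier F" "T0 wT \<in> vcarrier F"
          using lin_mapD(1)[OF U0(1)] lin_mapD(1)[OF T0(1)] w \<Delta>wT by auto
        have "p (\<Delta> w') = vnorm F (U0 (\<Delta> wT) - U0 wU)"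
          using U0(2)[OF vs_closed(3)[OF V \<Delta>wT w(2)]] lin_map_algebra(3)[OF V U0(1) \<Delta>wT w(2)] \<Delta>w' by simp
        also have "\<dots> \<le> vnorm F (U0 (\<Delta> wT) - T0 wT) + vnorm F (T0 wT - U0 wU)"
          by (rule norm_diff_three[OF F FU(1,3,2)])
        also have "vnorm F (U0 (\<Delta> wT) - T0 wT) = vnorm F (T0 wT - U0 (\<Delta> wT))" by (rule norm_algebra(3)[OF FV FN FU(1,3)])
        also have "\<dots> \<le> C * \<kappa>\<^sup>2 * m wT" by (rule U0\<Delta>[OF w(1)])
        also have "\<dots> \<le> C * \<kappa>\<^sup>2 * \<kappa>" using mwT C(1) by (intro mult_left_mono) auto
        also have "vnorm F (T0 wT - U0 wU) \<le> C * vnorm (norm_dual F) g"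
          using TU[OF g(1)] by (simp add: tens_def wT_def wU_def)
        also have "\<dots> \<le> C * 1" by (rule mult_left_mono[OF g(2) C(1)])
        finally show ?thesis by (simp add: algebra_simps power3_eq_cube power2_eq_square)
      qed
      have "m w' \<le> exp e * p (\<Delta> w')" using near1 w' by (simp add: norm_near_def)
      also have "\<dots> \<le> exp e * (C * (\<kappa> ^ 3 + 1))" using pw by simp
      finally have mw': "m w' \<le> exp e * (C * (\<kappa> ^ 3 + 1))" .
      have "vnorm F (T1 \<psi> - U1 \<xi>) = norm (\<psi> w')" using gw is_normD(1)[OF FN dm] by simp
      also have "\<dots> \<le> (\<Sum>i<k. norm (c i w') * norm (\<psi> (b i)))"
        using coord_basis_functional_expand[OF V b l\<psi> w'] norm_sum[of "\<lambda>i. c i w' * \<psi> (b i)" "{..<k}"]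
        by (simp add: norm_mult)
      also have "\<dots> \<le> (\<Sum>i<k. norm (c i w') * (\<kappa> * n \<psi>))"
      proof (intro sum_mono mult_left_mono)
        fix i assume "i \<in> {..<k}"
        then show "norm (\<psi> (b i)) \<le> \<kappa> * n \<psi>"
          using member_le_sum[of i "{..<k}" "\<lambda>i. norm (\<psi> (b i))"] b2[OF \<psi>] by simp
      qed simp
      also have "\<dots> = (\<Sum>i<k. norm (c i w')) * (\<kappa> * n \<psi>)" by (simp only: sum_distrib_right)
      also have "\<dots> \<le> (\<kappa> * m w') * (\<kappa> * n \<psi>)"
        using b1[OF w'] \<kappa>(1) is_normD(1)[OF nn \<psi>] by (intro mult_right_mono mult_nonneg_nonneg) auto
      also have "\<dots> \<le> (\<kappa> * (exp e * (C * (\<kappa> ^ 3 + 1)))) * (\<kappa> * n \<psi>)"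
        using mw' \<kappa>(1) is_normD(1)[OF nn \<psi>] by (intro mult_right_mono mult_left_mono mult_nonneg_nonneg) auto
      also have "\<dots> = (C * (\<kappa>\<^sup>2 * exp e * (\<kappa> ^ 3 + 1))) * n \<psi>" by (simp add: power2_eq_square mult_ac)
      also have "\<dots> \<le> (C * M) * n \<psi>"
        using M(3) C(1) is_normD(1)[OF nn \<psi>] by (intro mult_right_mono mult_left_mono) auto
      also have "\<dots> \<le> s * n \<psi>" using CM is_normD(1)[OF nn \<psi>] by (rule mult_right_mono)
      finally have fin: "vnorm F (T1 \<psi> - U1 \<xi>) \<le> s * n \<psi>" .
      have "\<bar>n \<psi> - q' \<psi>\<bar> \<le> vnorm F (T1 \<psi> - U1 \<xi>)"
        using norm_algebra(6)[OF FV FN mem] T1(2)[OF \<psi>] q'\<psi> by simp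
      then show "\<bar>q' \<psi> - n \<psi>\<bar> \<le> (1 - exp (- e)) * n \<psi>" using fin by (simp add: s_def abs_minus_commute)
    qed
    then show "\<exists>p' q'. (p', q') \<in> orbit2 V (p, q) \<and> norm_near V e m p' \<and> norm_near (alg_dual V) e n q'"
      using orb near1' by blast
  qed
qed

text \<open>All four factors are moved by one approximate isometry \<open>S\<close> and then corrected to isometries. A functional \<open>f\<close> on the target is pulled
  back to the finite-dimensional domain of \<open>S\<close> and extended to \<open>F\<close>; on the extension the given
  operators take values that \<open>S\<close> maps to those of the moved operators at \<open>f\<close>.\<close>

lemma d_rel_transfer:
  fixes V :: "('k::rc_scalar, 'v::ab_group_add, 'z) vspace_scheme"
    and F :: "('k, 'w::ab_group_add) nspace" and G :: "('k, 'u::ab_group_add) nspace"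
  assumes tr: "transfers F G" and V: "vec_space V" and b: "coord_basis V k b c" and F: "normed_space F" and G: "normed_space G"
    and P: "P \<in> Norms_in V G \<times> Norms_in (alg_dual V) G" and Q: "Q \<in> Norms_in V G \<times> Norms_in (alg_dual V) G"
    and C: "C \<ge> 0" and R: "d_rel V F C P Q" and e: "e > 0"
  shows "d_rel V G (C + e) P Q"
proof -
  note FV = normed_spaceD(1)[OF F] and GV = normed_spaceD(1)[OF G] and GN = normed_spaceD(2)[OF G]
    and V' = vec_space_alg_dual[OF V]
  have k: "has_dim V k" by (rule coord_basis_imp_has_dim[OF V b])
  have k': "has_dim (alg_dual V) k" by (rule has_dim_alg_dual[OF V k])
  have cm: "c i \<in> vcarrier (alg_dual V)" if "i < k" for i using coord_basisD(2)[OF b that] by (simp add: alg_dual_carrier)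
  note bV = coord_basisD(1)[OF b]
  obtain m n where P1: "P = (m, n)" and m: "m \<in> Norms_in V G" and n: "n \<in> Norms_in (alg_dual V) G" using P by auto
  obtain p q where Q1: "Q = (p, q)" and p: "p \<in> Norms_in V G" and q: "q \<in> Norms_in (alg_dual V) G" using Q by auto
  note mn = NormsD(1)[OF Norms_inD(1)[OF m]] and nn = NormsD(1)[OF Norms_inD(1)[OF n]]
    and pn = NormsD(1)[OF Norms_inD(1)[OF p]] and qn = NormsD(1)[OF Norms_inD(1)[OF q]]
  obtain T0 T1 U0 U1 where T: "T0 \<in> Emb (with_norm V m) F" "T1 \<in> Emb (with_norm (alg_dual V) n) F"
    and U: "U0 \<in> Emb (with_norm V p) F" "U1 \<in> Emb (with_norm (alg_dual V) q) F"
    and TU: "\<And>f. f \<in> vcarrier (norm_dual F) \<Longrightarrow> vnorm F (tens V T0 T1 f - tens V U0 U1 f) \<le> C * vnorm (norm_dual F) f"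
    using R unfolding P1 Q1 by (rule d_relE) (rule that)
  define M1 where "M1 = (\<Sum>i<k. n (c i) * m (b i))"
  define M2 where "M2 = (\<Sum>i<k. q (c i) * p (b i))"
  have M: "M1 \<ge> 0" "M2 \<ge> 0" unfolding M1_def M2_def
    using is_normD(1)[OF nn cm] is_normD(1)[OF mn bV] is_normD(1)[OF qn cm] is_normD(1)[OF pn bV]
    by (auto intro!: sum_nonneg mult_nonneg_nonneg)
  \<comment> \<open>The total error is \<open>\<epsilon> * (3 * C + 4 * M1 + 4 * M2)\<close>: \<open>3 * C\<close> from \<open>(1 + \<epsilon>)\<^sup>2\<close>, the rest from the corrections.\<close>
  define D where "D = 3 * C + 4 * M1 + 4 * M2 + 1"
  have D: "D > 0" using C M by (simp add: D_def)
  define \<epsilon> where "\<epsilon> = min 1 (e / D)"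
  have \<epsilon>: "\<epsilon> > 0" "\<epsilon> \<le> 1" using e D by (auto simp: \<epsilon>_def)
  have "\<epsilon> * D \<le> e" using D by (simp add: \<epsilon>_def pos_le_divide_eq[symmetric])
  then have \<epsilon>e: "\<epsilon> * (3 * C + 4 * M1 + 4 * M2) \<le> e" using \<epsilon>(1) by (simp add: D_def distrib_left)
  let ?I = "\<lambda>T. F\<lparr>vcarrier := T ` vcarrier V\<rparr>" and ?J = "\<lambda>T. F\<lparr>vcarrier := T ` vcarrier (alg_dual V)\<rparr>"
  define \<U> where "\<U> = {?I T0, ?J T1, ?I U0, ?J U1}"
  have ages: "\<U> \<subseteq> Age F"
    using Emb_image_Age(1)[OF F normed_space_with_norm[OF V mn] _ T(1)] Emb_image_Age(1)[OF F normed_space_with_norm[OF V' nn] _ T(2)]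
      Emb_image_Age(1)[OF F normed_space_with_norm[OF V pn] _ U(1)] Emb_image_Age(1)[OF F normed_space_with_norm[OF V' qn] _ U(2)] k k'
    by (simp add: \<U>_def)
  have embs: "Emb W G \<noteq> {}" if "W \<in> \<U>" for W
    using that image_embeds[OF F V mn T(1) Norms_inD(2)[OF m]] image_embeds[OF F V' nn T(2) Norms_inD(2)[OF n]]
      image_embeds[OF F V pn U(1) Norms_inD(2)[OF p]] image_embeds[OF F V' qn U(2) Norms_inD(2)[OF q]] by (auto simp: \<U>_def)
  have fin: "finite \<U>" by (simp add: \<U>_def)
  obtain Y S where Y: "Y \<in> Age F" "\<And>W. W \<in> \<U> \<Longrightarrow> vcarrier W \<subseteq> vcarrier Y" and S: "S \<in> Emb_approx \<epsilon> Y G"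
    and near: "\<And>W. W \<in> \<U> \<Longrightarrow> \<exists>a\<in>Emb W G. \<forall>x\<in>vcarrier W. vnorm G (S x - a x) \<le> \<epsilon> * vnorm F x"
    by (rule transfersD[OF tr fin ages embs \<epsilon>(1)]) (assumption, rule that)
  note YN = AgeD[OF F Y(1)]
  note YV = normed_spaceD(1)[OF YN(1)]
  have S_le: "vnorm G (S x) \<le> (1 + \<epsilon>) * vnorm F x" if "x \<in> vcarrier Y" for x
    using Emb_approxD(3)[OF S that] YN(5) by simp
  have S_lin: "lin_map Y G S" by (rule Emb_approxD(1)[OF S])
  have sub: "T0 ` vcarrier V \<subseteq> vcarrier Y" "T1 ` vcarrier (alg_dual V) \<subseteq> vcarrier Y"
    "U0 ` vcarrier V \<subseteq> vcarrier Y" "U1 ` vcarrier (alg_dual V) \<subseteq> vcarrier Y"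
    using Y(2)[of "?I T0"] Y(2)[of "?J T1"] Y(2)[of "?I U0"] Y(2)[of "?J U1"] by (simp_all add: \<U>_def)
  obtain T0' where T0': "T0' \<in> Emb (with_norm V m) G" "\<And>x. x \<in> vcarrier V \<Longrightarrow> vnorm G (S (T0 x) - T0' x) \<le> \<epsilon> * m x"
    using transfer_embedding[OF T(1), of G S \<epsilon>] near[of "?I T0"] by (auto simp: \<U>_def)
  obtain T1' where T1': "T1' \<in> Emb (with_norm (alg_dual V) n) G" "\<And>x. x \<in> vcarrier (alg_dual V) \<Longrightarrow> vnorm G (S (T1 x) - T1' x) \<le> \<epsilon> * n x"
    using transfer_embedding[OF T(2), of G S \<epsilon>] near[of "?J T1"] by (auto simp: \<U>_def)
  obtain U0' where U0': "U0' \<in> Emb (with_norm V p) G" "\<And>x. x \<in> vcarrier V \<Longrightarrow> vnorm G (S (U0 x) - U0' x) \<le> \<epsilon> * p x"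
    using transfer_embedding[OF U(1), of G S \<epsilon>] near[of "?I U0"] by (auto simp: \<U>_def)
  obtain U1' where U1': "U1' \<in> Emb (with_norm (alg_dual V) q) G" "\<And>x. x \<in> vcarrier (alg_dual V) \<Longrightarrow> vnorm G (S (U1 x) - U1' x) \<le> \<epsilon> * q x"
    using transfer_embedding[OF U(2), of G S \<epsilon>] near[of "?J U1"] by (auto simp: \<U>_def)
  have toY: "lin_map X Y A" if "lin_map X F A" "A ` vcarrier X \<subseteq> vcarrier Y" for X :: "('k, 'c::ab_group_add, 'd) vspace_scheme" and A
    using that YN(4) by (auto simp: lin_map_def)
  \<comment> \<open>Replacing the factors by their corrections to isometries costs little.\<close>
  have correct: "vnorm G (tens V A' B' f - tens V (\<lambda>x. S (A x)) (\<lambda>\<phi>. S (B \<phi>)) f) \<le> 4 * \<epsilon> * (\<Sum>i<k. t (c i) * r (b i)) * vnorm (norm_dual G) f"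
    if r: "is_norm V r" and t: "is_norm (alg_dual V) t" and A: "A \<in> Emb (with_norm V r) F" and B: "B \<in> Emb (with_norm (alg_dual V) t) F"
      and AY: "A ` vcarrier V \<subseteq> vcarrier Y" and BY: "B ` vcarrier (alg_dual V) \<subseteq> vcarrier Y"
      and A': "A' \<in> Emb (with_norm V r) G" "\<And>x. x \<in> vcarrier V \<Longrightarrow> vnorm G (S (A x) - A' x) \<le> \<epsilon> * r x"
      and B': "B' \<in> Emb (with_norm (alg_dual V) t) G" "\<And>x. x \<in> vcarrier (alg_dual V) \<Longrightarrow> vnorm G (S (B x) - B' x) \<le> \<epsilon> * t x"
      and f: "f \<in> vcarrier (norm_dual G)" for r t A B A' B' f
  proof -
    have AF: "lin_map V F A" "lin_map (alg_dual V) F B" using EmbD(1)[OF A] EmbD(1)[OF B] by auto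
    have SA: "lin_map V G (\<lambda>x. S (A x))" "lin_map (alg_dual V) G (\<lambda>\<phi>. S (B \<phi>))"
      using lin_map_comp[OF toY[OF AF(1) AY] S_lin] lin_map_comp[OF toY[OF AF(2) BY] S_lin] by auto
    have A'l: "lin_map V G A'" "lin_map (alg_dual V) G B'" using EmbD(1)[OF A'(1)] EmbD(1)[OF B'(1)] by auto
    have "vnorm G (tens V A' B' f - tens V (\<lambda>x. S (A x)) (\<lambda>\<phi>. S (B \<phi>)) f) \<le> 2 * 2 * \<epsilon> * (\<Sum>i<k. t (c i) * r (b i)) * vnorm (norm_dual G) f"
    proof (rule tens_diff_bound[OF V b G A'l(1) SA(1) A'l(2) SA(2) r t _ _ _ _ _ _ f])
      show "vnorm G (A' x - S (A x)) \<le> \<epsilon> * r x" if x: "x \<in> vcarrier V" for x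
        using A'(2)[OF x] norm_algebra(3)[OF GV GN lin_mapD(1)[OF A'l(1) x] lin_mapD(1)[OF SA(1) x]] by simp
      show "vnorm G (B' x - S (B x)) \<le> \<epsilon> * t x" if x: "x \<in> vcarrier (alg_dual V)" for x
        using B'(2)[OF x] norm_algebra(3)[OF GV GN lin_mapD(1)[OF A'l(2) x] lin_mapD(1)[OF SA(2) x]] by simp
      show "vnorm G (S (A x)) \<le> 2 * r x" if x: "x \<in> vcarrier V" for x
      proof -
        have "vnorm G (S (A x)) \<le> (1 + \<epsilon>) * vnorm F (A x)" by (rule S_le) (use AY x in auto)
        also have "\<dots> \<le> 2 * r x" using EmbD(2)[OF A, of x] x \<epsilon> is_normD(1)[OF r x] by (auto intro: mult_right_mono)
        finally show ?thesis .
      qed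
      show "vnorm G (B' \<phi>) \<le> 2 * t \<phi>" if \<phi>: "\<phi> \<in> vcarrier (alg_dual V)" for \<phi>
        using EmbD(2)[OF B'(1), of \<phi>] \<phi> is_normD(1)[OF t \<phi>] by simp
    qed (use \<epsilon> in auto)
    then show ?thesis by simp
  qed
  show ?thesis unfolding P1 Q1
  proof (rule d_relI[OF T0'(1) T1'(1) U0'(1) U1'(1)])
    fix f assume f: "f \<in> vcarrier (norm_dual G)"
    let ?N = "vnorm (norm_dual G) f"
    have N0: "0 \<le> ?N" by (rule norm_dual_bound(1)[OF G f])
    note lf = norm_dualD[OF f]
    obtain fh where fh: "lin_functional F fh" "\<And>x. x \<in> vcarrier Y \<Longrightarrow> fh x = f (S x)"
      "\<And>x. x \<in> vcarrier F \<Longrightarrow> norm (fh x) \<le> (?N * (1 + \<epsilon>)) * vnorm F x"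
    proof (rule Hahn_Banach_extension[OF F YN(3), of "\<lambda>x. f (S x)" "?N * (1 + \<epsilon>)"])
      show "module.subspace (vscale F) (vcarrier Y)" using vec_space_subspace[OF YV] YN(4) by simp
      fix x assume x: "x \<in> vcarrier Y"
      note Sx = lin_mapD(1)[OF S_lin x]
      show "f (S (x + y)) = f (S x) + f (S y)" if y: "y \<in> vcarrier Y" for y
        using lin_mapD(2)[OF S_lin x y] lin_functional_algebra(2)[OF GV lf Sx lin_mapD(1)[OF S_lin y]] by simp
      show "f (S (vscale F d x)) = d * f (S x)" for d
        using lin_mapD(3)[OF S_lin x, of d] lin_functional_algebra(5)[OF GV lf Sx] YN(4) by simp
      have "norm (f (S x)) \<le> ?N * vnorm G (S x)" by (rule norm_dual_bound(2)[OF G f Sx])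
      also have "\<dots> \<le> ?N * ((1 + \<epsilon>) * vnorm F x)" by (rule mult_left_mono[OF S_le[OF x] N0])
      finally show "norm (f (S x)) \<le> ?N * (1 + \<epsilon>) * vnorm F x" by (simp add: mult.assoc)
    qed (use N0 \<epsilon> that in auto)
    have K0: "0 \<le> ?N * (1 + \<epsilon>)" using N0 \<epsilon> by simp
    note fhd = norm_dual_le[OF F fh(1) K0 fh(3)]
    have push: "tens V (\<lambda>x. S (A x)) (\<lambda>\<phi>. S (B \<phi>)) f = S (tens V A B fh)"
      if B: "B \<in> Emb (with_norm (alg_dual V) t) F" and BY: "B ` vcarrier (alg_dual V) \<subseteq> vcarrier Y" for A B t
    proof -
      have Bl: "lin_map (alg_dual V) F B" using EmbD(1)[OF B] by simp
      have SB: "lin_map (alg_dual V) G (\<lambda>\<phi>. S (B \<phi>))" by (rule lin_map_comp[OF toY[OF Bl BY] S_lin])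
      have "dual_pt V (\<lambda>\<phi>. S (B \<phi>)) f = dual_pt V B fh"
      proof (rule dual_pt(4)[OF V b GV SB lf dual_pt(1)[OF V b FV Bl fh(1)]])
        show "\<phi> (dual_pt V B fh) = f (S (B \<phi>))" if "\<phi> \<in> vcarrier (alg_dual V)" for \<phi>
          using dual_pt(2)[OF V b FV Bl fh(1) that] fh(2)[of "B \<phi>"] BY that by auto
      qed
      then show ?thesis by (simp add: tens_def)
    qed
    have inY: "tens V A B fh \<in> vcarrier Y"
      if B: "B \<in> Emb (with_norm (alg_dual V) t) F" and AY: "A ` vcarrier V \<subseteq> vcarrier Y" for A B t
      unfolding tens_def using dual_pt(1)[OF V b FV _ fh(1), of B] EmbD(1)[OF B] AY by auto
    let ?t = "tens V T0 T1 fh" and ?u = "tens V U0 U1 fh"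
    have tuY: "?t \<in> vcarrier Y" "?u \<in> vcarrier Y" using inY[OF T(2) sub(1)] inY[OF U(2) sub(3)] by auto
    have "vnorm G (S ?t - S ?u) \<le> (1 + \<epsilon>) * vnorm F (?t - ?u)"
      using S_le[OF vs_closed(3)[OF YV tuY]] lin_map_algebra(3)[OF YV S_lin tuY] by simp
    also have "\<dots> \<le> (1 + \<epsilon>) * (C * (?N * (1 + \<epsilon>)))"
    proof (rule mult_left_mono)
      have "vnorm F (?t - ?u) \<le> C * vnorm (norm_dual F) fh" by (rule TU[OF fhd(1)])
      also have "\<dots> \<le> C * (?N * (1 + \<epsilon>))" by (rule mult_left_mono[OF fhd(2) C])
      finally show "vnorm F (?t - ?u) \<le> C * (?N * (1 + \<epsilon>))" .
    qed (use \<epsilon> in simp)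
    also have "\<dots> \<le> (C + \<epsilon> * (3 * C)) * ?N"
    proof -
      have "\<epsilon> * \<epsilon> \<le> \<epsilon>" using \<epsilon> by (simp add: mult_left_le)
      then have "(1 + \<epsilon>) * (1 + \<epsilon>) \<le> 1 + 3 * \<epsilon>" by (simp add: algebra_simps)
      then have "((1 + \<epsilon>) * (1 + \<epsilon>)) * (C * ?N) \<le> (1 + 3 * \<epsilon>) * (C * ?N)" using C N0 by (intro mult_right_mono) auto
      then show ?thesis by (simp add: algebra_simps)
    qed
    finally have mid: "vnorm G (S ?t - S ?u) \<le> (C + \<epsilon> * (3 * C)) * ?N" .
    let ?t' = "tens V T0' T1' f" and ?u' = "tens V U0' U1' f"
    have c1: "vnorm G (?t' - S ?t) \<le> 4 * \<epsilon> * M1 * ?N"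
      using correct[OF mn nn T sub(1,2) T0' T1' f] push[OF T(2) sub(2), of T0] by (simp add: M1_def)
    have c2: "vnorm G (?u' - S ?u) \<le> 4 * \<epsilon> * M2 * ?N"
      using correct[OF pn qn U sub(3,4) U0' U1' f] push[OF U(2) sub(4), of U0] by (simp add: M2_def)
    have mem: "?t' \<in> vcarrier G" "?u' \<in> vcarrier G" "S ?t \<in> vcarrier G" "S ?u \<in> vcarrier G"
      using tens_in_carrier[OF V b G T0'(1) T1'(1) f] tens_in_carrier[OF V b G U0'(1) U1'(1) f]
        lin_mapD(1)[OF S_lin tuY(1)] lin_mapD(1)[OF S_lin tuY(2)] by auto
    have "vnorm G (?t' - ?u') \<le> vnorm G (?t' - S ?t) + vnorm G (S ?t - ?u')" by (rule norm_diff_three[OF G mem(1,3,2)])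
    also have "vnorm G (S ?t - ?u') \<le> vnorm G (S ?t - S ?u) + vnorm G (S ?u - ?u')" by (rule norm_diff_three[OF G mem(3,4,2)])
    also have "vnorm G (S ?u - ?u') = vnorm G (?u' - S ?u)" by (rule norm_algebra(3)[OF GV GN mem(4,2)])
    finally have "vnorm G (?t' - ?u') \<le> (C + \<epsilon> * (3 * C + 4 * M1 + 4 * M2)) * ?N"
      using c1 c2 mid by (simp add: algebra_simps)
    also have "\<dots> \<le> (C + e) * ?N" using \<epsilon>e N0 by (intro mult_right_mono) auto
    finally show "vnorm G (?t' - ?u') \<le> (C + e) * ?N" .
  qed
qed

lemma Norms_in_Norm_pairs: "Norms_in V F \<times> Norms_in (alg_dual V) F \<subseteq> Norm_pairs V"
  by (auto simp: Norms_in_def)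

lemma Norms_in_orbit2:
  assumes V: "vec_space V" and P: "P \<in> Norms_in V F \<times> Norms_in (alg_dual V) F" and P': "P' \<in> orbit2 V P"
  shows "P' \<in> Norms_in V F \<times> Norms_in (alg_dual V) F"
proof -
  obtain m n where P1: "P = (m, n)" and m: "m \<in> Norms_in V F" and n: "n \<in> Norms_in (alg_dual V) F" using P by auto
  obtain m' n' where P1': "P' = (m', n')" by (cases P')
  obtain \<Delta> where D: "m' \<in> Norms V" "n' \<in> Norms (alg_dual V)" "\<Delta> \<in> GL V" "\<And>x. x \<in> vcarrier V \<Longrightarrow> m' (\<Delta> x) = m x"
    "\<And>f. f \<in> vcarrier (alg_dual V) \<Longrightarrow> n' f = n (adjoint V \<Delta> f)"
    using orbit2E[OF V Norms_inD(1)[OF m] Norms_inD(1)[OF n]] P' unfolding P1 P1' by metis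
  have "m' \<in> Norms_in V F"
    by (rule Norms_in_orbit[OF V m orbitI[OF V Norms_inD(1)[OF m] D(1,3)]]) (rule D(4))
  moreover obtain T1 where T1: "T1 \<in> Emb (with_norm (alg_dual V) n) F" using Norms_inD(2)[OF n] by blast
  have "(\<lambda>f. T1 (adjoint V \<Delta> f)) \<in> Emb (with_norm (alg_dual V) n') F"
    by (rule Emb_orbit[OF adjoint_GL[OF V D(3)] _ T1]) (simp add: D(5))
  then have "n' \<in> Norms_in (alg_dual V) F" using D(2) by (auto simp: Norms_in_def)
  ultimately show ?thesis unfolding P1' by blast
qed

text \<open>The estimates for pairs of norms pass to classes: a class within \<open>K\<close> of the base point has a
  representative within \<open>K + 1\<close> of the given one, and a class close to it one that is close to that
  representative.\<close>

lemma pairs_of_norms_equiv: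
  fixes F :: "('k::rc_scalar, 'w::ab_group_add) nspace" and k :: nat
  assumes F: "fraisse F" and P0: "P0 \<in> D_in k F" and e: "e > 0"
  shows "\<exists>\<delta>>0. \<forall>P\<in>D_in k F. \<forall>Q\<in>D_in k F. omega2_quot k P0 P \<le> K \<longrightarrow>
      (omega2_quot k P Q < \<delta> \<longrightarrow> d_dist k F P Q < e) \<and> (d_dist k F P Q < \<delta> \<longrightarrow> omega2_quot k P Q < e)"
proof -
  have F': "normed_space F" using F by (simp add: fraisse_def banach_space_def)
  define V where "V = (coord_space k :: ('k, nat \<Rightarrow> 'k) vspace)"
  have V: "vec_space V" and k: "has_dim V k" unfolding V_def by (rule vec_space_coord_space has_dim_coord_space)+
  have fd: "fin_dim V" using k by (auto simp: fin_dim_def)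
  note V' = vec_space_alg_dual[OF V] and fd' = fin_dim_alg_dual[OF V fd]
  obtain b c where b: "coord_basis V k b c" using has_dim_coord_basis[OF V k] by metis
  define N where "N = Norms_in V F \<times> Norms_in (alg_dual V) F"
  have D_in: "D_in k F = orbit2 V ` N" by (simp add: D_in_def V_def N_def)
  have NP: "P \<in> Norm_pairs V" if "P \<in> N" for P using that Norms_in_Norm_pairs unfolding N_def by blast
  have om: "omega2_quot k (orbit2 V P) (orbit2 V Q) < r \<longleftrightarrow> (\<exists>Q'\<in>orbit2 V Q. omega2 V P Q' < r)"
    if "P \<in> Norm_pairs V" "Q \<in> Norm_pairs V" for P Q r using omega2_quot_metric(1)[of P k Q r] that by (simp add: V_def)
  have om_split: "norm_near V t (fst P) (fst Q) \<and> norm_near (alg_dual V) t (snd P) (snd Q)"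
    if P: "P \<in> Norm_pairs V" and Q: "Q \<in> Norm_pairs V" and lt: "omega2 V P Q < t" for P Q t
  proof -
    have pq: "is_norm V (fst P)" "is_norm V (fst Q)" "is_norm (alg_dual V) (snd P)" "is_norm (alg_dual V) (snd Q)"
      using P Q NormsD(1) by auto
    have "0 \<le> omega V (fst P) (fst Q)" "0 \<le> omega (alg_dual V) (snd P) (snd Q)"
      using omega_le_iff(1)[OF V fd pq(1,2)] omega_le_iff(1)[OF V' fd' pq(3,4)] by auto
    then have "omega V (fst P) (fst Q) \<le> t" "omega (alg_dual V) (snd P) (snd Q) \<le> t" using lt by (auto simp: omega2_def)
    then show ?thesis using omega_near[OF V fd pq(1,2)] omega_near[OF V' fd' pq(3,4)] by blast
  qed
  obtain m0 n0 where P0: "P0 = orbit2 V (m0, n0)" "(m0, n0) \<in> N" using P0 unfolding D_in by auto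
  have P0N: "(m0, n0) \<in> Norm_pairs V" by (rule NP[OF P0(2)])
  have m0: "is_norm V m0" and n0: "is_norm (alg_dual V) n0" using P0N NormsD(1) by auto
  obtain \<delta>1 where \<delta>1: "\<delta>1 > 0" and fwd: "\<And>m n p q. m \<in> Norms_in V F \<Longrightarrow> n \<in> Norms_in (alg_dual V) F \<Longrightarrow> p \<in> Norms_in V F \<Longrightarrow>
    q \<in> Norms_in (alg_dual V) F \<Longrightarrow> norm_near V (K + 1) m0 m \<Longrightarrow> norm_near (alg_dual V) (K + 1) n0 n \<Longrightarrow>
    norm_near V \<delta>1 m p \<Longrightarrow> norm_near (alg_dual V) \<delta>1 n q \<Longrightarrow> d_rel V F (e / 2) (m, n) (p, q)"
    by (rule d_rel_of_omega[OF V b F m0 n0 half_gt_zero[OF e], of "K + 1"]) (rule that)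
  obtain \<delta>2 where \<delta>2: "\<delta>2 > 0" and bwd: "\<And>m n p q C. m \<in> Norms V \<Longrightarrow> n \<in> Norms (alg_dual V) \<Longrightarrow> p \<in> Norms V \<Longrightarrow>
    q \<in> Norms (alg_dual V) \<Longrightarrow> norm_near V (K + 1) m0 m \<Longrightarrow> norm_near (alg_dual V) (K + 1) n0 n \<Longrightarrow>
    0 \<le> C \<Longrightarrow> C < \<delta>2 \<Longrightarrow> d_rel V F C (m, n) (p, q) \<Longrightarrow>
    \<exists>p' q'. (p', q') \<in> orbit2 V (p, q) \<and> norm_near V (e / 3) m p' \<and> norm_near (alg_dual V) (e / 3) n q'"
    by (rule omega_of_d_rel[OF V b F' m0 n0, of "e / 3" "K + 1"]) (use e in simp, rule that)
  show ?thesis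
  proof (intro exI conjI ballI impI)
    show "min \<delta>1 \<delta>2 > 0" using \<delta>1 \<delta>2 by simp
    fix P Q assume P: "P \<in> D_in k F" and Q: "Q \<in> D_in k F" and Kle: "omega2_quot k P0 P \<le> K"
    obtain P1 where P1: "P = orbit2 V P1" "P1 \<in> N" using P unfolding D_in by blast
    obtain Q1 where Q1: "Q = orbit2 V Q1" "Q1 \<in> N" using Q unfolding D_in by blast
    have "omega2_quot k (orbit2 V (m0, n0)) (orbit2 V P1) < K + 1" using Kle P0(1) P1(1) by simp
    then obtain P2 where P2: "P2 \<in> orbit2 V P1" "omega2 V (m0, n0) P2 < K + 1" using om[OF P0N NP[OF P1(2)]] by blast
    have P2N: "P2 \<in> N" using Norms_in_orbit2[OF V _ P2(1)] P1(2) unfolding N_def by blast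
    have P_eq: "P = orbit2 V P2" using orbit2_eq[OF V NP[OF P1(2)] P2(1)] P1(1) by simp
    obtain m n where mn: "P2 = (m, n)" "m \<in> Norms_in V F" "n \<in> Norms_in (alg_dual V) F" using P2N unfolding N_def by auto
    have near0: "norm_near V (K + 1) m0 m" "norm_near (alg_dual V) (K + 1) n0 n"
      using om_split[OF P0N NP[OF P2N] P2(2)] mn(1) by auto
    { assume lt: "omega2_quot k P Q < min \<delta>1 \<delta>2"
      then obtain Q2 where Q2: "Q2 \<in> orbit2 V Q1" "omega2 V P2 Q2 < \<delta>1"
        using om[OF NP[OF P2N] NP[OF Q1(2)], of \<delta>1] P_eq Q1(1) by auto
      have Q2N: "Q2 \<in> N" using Norms_in_orbit2[OF V _ Q2(1)] Q1(2) unfolding N_def by blast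
      have Q_eq: "Q = orbit2 V Q2" using orbit2_eq[OF V NP[OF Q1(2)] Q2(1)] Q1(1) by simp
      obtain p q where pq: "Q2 = (p, q)" "p \<in> Norms_in V F" "q \<in> Norms_in (alg_dual V) F" using Q2N unfolding N_def by auto
      have "norm_near V \<delta>1 m p" "norm_near (alg_dual V) \<delta>1 n q"
        using om_split[OF NP[OF P2N] NP[OF Q2N] Q2(2)] mn(1) pq(1) by auto
      then have "d_rel V F (e / 2) P2 Q2" unfolding mn(1) pq(1) by (rule fwd[OF mn(2,3) pq(2,3) near0])
      moreover have "0 \<le> e / 2" "e / 2 < e" using e by auto
      ultimately show "d_dist k F P Q < e"
        using d_dist_less_iff[OF F', of P2 k Q2 e, folded V_def] P2N Q2N unfolding P_eq Q_eq N_def by blast }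
    { assume "d_dist k F P Q < min \<delta>1 \<delta>2"
      then have "d_dist k F (orbit2 V P2) (orbit2 V Q1) < \<delta>2" using P_eq Q1(1) by simp
      then obtain C where C: "0 \<le> C" "C < \<delta>2" "d_rel V F C P2 Q1"
        using d_dist_less_iff[OF F', of P2 k Q1 \<delta>2, folded V_def] P2N Q1(2) unfolding N_def by blast
      obtain p q where pq: "Q1 = (p, q)" by (cases Q1)
      have N4: "m \<in> Norms V" "n \<in> Norms (alg_dual V)" "p \<in> Norms V" "q \<in> Norms (alg_dual V)"
        using NP[OF P2N] NP[OF Q1(2)] mn(1) pq by auto
      obtain p' q' where pq': "(p', q') \<in> orbit2 V (p, q)" "norm_near V (e / 3) m p'" "norm_near (alg_dual V) (e / 3) n q'"
        using bwd[OF N4 near0 C(1,2)] C(3) unfolding mn(1) pq by blast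
      have N': "p' \<in> Norms V" "q' \<in> Norms (alg_dual V)" using orbit2_subset[OF V NP[OF Q1(2)]] pq' pq by auto
      have "omega V m p' \<le> e / 3" "omega (alg_dual V) n q' \<le> e / 3"
        using omega_le_iff(2)[OF V fd NormsD(1)[OF N4(1)] NormsD(1)[OF N'(1)], of "e / 3"]
          omega_le_iff(2)[OF V' fd' NormsD(1)[OF N4(2)] NormsD(1)[OF N'(2)], of "e / 3"] pq'(2,3) e by auto
      then have "omega2 V P2 (p', q') < e" using e by (simp add: omega2_def mn(1))
      then have "omega2_quot k (orbit2 V P2) (orbit2 V Q1) < e"
        using om[OF NP[OF P2N] NP[OF Q1(2)], of e] pq'(1) pq by blast
      then show "omega2_quot k P Q < e" using P_eq Q1(1) by simp }
  qed
qed

lemma spaces_of_norm_pairs: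
  fixes E :: "('k::rc_scalar, 'e::ab_group_add) nspace" and Ehat :: "('k, 'b::ab_group_add) nspace" and k :: nat
  assumes E: "normed_space E" and am: "amalgamation_class (Age E)" and lim: "fraisse_limit (Age E) Ehat"
  shows "compatible_metric (metric_topology (D_space k) (omega2_quot k)) (D_in k Ehat) (d_dist k Ehat)"
    "unif_equiv_on_bounded (D_in k Ehat) (d_dist k Ehat) (omega2_quot k)"
    "\<And>P Q. P \<in> D_in k E \<Longrightarrow> Q \<in> D_in k E \<Longrightarrow> d_dist k E P Q = d_dist k Ehat P Q"
    "dense_subset (metric_topology (D_space k) (omega2_quot k)) (D_in k E) (D_in k Ehat)"
proof -
  define V where "V = (coord_space k :: ('k, nat \<Rightarrow> 'k) vspace)"
  have V: "vec_space V" and k: "has_dim V k" unfolding V_def by (rule vec_space_coord_space has_dim_coord_space)+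
  have fd: "fin_dim V" using k by (auto simp: fin_dim_def)
  note V' = vec_space_alg_dual[OF V] and fd' = fin_dim_alg_dual[OF V fd]
  obtain b c where b: "coord_basis V k b c" using has_dim_coord_basis[OF V k] by metis
  have fr: "fraisse Ehat" using lim by (simp add: fraisse_limit_def)
  have H: "normed_space Ehat" using fr by (simp add: fraisse_def banach_space_def)
  have D_space: "D_space k = orbit2 V ` Norm_pairs V" by (simp add: D_space_def V_def)
  have om: "omega2_quot k (orbit2 V P) (orbit2 V Q) < r \<longleftrightarrow> (\<exists>Q'\<in>orbit2 V Q. omega2 V P Q' < r)"
    if "P \<in> Norm_pairs V" "Q \<in> Norm_pairs V" for P Q r using omega2_quot_metric(1)[of P k Q r] that by (simp add: V_def)
  have om_metric: "Metric_space (D_space k :: ('k, nat \<Rightarrow> 'k) norm_pair set set) (dist_on (D_space k) (omega2_quot k))"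
    using omega2_quot_metric(2)[where k = k] by (simp add: D_space_def V_def)
  have D_in: "D_in k F = orbit2 V ` (Norms_in V F \<times> Norms_in (alg_dual V) F)" for F :: "('k, 'c::ab_group_add) nspace"
    by (simp add: D_in_def V_def)
  have NP: "P \<in> Norm_pairs V" if "P \<in> Norms_in V F \<times> Norms_in (alg_dual V) F" for P and F :: "('k, 'c::ab_group_add) nspace"
    using that Norms_in_Norm_pairs by blast
  have sub: "D_in k F \<subseteq> D_space k" for F :: "('k, 'c::ab_group_add) nspace"
    unfolding D_in D_space using Norms_in_Norm_pairs by blast
  note equiv = pairs_of_norms_equiv[OF fr]
  have loc: "\<exists>\<delta>>0. \<forall>Q\<in>D_in k Ehat. (omega2_quot k P Q < \<delta> \<longrightarrow> d_dist k Ehat P Q < e) \<and>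
      (d_dist k Ehat P Q < \<delta> \<longrightarrow> omega2_quot k P Q < e)" if P: "P \<in> D_in k Ehat" and e: "e > 0" for P e
  proof -
    have "omega2_quot k P P \<le> 0" using Metric_space_dist_onD(3)[OF om_metric] P sub by (metis order_refl subsetD)
    then show ?thesis using equiv[OF P e, of 0] P by blast
  qed
  show "compatible_metric (metric_topology (D_space k) (omega2_quot k)) (D_in k Ehat) (d_dist k Ehat)"
  proof (rule compatible_metric_from_relation[OF om_metric sub, where R = "\<lambda>C P Q. \<exists>P'\<in>P. \<exists>Q'\<in>Q. d_rel V Ehat C P' Q'"])
    fix P Q r assume "P \<in> D_in k Ehat" "Q \<in> D_in k Ehat"
    then obtain P1 Q1 where P1: "P1 \<in> Norms_in V Ehat \<times> Norms_in (alg_dual V) Ehat" "P = orbit2 V P1"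
      and Q1: "Q1 \<in> Norms_in V Ehat \<times> Norms_in (alg_dual V) Ehat" "Q = orbit2 V Q1" unfolding D_in by blast
    show "d_dist k Ehat P Q < r \<longleftrightarrow> (\<exists>C. 0 \<le> C \<and> C < r \<and> (\<exists>P'\<in>P. \<exists>Q'\<in>Q. d_rel V Ehat C P' Q'))"
      unfolding P1(2) Q1(2) d_rel_orbits[OF V b H NP[OF P1(1)] NP[OF Q1(1)]]
      using d_dist_less_iff[OF H, of P1 k Q1 r, folded V_def] P1(1) Q1(1) by blast
  next
    fix P Q C assume "\<exists>P'\<in>P. \<exists>Q'\<in>Q. d_rel V Ehat C P' Q'"
    then show "\<exists>P'\<in>Q. \<exists>Q'\<in>P. d_rel V Ehat C P' Q'" using d_rel_sym[OF V b H] by blast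
  next
    fix P Q S C D e assume "P \<in> D_in k Ehat" "Q \<in> D_in k Ehat" "S \<in> D_in k Ehat" and D: "0 \<le> D"
      and PQ: "\<exists>P'\<in>P. \<exists>Q'\<in>Q. d_rel V Ehat C P' Q'" and QS: "\<exists>P'\<in>Q. \<exists>Q'\<in>S. d_rel V Ehat D P' Q'" and e: "(0::real) < e"
    then obtain P1 Q1 S1 where P1: "P1 \<in> Norm_pairs V" "P = orbit2 V P1"
      and Q1: "Q1 \<in> Norm_pairs V" "Q = orbit2 V Q1" and S1: "S1 \<in> Norm_pairs V" "S = orbit2 V S1" unfolding D_in using NP by blast
    have "d_rel V Ehat C P1 Q1" "d_rel V Ehat D Q1 S1"
      using PQ QS unfolding P1(2) Q1(2) S1(2) d_rel_orbits[OF V b H P1(1) Q1(1)] d_rel_orbits[OF V b H Q1(1) S1(1)] by auto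
    from d_rel_triangle[OF V b fr Q1(1) this D e]
    show "\<exists>P'\<in>P. \<exists>Q'\<in>S. d_rel V Ehat (C + D + e) P' Q'"
      unfolding P1(2) S1(2) d_rel_orbits[OF V b H P1(1) S1(1)] .
  next
    fix P e assume P: "P \<in> D_in k Ehat" and e: "(0::real) < e"
    show "\<exists>\<delta>>0. \<forall>Q\<in>D_in k Ehat. omega2_quot k P Q < \<delta> \<longrightarrow> d_dist k Ehat P Q < e" using loc[OF P e] by meson
    show "\<exists>\<delta>>0. \<forall>Q\<in>D_in k Ehat. d_dist k Ehat P Q < \<delta> \<longrightarrow> omega2_quot k P Q < e" using loc[OF P e] by meson
  qed
  show "unif_equiv_on_bounded (D_in k Ehat) (d_dist k Ehat) (omega2_quot k)"
    by (rule unif_equiv_from_based) (rule equiv)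
  have subE: "Norms_in V E \<times> Norms_in (alg_dual V) E \<subseteq> Norms_in V Ehat \<times> Norms_in (alg_dual V) Ehat"
    using Norms_in_limit[OF E lim V fd] Norms_in_limit[OF E lim V' fd'] by blast
  have t1: "transfers E Ehat" by (rule transfers_if_Age_embeds[OF E H Age_Emb_limit[OF E lim]])
  have t2: "transfers Ehat E" by (rule transfers_from_limit[OF E am lim])
  show "d_dist k E P Q = d_dist k Ehat P Q" if PQ: "P \<in> D_in k E" "Q \<in> D_in k E" for P Q
  proof -
    obtain P1 Q1 where P1: "P1 \<in> Norms_in V E \<times> Norms_in (alg_dual V) E" "P = orbit2 V P1"
      and Q1: "Q1 \<in> Norms_in V E \<times> Norms_in (alg_dual V) E" "Q = orbit2 V Q1" using PQ unfolding D_in by blast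
    have P1': "P1 \<in> Norms_in V Ehat \<times> Norms_in (alg_dual V) Ehat" and Q1': "Q1 \<in> Norms_in V Ehat \<times> Norms_in (alg_dual V) Ehat"
      using P1(1) Q1(1) subE by auto
    have iE: "d_dist k E P Q < r \<longleftrightarrow> (\<exists>C. 0 \<le> C \<and> C < r \<and> d_rel V E C P1 Q1)" for r
      unfolding P1(2) Q1(2) using d_dist_less_iff[OF E, of P1 k Q1 r, folded V_def] P1(1) Q1(1) by blast
    have iH: "d_dist k Ehat P Q < r \<longleftrightarrow> (\<exists>C. 0 \<le> C \<and> C < r \<and> d_rel V Ehat C P1 Q1)" for r
      unfolding P1(2) Q1(2) using d_dist_less_iff[OF H, of P1 k Q1 r, folded V_def] P1' Q1' by blast
    show ?thesis
    proof (rule antisym)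
      show "d_dist k E P Q \<le> d_dist k Ehat P Q"
        by (rule dist_le_of_rel[OF iH iE]) (rule d_rel_transfer[OF t2 V b H E P1(1) Q1(1)])
      show "d_dist k Ehat P Q \<le> d_dist k E P Q"
        by (rule dist_le_of_rel[OF iE iH]) (rule d_rel_transfer[OF t1 V b E H P1' Q1'])
    qed
  qed
  show "dense_subset (metric_topology (D_space k) (omega2_quot k)) (D_in k E) (D_in k Ehat)"
  proof (rule dense_subset_metric[OF om_metric _ sub])
    show "D_in k E \<subseteq> D_in k Ehat" unfolding D_in using subE by blast
    fix P e assume "P \<in> D_in k Ehat" and e: "(0::real) < e"
    then obtain m n where mn: "m \<in> Norms_in V Ehat" "n \<in> Norms_in (alg_dual V) Ehat" "P = orbit2 V (m, n)" unfolding D_in by blast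
    obtain p where p: "p \<in> Norms_in V E" "omega V m p < e / 2" using Norms_in_dense[OF E lim V fd mn(1) half_gt_zero[OF e]] by blast
    obtain q where q: "q \<in> Norms_in (alg_dual V) E" "omega (alg_dual V) n q < e / 2"
      using Norms_in_dense[OF E lim V' fd' mn(2) half_gt_zero[OF e]] by blast
    have N: "(m, n) \<in> Norm_pairs V" "(p, q) \<in> Norm_pairs V" using mn p q by (auto simp: Norms_in_def)
    have "omega2 V (m, n) (p, q) < e" using p(2) q(2) by (simp add: omega2_def)
    then have "omega2_quot k P (orbit2 V (p, q)) < e"
      unfolding mn(3) using om[OF N, of e] orbit2_self[OF V N(2)] by blast
    moreover have "orbit2 V (p, q) \<in> D_in k E" unfolding D_in using p q by blast
    ultimately show "\<exists>Q\<in>D_in k E. omega2_quot k P Q < e" by blast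
  qed
qed

theorem theorem3p11:
  fixes normE :: "(nat \<Rightarrow> 'k::rc_scalar) \<Rightarrow> real"
    and E :: "('k, nat \<Rightarrow> 'k) nspace"
    and Ehat :: "('k, 'b::ab_group_add) nspace"
  assumes E_def: "E = with_norm fin_seqs normE"
    and E_normed: "normed_space E"
    and E_amalg: "amalgamation_class (Age E)"
    and Ehat_limit: "fraisse_limit (Age E) Ehat"
  shows
    "(\<forall>X :: ('k, 'x::ab_group_add) nspace. normed_space X \<and> fin_dim X \<longrightarrow>
        compatible_metric (norm_topology X) (Norms_in X Ehat) (partial_dist X Ehat) \<and>
        unif_equiv_on_bounded (Norms_in X Ehat) (partial_dist X Ehat) (omega X) \<and>
        (\<forall>m\<in>Norms_in X E. \<forall>n\<in>Norms_in X E. partial_dist X E m n = partial_dist X Ehat m n) \<and>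
        dense_subset (norm_topology X) (Norms_in X E) (Norms_in X Ehat))
     \<and>
     (\<forall>k.
        compatible_metric (BM_topology TYPE('k) k) (BM_in k Ehat) (gamma_dist k Ehat) \<and>
        (\<forall>P\<in>BM_in k E. \<forall>Q\<in>BM_in k E. gamma_dist k Ehat P Q = gamma_dist k E P Q) \<and>
        dense_subset (BM_topology TYPE('k) k) (BM_in k E) (BM_in k Ehat))
     \<and>
     (\<forall>k.
        compatible_metric (metric_topology (D_space k) (omega2_quot k)) (D_in k Ehat) (d_dist k Ehat) \<and>
        unif_equiv_on_bounded (D_in k Ehat) (d_dist k Ehat) (omega2_quot k) \<and>
        (\<forall>P\<in>D_in k E. \<forall>Q\<in>D_in k E. d_dist k E P Q = d_dist k Ehat P Q) \<and>
        dense_subset (metric_topology (D_space k) (omega2_quot k)) (D_in k E) (D_in k Ehat))"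
proof (intro conjI allI impI ballI)
  note part_a = spaces_of_norms[OF E_normed E_amalg Ehat_limit]
  fix X :: "('k, 'x) nspace" assume "normed_space X \<and> fin_dim X"
  then have X: "normed_space X" "fin_dim X" by auto
  show "compatible_metric (norm_topology X) (Norms_in X Ehat) (partial_dist X Ehat)"
    "unif_equiv_on_bounded (Norms_in X Ehat) (partial_dist X Ehat) (omega X)"
    "dense_subset (norm_topology X) (Norms_in X E) (Norms_in X Ehat)"
    by (rule part_a[OF X])+
  show "partial_dist X E m n = partial_dist X Ehat m n" if "m \<in> Norms_in X E" "n \<in> Norms_in X E" for m n
    by (rule part_a(3)[OF X that])
qed (auto intro: Banach_Mazur_compacta[OF E_normed E_amalg Ehat_limit] spaces_of_norm_pairs[OF E_normed E_amalg Ehat_limit])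

end
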